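(* A two-dimensional, stable half-bubble is isometric to a half-plane.
   Context: A two-dimensional half-bubble is a complete, connected, properly embedded minimal surface $\Sigma\subset\mathbb{R}^3$ contained in a closed half-space, having non-empty free boundary with respect to the boundary plane $\Pi$ of that half-space (it meets $\Pi$ orthogonally along $\partial\Sigma=\Sigma\cap\Pi$), and having finite total curvature $\int_\Sigma|A|^2\,d\mathscr{H}^2<\infty$. The index of $\Sigma$ is the largest dimension of a linear subspace of $C^\infty_c(\Sigma)$ (supports may intersect $\partial\Sigma$) on which $\int_\Sigma(|\nabla u|^2-|A|^2u^2)\,d\mathscr{H}^2$ is negative definite. Stable means index zero. *)

theory Defs
  imports "HOL-Analysis.Analysis" "HOL-Library.Function_Algebras"
begin

section \<open>Two-dimensional Hausdorff measure\<close>

text \<open>The factor \<open>pi * (diameter / 2)\<^sup>2\<close> is the usual normalisation, for which the measure agrees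
  with area on planes.\<close>

definition hausdorff2_pre :: "real \<Rightarrow> 'a::metric_space set \<Rightarrow> ennreal" where
  "hausdorff2_pre \<delta> A =
     (INF C \<in> {C :: nat \<Rightarrow> 'a set. A \<subseteq> (\<Union>i. C i) \<and> (\<forall>i. bounded (C i) \<and> diameter (C i) \<le> \<delta>)}.
        \<Sum>i. ennreal (pi * (diameter (C i) / 2)\<^sup>2))"

definition hausdorff2_outer :: "'a::metric_space set \<Rightarrow> ennreal" where
  "hausdorff2_outer A = (SUP \<delta> \<in> {0<..}. hausdorff2_pre \<delta> A)"

definition hausdorff2 :: "'a::metric_space measure" where
  "hausdorff2 = measure_of UNIV (sets borel) hausdorff2_outer"

text \<open>Since \<open>measure_of\<close> yields the zero measure unless it is given a measure, we show that
  \<open>hausdorff2_outer\<close> is countably additive on Borel sets.\<close>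

lemma hausdorff2_pre_mono: "A \<subseteq> B \<Longrightarrow> hausdorff2_pre \<delta> A \<le> hausdorff2_pre \<delta> B"
  unfolding hausdorff2_pre_def by (rule INF_superset_mono) auto

lemma hausdorff2_pre_antimono: "\<delta> \<le> \<epsilon> \<Longrightarrow> hausdorff2_pre \<epsilon> A \<le> hausdorff2_pre \<delta> A"
  unfolding hausdorff2_pre_def by (rule INF_superset_mono) (auto intro: order_trans)

lemma hausdorff2_pre_UN:
  fixes A :: "nat \<Rightarrow> 'a::metric_space set"
  shows "hausdorff2_pre \<delta> (\<Union>n. A n) \<le> (\<Sum>n. hausdorff2_pre \<delta> (A n))"
proof (rule ennreal_le_epsilon)
  fix e :: real
  assume "0 < e" and "(\<Sum>n. hausdorff2_pre \<delta> (A n)) < top"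
  then have *: "\<And>n. hausdorff2_pre \<delta> (A n) < hausdorff2_pre \<delta> (A n) + e * (1/2)^Suc n"
    by (auto simp add: less_top dest!: ennreal_suminf_lessD)
  have "\<exists>C. A n \<subseteq> (\<Union>i. C i) \<and> (\<forall>i. bounded (C i) \<and> diameter (C i) \<le> \<delta>) \<and>
       (\<Sum>i. ennreal (pi * (diameter (C i) / 2)\<^sup>2)) < hausdorff2_pre \<delta> (A n) + e * (1/2)^Suc n" for n
    using *[of n] unfolding hausdorff2_pre_def[of \<delta> "A n"] INF_less_iff by auto
  then obtain B where B: "\<And>n. A n \<subseteq> (\<Union>i. B n i)"
      "\<And>n i. bounded (B n i) \<and> diameter (B n i) \<le> \<delta>"
      "\<And>n. (\<Sum>i. ennreal (pi * (diameter (B n i) / 2)\<^sup>2)) < hausdorff2_pre \<delta> (A n) + e * (1/2)^Suc n"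
    by metis
  define C where "C = case_prod B o prod_decode"
  have "(\<Union>n. A n) \<subseteq> (\<Union>i. C i)"
    using B(1) by (auto simp add: C_def subset_eq) (metis prod.case prod_encode_inverse)
  moreover have "\<forall>i. bounded (C i) \<and> diameter (C i) \<le> \<delta>"
    using B(2) by (auto simp: C_def split_def)
  ultimately have "hausdorff2_pre \<delta> (\<Union>n. A n) \<le> (\<Sum>i. ennreal (pi * (diameter (C i) / 2)\<^sup>2))"
    unfolding hausdorff2_pre_def by (intro INF_lower) auto
  also have "\<dots> = (\<Sum>i. (\<lambda>p. ennreal (pi * (diameter (case_prod B p) / 2)\<^sup>2)) (prod_decode i))"
    by (simp add: C_def)
  also have "\<dots> = (\<Sum>n. \<Sum>i. ennreal (pi * (diameter (B n i) / 2)\<^sup>2))"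
    by (rule suminf_ennreal_2dimen) simp
  also have "\<dots> \<le> (\<Sum>n. hausdorff2_pre \<delta> (A n) + e * (1/2) ^ Suc n)"
    using B(3) by (intro suminf_le allI less_imp_le) auto
  also have "\<dots> = (\<Sum>n. hausdorff2_pre \<delta> (A n)) + (\<Sum>n. ennreal e * ennreal ((1/2) ^ Suc n))"
    using \<open>0 < e\<close> by (subst suminf_add[symmetric])
      (auto simp del: ennreal_suminf_cmult simp add: ennreal_mult[symmetric])
  also have "\<dots> = (\<Sum>n. hausdorff2_pre \<delta> (A n)) + e"
    unfolding ennreal_suminf_cmult
    by (subst suminf_ennreal_eq[OF zero_le_power power_half_series]) auto
  finally show "hausdorff2_pre \<delta> (\<Union>n. A n) \<le> (\<Sum>n. hausdorff2_pre \<delta> (A n)) + e" .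
qed

lemma hausdorff2_outer_empty: "hausdorff2_outer {} = 0"
proof -
  have "hausdorff2_pre \<delta> ({} :: 'a set) \<le> (\<Sum>i::nat. ennreal (pi * (diameter ({} :: 'a set) / 2)\<^sup>2))"
    if "0 < \<delta>" for \<delta>
    using that unfolding hausdorff2_pre_def by (intro INF_lower) auto
  then show ?thesis
    by (auto simp: hausdorff2_outer_def intro!: antisym SUP_least)
qed

lemma hausdorff2_outer_mono: "A \<subseteq> B \<Longrightarrow> hausdorff2_outer A \<le> hausdorff2_outer B"
  unfolding hausdorff2_outer_def by (intro SUP_mono) (auto intro: hausdorff2_pre_mono)

lemma hausdorff2_outer_UN: "hausdorff2_outer (\<Union>n::nat. A n) \<le> (\<Sum>n. hausdorff2_outer (A n))"
  unfolding hausdorff2_outer_def[of "\<Union>n. A n"]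
proof (rule SUP_least)
  fix \<delta> :: real assume "\<delta> \<in> {0<..}"
  then have "(\<Sum>n. hausdorff2_pre \<delta> (A n)) \<le> (\<Sum>n. hausdorff2_outer (A n))"
    unfolding hausdorff2_outer_def by (intro suminf_le SUP_upper) auto
  then show "hausdorff2_pre \<delta> (\<Union>n. A n) \<le> (\<Sum>n. hausdorff2_outer (A n))"
    using hausdorff2_pre_UN order_trans by blast
qed

lemma outer_measure_space_hausdorff2_outer: "outer_measure_space UNIV hausdorff2_outer"
  by (auto simp: outer_measure_space_def positive_def increasing_def countably_subadditive_def
      hausdorff2_outer_empty hausdorff2_outer_mono hausdorff2_outer_UN)

lemma hausdorff2_outer_Un: "hausdorff2_outer (A \<union> B) \<le> hausdorff2_outer A + hausdorff2_outer B"
proof -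
  have "subadditive (Pow UNIV) (hausdorff2_outer :: 'a set \<Rightarrow> ennreal)"
    using outer_measure_space_hausdorff2_outer
    by (intro ring_of_sets.countably_subadditive_subadditive[OF ring_of_sets_Pow])
      (auto simp: outer_measure_space_def)
  moreover have "hausdorff2_outer (A \<union> B) = hausdorff2_outer (A \<union> (B - A))"
    by simp
  ultimately have "hausdorff2_outer (A \<union> B) \<le> hausdorff2_outer A + hausdorff2_outer (B - A)"
    by (metis Diff_disjoint Pow_UNIV UNIV_I subadditiveD)
  also have "\<dots> \<le> hausdorff2_outer A + hausdorff2_outer B"
    by (intro add_left_mono hausdorff2_outer_mono) auto
  finally show ?thesis .
qed

lemma hausdorff2_outer_separated:
  fixes A B :: "'a::metric_space set"
  assumes "0 < e" and sep: "\<And>x y. x \<in> A \<Longrightarrow> y \<in> B \<Longrightarrow> e \<le> dist x y"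
  shows "hausdorff2_outer A + hausdorff2_outer B \<le> hausdorff2_outer (A \<union> B)"
proof -
  have pre: "hausdorff2_pre \<delta> A + hausdorff2_pre \<delta> B \<le> hausdorff2_pre \<delta> (A \<union> B)"
    if "0 < \<delta>" "\<delta> < e" for \<delta>
    unfolding hausdorff2_pre_def[of \<delta> "A \<union> B"]
  proof (rule INF_greatest, clarify)
    fix C :: "nat \<Rightarrow> 'a set"
    assume C: "A \<union> B \<subseteq> (\<Union>i. C i)" "\<forall>i. bounded (C i) \<and> diameter (C i) \<le> \<delta>"
    let ?w = "\<lambda>D :: 'a set. ennreal (pi * (diameter D / 2)\<^sup>2)"
    define P where "P D i = (if C i \<inter> D = {} then {} else C i)" for D i
    have le: "hausdorff2_pre \<delta> D \<le> (\<Sum>i. ?w (P D i))" if "D \<subseteq> A \<union> B" for D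
      unfolding hausdorff2_pre_def
    proof (rule INF_lower, intro CollectI conjI)
      show "D \<subseteq> (\<Union>i. P D i)"
        using that C(1) by (auto simp: P_def) blast
      show "\<forall>i. bounded (P D i) \<and> diameter (P D i) \<le> \<delta>"
        using C(2) \<open>0 < \<delta>\<close> by (auto simp: P_def)
    qed
    have "?w (P A i) + ?w (P B i) \<le> ?w (C i)" for i
    proof -
      have "C i \<inter> A = {} \<or> C i \<inter> B = {}"
      proof (rule ccontr)
        assume "\<not> ?thesis"
        then obtain x y where xy: "x \<in> C i" "x \<in> A" "y \<in> C i" "y \<in> B"
          by blast
        then have "dist x y \<le> diameter (C i)"
          using C(2) by (intro diameter_bounded_bound) auto
        with sep[OF xy(2,4)] C(2) \<open>\<delta> < e\<close> show False
          by (smt (verit))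
      qed
      then show ?thesis
        by (auto simp: P_def)
    qed
    then have "(\<Sum>i. ?w (P A i) + ?w (P B i)) \<le> (\<Sum>i. ?w (C i))"
      by (intro suminf_le) auto
    then have "(\<Sum>i. ?w (P A i)) + (\<Sum>i. ?w (P B i)) \<le> (\<Sum>i. ?w (C i))"
      by (subst suminf_add) auto
    with add_mono[OF le[of A] le[of B]]
    show "hausdorff2_pre \<delta> A + hausdorff2_pre \<delta> B \<le> (\<Sum>i. ?w (C i))"
      by (meson Un_upper1 Un_upper2 order_trans)
  qed
  have "hausdorff2_outer A + hausdorff2_outer B =
      (SUP \<delta>\<in>{0<..}. hausdorff2_pre \<delta> A + hausdorff2_pre \<delta> B)"
    unfolding hausdorff2_outer_def
  proof (rule SUP_add_directed_ennreal[symmetric])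
    fix i j :: real assume "i \<in> {0<..}" "j \<in> {0<..}"
    then show "\<exists>k\<in>{0<..}. hausdorff2_pre i A + hausdorff2_pre j B \<le> hausdorff2_pre k A + hausdorff2_pre k B"
      by (intro bexI[of _ "min i j"] add_mono hausdorff2_pre_antimono) auto
  qed
  also have "\<dots> \<le> hausdorff2_outer (A \<union> B)"
  proof (rule SUP_least)
    fix \<delta> :: real assume \<delta>: "\<delta> \<in> {0<..}"
    define \<eta> where "\<eta> = min \<delta> (e / 2)"
    have \<eta>: "0 < \<eta>" "\<eta> < e" "\<eta> \<le> \<delta>"
      using \<delta> \<open>0 < e\<close> by (auto simp: \<eta>_def)
    have "hausdorff2_pre \<delta> A + hausdorff2_pre \<delta> B \<le> hausdorff2_pre \<eta> A + hausdorff2_pre \<eta> B"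
      using \<eta> by (intro add_mono hausdorff2_pre_antimono)
    also have "\<dots> \<le> hausdorff2_pre \<eta> (A \<union> B)"
      using \<eta> by (intro pre)
    also have "\<dots> \<le> hausdorff2_outer (A \<union> B)"
      unfolding hausdorff2_outer_def using \<eta> by (intro SUP_upper) auto
    finally show "hausdorff2_pre \<delta> A + hausdorff2_pre \<delta> B \<le> hausdorff2_outer (A \<union> B)" .
  qed
  finally show ?thesis .
qed

text \<open>The Caratheodory criterion for closed sets.\<close>

lemma hausdorff2_outer_closed:
  fixes F X :: "'a::metric_space set"
  assumes "closed F"
  shows "hausdorff2_outer (X \<inter> F) + hausdorff2_outer (X - F) \<le> hausdorff2_outer X"
proof (cases "F = {} \<or> hausdorff2_outer X = top")
  case True
  then show ?thesis
    by (auto simp: hausdorff2_outer_empty)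
next
  case False
  let ?h = "hausdorff2_outer :: 'a set \<Rightarrow> ennreal"
  define Y where "Y n = {x \<in> X. 1 / real (Suc n) \<le> infdist x F}" for n
  define R where "R n = Y (Suc n) - Y n" for n
  have Y_mono: "Y m \<subseteq> Y n" if "m \<le> n" for m n
  proof -
    have "1 / real (Suc n) \<le> 1 / real (Suc m)"
      using that by (simp add: frac_le)
    then show ?thesis by (auto simp: Y_def)
  qed
  have Y_F: "?h (X \<inter> F) + ?h (Y n) \<le> ?h X" for n
  proof -
    have "?h (X \<inter> F) + ?h (Y n) \<le> ?h (X \<inter> F \<union> Y n)"
    proof (rule hausdorff2_outer_separated)
      show "0 < 1 / real (Suc n)" by simp
      fix x y assume "x \<in> X \<inter> F" "y \<in> Y n"
      then show "1 / real (Suc n) \<le> dist x y"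
        using infdist_le[of x F y] by (auto simp: Y_def dist_commute)
    qed
    also have "\<dots> \<le> ?h X"
      by (intro hausdorff2_outer_mono) (auto simp: Y_def)
    finally show ?thesis .
  qed
  have Y_R: "?h (Y n) + ?h (R (Suc n)) \<le> ?h (Y n \<union> R (Suc n))" for n
  proof (rule hausdorff2_outer_separated)
    show "0 < 1 / real (Suc n) - 1 / real (Suc (Suc n))"
      by (simp add: frac_less2)
    fix x y assume xy: "x \<in> Y n" "y \<in> R (Suc n)"
    have "infdist x F \<le> infdist y F + dist x y"
      by (rule infdist_triangle)
    moreover have "infdist y F < 1 / real (Suc (Suc n))" "1 / real (Suc n) \<le> infdist x F"
      using xy by (auto simp: R_def Y_def)
    ultimately show "1 / real (Suc n) - 1 / real (Suc (Suc n)) \<le> dist x y"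
      by linarith
  qed
  define a where "a k = ?h (R (Suc k))" for k
  have rings: "(\<Sum>k<n. a (2 * k + c)) \<le> ?h (Y (2 * n + c))" for n c
  proof (induction n)
    case (Suc n)
    have "(\<Sum>k<Suc n. a (2 * k + c)) \<le> ?h (Y (2 * n + c)) + ?h (R (Suc (2 * n + c)))"
      using Suc by (simp add: add_right_mono a_def)
    also have "\<dots> \<le> ?h (Y (2 * n + c) \<union> R (Suc (2 * n + c)))"
      by (rule Y_R)
    also have "\<dots> \<le> ?h (Y (2 * Suc n + c))"
    proof (rule hausdorff2_outer_mono)
      show "Y (2 * n + c) \<union> R (Suc (2 * n + c)) \<subseteq> Y (2 * Suc n + c)"
        using Y_mono[of "2 * n + c" "2 * Suc n + c"] by (auto simp: R_def)
    qed
    finally show ?case .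
  qed simp
  have Y_X: "?h (Y n) \<le> ?h X" for n
    by (rule hausdorff2_outer_mono) (auto simp: Y_def)
  have "(\<Sum>k<n. a k) \<le> ?h X + ?h X" for n
  proof -
    have "(\<Sum>k<n. a k) \<le> (\<Sum>k<2 * n. a k)"
      by (rule sum_mono2) auto
    also have "\<dots> = (\<Sum>k<n. a (2 * k + 0)) + (\<Sum>k<n. a (2 * k + 1))"
      by (induction n) (auto simp: algebra_simps)
    also have "\<dots> \<le> ?h X + ?h X"
      by (intro add_mono order_trans[OF rings Y_X])
    finally show ?thesis .
  qed
  then have "(\<Sum>k. a k) \<le> ?h X + ?h X"
    by (intro suminf_le_const) auto
  moreover have "?h X + ?h X < top"
    using False by (simp add: less_top)
  ultimately have fin: "(\<Sum>k. a k) < top"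
    by (rule le_less_trans)
  define b where "b k = enn2real (a k)" for k
  have ab: "a k = ennreal (b k)" for k
    using ennreal_suminf_lessD[OF fin, of k] by (simp add: b_def)
  have b0: "0 \<le> b k" for k
    by (simp add: b_def)
  have "summable b"
    using fin b0 by (intro summable_suminf_not_top) (auto simp: ab)
  then have lim: "(\<lambda>m. \<Sum>k. b (k + m)) \<longlonglongrightarrow> 0"
    by (rule suminf_exist_split2)
  have tail: "(\<Sum>k. a (k + m)) = ennreal (\<Sum>k. b (k + m))" for m
    unfolding ab using \<open>summable b\<close> b0 by (intro suminf_ennreal2) (auto simp: summable_iff_shift)
  have bound: "?h (X \<inter> F) + ?h (X - F) \<le> ?h X + ennreal (\<Sum>k. b (k + m))" for m
  proof -
    have "X - F \<subseteq> Y (Suc m) \<union> (\<Union>k. R (Suc (k + m)))"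
    proof
      fix x assume x: "x \<in> X - F"
      then have "0 < infdist x F"
        using False \<open>closed F\<close> by (metis DiffD2 in_closed_iff_infdist_zero infdist_nonneg less_eq_real_def)
      then obtain N where "1 / real (Suc N) < infdist x F"
        using nat_approx_posE by blast
      with x have ex: "x \<in> Y N"
        by (auto simp: Y_def)
      define l where "l = (LEAST n. x \<in> Y n)"
      have l: "x \<in> Y l" "\<And>n. n < l \<Longrightarrow> x \<notin> Y n"
        unfolding l_def using ex by (auto intro: LeastI dest: not_less_Least)
      show "x \<in> Y (Suc m) \<union> (\<Union>k. R (Suc (k + m)))"
      proof (cases "l \<le> Suc m")
        case True
        then show ?thesis using l(1) Y_mono by blast
      next
        case False
        then have "l = Suc (Suc (l - Suc (Suc m) + m))"
          by simp
        then have "x \<in> R (Suc (l - Suc (Suc m) + m))"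
          using l unfolding R_def by (metis DiffI lessI)
        then show ?thesis by blast
      qed
    qed
    then have "?h (X - F) \<le> ?h (Y (Suc m)) + ?h (\<Union>k. R (Suc (k + m)))"
      by (meson hausdorff2_outer_Un hausdorff2_outer_mono order_trans)
    also have "\<dots> \<le> ?h (Y (Suc m)) + (\<Sum>k. a (k + m))"
      unfolding a_def by (intro add_left_mono hausdorff2_outer_UN)
    finally have "?h (X \<inter> F) + ?h (X - F) \<le> (?h (X \<inter> F) + ?h (Y (Suc m))) + (\<Sum>k. a (k + m))"
      by (simp add: add_left_mono add.assoc)
    also have "\<dots> \<le> ?h X + (\<Sum>k. a (k + m))"
      by (intro add_right_mono Y_F)
    finally show ?thesis
      by (simp add: tail)
  qed
  have "(\<lambda>m. ?h X + ennreal (\<Sum>k. b (k + m))) \<longlonglongrightarrow> ?h X + ennreal 0"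
    by (intro tendsto_add tendsto_const tendsto_ennrealI lim)
  then show ?thesis
    using bound by (intro LIMSEQ_le_const[of _ "?h X"]) auto
qed

lemma sets_hausdorff2 [simp, measurable_cong]: "sets hausdorff2 = sets borel"
  using sets.sigma_sets_eq[of borel] by (simp add: hausdorff2_def)

lemma space_hausdorff2 [simp]: "space hausdorff2 = UNIV"
  by (simp add: hausdorff2_def)

lemma emeasure_hausdorff2:
  fixes A :: "'a::metric_space set"
  assumes "A \<in> sets borel"
  shows "emeasure hausdorff2 A = hausdorff2_outer A"
proof -
  let ?L = "lambda_system UNIV UNIV (hausdorff2_outer :: 'a set \<Rightarrow> ennreal)"
  have ms: "measure_space UNIV ?L hausdorff2_outer"
    using sigma_algebra.caratheodory_lemma[OF sigma_algebra_Pow, of UNIV hausdorff2_outer]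
      outer_measure_space_hausdorff2_outer by simp
  then interpret L: sigma_algebra UNIV ?L
    by (simp add: measure_space_def)
  have "F \<in> ?L" if "closed F" for F
  proof -
    have "hausdorff2_outer (F \<inter> X) + hausdorff2_outer ((UNIV - F) \<inter> X) = hausdorff2_outer X" for X
    proof (rule antisym)
      show "hausdorff2_outer (F \<inter> X) + hausdorff2_outer ((UNIV - F) \<inter> X) \<le> hausdorff2_outer X"
        using hausdorff2_outer_closed[OF that, of X] by (simp add: Int_commute Diff_eq)
      have "X = (F \<inter> X) \<union> ((UNIV - F) \<inter> X)" by blast
      then show "hausdorff2_outer X \<le> hausdorff2_outer (F \<inter> X) + hausdorff2_outer ((UNIV - F) \<inter> X)"
        using hausdorff2_outer_Un by metis
    qed
    then show ?thesis
      by (simp add: lambda_system_def)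
  qed
  then have "sets (borel :: 'a measure) \<subseteq> ?L"
    unfolding borel_eq_closed by (auto intro!: L.sigma_sets_subset)
  then have "measure_space UNIV (sets borel) (hausdorff2_outer :: 'a set \<Rightarrow> ennreal)"
    using measure_down[OF ms] sets.sigma_algebra_axioms[of "borel :: 'a measure"] by simp
  then show ?thesis
    using assms sets.space_closed[of "borel :: 'a measure"] unfolding hausdorff2_def measure_space_def
    by (subst emeasure_measure_of_sigma) auto
qed

section \<open>Smooth functions\<close>

primrec Ck_on :: "nat \<Rightarrow> 'a::euclidean_space set \<Rightarrow> ('a \<Rightarrow> 'b::real_normed_vector) \<Rightarrow> bool" where
  "Ck_on 0 W f \<longleftrightarrow> continuous_on W f"
| "Ck_on (Suc k) W f \<longleftrightarrow>
     (\<forall>x\<in>W. f differentiable (at x)) \<and> (\<forall>v. Ck_on k W (\<lambda>x. frechet_derivative f (at x) v))"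

text \<open>Meaningful for open \<open>W\<close> only, and used only there.\<close>

definition smooth_on :: "'a::euclidean_space set \<Rightarrow> ('a \<Rightarrow> 'b::real_normed_vector) \<Rightarrow> bool" where
  "smooth_on W f \<longleftrightarrow> (\<forall>k. Ck_on k W f)"

section \<open>Embedded surfaces with boundary in three-space\<close>

definition upper :: "(real^2) set" where
  "upper = {y. 0 \<le> y $ 2}"

text \<open>Interior and boundary parametrizations are treated uniformly: \<open>\<phi>\<close> is smooth on an open set
  \<open>U\<close> of the plane, but only its restriction to \<open>U \<inter> upper\<close> parametrizes a piece of the surface.
  If \<open>U\<close> does not meet the line \<open>y $ 2 = 0\<close>, the piece contains no boundary point.\<close>

definition local_param :: "(real^3) set \<Rightarrow> (real^2) set \<Rightarrow> (real^2 \<Rightarrow> real^3) \<Rightarrow> bool" where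
  "local_param S U \<phi> \<longleftrightarrow>
     open U \<and> smooth_on U \<phi> \<and>
     (\<forall>y \<in> U \<inter> upper. inj (frechet_derivative \<phi> (at y))) \<and>
     openin (top_of_set S) (\<phi> ` (U \<inter> upper)) \<and>
     (\<exists>\<psi>. homeomorphism (U \<inter> upper) (\<phi> ` (U \<inter> upper)) \<phi> \<psi>)"

definition embedded_surface :: "(real^3) set \<Rightarrow> bool" where
  "embedded_surface S \<longleftrightarrow> (\<forall>p\<in>S. \<exists>U \<phi>. local_param S U \<phi> \<and> p \<in> \<phi> ` (U \<inter> upper))"

definition surface_boundary :: "(real^3) set \<Rightarrow> (real^3) set" where
  "surface_boundary S = {\<phi> y | U \<phi> y. local_param S U \<phi> \<and> y \<in> U \<and> y $ 2 = 0}"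

text \<open>At boundary points this is the full tangent plane, not a half-plane.\<close>

definition tangent_space :: "(real^3) set \<Rightarrow> real^3 \<Rightarrow> (real^3) set" where
  "tangent_space S p =
     {frechet_derivative \<phi> (at y) \<xi> | U \<phi> y \<xi>. local_param S U \<phi> \<and> y \<in> U \<inter> upper \<and> \<phi> y = p}"

text \<open>An embedded submanifold is properly embedded iff it is a closed subset.\<close>

definition properly_embedded_surface :: "(real^3) set \<Rightarrow> bool" where
  "properly_embedded_surface S \<longleftrightarrow> embedded_surface S \<and> closed S"

definition intrinsic_dist :: "(real^3) set \<Rightarrow> real^3 \<Rightarrow> real^3 \<Rightarrow> real" where
  "intrinsic_dist S p q =
     Inf {integral {0..1} (\<lambda>t. norm (vector_derivative \<gamma> (at t))) | \<gamma>.
            valid_path \<gamma> \<and> path_image \<gamma> \<subseteq> S \<and> pathstart \<gamma> = p \<and> pathfinish \<gamma> = q}"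

definition complete_surface :: "(real^3) set \<Rightarrow> bool" where
  "complete_surface S \<longleftrightarrow> Metric_space.mcomplete S (intrinsic_dist S)"

section \<open>Curvature\<close>

definition pd :: "2 \<Rightarrow> (real^2 \<Rightarrow> 'b::real_normed_vector) \<Rightarrow> real^2 \<Rightarrow> 'b" where
  "pd i f y = frechet_derivative f (at y) (axis i 1)"

definition first_form :: "(real^2 \<Rightarrow> real^3) \<Rightarrow> real^2 \<Rightarrow> real^2^2" where
  "first_form \<phi> y = (\<chi> i j. pd i \<phi> y \<bullet> pd j \<phi> y)"

definition unit_normal :: "(real^2 \<Rightarrow> real^3) \<Rightarrow> real^2 \<Rightarrow> real^3" where
  "unit_normal \<phi> y = sgn (cross3 (pd 1 \<phi> y) (pd 2 \<phi> y))"

definition second_form :: "(real^2 \<Rightarrow> real^3) \<Rightarrow> real^2 \<Rightarrow> real^2^2" where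
  "second_form \<phi> y = (\<chi> i j. pd i (pd j \<phi>) y \<bullet> unit_normal \<phi> y)"

definition shape_operator :: "(real^2 \<Rightarrow> real^3) \<Rightarrow> real^2 \<Rightarrow> real^2^2" where
  "shape_operator \<phi> y = matrix_inv (first_form \<phi> y) ** second_form \<phi> y"

definition minimal_surface :: "(real^3) set \<Rightarrow> bool" where
  "minimal_surface S \<longleftrightarrow>
     (\<forall>U \<phi>. local_param S U \<phi> \<longrightarrow> (\<forall>y \<in> U \<inter> upper. trace (shape_operator \<phi> y) = 0))"

text \<open>The squared norm of the second fundamental form, that is \<open>g\<^sup>i\<^sup>k g\<^sup>j\<^sup>l h\<^sub>i\<^sub>j h\<^sub>k\<^sub>l\<close>, the sum of the
  squares of the principal curvatures.  It does not depend on the parametrization, so that the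
  description is proper at every point of an embedded surface.\<close>

definition norm_A_sq :: "(real^3) set \<Rightarrow> real^3 \<Rightarrow> real" where
  "norm_A_sq S p =
     (THE a. \<exists>U \<phi> y. local_param S U \<phi> \<and> y \<in> U \<inter> upper \<and> \<phi> y = p \<and>
               a = trace (shape_operator \<phi> y ** shape_operator \<phi> y))"

definition finite_total_curvature :: "(real^3) set \<Rightarrow> bool" where
  "finite_total_curvature S \<longleftrightarrow> (\<integral>\<^sup>+x\<in>S. ennreal (norm_A_sq S x) \<partial>hausdorff2) < \<infinity>"

section \<open>Half-bubbles\<close>

text \<open>The half-space is \<open>{x. a \<le> n \<bullet> x}\<close>, with unit inner normal \<open>n\<close>.  The surface meets the
  boundary plane orthogonally iff \<open>n\<close> is tangent to the surface along the boundary.\<close>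

definition half_bubble :: "(real^3) set \<Rightarrow> bool" where
  "half_bubble S \<longleftrightarrow>
     properly_embedded_surface S \<and> connected S \<and> complete_surface S \<and> minimal_surface S \<and>
     (\<exists>n a. norm n = 1 \<and> S \<subseteq> {x. a \<le> n \<bullet> x} \<and>
        surface_boundary S = S \<inter> {x. n \<bullet> x = a} \<and> surface_boundary S \<noteq> {} \<and>
        (\<forall>p \<in> surface_boundary S. n \<in> tangent_space S p)) \<and>
     finite_total_curvature S"

section \<open>Index and stability\<close>

definition smooth_on_surface :: "(real^3) set \<Rightarrow> (real^3 \<Rightarrow> 'b::real_normed_vector) \<Rightarrow> bool" where
  "smooth_on_surface S f \<longleftrightarrow>
     (\<forall>p\<in>S. \<exists>W g. open W \<and> p \<in> W \<and> smooth_on W g \<and> (\<forall>x \<in> W \<inter> S. f x = g x))"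

text \<open>Functions on the surface are extended by zero to the whole space, so that they are equal as
  HOL functions iff they agree on the surface.  The compact set \<open>K\<close> may meet the boundary.\<close>

definition test_functions :: "(real^3) set \<Rightarrow> (real^3 \<Rightarrow> real) set" where
  "test_functions S =
     {u. smooth_on_surface S u \<and> (\<exists>K. compact K \<and> K \<subseteq> S \<and> (\<forall>x. x \<notin> K \<longrightarrow> u x = 0))}"

text \<open>The derivative within the surface is only determined on tangent vectors, whence the
  restriction to tangential \<open>v\<close>.\<close>

definition surface_gradient :: "(real^3) set \<Rightarrow> (real^3 \<Rightarrow> real) \<Rightarrow> real^3 \<Rightarrow> real^3" where
  "surface_gradient S u p =
     (THE v. v \<in> tangent_space S p \<and> (u has_derivative (\<lambda>w. v \<bullet> w)) (at p within S))"

definition second_variation :: "(real^3) set \<Rightarrow> (real^3 \<Rightarrow> real) \<Rightarrow> real" where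
  "second_variation S u =
     (LINT x:S|hausdorff2. (norm (surface_gradient S u x))\<^sup>2 - norm_A_sq S x * (u x)\<^sup>2)"

interpretation fun_space: vector_space "\<lambda>(c::real) (u::real^3 \<Rightarrow> real) x. c * u x"
  by unfold_locales (auto simp: fun_eq_iff algebra_simps)

text \<open>It suffices to consider finite-dimensional subspaces; the supremum is infinite if their
  dimensions are unbounded.\<close>

definition surface_index :: "(real^3) set \<Rightarrow> enat" where
  "surface_index S =
     Sup {enat (fun_space.dim V) | V. fun_space.subspace V \<and> (\<exists>B. finite B \<and> fun_space.span B = V) \<and>
            V \<subseteq> test_functions S \<and> (\<forall>u\<in>V. u \<noteq> 0 \<longrightarrow> second_variation S u < 0)}"

definition stable_surface :: "(real^3) set \<Rightarrow> bool" where
  "stable_surface S \<longleftrightarrow> surface_index S = 0"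

section \<open>Isometries and half-planes\<close>

text \<open>Riemannian isometry with respect to the induced metrics: a diffeomorphism whose differential
  preserves inner products of tangent vectors.\<close>

definition isometric_surfaces :: "(real^3) set \<Rightarrow> (real^3) set \<Rightarrow> bool" where
  "isometric_surfaces S T \<longleftrightarrow>
     (\<exists>f g. smooth_on_surface S f \<and> smooth_on_surface T g \<and> homeomorphism S T f g \<and>
        (\<forall>p\<in>S. \<exists>D. (f has_derivative D) (at p within S) \<and>
           (\<forall>v \<in> tangent_space S p. \<forall>w \<in> tangent_space S p. D v \<bullet> D w = v \<bullet> w)))"

definition half_plane :: "(real^3) set \<Rightarrow> bool" where
  "half_plane P \<longleftrightarrow>
     (\<exists>p u v. norm u = 1 \<and> norm v = 1 \<and> u \<bullet> v = 0 \<and> P = {p + s *\<^sub>R u + t *\<^sub>R v | s t. 0 \<le> t})"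

end

theory Submission
  imports Defs
begin

text \<open>Let \<open>F = sqrt (|A|\<^sup>2 + e)\<close>.  The Simons identity makes \<open>ln F\<close> a function with Laplacian at least
  \<open>- |A|\<^sup>2\<close>, and the free boundary condition makes the normal derivative of \<open>F\<close> vanish along the boundary, as
  it would after reflection across the boundary plane.  Stability, tested with \<open>\<phi> F\<close>, then yields
  \<open>\<integral> \<phi>\<^sup>2 |grad F|\<^sup>2 \<le> \<integral> (|A|\<^sup>2 + e) |grad \<phi>|\<^sup>2\<close>.  Let \<open>e\<close> tend to 0 in the right-hand side, which is possible as
  compact parts of the surface have finite area, and then let \<open>\<phi>\<close> be cut-off functions of radius
  \<open>r \<rightarrow> \<infinity>\<close> with gradient of order \<open>1 / r\<close>: since the total curvature is finite, \<open>|A|\<close> is constant, and the Simons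
  identity forces it to be 0.  So the surface is an open and closed part of a half-plane.\<close>

section \<open>Calculus of smooth functions\<close>

abbreviation fd :: "('a::euclidean_space \<Rightarrow> 'b::real_normed_vector) \<Rightarrow> 'a \<Rightarrow> 'a \<Rightarrow> 'b" where
  "fd f x v \<equiv> frechet_derivative f (at x) v"

lemma fd_eqI: "(f has_derivative D) (at x) \<Longrightarrow> fd f x v = D v"
  using frechet_derivative_at by metis

lemma frechet_derivative_cong_open:
  assumes "open W" "x \<in> W" "\<And>y. y \<in> W \<Longrightarrow> f y = g y"
  shows "frechet_derivative f (at x) = frechet_derivative g (at x)"
    and "f differentiable (at x) \<longleftrightarrow> g differentiable (at x)"
proof -
  have "(f has_derivative D) (at x) \<longleftrightarrow> (g has_derivative D) (at x)" for D
    using assms has_derivative_transform_within_open[of f D x UNIV W g]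
      has_derivative_transform_within_open[of g D x UNIV W f] by auto
  then show "frechet_derivative f (at x) = frechet_derivative g (at x)"
    and "f differentiable (at x) \<longleftrightarrow> g differentiable (at x)"
    by (simp_all add: frechet_derivative_def differentiable_def)
qed

lemma Ck_on_cong:
  assumes "open W" "\<And>x. x \<in> W \<Longrightarrow> f x = g x"
  shows "Ck_on k W f \<longleftrightarrow> Ck_on k W g"
  using assms(2)
proof (induction k arbitrary: f g)
  case 0
  then show ?case by (auto cong: continuous_on_cong)
next
  case (Suc k)
  have "Ck_on k W (\<lambda>x. fd f x v) \<longleftrightarrow> Ck_on k W (\<lambda>x. fd g x v)" for v
  proof (rule Suc.IH)
    fix x assume "x \<in> W"
    then show "fd f x v = fd g x v"
      using frechet_derivative_cong_open(1)[OF assms(1), of x f g] Suc.prems by simp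
  qed
  moreover have "f differentiable (at x) \<longleftrightarrow> g differentiable (at x)" if "x \<in> W" for x
    using Suc.prems frechet_derivative_cong_open(2)[OF assms(1) that] by blast
  ultimately show ?case by simp
qed

lemma Ck_on_SucI:
  assumes "open W" "\<And>x. x \<in> W \<Longrightarrow> (f has_derivative D x) (at x)" "\<And>v. Ck_on k W (\<lambda>x. D x v)"
  shows "Ck_on (Suc k) W f"
proof -
  have "Ck_on k W (\<lambda>x. fd f x v)" for v
    using Ck_on_cong[OF assms(1), of "\<lambda>x. fd f x v" "\<lambda>x. D x v" k] fd_eqI[OF assms(2)] assms(3)
    by blast
  then show ?thesis using assms(2) by (auto simp: differentiable_def)
qed

lemma Ck_on_Suc_differentiable:
  "Ck_on (Suc k) W f \<Longrightarrow> x \<in> W \<Longrightarrow> (f has_derivative frechet_derivative f (at x)) (at x)"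
  by (simp add: frechet_derivative_works)

lemma Ck_on_Suc_mono: "Ck_on (Suc k) W f \<Longrightarrow> Ck_on k W f"
proof (induction k arbitrary: f)
  case 0
  then show ?case
    using continuous_at_imp_continuous_on differentiable_imp_continuous_within by fastforce
next
  case (Suc k)
  then show ?case by (metis Ck_on.simps(2))
qed

lemma Ck_on_continuous: "Ck_on k W f \<Longrightarrow> continuous_on W f"
  by (induction k) (use Ck_on.simps(1) Ck_on_Suc_mono in blast)+

lemma Ck_on_subset: "Ck_on k W f \<Longrightarrow> V \<subseteq> W \<Longrightarrow> Ck_on k V f"
  by (induction k arbitrary: f) (auto intro: continuous_on_subset)

lemma Ck_on_const: "open W \<Longrightarrow> Ck_on k W (\<lambda>x. c)"
  by (induction k arbitrary: c) (auto intro!: Ck_on_SucI[where D = "\<lambda>_ _. 0"] simp del: Ck_on.simps(2))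

lemma Ck_on_bounded_linear:
  assumes "bounded_linear L" "open W" shows "Ck_on k W L"
proof (cases k)
  case 0 then show ?thesis using assms by (simp add: linear_continuous_on)
next
  case (Suc m)
  have "(L has_derivative L) (at x)" for x
    using assms(1) by (rule bounded_linear.has_derivative) (rule has_derivative_ident)
  then show ?thesis unfolding Suc using assms(2)
    by (auto intro!: Ck_on_SucI[where D = "\<lambda>_. L"] Ck_on_const simp del: Ck_on.simps(2))
qed

lemma Ck_on_add:
  assumes "open W" "Ck_on k W f" "Ck_on k W g" shows "Ck_on k W (\<lambda>x. f x + g x)"
  using assms(2,3)
proof (induction k arbitrary: f g)
  case (Suc k)
  show ?case
    by (rule Ck_on_SucI[where D = "\<lambda>x v. fd f x v + fd g x v"])
      (use Suc assms(1) in \<open>auto intro!: has_derivative_add simp: frechet_derivative_works[symmetric]\<close>)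
qed (auto intro: continuous_intros)

lemma (in bounded_bilinear) Ck_on_prod:
  assumes "open W" "Ck_on k W f" "Ck_on k W g" shows "Ck_on k W (\<lambda>x. prod (f x) (g x))"
  using assms(2,3)
proof (induction k arbitrary: f g)
  case 0 then show ?case by (auto intro: continuous_on)
next
  case (Suc k)
  have "Ck_on k W (\<lambda>x. prod (f x) (fd g x v))" "Ck_on k W (\<lambda>x. prod (fd f x v) (g x))" for v
    using Suc Ck_on_Suc_mono[of k W f] Ck_on_Suc_mono[of k W g] by auto
  then show ?case
    using Suc.prems assms(1)
    by (intro Ck_on_SucI[where D = "\<lambda>x v. prod (f x) (fd g x v) + prod (fd f x v) (g x)"])
      (auto intro!: FDERIV Ck_on_add simp: frechet_derivative_works[symmetric])
qed

lemma Ck_on_linear_comp: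
  assumes "open W" "bounded_linear L" "Ck_on k W f" shows "Ck_on k W (\<lambda>x. L (f x))"
  using assms(3)
proof (induction k arbitrary: f)
  case 0 then show ?case using assms(2) by (auto intro: bounded_linear.continuous_on)
next
  case (Suc k)
  then show ?case using assms(1)
    by (intro Ck_on_SucI[where D = "\<lambda>x v. L (fd f x v)"])
      (auto intro!: bounded_linear.has_derivative[OF assms(2)] simp: frechet_derivative_works[symmetric])
qed

lemma Ck_on_sum:
  assumes "open W" "\<And>i. i \<in> I \<Longrightarrow> Ck_on k W (f i)" shows "Ck_on k W (\<lambda>x. \<Sum>i\<in>I. f i x)"
  using assms(2) by (induction I rule: infinite_finite_induct) (auto intro!: Ck_on_add Ck_on_const assms(1))

lemma fd_linear_sum:
  fixes f :: "'a::euclidean_space \<Rightarrow> 'b::real_normed_vector"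
  assumes "f differentiable (at x)"
  shows "fd f x v = (\<Sum>i\<in>Basis. (v \<bullet> i) *\<^sub>R fd f x i)"
proof -
  have l: "linear (frechet_derivative f (at x))"
    using assms frechet_derivative_works has_derivative_linear by blast
  have "fd f x v = fd f x (\<Sum>i\<in>Basis. (v \<bullet> i) *\<^sub>R i)" by (simp add: euclidean_representation)
  also have "\<dots> = (\<Sum>i\<in>Basis. (v \<bullet> i) *\<^sub>R fd f x i)"
    by (simp add: linear_sum[OF l] linear_cmul[OF l])
  finally show ?thesis .
qed

lemma Ck_on_compose:
  fixes g :: "'a::euclidean_space \<Rightarrow> 'b::euclidean_space" and f :: "'b \<Rightarrow> 'c::real_normed_vector"
  assumes "open W" "open V" "Ck_on k V f" "Ck_on k W g" "g ` W \<subseteq> V"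
  shows "Ck_on k W (\<lambda>x. f (g x))"
  using assms(3,4)
proof (induction k arbitrary: f)
  case 0
  then show ?case using assms(5) by (auto intro: continuous_on_compose2)
next
  case (Suc k)
  have gk: "Ck_on k W g" using Suc.prems(2) by (rule Ck_on_Suc_mono)
  have comp: "Ck_on k W (\<lambda>x. fd f (g x) i)" for i
    using Suc.prems(1) gk by (intro Suc.IH) auto
  show ?case
  proof (rule Ck_on_SucI[where D = "\<lambda>x v. fd f (g x) (fd g x v)"])
    fix x assume x: "x \<in> W"
    then have "g x \<in> V" using assms(5) by auto
    then show "((\<lambda>x. f (g x)) has_derivative (\<lambda>v. fd f (g x) (fd g x v))) (at x)"
      using x Suc.prems
      by (intro has_derivative_compose[of g _ x UNIV f]) (auto simp: frechet_derivative_works[symmetric])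
  next
    fix v
    have "Ck_on k W (\<lambda>x. \<Sum>i\<in>Basis. (fd g x v \<bullet> i) *\<^sub>R fd f (g x) i)"
      using Suc.prems(2) comp
      by (intro Ck_on_sum assms(1) bounded_bilinear.Ck_on_prod[OF bounded_bilinear_scaleR]
          Ck_on_linear_comp[OF assms(1) bounded_linear_inner_left]) auto
    moreover have "fd f (g x) (fd g x v) = (\<Sum>i\<in>Basis. (fd g x v \<bullet> i) *\<^sub>R fd f (g x) i)" if "x \<in> W" for x
      using that assms(5) Suc.prems(1) by (intro fd_linear_sum) auto
    ultimately show "Ck_on k W (\<lambda>x. fd f (g x) (fd g x v))"
      using Ck_on_cong[OF assms(1)] by (metis (mono_tags, lifting))
  qed (rule assms(1))
qed

lemma smooth_on_subset: "smooth_on W f \<Longrightarrow> V \<subseteq> W \<Longrightarrow> smooth_on V f"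
  by (auto simp: smooth_on_def intro: Ck_on_subset)

lemma smooth_on_has_derivative:
  "smooth_on W f \<Longrightarrow> x \<in> W \<Longrightarrow> (f has_derivative frechet_derivative f (at x)) (at x)"
  unfolding smooth_on_def using Ck_on_Suc_differentiable by blast

lemma smooth_on_differentiable: "smooth_on W f \<Longrightarrow> x \<in> W \<Longrightarrow> f differentiable (at x)"
  using smooth_on_has_derivative differentiable_def by blast

lemma smooth_on_continuous_on: "smooth_on W f \<Longrightarrow> continuous_on W f"
  unfolding smooth_on_def using Ck_on_continuous by blast

lemma smooth_on_fd: "smooth_on W f \<Longrightarrow> smooth_on W (\<lambda>x. fd f x v)"
  unfolding smooth_on_def by (metis Ck_on.simps(2))

lemma smooth_on_const: "open W \<Longrightarrow> smooth_on W (\<lambda>x. c)"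
  by (simp add: smooth_on_def Ck_on_const)

lemma smooth_on_bounded_linear: "bounded_linear L \<Longrightarrow> open W \<Longrightarrow> smooth_on W L"
  by (simp add: smooth_on_def Ck_on_bounded_linear)

lemma smooth_on_id: "open W \<Longrightarrow> smooth_on W (\<lambda>x. x)"
  using smooth_on_bounded_linear[OF bounded_linear_ident] .

lemma smooth_on_add: "open W \<Longrightarrow> smooth_on W f \<Longrightarrow> smooth_on W g \<Longrightarrow> smooth_on W (\<lambda>x. f x + g x)"
  by (simp add: smooth_on_def Ck_on_add)

lemma (in bounded_bilinear) smooth_on_prod:
  "open W \<Longrightarrow> smooth_on W f \<Longrightarrow> smooth_on W g \<Longrightarrow> smooth_on W (\<lambda>x. prod (f x) (g x))"
  by (simp add: smooth_on_def Ck_on_prod)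

lemma smooth_on_linear_comp:
  "open W \<Longrightarrow> bounded_linear L \<Longrightarrow> smooth_on W f \<Longrightarrow> smooth_on W (\<lambda>x. L (f x))"
  by (simp add: smooth_on_def Ck_on_linear_comp)

lemma smooth_on_minus: "open W \<Longrightarrow> smooth_on W f \<Longrightarrow> smooth_on W (\<lambda>x. - f x)"
  by (rule smooth_on_linear_comp) (auto intro: bounded_linear_minus bounded_linear_ident)

lemma smooth_on_diff: "open W \<Longrightarrow> smooth_on W f \<Longrightarrow> smooth_on W g \<Longrightarrow> smooth_on W (\<lambda>x. f x - g x)"
  using smooth_on_add[of W f "\<lambda>x. - g x"] smooth_on_minus[of W g] by simp

lemmas smooth_on_mult = bounded_bilinear.smooth_on_prod[OF bounded_bilinear_mult]
lemmas smooth_on_scaleR = bounded_bilinear.smooth_on_prod[OF bounded_bilinear_scaleR]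
lemmas smooth_on_inner = bounded_bilinear.smooth_on_prod[OF bounded_bilinear_inner]

lemma smooth_on_power:
  fixes f :: "'a::euclidean_space \<Rightarrow> real"
  shows "open W \<Longrightarrow> smooth_on W f \<Longrightarrow> smooth_on W (\<lambda>x. f x ^ n)"
  by (induction n) (auto intro: smooth_on_const smooth_on_mult)

lemma smooth_on_compose:
  fixes g :: "'a::euclidean_space \<Rightarrow> 'b::euclidean_space" and f :: "'b \<Rightarrow> 'c::real_normed_vector"
  assumes "open W" "open V" "smooth_on V f" "smooth_on W g" "g ` W \<subseteq> V"
  shows "smooth_on W (\<lambda>x. f (g x))"
  using assms by (auto simp: smooth_on_def intro: Ck_on_compose)

lemma Ck_on_real_SucI:
  fixes f :: "real \<Rightarrow> real"
  assumes "open W" "\<And>x. x \<in> W \<Longrightarrow> (f has_real_derivative f' x) (at x)" "Ck_on k W f'"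
  shows "Ck_on (Suc k) W f"
proof (rule Ck_on_SucI[OF assms(1)])
  show "(f has_derivative (*) (f' x)) (at x)" if "x \<in> W" for x
    using assms(2)[OF that] by (simp add: has_field_derivative_def)
  show "Ck_on k W (\<lambda>x. f' x * v)" for v
    by (rule bounded_bilinear.Ck_on_prod[OF bounded_bilinear_mult assms(1,3) Ck_on_const[OF assms(1)]])
qed

lemma smooth_on_real_inverse: "smooth_on (- {0}) (inverse :: real \<Rightarrow> real)"
proof -
  have "Ck_on k (- {0}) (inverse :: real \<Rightarrow> real)" for k
  proof (induction k)
    case (Suc k)
    have o: "open (- {0 :: real})" by auto
    have "Ck_on k (- {0 :: real}) (\<lambda>x. - (inverse x * inverse x))"
      by (intro Ck_on_linear_comp[OF o bounded_linear_minus[OF bounded_linear_ident]]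
          bounded_bilinear.Ck_on_prod[OF bounded_bilinear_mult o Suc Suc])
    then show ?case
      by (intro Ck_on_real_SucI[OF o]) (auto intro!: derivative_eq_intros)
  qed (auto intro!: continuous_intros)
  then show ?thesis by (simp add: smooth_on_def)
qed

lemma smooth_on_inverse:
  fixes f :: "'a::euclidean_space \<Rightarrow> real"
  assumes "open W" "smooth_on W f" "\<And>x. x \<in> W \<Longrightarrow> f x \<noteq> 0"
  shows "smooth_on W (\<lambda>x. inverse (f x))"
  using assms by (intro smooth_on_compose[OF _ _ smooth_on_real_inverse]) auto

lemma smooth_on_divide:
  fixes f g :: "'a::euclidean_space \<Rightarrow> real"
  assumes "open W" "smooth_on W f" "smooth_on W g" "\<And>x. x \<in> W \<Longrightarrow> g x \<noteq> 0"
  shows "smooth_on W (\<lambda>x. f x / g x)"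
  unfolding divide_inverse using assms by (intro smooth_on_mult smooth_on_inverse)

lemma smooth_on_real_sqrt: "smooth_on {0<..} sqrt"
proof -
  have "Ck_on k {0<..} sqrt" for k
  proof (induction k)
    case (Suc k)
    have o: "open {0 :: real<..}" by auto
    have "Ck_on k {0 :: real<..} (\<lambda>x. inverse (sqrt x) * (1/2))"
      using smooth_on_real_inverse
      by (intro bounded_bilinear.Ck_on_prod[OF bounded_bilinear_mult o] Ck_on_const[OF o]
          Ck_on_compose[OF o _ _ Suc, of "- {0}" inverse]) (auto simp: smooth_on_def)
    then show ?case
      by (intro Ck_on_real_SucI[OF o]) (auto intro!: derivative_eq_intros simp: field_simps)
  qed (auto intro!: continuous_intros)
  then show ?thesis by (simp add: smooth_on_def)
qed

lemma smooth_on_sqrt: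
  fixes f :: "'a::euclidean_space \<Rightarrow> real"
  assumes "open W" "smooth_on W f" "\<And>x. x \<in> W \<Longrightarrow> 0 < f x"
  shows "smooth_on W (\<lambda>x. sqrt (f x))"
  using assms by (intro smooth_on_compose[OF _ _ smooth_on_real_sqrt]) auto

lemmas smooth_intros = smooth_on_const smooth_on_id smooth_on_add smooth_on_diff smooth_on_minus
  smooth_on_mult smooth_on_scaleR smooth_on_inner smooth_on_power smooth_on_divide smooth_on_sqrt
  smooth_on_fd

subsection \<open>Bump functions\<close>

definition flat_exp :: "nat \<Rightarrow> real \<Rightarrow> real" where
  "flat_exp n x = (if 0 < x then exp (- inverse x) * inverse x ^ n else 0)"

lemma flat_exp_bound: "\<bar>flat_exp n x\<bar> \<le> fact (n + 2) * x\<^sup>2"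
proof (cases "0 < x")
  case True
  define t where "t = inverse x"
  have t: "t > 0" using True by (simp add: t_def)
  have "t ^ (n+2) /\<^sub>R fact (n+2) \<le> (\<Sum>i. t ^ i /\<^sub>R fact i)"
  proof -
    have "(\<Sum>i\<in>{n+2}. t ^ i /\<^sub>R fact i) \<le> (\<Sum>i. t ^ i /\<^sub>R fact i)"
      using t by (intro sum_le_suminf summable_exp_generic) auto
    then show ?thesis by simp
  qed
  then have "t ^ (n+2) \<le> exp t * fact (n+2)"
    by (simp add: exp_def divide_le_eq pos_divide_le_eq divideR_right field_simps del: fact_Suc power_Suc)
  then have "exp (-t) * t ^ n * t^2 \<le> fact (n+2)"
    by (simp add: exp_minus field_simps power_add power2_eq_square)
  then have "exp (-t) * t ^ n * t^2 * x^2 \<le> fact (n+2) * x^2"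
    by (rule mult_right_mono) auto
  moreover have "t^2 * x^2 = 1" using True by (simp add: t_def field_simps)
  then have "exp (-t) * t ^ n * t^2 * x^2 = exp (-t) * t ^ n" by (simp add: mult.assoc)
  moreover have "flat_exp n x = exp (-t) * t ^ n" "0 \<le> flat_exp n x"
    using True by (simp_all add: flat_exp_def t_def)
  ultimately show ?thesis by linarith
qed (simp add: flat_exp_def)

lemma flat_exp_deriv:
  "(flat_exp n has_real_derivative (flat_exp (n+2) x - real n * flat_exp (n+1) x)) (at x)"
proof -
  consider "x > 0" | "x < 0" | "x = 0" by linarith
  then show ?thesis
  proof cases
    case 1
    have "((\<lambda>x. exp (- inverse x) * inverse x ^ n) has_real_derivative
       (flat_exp (n+2) x - real n * flat_exp (n+1) x)) (at x)"
    proof (cases n)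
      case 0
      then show ?thesis using 1
        by (auto intro!: derivative_eq_intros simp: flat_exp_def power2_eq_square)
    next
      case (Suc m)
      then have "real n * (inverse x * (inverse x * inverse x ^ (n - Suc 0))) = real n * (inverse x * inverse x ^ n)"
        by simp
      then show ?thesis using 1
        by (auto intro!: derivative_eq_intros simp: flat_exp_def algebra_simps)
    qed
    then show ?thesis
      by (rule has_field_derivative_transform_within_open[where S = "{0<..}"])
        (use 1 in \<open>auto simp: flat_exp_def\<close>)
  next
    case 2
    have "((\<lambda>x. 0) has_real_derivative (flat_exp (n+2) x - real n * flat_exp (n+1) x)) (at x)"
      using 2 by (simp add: flat_exp_def)
    then show ?thesis
      by (rule has_field_derivative_transform_within_open[where S = "{..<0}"])
        (use 2 in \<open>auto simp: flat_exp_def\<close>)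
  next
    case 3
    have "(\<lambda>h. (flat_exp n (0 + h) - flat_exp n 0) / h) \<midarrow>0\<rightarrow> 0"
    proof (rule Lim_null_comparison)
      have "norm ((flat_exp n (0 + h) - flat_exp n 0) / h) \<le> fact (n+2) * \<bar>h\<bar>" for h
      proof (cases "h = 0")
        case False
        have "\<bar>flat_exp n h\<bar> / \<bar>h\<bar> \<le> fact (n+2) * h\<^sup>2 / \<bar>h\<bar>"
          by (rule divide_right_mono[OF flat_exp_bound]) auto
        also have "\<dots> = fact (n+2) * \<bar>h\<bar>"
          using False by (simp add: power2_eq_square) (auto simp: abs_if)
        finally show ?thesis by (simp add: flat_exp_def[of n 0])
      qed auto
      then show "\<forall>\<^sub>F h in at 0. norm ((flat_exp n (0 + h) - flat_exp n 0) / h) \<le> fact (n+2) * \<bar>h\<bar>"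
        by auto
      show "(\<lambda>h. fact (n+2) * \<bar>h\<bar> :: real) \<midarrow>0\<rightarrow> 0"
        by (auto intro!: tendsto_eq_intros)
    qed
    then show ?thesis using 3 by (simp add: DERIV_def flat_exp_def)
  qed
qed

lemma smooth_on_flat_exp: "smooth_on UNIV (flat_exp n)"
proof -
  have "Ck_on k UNIV (flat_exp n)" for k
  proof (induction k arbitrary: n)
    case 0
    then show ?case
      using DERIV_isCont[OF flat_exp_deriv] by (auto intro: continuous_at_imp_continuous_on)
  next
    case (Suc k)
    have "Ck_on k UNIV (\<lambda>x. flat_exp (n+2) x + (- real n) * flat_exp (n+1) x)"
      by (intro Ck_on_add Suc bounded_bilinear.Ck_on_prod[OF bounded_bilinear_mult] Ck_on_const) auto
    then show ?case
      using flat_exp_deriv by (intro Ck_on_real_SucI) auto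
  qed
  then show ?thesis by (simp add: smooth_on_def)
qed

lemma exists_bump:
  fixes p :: "'a::euclidean_space"
  assumes "0 < r"
  obtains b :: "'a \<Rightarrow> real" where "smooth_on UNIV b" "\<And>x. 0 \<le> b x" "\<And>x. b x \<le> 1"
    "\<And>x. x \<in> ball p (r/2) \<Longrightarrow> b x = 1" "\<And>x. x \<notin> ball p r \<Longrightarrow> b x = 0"
proof -
  define e where "e = flat_exp 0"
  have e: "0 \<le> e x" "0 < x \<Longrightarrow> 0 < e x" "x \<le> 0 \<Longrightarrow> e x = 0" for x
    by (auto simp: e_def flat_exp_def)
  have pos: "0 < e t + e (1 - t)" for t
    using e[of t] e[of "1 - t"] by (cases "t > 0") (auto simp: add_pos_nonneg add_nonneg_pos)
  define s where "s t = e t / (e t + e (1 - t))" for t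
  have es: "smooth_on UNIV e" unfolding e_def by (rule smooth_on_flat_exp)
  have "smooth_on UNIV (\<lambda>t. e (1 - t))"
    by (rule smooth_on_compose[OF _ _ es]) (auto intro!: smooth_intros)
  then have ss: "smooth_on UNIV s"
    unfolding s_def using pos es by (intro smooth_intros) (auto simp: less_le)
  define b where "b x = s ((r\<^sup>2 - (x - p) \<bullet> (x - p)) / (3/4 * r\<^sup>2))" for x
  show ?thesis
  proof
    show "smooth_on UNIV b"
      unfolding b_def using assms
      by (intro smooth_on_compose[OF _ _ ss]) (auto intro!: smooth_intros)
    show "0 \<le> b x" for x using e pos by (auto simp: b_def s_def intro!: divide_nonneg_pos)
    show "b x \<le> 1" for x using e pos by (auto simp: b_def s_def divide_le_eq_1)
    show "b x = 1" if "x \<in> ball p (r/2)" for x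
    proof -
      have "norm (x - p) < r / 2" using that by (simp add: dist_norm norm_minus_commute)
      then have "(norm (x - p))\<^sup>2 \<le> (r / 2)\<^sup>2" by (intro power_mono) auto
      then have "1 \<le> (r\<^sup>2 - (x - p) \<bullet> (x - p)) / (3/4 * r\<^sup>2)"
        using assms by (simp add: dot_square_norm field_simps power2_eq_square)
      then have "e (1 - (r\<^sup>2 - (x - p) \<bullet> (x - p)) / (3/4 * r\<^sup>2)) = 0"
        "0 < e ((r\<^sup>2 - (x - p) \<bullet> (x - p)) / (3/4 * r\<^sup>2))" by (intro e; linarith)+
      then show ?thesis by (simp add: b_def s_def)
    qed
    show "b x = 0" if "x \<notin> ball p r" for x
    proof -
      have "r \<le> norm (x - p)" using that by (simp add: dist_norm norm_minus_commute)
      then have "r\<^sup>2 \<le> (norm (x - p))\<^sup>2" using assms by (intro power_mono) auto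
      then have "(r\<^sup>2 - (x - p) \<bullet> (x - p)) / (3/4 * r\<^sup>2) \<le> 0"
        using assms by (simp add: dot_square_norm divide_nonpos_pos)
      then show ?thesis using e by (auto simp: b_def s_def)
    qed
  qed
qed

subsection \<open>Second derivatives\<close>

lemma fd_compose:
  assumes "smooth_on V G" "smooth_on W F" "y \<in> V" "G y \<in> W"
  shows "fd (\<lambda>y. F (G y)) y v = fd F (G y) (fd G y v)"
  by (rule fd_eqI, rule has_derivative_compose[of G _ y UNIV F])
    (use assms smooth_on_has_derivative in auto)

lemma fd_second_compose:
  fixes G :: "'a::euclidean_space \<Rightarrow> 'b::euclidean_space" and F :: "'b \<Rightarrow> 'c::real_normed_vector"
  assumes V: "open V" and W: "open W" and G: "smooth_on V G" and F: "smooth_on W F"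
    and sub: "G ` V \<subseteq> W" and y: "y \<in> V"
  shows "fd (\<lambda>y. fd (\<lambda>y. F (G y)) y b) y a =
    fd (\<lambda>x. fd F x (fd G y b)) (G y) (fd G y a) + fd F (G y) (fd (\<lambda>y. fd G y b) y a)"
proof -
  have eq: "fd (\<lambda>y. F (G y)) z b = (\<Sum>i\<in>Basis. (fd G z b \<bullet> i) *\<^sub>R fd F (G z) i)" if "z \<in> V" for z
  proof -
    have "G z \<in> W" using that sub by auto
    then show ?thesis
      using fd_compose[OF G F that] fd_linear_sum[OF smooth_on_differentiable[OF F]] by metis
  qed
  have Gy: "G y \<in> W" using y sub by auto
  have dG: "((\<lambda>z. fd G z b) has_derivative frechet_derivative (\<lambda>z. fd G z b) (at y)) (at y)"
    using smooth_on_has_derivative[OF smooth_on_fd[OF G] y] .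
  have dF: "((\<lambda>z. fd F (G z) i) has_derivative
      (\<lambda>a. fd (\<lambda>x. fd F x i) (G y) (fd G y a))) (at y)" for i
    using smooth_on_has_derivative[OF smooth_on_fd[OF F] Gy] smooth_on_has_derivative[OF G y]
    by (intro has_derivative_compose[of G _ y UNIV "\<lambda>x. fd F x i"])
  have "((\<lambda>z. \<Sum>i\<in>Basis. (fd G z b \<bullet> i) *\<^sub>R fd F (G z) i) has_derivative
      (\<lambda>a. \<Sum>i\<in>Basis. (fd G y b \<bullet> i) *\<^sub>R fd (\<lambda>x. fd F x i) (G y) (fd G y a)
          + (fd (\<lambda>z. fd G z b) y a \<bullet> i) *\<^sub>R fd F (G y) i)) (at y)"
    by (intro has_derivative_sum has_derivative_scaleR dF
        bounded_linear.has_derivative[OF bounded_linear_inner_left dG])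
  then have "((\<lambda>y. fd (\<lambda>y. F (G y)) y b) has_derivative
      (\<lambda>a. \<Sum>i\<in>Basis. (fd G y b \<bullet> i) *\<^sub>R fd (\<lambda>x. fd F x i) (G y) (fd G y a)
          + (fd (\<lambda>z. fd G z b) y a \<bullet> i) *\<^sub>R fd F (G y) i)) (at y)"
    by (rule has_derivative_transform_within_open[OF _ V y]) (rule eq[symmetric])
  then have 1: "fd (\<lambda>y. fd (\<lambda>y. F (G y)) y b) y a =
     (\<Sum>i\<in>Basis. (fd G y b \<bullet> i) *\<^sub>R fd (\<lambda>x. fd F x i) (G y) (fd G y a))
     + (\<Sum>i\<in>Basis. (fd (\<lambda>z. fd G z b) y a \<bullet> i) *\<^sub>R fd F (G y) i)"
    by (simp add: fd_eqI sum.distrib)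
  have "((\<lambda>x. \<Sum>i\<in>Basis. (fd G y b \<bullet> i) *\<^sub>R fd F x i) has_derivative
     (\<lambda>a. \<Sum>i\<in>Basis. (fd G y b \<bullet> i) *\<^sub>R fd (\<lambda>x. fd F x i) (G y) a)) (at (G y))"
    by (intro has_derivative_sum has_derivative_scaleR_right smooth_on_has_derivative[OF smooth_on_fd[OF F] Gy])
  then have "((\<lambda>x. fd F x (fd G y b)) has_derivative
     (\<lambda>a. \<Sum>i\<in>Basis. (fd G y b \<bullet> i) *\<^sub>R fd (\<lambda>x. fd F x i) (G y) a)) (at (G y))"
    by (rule has_derivative_transform_within_open[OF _ W Gy])
      (rule fd_linear_sum[OF smooth_on_differentiable[OF F], symmetric])
  then have 2: "fd (\<lambda>x. fd F x (fd G y b)) (G y) (fd G y a) =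
     (\<Sum>i\<in>Basis. (fd G y b \<bullet> i) *\<^sub>R fd (\<lambda>x. fd F x i) (G y) (fd G y a))"
    by (simp add: fd_eqI)
  show ?thesis
    unfolding 1 2 using fd_linear_sum[OF smooth_on_differentiable[OF F Gy]] by metis
qed

lemma second_difference_mvt:
  fixes f :: "'a::euclidean_space \<Rightarrow> real"
  assumes W: "open W" and f: "smooth_on W f" and h: "0 < h"
    and seg: "\<And>s t. 0 \<le> s \<Longrightarrow> s \<le> h \<Longrightarrow> 0 \<le> t \<Longrightarrow> t \<le> h \<Longrightarrow> x + s *\<^sub>R u + t *\<^sub>R v \<in> W"
  shows "\<exists>s t. 0 \<le> s \<and> s \<le> h \<and> 0 \<le> t \<and> t \<le> h \<and>
    f (x + h *\<^sub>R u + h *\<^sub>R v) - f (x + h *\<^sub>R u) - f (x + h *\<^sub>R v) + f x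
      = h * (h * fd (\<lambda>x. fd f x u) (x + s *\<^sub>R u + t *\<^sub>R v) v)"
proof -
  have d: "((\<lambda>s. g (a + s *\<^sub>R w)) has_real_derivative fd g (a + s *\<^sub>R w) w) (at s)"
    if "smooth_on W g" "a + s *\<^sub>R w \<in> W" for g :: "'a \<Rightarrow> real" and a w s
  proof -
    have l: "linear (frechet_derivative g (at (a + s *\<^sub>R w)))"
      using smooth_on_has_derivative[OF that] has_derivative_linear by blast
    have "((\<lambda>s. g (a + s *\<^sub>R w)) has_derivative (\<lambda>c. fd g (a + s *\<^sub>R w) (c *\<^sub>R w))) (at s)"
      by (rule has_derivative_compose[of "\<lambda>s. a + s *\<^sub>R w" _ s UNIV g])
        (use smooth_on_has_derivative[OF that] in \<open>auto intro!: derivative_eq_intros\<close>)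
    then show ?thesis
      unfolding has_field_derivative_def
      by (rule has_derivative_eq_rhs) (simp add: linear_cmul[OF l] fun_eq_iff mult.commute)
  qed
  have "\<exists>s>0. s < h \<and> (f (x + h *\<^sub>R v + h *\<^sub>R u) - f (x + h *\<^sub>R u)) - (f (x + h *\<^sub>R v + 0 *\<^sub>R u) - f (x + 0 *\<^sub>R u))
     = (h - 0) * (fd f (x + h *\<^sub>R v + s *\<^sub>R u) u - fd f (x + s *\<^sub>R u) u)"
    using seg[of _ h] seg[of _ 0] h
    by (intro MVT2 DERIV_diff d[OF f]) (auto simp: algebra_simps)
  then obtain s where s: "0 < s" "s < h" and 1:
    "(f (x + h *\<^sub>R v + h *\<^sub>R u) - f (x + h *\<^sub>R u)) - (f (x + h *\<^sub>R v) - f x)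
     = h * (fd f (x + h *\<^sub>R v + s *\<^sub>R u) u - fd f (x + s *\<^sub>R u) u)"
    by auto
  have "\<exists>t>0. t < h \<and> fd f ((x + s *\<^sub>R u) + h *\<^sub>R v) u - fd f ((x + s *\<^sub>R u) + 0 *\<^sub>R v) u
     = (h - 0) * fd (\<lambda>x. fd f x u) ((x + s *\<^sub>R u) + t *\<^sub>R v) v"
    using seg[of s] h s by (intro MVT2 d[OF smooth_on_fd[OF f]]) auto
  then obtain t where t: "0 < t" "t < h" and 2:
    "fd f ((x + s *\<^sub>R u) + h *\<^sub>R v) u - fd f (x + s *\<^sub>R u) u = h * fd (\<lambda>x. fd f x u) (x + s *\<^sub>R u + t *\<^sub>R v) v"
    by auto
  have "x + h *\<^sub>R v + s *\<^sub>R u = (x + s *\<^sub>R u) + h *\<^sub>R v" by (simp add: algebra_simps)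
  then have "f (x + h *\<^sub>R u + h *\<^sub>R v) - f (x + h *\<^sub>R u) - f (x + h *\<^sub>R v) + f x
      = h * (h * fd (\<lambda>x. fd f x u) (x + s *\<^sub>R u + t *\<^sub>R v) v)"
    using 1 2 by (simp add: algebra_simps)
  then show ?thesis using s t by (intro exI[of _ s] exI[of _ t]) auto
qed

lemma fd_commute:
  fixes f :: "'a::euclidean_space \<Rightarrow> real"
  assumes W: "open W" and f: "smooth_on W f" and x: "x \<in> W"
  shows "fd (\<lambda>x. fd f x u) x v = fd (\<lambda>x. fd f x v) x u"
proof (rule ccontr)
  define A where "A = (\<lambda>z. fd (\<lambda>x. fd f x u) z v)"
  define B where "B = (\<lambda>z. fd (\<lambda>x. fd f x v) z u)"
  assume "fd (\<lambda>x. fd f x u) x v \<noteq> fd (\<lambda>x. fd f x v) x u"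
  then have ne: "0 < \<bar>A x - B x\<bar> / 2" by (simp add: A_def B_def)
  have "isCont A x" "isCont B x"
    using smooth_on_continuous_on[OF smooth_on_fd[OF smooth_on_fd[OF f]]] W x
    unfolding A_def B_def by (metis continuous_on_eq_continuous_at)+
  then obtain d1 d2 where d: "d1 > 0" "\<And>z. dist z x < d1 \<Longrightarrow> dist (A z) (A x) < \<bar>A x - B x\<bar> / 2"
    "d2 > 0" "\<And>z. dist z x < d2 \<Longrightarrow> dist (B z) (B x) < \<bar>A x - B x\<bar> / 2"
    using ne by (metis continuous_at_eps_delta)
  obtain r where r: "r > 0" "ball x r \<subseteq> W" using W x open_contains_ball by blast
  define d where "d = min r (min d1 d2)"
  define h where "h = d / (2 * (norm u + norm v + 1))"
  have d0: "d > 0" using d r by (auto simp: d_def)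
  have n0: "0 < norm u + norm v + 1" by (metis add_nonneg_pos norm_ge_zero add_nonneg_nonneg zero_less_one)
  have h0: "h > 0" using d0 n0 by (simp add: h_def)
  have in_ball: "dist (x + s *\<^sub>R u + t *\<^sub>R v) x < d" if "0 \<le> s" "s \<le> h" "0 \<le> t" "t \<le> h" for s t
  proof -
    have "dist (x + s *\<^sub>R u + t *\<^sub>R v) x = norm (s *\<^sub>R u + t *\<^sub>R v)" by (simp add: dist_norm add.assoc)
    also have "\<dots> \<le> s * norm u + t * norm v"
      using that by (intro order_trans[OF norm_triangle_ineq]) auto
    also have "\<dots> \<le> h * norm u + h * norm v" using that by (intro add_mono mult_right_mono) auto
    also have "\<dots> \<le> h * (norm u + norm v + 1)" using h0 by (simp add: algebra_simps)
    also have "\<dots> = d / 2" using n0 by (simp add: h_def field_simps)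
    finally show ?thesis using d0 by linarith
  qed
  have in_W: "x + s *\<^sub>R u + t *\<^sub>R v \<in> W" if "0 \<le> s" "s \<le> h" "0 \<le> t" "t \<le> h" for s t
    using in_ball[OF that] r by (auto simp: d_def dist_commute)
  obtain s t where st: "0 \<le> s" "s \<le> h" "0 \<le> t" "t \<le> h" and
    1: "f (x + h *\<^sub>R u + h *\<^sub>R v) - f (x + h *\<^sub>R u) - f (x + h *\<^sub>R v) + f x = h * (h * A (x + s *\<^sub>R u + t *\<^sub>R v))"
    using second_difference_mvt[OF W f h0 in_W] unfolding A_def by blast
  have in_W': "x + s *\<^sub>R v + t *\<^sub>R u \<in> W" if "0 \<le> s" "s \<le> h" "0 \<le> t" "t \<le> h" for s t
    using in_W[of t s] that by (simp add: algebra_simps)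
  obtain s' t' where st': "0 \<le> s'" "s' \<le> h" "0 \<le> t'" "t' \<le> h" and
    2: "f (x + h *\<^sub>R v + h *\<^sub>R u) - f (x + h *\<^sub>R v) - f (x + h *\<^sub>R u) + f x = h * (h * B (x + s' *\<^sub>R v + t' *\<^sub>R u))"
    using second_difference_mvt[OF W f h0 in_W'] unfolding B_def by blast
  have "h * (h * A (x + s *\<^sub>R u + t *\<^sub>R v)) = h * (h * B (x + s' *\<^sub>R v + t' *\<^sub>R u))"
    using 1 2 by (simp add: algebra_simps)
  then have "A (x + s *\<^sub>R u + t *\<^sub>R v) = B (x + t' *\<^sub>R u + s' *\<^sub>R v)"
    using h0 by (simp add: algebra_simps)
  moreover have "dist (A (x + s *\<^sub>R u + t *\<^sub>R v)) (A x) < \<bar>A x - B x\<bar> / 2"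
    using in_ball[OF st] by (intro d) (simp add: d_def)
  moreover have "dist (B (x + t' *\<^sub>R u + s' *\<^sub>R v)) (B x) < \<bar>A x - B x\<bar> / 2"
    using in_ball[of t' s'] st' by (intro d) (simp add: d_def)
  ultimately show False by (auto simp: dist_real_def abs_if split: if_splits)
qed

section \<open>Hausdorff measure of graphs\<close>

lemma hausdorff2_pre_empty: "0 \<le> \<delta> \<Longrightarrow> hausdorff2_pre \<delta> ({} :: 'a::metric_space set) = 0"
proof -
  assume "0 \<le> \<delta>"
  then have "hausdorff2_pre \<delta> ({} :: 'a set) \<le> (\<Sum>i::nat. ennreal (pi * (diameter ({} :: 'a set) / 2)\<^sup>2))"
    unfolding hausdorff2_pre_def by (intro INF_lower) auto
  then show ?thesis by simp
qed

lemma hausdorff2_pre_Un: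
  assumes "0 \<le> \<delta>"
  shows "hausdorff2_pre \<delta> (A \<union> B) \<le> hausdorff2_pre \<delta> A + hausdorff2_pre \<delta> (B :: 'a::metric_space set)"
proof -
  define C where "C n = (if n = 0 then A else if n = 1 then B else {})" for n :: nat
  have "A \<union> B = (\<Union>n. C n)" by (auto simp: C_def split: if_splits)
  then have "hausdorff2_pre \<delta> (A \<union> B) \<le> (\<Sum>n. hausdorff2_pre \<delta> (C n))"
    using hausdorff2_pre_UN by metis
  also have "\<dots> = (\<Sum>n\<in>{0,1}. hausdorff2_pre \<delta> (C n))"
    using assms by (intro suminf_finite) (auto simp: C_def hausdorff2_pre_empty)
  finally show ?thesis by (simp add: C_def)
qed

lemma hausdorff2_pre_lipschitz:
  fixes f :: "'a::euclidean_space \<Rightarrow> 'b::euclidean_space"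
  assumes L: "0 < L" and \<delta>: "0 \<le> \<delta>" and f: "\<And>x y. x \<in> A \<Longrightarrow> y \<in> A \<Longrightarrow> dist (f x) (f y) \<le> L * dist x y"
  shows "hausdorff2_pre (L * \<delta>) (f ` A) \<le> ennreal (L\<^sup>2) * hausdorff2_pre \<delta> A"
proof -
  have L1: "ennreal (inverse (L\<^sup>2)) * (ennreal (L\<^sup>2) * z) = z" "ennreal (L\<^sup>2) * (ennreal (inverse (L\<^sup>2)) * z) = z" for z
    using L by (simp_all add: mult.assoc[symmetric] ennreal_mult[symmetric])
  have "ennreal (inverse (L\<^sup>2)) * hausdorff2_pre (L * \<delta>) (f ` A) \<le> hausdorff2_pre \<delta> A"
    unfolding hausdorff2_pre_def[of \<delta> A]
  proof (rule INF_greatest, clarify)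
    fix C :: "nat \<Rightarrow> 'a set"
    assume C: "A \<subseteq> (\<Union>i. C i)" "\<forall>i. bounded (C i) \<and> diameter (C i) \<le> \<delta>"
    define C' where "C' i = f ` (C i \<inter> A)" for i
    have d: "norm (x - y) \<le> L * diameter (C i)" if "x \<in> C' i" "y \<in> C' i" for x y i
    proof -
      obtain u v where uv: "u \<in> C i \<inter> A" "v \<in> C i \<inter> A" "x = f u" "y = f v"
        using \<open>x \<in> C' i\<close> \<open>y \<in> C' i\<close> by (auto simp: C'_def)
      have "norm (x - y) \<le> L * dist u v" using f uv by (simp add: dist_norm[symmetric])
      also have "\<dots> \<le> L * diameter (C i)"
        using uv C(2) L by (intro mult_left_mono diameter_bounded_bound) auto
      finally show ?thesis .
    qed
    have dC: "0 \<le> diameter (C i)" for i using C(2) diameter_ge_0 by blast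
    have diam: "diameter (C' i) \<le> L * diameter (C i)" for i
      using d dC L by (intro diameter_le) auto
    have bdd: "bounded (C' i)" for i
      using d[of _ i] unfolding bounded_def dist_norm by blast
    have "hausdorff2_pre (L * \<delta>) (f ` A) \<le> (\<Sum>i. ennreal (pi * (diameter (C' i) / 2)\<^sup>2))"
      unfolding hausdorff2_pre_def
    proof (rule INF_lower, intro CollectI conjI allI)
      show "f ` A \<subseteq> (\<Union>i. C' i)" using C(1) unfolding C'_def by blast
      show "diameter (C' i) \<le> L * \<delta>" for i
        using diam[of i] C(2) L by (meson mult_left_mono less_imp_le order_trans)
    qed (rule bdd)
    also have "\<dots> \<le> (\<Sum>i. ennreal (L\<^sup>2) * ennreal (pi * (diameter (C i) / 2)\<^sup>2))"
    proof (intro suminf_le allI)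
      fix i
      have "(diameter (C' i))\<^sup>2 \<le> (L * diameter (C i))\<^sup>2"
        using diam diameter_ge_0[OF bdd] by (intro power_mono) auto
      then have "pi * (diameter (C' i) / 2)\<^sup>2 \<le> L\<^sup>2 * (pi * (diameter (C i) / 2)\<^sup>2)"
        by (simp add: power_mult_distrib power_divide mult.left_commute)
      then show "ennreal (pi * (diameter (C' i) / 2)\<^sup>2) \<le> ennreal (L\<^sup>2) * ennreal (pi * (diameter (C i) / 2)\<^sup>2)"
        by (simp add: ennreal_mult[symmetric] ennreal_leI)
    qed auto
    also have "\<dots> = ennreal (L\<^sup>2) * (\<Sum>i. ennreal (pi * (diameter (C i) / 2)\<^sup>2))" by simp
    finally show "ennreal (inverse (L\<^sup>2)) * hausdorff2_pre (L * \<delta>) (f ` A) \<le> (\<Sum>i. ennreal (pi * (diameter (C i) / 2)\<^sup>2))"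
      using mult_left_mono[of _ _ "ennreal (inverse (L\<^sup>2))"] L1(1) by (metis zero_le)
  qed
  then show ?thesis
    using mult_left_mono[of _ _ "ennreal (L\<^sup>2)"] L1(2) by (metis zero_le)
qed

lemma hausdorff2_outer_lipschitz:
  fixes f :: "'a::euclidean_space \<Rightarrow> 'b::euclidean_space"
  assumes L: "0 < L" and f: "\<And>x y. x \<in> A \<Longrightarrow> y \<in> A \<Longrightarrow> dist (f x) (f y) \<le> L * dist x y"
  shows "hausdorff2_outer (f ` A) \<le> ennreal (L\<^sup>2) * hausdorff2_outer A"
  unfolding hausdorff2_outer_def[of "f ` A"]
proof (rule SUP_least)
  fix \<delta> :: real assume "\<delta> \<in> {0<..}"
  then have d: "0 < \<delta> / L" using L by simp
  have "hausdorff2_pre \<delta> (f ` A) \<le> ennreal (L\<^sup>2) * hausdorff2_pre (\<delta> / L) A"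
    using hausdorff2_pre_lipschitz[OF L less_imp_le[OF d] f] L by simp
  also have "\<dots> \<le> ennreal (L\<^sup>2) * hausdorff2_outer A"
    unfolding hausdorff2_outer_def using d by (intro mult_left_mono SUP_upper) auto
  finally show "hausdorff2_pre \<delta> (f ` A) \<le> ennreal (L\<^sup>2) * hausdorff2_outer A" .
qed

text \<open>A square is the union of four copies of itself scaled by one half, so that refining the
  diameter bound by one half does not increase the approximating sums.\<close>

lemma hausdorff2_unit_square_finite: "hausdorff2_outer (cbox 0 (1 :: real^2)) < top"
proof -
  let ?Q = "cbox 0 (1 :: real^2)"
  define g where "g a x = (1/2) *\<^sub>R (x + a)" for a x :: "real^2"
  have half: "hausdorff2_pre (\<delta> / 2) ?Q \<le> hausdorff2_pre \<delta> ?Q" if "0 < \<delta>" for \<delta>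
  proof -
    have g: "hausdorff2_pre (\<delta> / 2) (g a ` ?Q) \<le> ennreal (1/4) * hausdorff2_pre \<delta> ?Q" for a
    proof -
      have "dist (g a x) (g a y) \<le> 1/2 * dist x y" for x y
        by (simp add: g_def dist_norm scaleR_diff_right[symmetric])
      then show ?thesis
        using hausdorff2_pre_lipschitz[of "1/2" \<delta> ?Q "g a"] that by (simp add: power2_eq_square)
    qed
    have "?Q \<subseteq> (g 0 ` ?Q \<union> g (axis 1 1) ` ?Q) \<union> (g (axis 2 1) ` ?Q \<union> g 1 ` ?Q)"
    proof
      fix x assume x: "x \<in> ?Q"
      define a :: "real^2" where "a = (\<chi> i. if x $ i \<le> 1/2 then 0 else 1)"
      have "x = g a (2 *\<^sub>R x - a)" by (simp add: g_def scaleR_add_right)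
      moreover have "2 *\<^sub>R x - a \<in> ?Q" using x by (auto simp: mem_box_cart a_def)
      ultimately have "x \<in> g a ` ?Q" by blast
      moreover have "a \<in> {0, axis 1 1, axis 2 1, 1}"
        by (auto simp: a_def vec_eq_iff forall_2 axis_def)
      ultimately show "x \<in> (g 0 ` ?Q \<union> g (axis 1 1) ` ?Q) \<union> (g (axis 2 1) ` ?Q \<union> g 1 ` ?Q)" by blast
    qed
    then have "hausdorff2_pre (\<delta> / 2) ?Q \<le>
        hausdorff2_pre (\<delta> / 2) ((g 0 ` ?Q \<union> g (axis 1 1) ` ?Q) \<union> (g (axis 2 1) ` ?Q \<union> g 1 ` ?Q))"
      by (rule hausdorff2_pre_mono)
    also have "\<dots> \<le> (ennreal (1/4) * hausdorff2_pre \<delta> ?Q + ennreal (1/4) * hausdorff2_pre \<delta> ?Q) +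
        (ennreal (1/4) * hausdorff2_pre \<delta> ?Q + ennreal (1/4) * hausdorff2_pre \<delta> ?Q)"
      using that by (intro order_trans[OF hausdorff2_pre_Un] add_mono g) auto
    also have "\<dots> = (ennreal (1/4) + ennreal (1/4) + (ennreal (1/4) + ennreal (1/4))) * hausdorff2_pre \<delta> ?Q"
      by (simp add: distrib_right)
    also have "ennreal (1/4) + ennreal (1/4) + (ennreal (1/4) + ennreal (1/4)) = ennreal (1/4 + 1/4 + (1/4 + 1/4))"
      by (simp only: ennreal_plus[symmetric])
    finally show ?thesis by simp
  qed
  define d where "d = diameter ?Q + 1"
  have d: "0 < d" using diameter_ge_0[of ?Q] by (simp add: d_def)
  have pow: "hausdorff2_pre (d / 2 ^ n) ?Q \<le> hausdorff2_pre d ?Q" for n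
  proof (induction n)
    case (Suc n)
    have "hausdorff2_pre (d / 2 ^ n / 2) ?Q \<le> hausdorff2_pre (d / 2 ^ n) ?Q"
      using d by (intro half) auto
    then show ?case using Suc by (simp add: mult.commute)
  qed simp
  have "hausdorff2_outer ?Q \<le> hausdorff2_pre d ?Q"
    unfolding hausdorff2_outer_def
  proof (rule SUP_least)
    fix \<delta> :: real assume "\<delta> \<in> {0<..}"
    then have "0 < \<delta> / d" using d by simp
    then obtain n where "(1/2) ^ n < \<delta> / d"
      using real_arch_pow_inv[of "\<delta> / d" "1/2 :: real"] by fastforce
    then have "d * (1/2) ^ n < d * (\<delta> / d)" using d by (rule mult_strict_left_mono)
    moreover have "d * (\<delta> / d) = \<delta>" using d by simp
    moreover have "d * (1/2) ^ n = d / 2 ^ n" by (simp add: power_one_over)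
    ultimately have "d / 2 ^ n \<le> \<delta>" by linarith
    then show "hausdorff2_pre \<delta> ?Q \<le> hausdorff2_pre d ?Q"
      using order_trans[OF hausdorff2_pre_antimono pow] by simp
  qed
  also have "\<dots> \<le> (\<Sum>i::nat. ennreal (pi * (diameter (if i = 0 then ?Q else {}) / 2)\<^sup>2))"
    unfolding hausdorff2_pre_def
    by (rule INF_lower) (use d in \<open>auto simp: d_def bounded_cbox\<close>)
  also have "\<dots> = (\<Sum>i\<in>{0::nat}. ennreal (pi * (diameter (if i = 0 then ?Q else {}) / 2)\<^sup>2))"
    by (rule suminf_finite) auto
  also have "\<dots> < top" by simp
  finally show ?thesis .
qed

lemma lborel_le_hausdorff2:
  fixes A :: "(real^2) set"
  assumes "A \<in> sets borel"
  shows "emeasure lborel A \<le> 4 * hausdorff2_outer A"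
proof -
  have q: "ennreal (1/4) * (4 * z) = z" "4 * (ennreal (1/4) * z) = z" for z
  proof -
    have "ennreal (1/4) * ennreal 4 = 1"
      by (subst ennreal_mult[symmetric]) auto
    then have "ennreal (1/4) * 4 = 1" by simp
    then show "ennreal (1/4) * (4 * z) = z" "4 * (ennreal (1/4) * z) = z"
      by (metis mult.assoc mult_1, metis mult.assoc mult.commute mult_1)
  qed
  have "ennreal (1/4) * emeasure lborel A \<le> hausdorff2_pre 1 A"
    unfolding hausdorff2_pre_def
  proof (rule INF_greatest, clarify)
    fix C :: "nat \<Rightarrow> (real^2) set"
    assume C: "A \<subseteq> (\<Union>i. C i)" "\<forall>i. bounded (C i) \<and> diameter (C i) \<le> 1"
    define x where "x i = (SOME z. z \<in> C i)" for i
    define B where "B i = (if C i = {} then {} else cball (x i) (diameter (C i)))" for i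
    have CB: "C i \<subseteq> B i" for i
    proof
      fix z assume "z \<in> C i"
      then have "x i \<in> C i" unfolding x_def by (rule someI)
      then show "z \<in> B i"
        using \<open>z \<in> C i\<close> C(2) diameter_bounded_bound[of "C i" "x i" z] by (auto simp: B_def)
    qed
    have mB: "emeasure lborel (B i) \<le> 4 * ennreal (pi * (diameter (C i) / 2)\<^sup>2)" for i
    proof -
      have "0 \<le> diameter (C i)" using C(2) diameter_ge_0 by blast
      then have "emeasure lborel (B i) \<le> ennreal (pi * (diameter (C i))\<^sup>2)"
        by (auto simp: B_def emeasure_cball unit_ball_vol_2)
      also have "pi * (diameter (C i))\<^sup>2 = 4 * (pi * (diameter (C i) / 2)\<^sup>2)"
        by (simp add: power2_eq_square)
      also have "ennreal \<dots> = 4 * ennreal (pi * (diameter (C i) / 2)\<^sup>2)"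
        by (simp add: ennreal_mult)
      finally show ?thesis .
    qed
    have "emeasure lborel A \<le> emeasure lborel (\<Union>i. B i)"
    proof (rule emeasure_mono)
      show "A \<subseteq> (\<Union>i. B i)" using C(1) CB by blast
    qed (auto simp: B_def)
    also have "\<dots> \<le> (\<Sum>i. emeasure lborel (B i))"
      by (rule emeasure_subadditive_countably) (auto simp: B_def)
    also have "\<dots> \<le> (\<Sum>i. 4 * ennreal (pi * (diameter (C i) / 2)\<^sup>2))"
      using mB by (intro suminf_le) auto
    also have "\<dots> = 4 * (\<Sum>i. ennreal (pi * (diameter (C i) / 2)\<^sup>2))" by simp
    finally show "ennreal (1/4) * emeasure lborel A \<le> (\<Sum>i. ennreal (pi * (diameter (C i) / 2)\<^sup>2))"
      using mult_left_mono[of _ _ "ennreal (1/4)"] q(1) by (metis zero_le)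
  qed
  also have "\<dots> \<le> hausdorff2_outer A"
    unfolding hausdorff2_outer_def by (rule SUP_upper) auto
  finally show ?thesis
    using mult_left_mono[of _ _ "4::ennreal"] q(2) by (metis zero_le)
qed

lemma lborel_reflect: "distr lborel borel (\<lambda>y. x - y) = (lborel :: 'a::euclidean_space measure)"
proof -
  have "distr (distr lborel borel (\<lambda>y. (-1) *\<^sub>R y + 0)) borel ((+) x) = distr lborel borel (\<lambda>y :: 'a. x - y)"
    by (subst distr_distr) (auto simp: o_def)
  moreover have "lborel = density (distr lborel borel (\<lambda>y :: 'a. 0 + (-1) *\<^sub>R y)) (\<lambda>_. ennreal (\<bar>-1\<bar> ^ DIM('a)))"
    by (rule lborel_affine[of "-1" 0]) simp
  then have "distr lborel borel (\<lambda>y :: 'a. (-1) *\<^sub>R y + 0) = lborel" by (simp add: density_1)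
  ultimately show ?thesis by (simp add: lborel_distr_plus)
qed

text \<open>Uniqueness of Haar measure: integrate \<open>1\<^sub>A(x) 1\<^sub>B(x + y)\<close> in both orders.\<close>

lemma translation_invariant_measure_unique:
  fixes M :: "'a::euclidean_space measure"
  assumes sets: "sets M = sets borel" and sf: "sigma_finite_measure M"
    and inv: "\<And>a. distr M borel ((+) a) = M"
    and A: "A \<in> sets borel" and B: "B \<in> sets borel"
  shows "emeasure M A * emeasure lborel B = emeasure M B * emeasure lborel A"
proof -
  interpret M: sigma_finite_measure M by (rule sf)
  interpret P: pair_sigma_finite M lborel by standard
  note [measurable_cong] = sets
  note [measurable] = A B
  have "(\<integral>\<^sup>+x. (\<integral>\<^sup>+y. indicator A x * indicator B (x + y) \<partial>lborel) \<partial>M)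
      = (\<integral>\<^sup>+y. (\<integral>\<^sup>+x. indicator A x * indicator B (x + y) \<partial>M) \<partial>lborel)"
    by (rule P.Fubini'[symmetric]) measurable
  also have "\<dots> = (\<integral>\<^sup>+y. (\<integral>\<^sup>+x. indicator A (x - y) * indicator B x \<partial>M) \<partial>lborel)"
  proof (rule nn_integral_cong)
    fix y
    have "(\<integral>\<^sup>+x. indicator A (x - y) * indicator B x \<partial>M)
        = (\<integral>\<^sup>+x. indicator A (x - y) * indicator B x \<partial>(distr M borel ((+) y)))"
      by (simp add: inv)
    also have "\<dots> = (\<integral>\<^sup>+x. indicator A x * indicator B (x + y) \<partial>M)"
      by (subst nn_integral_distr) (auto simp: add.commute)
    finally show "(\<integral>\<^sup>+x. indicator A x * indicator B (x + y) \<partial>M)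
        = (\<integral>\<^sup>+x. indicator A (x - y) * indicator B x \<partial>M)" by simp
  qed
  also have "\<dots> = (\<integral>\<^sup>+x. (\<integral>\<^sup>+y. indicator A (x - y) * indicator B x \<partial>lborel) \<partial>M)"
    by (rule P.Fubini') measurable
  also have "\<dots> = (\<integral>\<^sup>+x. emeasure lborel A * indicator B x \<partial>M)"
  proof (rule nn_integral_cong)
    fix x
    have "(\<integral>\<^sup>+y. indicator A (x - y) \<partial>lborel) = (\<integral>\<^sup>+y. indicator A y \<partial>(distr lborel borel (\<lambda>y. x - y)))"
      by (subst nn_integral_distr) auto
    then show "(\<integral>\<^sup>+y. indicator A (x - y) * indicator B x \<partial>lborel) = emeasure lborel A * indicator B x"
      by (simp add: nn_integral_multc lborel_reflect)
  qed
  also have "\<dots> = emeasure lborel A * emeasure M B"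
    by (simp add: nn_integral_cmult_indicator)
  also have "(\<integral>\<^sup>+x. (\<integral>\<^sup>+y. indicator A x * indicator B (x + y) \<partial>lborel) \<partial>M)
      = (\<integral>\<^sup>+x. emeasure lborel B * indicator A x \<partial>M)"
  proof (rule nn_integral_cong)
    fix x
    have "(\<integral>\<^sup>+y. indicator B (x + y) \<partial>lborel) = (\<integral>\<^sup>+y. indicator B y \<partial>(distr lborel borel ((+) x)))"
      by (subst nn_integral_distr) auto
    then show "(\<integral>\<^sup>+y. indicator A x * indicator B (x + y) \<partial>lborel) = emeasure lborel B * indicator A x"
      by (simp add: nn_integral_cmult lborel_distr_plus mult.commute)
  qed
  also have "\<dots> = emeasure lborel B * emeasure M A"
    by (simp add: nn_integral_cmult_indicator)
  finally show ?thesis by (simp add: mult.commute)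
qed

text \<open>The value of this factor, \<open>1\<close> by the isodiametric inequality, plays no role.\<close>

definition hausdorff2_const :: real where
  "hausdorff2_const = enn2real (emeasure hausdorff2 (cbox 0 (1 :: real^2)))"

lemma emeasure_lborel_unit_square: "emeasure lborel (cbox 0 (1 :: real^2)) = 1"
proof -
  have b1: "(1 :: real^2) \<bullet> b = 1" if "b \<in> Basis" for b
    using that by (auto simp: Basis_vec_def inner_axis)
  show ?thesis by (simp add: emeasure_lborel_cbox_eq b1)
qed

lemma emeasure_hausdorff2_unit_square:
  "emeasure hausdorff2 (cbox 0 (1 :: real^2)) = ennreal hausdorff2_const" and hausdorff2_const_pos: "0 < hausdorff2_const"
proof -
  have fin: "emeasure hausdorff2 (cbox 0 (1 :: real^2)) < top"
    using hausdorff2_unit_square_finite by (simp add: emeasure_hausdorff2)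
  then show *: "emeasure hausdorff2 (cbox 0 (1 :: real^2)) = ennreal hausdorff2_const"
    by (simp add: hausdorff2_const_def)
  have "emeasure lborel (cbox 0 (1 :: real^2)) \<le> 4 * ennreal hausdorff2_const"
    using lborel_le_hausdorff2[of "cbox 0 (1 :: real^2)"] * by (simp add: emeasure_hausdorff2)
  then have "ennreal hausdorff2_const \<noteq> 0" by (auto simp: emeasure_lborel_unit_square)
  then show "0 < hausdorff2_const" using ennreal_neg not_less by metis
qed

lemma emeasure_hausdorff2_plane:
  fixes A :: "(real^2) set"
  assumes A: "A \<in> sets borel"
  shows "emeasure hausdorff2 A = ennreal hausdorff2_const * emeasure lborel A"
proof -
  let ?M = "hausdorff2 :: (real^2) measure"
  have le: "emeasure ?M ((\<lambda>x. k *\<^sub>R x + a) ` X) \<le> ennreal (k\<^sup>2) * emeasure ?M X"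
    if "0 < k" "X \<in> sets borel" "(\<lambda>x. k *\<^sub>R x + a) ` X \<in> sets borel" for k a X
  proof -
    have "dist (k *\<^sub>R x + a) (k *\<^sub>R y + a) \<le> k * dist x y" for x y
      using that by (simp add: dist_norm scaleR_diff_right[symmetric])
    then show ?thesis
      using hausdorff2_outer_lipschitz[of k X "\<lambda>x. k *\<^sub>R x + a"] that by (simp add: emeasure_hausdorff2)
  qed
  have inv: "distr ?M borel ((+) a) = ?M" for a
  proof (rule measure_eqI)
    fix X assume "X \<in> sets (distr ?M borel ((+) a))"
    then have X: "X \<in> sets borel" by simp
    then have X': "(+) a -` X \<in> sets borel"
      using measurable_sets[of "(+) a" borel borel X] by simp
    have 1: "(\<lambda>x. 1 *\<^sub>R x + a) ` ((+) a -` X) = X"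
    proof (intro equalityI subsetI)
      fix x assume "x \<in> X"
      then have "x - a \<in> (+) a -` X" by simp
      then show "x \<in> (\<lambda>x. 1 *\<^sub>R x + a) ` ((+) a -` X)" by (auto intro!: image_eqI[of _ _ "x - a"])
    qed (auto simp: add.commute)
    have 2: "(\<lambda>x. 1 *\<^sub>R x + (- a)) ` X = (+) a -` X"
    proof (intro equalityI subsetI)
      fix x assume "x \<in> (+) a -` X"
      then show "x \<in> (\<lambda>x. 1 *\<^sub>R x + (- a)) ` X" by (auto intro!: image_eqI[of _ _ "a + x"])
    qed auto
    have "emeasure ?M X = emeasure ?M ((+) a -` X)"
      using le[of 1 "(+) a -` X" a] le[of 1 X "- a"] X X' unfolding 1 2 by (simp add: antisym)
    then show "emeasure (distr ?M borel ((+) a)) X = emeasure ?M X"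
      using X by (subst emeasure_distr) auto
  qed simp
  have sf: "sigma_finite_measure ?M"
  proof
    define D where "D n = (\<lambda>x. real (Suc n) *\<^sub>R x + (- (real (Suc n) / 2)) *\<^sub>R 1) ` cbox 0 (1 :: real^2)" for n
    have D: "D n \<in> sets borel" for n
      unfolding D_def by (intro borel_closed compact_imp_closed compact_continuous_image)
        (auto intro!: continuous_intros)
    have "emeasure ?M (D n) \<noteq> \<infinity>" for n
    proof -
      have "emeasure ?M (D n) \<le> ennreal ((real (Suc n))\<^sup>2) * ennreal hausdorff2_const"
        using le[of "real (Suc n)" "cbox 0 1" "(- (real (Suc n) / 2)) *\<^sub>R 1"] D[of n]
        unfolding emeasure_hausdorff2_unit_square[symmetric] D_def by simp
      also have "\<dots> < \<infinity>" by (simp add: ennreal_mult_less_top)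
      finally show ?thesis by simp
    qed
    moreover have "(\<Union>n. D n) = UNIV"
    proof (intro equalityI subsetI UNIV_I)
      fix x :: "real^2"
      obtain n where n: "2 * norm x < real n" using reals_Archimedean2 by blast
      define y where "y = (1 / real (Suc n)) *\<^sub>R (x + (real (Suc n) / 2) *\<^sub>R 1)"
      have "x = real (Suc n) *\<^sub>R y + (- (real (Suc n) / 2)) *\<^sub>R 1"
        by (simp add: y_def del: of_nat_Suc)
      moreover have "y \<in> cbox 0 1"
      proof -
        have "0 \<le> y $ i \<and> y $ i \<le> 1" for i
        proof -
          have "2 * \<bar>x $ i\<bar> \<le> real (Suc n)" using component_le_norm_cart[of x i] n by linarith
          then show ?thesis by (auto simp: y_def field_simps abs_le_iff)
        qed
        then show ?thesis by (simp add: mem_box_cart)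
      qed
      ultimately show "x \<in> (\<Union>n. D n)" unfolding D_def by blast
    qed
    ultimately show "\<exists>A. countable A \<and> A \<subseteq> sets ?M \<and> \<Union> A = space ?M \<and> (\<forall>a\<in>A. emeasure ?M a \<noteq> \<infinity>)"
      using D by (intro exI[of _ "range D"]) auto
  qed
  show ?thesis
    using translation_invariant_measure_unique[OF sets_hausdorff2 sf inv A, of "cbox 0 1"]
    by (simp add: emeasure_lborel_unit_square emeasure_hausdorff2_unit_square)
qed

lemma sum_Basis_2: "(\<Sum>i\<in>(Basis :: (real^2) set). h i) = h (axis 1 1) + h (axis 2 1)"
proof -
  have B: "(Basis :: (real^2) set) = (\<lambda>i. axis i 1) ` UNIV" by (auto simp: Basis_vec_def)
  have "inj (\<lambda>i. axis i 1 :: real^2)" by (auto simp: inj_on_def axis_eq_axis)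
  then have "(\<Sum>i\<in>(Basis :: (real^2) set). h i) = (\<Sum>i\<in>UNIV. (h \<circ> (\<lambda>i. axis i 1)) i)"
    unfolding B by (rule sum.reindex)
  then show ?thesis by (simp add: sum_2)
qed

lemma fd_eq_pd:
  fixes f :: "real^2 \<Rightarrow> 'b::real_normed_vector"
  assumes "f differentiable (at y)"
  shows "fd f y v = v $ 1 *\<^sub>R pd 1 f y + v $ 2 *\<^sub>R pd 2 f y"
  using fd_linear_sum[OF assms, of v] by (simp add: sum_Basis_2 pd_def inner_axis)

lemma pd_eqI: "(f has_derivative D) (at y) \<Longrightarrow> pd i f y = D (axis i 1)"
  unfolding pd_def by (rule fd_eqI)

lemma pd_cong: "open V \<Longrightarrow> y \<in> V \<Longrightarrow> (\<And>z. z \<in> V \<Longrightarrow> f z = g z) \<Longrightarrow> pd i f y = pd i g y"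
  unfolding pd_def using frechet_derivative_cong_open(1) by metis

lemma smooth_on_pd: "smooth_on V f \<Longrightarrow> smooth_on V (pd i f)"
  unfolding pd_def[abs_def] by (rule smooth_on_fd)

lemma pd_commute:
  fixes f :: "real^2 \<Rightarrow> real"
  shows "open V \<Longrightarrow> smooth_on V f \<Longrightarrow> y \<in> V \<Longrightarrow> pd i (pd j f) y = pd j (pd i f) y"
  unfolding pd_def by (rule fd_commute)

lemma norm2_sq: "(norm (v :: real^2))\<^sup>2 = (v $ 1)\<^sup>2 + (v $ 2)\<^sup>2"
  unfolding power2_norm_eq_inner inner_vec_def by (simp add: sum_2 power2_eq_square)

lemma smooth_on_linear_approx:
  fixes f :: "real^2 \<Rightarrow> real"
  assumes V: "open V" and f: "smooth_on V f" and y0: "y0 \<in> V" and e: "0 < e"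
  obtains r where "0 < r" "ball y0 r \<subseteq> V"
    "\<And>y z. y \<in> ball y0 r \<Longrightarrow> z \<in> ball y0 r \<Longrightarrow> \<bar>f y - f z - fd f y0 (y - z)\<bar> \<le> e * norm (y - z)"
proof -
  have cont: "isCont (pd i f) y0" for i
    using smooth_on_continuous_on[OF smooth_on_pd[OF f]] V y0 by (metis continuous_on_eq_continuous_at)
  obtain r0 where r0: "r0 > 0" "ball y0 r0 \<subseteq> V" using V y0 open_contains_ball by blast
  obtain r1 where r1: "r1 > 0" "\<And>z. dist z y0 < r1 \<Longrightarrow> dist (pd 1 f z) (pd 1 f y0) < e/2"
    using cont[of 1] e by (metis continuous_at_eps_delta half_gt_zero)
  obtain r2 where r2: "r2 > 0" "\<And>z. dist z y0 < r2 \<Longrightarrow> dist (pd 2 f z) (pd 2 f y0) < e/2"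
    using cont[of 2] e by (metis continuous_at_eps_delta half_gt_zero)
  define r where "r = min r0 (min r1 r2)"
  define h where "h y = f y - fd f y0 y" for y
  have bl: "bounded_linear (frechet_derivative f (at y0))"
    using smooth_on_has_derivative[OF f y0] has_derivative_bounded_linear by blast
  have dh: "(h has_derivative (\<lambda>v. fd f z v - fd f y0 v)) (at z within ball y0 r)" if "z \<in> ball y0 r" for z
  proof -
    have "z \<in> V" using that r0 by (auto simp: r_def)
    then show ?thesis
      unfolding h_def
      by (rule has_derivative_at_withinI[OF has_derivative_diff[OF smooth_on_has_derivative[OF f]
          bounded_linear_imp_has_derivative[OF bl]]])
  qed
  have on: "onorm (\<lambda>v. fd f z v - fd f y0 v) \<le> e" if "z \<in> ball y0 r" for z
  proof (rule onorm_le)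
    fix v :: "real^2"
    have z: "z \<in> V" using that r0 by (auto simp: r_def)
    have "fd f z v - fd f y0 v = v $ 1 * (pd 1 f z - pd 1 f y0) + v $ 2 * (pd 2 f z - pd 2 f y0)"
      by (simp add: fd_eq_pd[OF smooth_on_differentiable[OF f z]] fd_eq_pd[OF smooth_on_differentiable[OF f y0]] algebra_simps)
    also have "norm \<dots> \<le> \<bar>v $ 1\<bar> * (e/2) + \<bar>v $ 2\<bar> * (e/2)"
    proof -
      have "\<bar>pd 1 f z - pd 1 f y0\<bar> \<le> e/2" "\<bar>pd 2 f z - pd 2 f y0\<bar> \<le> e/2"
        using that r1(2)[of z] r2(2)[of z] by (auto simp: r_def dist_commute dist_real_def abs_minus_commute)
      then show ?thesis
        unfolding real_norm_def
        by (intro order_trans[OF abs_triangle_ineq] add_mono) (simp_all only: abs_mult mult_left_mono abs_ge_zero)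
    qed
    also have "\<dots> \<le> norm v * (e/2) + norm v * (e/2)"
      using e component_le_norm_cart[of v] by (intro add_mono mult_right_mono) auto
    finally show "norm (fd f z v - fd f y0 v) \<le> e * norm v" by (simp add: mult.commute)
  qed
  show ?thesis
  proof
    show "0 < r" using r0 r1 r2 by (simp add: r_def)
    show "ball y0 r \<subseteq> V" using r0 by (auto simp: r_def)
    fix y z assume "y \<in> ball y0 r" "z \<in> ball y0 r"
    then have "norm (h y - h z) \<le> e * norm (y - z)"
      by (intro differentiable_bound[OF convex_ball dh on])
    moreover have "fd f y0 (y - z) = fd f y0 y - fd f y0 z"
      using bl by (simp add: linear_diff bounded_linear.linear)
    ultimately show "\<bar>f y - f z - fd f y0 (y - z)\<bar> \<le> e * norm (y - z)" by (simp add: h_def algebra_simps)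
  qed
qed

lemma emeasure_lborel_linear_image:
  fixes E :: "(real^2) set"
  assumes L: "linear L" and E: "E \<in> sets borel" "bounded E" and LE: "L ` E \<in> sets borel"
  shows "emeasure lborel (L ` E) = ennreal \<bar>det (matrix L)\<bar> * emeasure lborel E"
proof -
  have E': "E \<in> lmeasurable"
  proof (rule bounded_set_imp_lmeasurable)
    show "E \<in> sets lebesgue" using E(1) by (simp add: sets_completionI_sets)
  qed (rule E(2))
  have LE': "L ` E \<in> lmeasurable" using measurable_linear_image[OF L E'] .
  have em: "emeasure lborel X = ennreal (measure lebesgue X)" if "X \<in> sets borel" "X \<in> lmeasurable" for X :: "(real^2) set"
    using that emeasure_eq_measure2[of X lebesgue] by (simp add: fmeasurable_def)
  show ?thesis
    unfolding em[OF LE LE'] em[OF E(1) E'] measure_linear_image[OF L E'] by (simp add: ennreal_mult)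
qed

locale graph_map =
  fixes q e1 e2 e3 :: "real^3" and V :: "(real^2) set" and f :: "real^2 \<Rightarrow> real"
  assumes on: "e1 \<bullet> e1 = 1" "e2 \<bullet> e2 = 1" "e3 \<bullet> e3 = 1" "e1 \<bullet> e2 = 0" "e1 \<bullet> e3 = 0" "e2 \<bullet> e3 = 0"
    and e3_cross: "e3 = cross3 e1 e2"
    and open_V: "open V" and smooth_f: "smooth_on V f"
begin

lemma on_sym: "e2 \<bullet> e1 = 0" "e3 \<bullet> e1 = 0" "e3 \<bullet> e2 = 0"
  using on by (simp_all add: inner_commute)

definition G :: "real^2 \<Rightarrow> real^3" where
  "G y = q + y $ 1 *\<^sub>R e1 + y $ 2 *\<^sub>R e2 + f y *\<^sub>R e3"

definition pr :: "real^3 \<Rightarrow> real^2" where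
  "pr x = vector [(x - q) \<bullet> e1, (x - q) \<bullet> e2]"

definition W :: "real^2 \<Rightarrow> real" where
  "W y = sqrt (1 + (pd 1 f y)\<^sup>2 + (pd 2 f y)\<^sup>2)"

lemma pr_G [simp]: "pr (G y) = y"
  by (simp add: pr_def G_def vec_eq_iff forall_2 inner_add_left inner_add_right on on_sym)

lemma inj_G: "inj G" by (metis injI pr_G)

lemma W_ge_1: "1 \<le> W y" by (simp add: W_def)

lemma W_pos: "0 < W y" using W_ge_1[of y] by linarith

lemma W_sq: "(W y)\<^sup>2 = 1 + (pd 1 f y)\<^sup>2 + (pd 2 f y)\<^sup>2" by (simp add: W_def)

lemma smooth_W: "smooth_on V W"
  unfolding W_def[abs_def] using open_V
  by (intro smooth_intros smooth_on_pd smooth_f) (auto simp: add_pos_nonneg)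

lemma dist_G: "dist (G y) (G z) = norm (y - z, f y - f z)"
proof -
  have "(norm (G y - G z))\<^sup>2 = (norm (y - z))\<^sup>2 + (f y - f z)\<^sup>2"
  proof -
    have eq: "G y - G z = (y$1 - z$1) *\<^sub>R e1 + (y$2 - z$2) *\<^sub>R e2 + (f y - f z) *\<^sub>R e3"
      by (simp add: G_def algebra_simps)
    have "(G y - G z) \<bullet> (G y - G z) = (y$1 - z$1)\<^sup>2 + (y$2 - z$2)\<^sup>2 + (f y - f z)\<^sup>2"
      unfolding eq by (simp only: inner_add_left inner_add_right inner_scaleR_left inner_scaleR_right on on_sym)
        (simp add: power2_eq_square)
    then show ?thesis by (simp add: power2_norm_eq_inner[symmetric] norm2_sq)
  qed
  then show ?thesis
    by (simp add: dist_norm norm_Pair real_sqrt_unique)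
qed

lemma continuous_pr: "continuous_on A pr"
proof -
  have "pr x = ((x - q) \<bullet> e1) *\<^sub>R axis 1 1 + ((x - q) \<bullet> e2) *\<^sub>R axis 2 1" for x
    by (simp add: pr_def vec_eq_iff forall_2 axis_def)
  then show ?thesis by (simp add: continuous_intros)
qed

lemma smooth_G: "smooth_on V G"
proof -
  have "bounded_linear (\<lambda>y :: real^2. y $ i)" for i by (rule bounded_linear_vec_nth)
  then show ?thesis
    unfolding G_def[abs_def] using open_V smooth_f
    by (intro smooth_on_add smooth_on_scaleR smooth_on_const smooth_on_bounded_linear[of "\<lambda>y. y $ _"]) auto
qed

lemma continuous_G: "continuous_on V G"
  by (rule smooth_on_continuous_on[OF smooth_G])

lemma borel_pr: "pr \<in> borel_measurable borel"
  using continuous_pr[of UNIV] by (rule borel_measurable_continuous_onI)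

definition G0 :: "real^2 \<Rightarrow> real^3" where "G0 y = (if y \<in> V then G y else 0)"
definition W0 :: "real^2 \<Rightarrow> real" where "W0 y = (if y \<in> V then W y else 0)"

lemma borel_G0: "G0 \<in> borel_measurable borel"
  unfolding G0_def[abs_def] using open_V
  by (intro borel_measurable_continuous_on_if continuous_G) auto

lemma borel_W0: "W0 \<in> borel_measurable borel"
  unfolding W0_def[abs_def] using open_V
  by (intro borel_measurable_continuous_on_if smooth_on_continuous_on[OF smooth_W]) auto

lemma borel_G_image:
  assumes E: "E \<in> sets borel" "E \<subseteq> V"
  shows "G ` E \<in> sets borel"
proof -
  have "G ` E = {x \<in> space borel. pr x \<in> E \<and> G0 (pr x) = x}"
    using E(2) by (auto simp: G0_def subset_eq image_iff) (metis)
  moreover have "{x \<in> space borel. pr x \<in> E \<and> G0 (pr x) = x} \<in> sets borel"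
  proof -
    note [measurable] = borel_pr borel_G0 E(1)
    show ?thesis by measurable
  qed
  ultimately show ?thesis by simp
qed

definition area :: "(real^2) set \<Rightarrow> ennreal" where
  "area E = (\<integral>\<^sup>+y\<in>E. ennreal (hausdorff2_const * W0 y) \<partial>lborel)"

text \<open>Near \<open>y0\<close> the graph map is almost an isometry composed with the linear map
  \<open>I + v v\<^sup>T / (W + 1)\<close>, \<open>v = grad f\<close>, the square root of the first fundamental form.\<close>

lemma area_local:
  assumes y0: "y0 \<in> V" and K: "1 < K"
  obtains r where "0 < r" "ball y0 r \<subseteq> V"
    "\<And>E. E \<in> sets borel \<Longrightarrow> E \<subseteq> ball y0 r \<Longrightarrow> hausdorff2_outer (G ` E) \<le> ennreal K * area E"
    "\<And>E. E \<in> sets borel \<Longrightarrow> E \<subseteq> ball y0 r \<Longrightarrow> area E \<le> ennreal K * hausdorff2_outer (G ` E)"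
proof -
  have "((\<lambda>e::real. (1 + e)\<^sup>2 / (1 - e)) \<longlongrightarrow> (1 + 0)\<^sup>2 / (1 - 0)) (at_right 0)"
    by (intro tendsto_intros) auto
  then have ev1: "\<forall>\<^sub>F e::real in at_right 0. (1 + e)\<^sup>2 / (1 - e) < K"
    using K by (intro order_tendstoD) auto
  have "((\<lambda>e::real. (1 + e) / (1 - e)\<^sup>2) \<longlongrightarrow> (1 + 0) / (1 - 0)\<^sup>2) (at_right 0)"
    by (intro tendsto_intros) auto
  then have ev2: "\<forall>\<^sub>F e::real in at_right 0. (1 + e) / (1 - e)\<^sup>2 < K"
    using K by (intro order_tendstoD) auto
  have ev3: "\<forall>\<^sub>F e::real in at_right 0. e < 1 \<and> 0 < e"
    by (auto simp: eventually_at_right_field intro!: exI[of _ 1])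
  obtain e :: real where e: "0 < e" "e < 1" "(1 + e)\<^sup>2 / (1 - e) < K" "(1 + e) / (1 - e)\<^sup>2 < K"
    using eventually_happens[OF eventually_conj[OF ev1 eventually_conj[OF ev2 ev3]]] by auto
  obtain r1 where r1: "0 < r1" "ball y0 r1 \<subseteq> V" and lin:
    "\<And>y z. y \<in> ball y0 r1 \<Longrightarrow> z \<in> ball y0 r1 \<Longrightarrow> \<bar>f y - f z - fd f y0 (y - z)\<bar> \<le> e * norm (y - z)"
    using smooth_on_linear_approx[OF open_V smooth_f y0 e(1)] by metis
  have "isCont W y0"
    using smooth_on_continuous_on[OF smooth_W] open_V y0 by (metis continuous_on_eq_continuous_at)
  then obtain r2 where r2: "r2 > 0" "\<And>z. dist z y0 < r2 \<Longrightarrow> dist (W z) (W y0) < e"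
    using e(1) by (metis continuous_at_eps_delta)
  define r where "r = min r1 r2"
  define a b s where "a = pd 1 f y0" and "b = pd 2 f y0" and "s = 1 / (W y0 + 1)"
  define M :: "real^2^2" where "M = vector [vector [1 + s * a * a, s * a * b], vector [s * a * b, 1 + s * b * b]]"
  define L where "L = (*v) M"
  have W2: "a\<^sup>2 + b\<^sup>2 = (W y0 - 1) * (W y0 + 1)"
    using W_sq[of y0] by (simp add: a_def b_def algebra_simps power2_eq_square)
  have sab: "s * (a\<^sup>2 + b\<^sup>2) = W y0 - 1"
    unfolding W2 s_def using W_pos[of y0] by (simp add: field_simps)
  have s2: "2 * s + s\<^sup>2 * (a\<^sup>2 + b\<^sup>2) = 1"
  proof -
    have "2 * s + s\<^sup>2 * (a\<^sup>2 + b\<^sup>2) = s * (2 + s * (a\<^sup>2 + b\<^sup>2))" by (simp add: power2_eq_square algebra_simps)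
    also have "\<dots> = s * (W y0 + 1)" unfolding sab by simp
    also have "\<dots> = 1" using W_pos[of y0] by (simp add: s_def)
    finally show ?thesis .
  qed
  have det: "det M = W y0"
  proof -
    have "det M = 1 + s * (a\<^sup>2 + b\<^sup>2)" by (simp add: M_def det_2 power2_eq_square algebra_simps)
    then show ?thesis using sab by simp
  qed
  have linL: "linear L" by (simp add: L_def)
  have norm_L: "norm (L v) = norm (v, fd f y0 v)" for v
  proof -
    have L1: "L v $ 1 = v $ 1 + s * a * (a * v $ 1 + b * v $ 2)" "L v $ 2 = v $ 2 + s * b * (a * v $ 1 + b * v $ 2)"
      by (simp_all add: L_def M_def matrix_vector_mult_def sum_2 algebra_simps)
    define t where "t = a * v $ 1 + b * v $ 2"
    have "(norm (L v))\<^sup>2 = (norm v)\<^sup>2 + t\<^sup>2 * (2 * s + s\<^sup>2 * (a\<^sup>2 + b\<^sup>2))"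
      unfolding norm2_sq L1 t_def[symmetric]
      by (simp add: power2_eq_square algebra_simps) (simp add: t_def algebra_simps)
    moreover have "fd f y0 v = t"
      by (simp add: fd_eq_pd[OF smooth_on_differentiable[OF smooth_f y0]] t_def a_def b_def mult.commute)
    ultimately have "(norm (L v))\<^sup>2 = (norm v)\<^sup>2 + (fd f y0 v)\<^sup>2" using s2 by simp
    then show ?thesis by (simp add: norm_Pair real_sqrt_unique)
  qed
  have norm_ge: "norm v \<le> norm (L v)" for v
    unfolding norm_L by (simp add: norm_Pair)
  have injL: "L y = L z \<longleftrightarrow> y = z" for y z
    using norm_ge[of "y - z"] linear_diff[OF linL, of y z] by auto
  have dist_L: "dist (L y) (L z) = norm (L (y - z))" for y z
    by (simp add: dist_norm linear_diff[OF linL])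
  have near: "\<bar>dist (G y) (G z) - dist (L y) (L z)\<bar> \<le> e * dist (L y) (L z)"
    if "y \<in> ball y0 r" "z \<in> ball y0 r" for y z
  proof -
    have "\<bar>norm (y - z, f y - f z) - norm (y - z, fd f y0 (y - z))\<bar>
        \<le> norm ((y - z, f y - f z) - (y - z, fd f y0 (y - z)))"
      by (rule norm_triangle_ineq3)
    also have "\<dots> = \<bar>f y - f z - fd f y0 (y - z)\<bar>" by (simp add: norm_Pair)
    also have "\<dots> \<le> e * norm (y - z)" using that by (intro lin) (auto simp: r_def)
    also have "\<dots> \<le> e * norm (L (y - z))" using e norm_ge by (intro mult_left_mono) auto
    finally show ?thesis by (simp add: dist_G dist_L norm_L)
  qed
  have r: "0 < r" "ball y0 r \<subseteq> V" using r1 r2 by (auto simp: r_def)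
  define k where "k = hausdorff2_const * W y0"
  have k0: "0 \<le> k" using hausdorff2_const_pos W_pos[of y0] by (simp add: k_def)
  have main: "hausdorff2_outer (G ` E) \<le> ennreal ((1 + e)\<^sup>2 * k) * emeasure lborel E"
    "ennreal k * emeasure lborel E \<le> ennreal (1 / (1 - e)\<^sup>2) * hausdorff2_outer (G ` E)"
    if E: "E \<in> sets borel" "E \<subseteq> ball y0 r" for E
  proof -
    obtain L' where L': "linear L'" "L' \<circ> L = id"
      using linear_injective_left_inverse[OF linL] injL by (auto simp: inj_on_def)
    have "inj L" "surj L" using injL linL by (auto simp: inj_on_def linear_injective_imp_surjective)
    then have "L ` E = L' -` E"
      using L'(2) by (auto simp: fun_eq_iff image_iff) (metis surj_def)
    moreover have "L' \<in> borel_measurable borel"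
      using L'(1) by (intro borel_measurable_continuous_onI linear_continuous_on) (simp add: linear_linear)
    ultimately have LE: "L ` E \<in> sets borel"
      using measurable_sets[of L' borel borel E] E by simp
    have "bounded E" using E(2) bounded_ball bounded_subset by blast
    then have HL: "hausdorff2_outer (L ` E) = ennreal k * emeasure lborel E"
      using emeasure_hausdorff2_plane[OF LE] emeasure_lborel_linear_image[OF linL E(1) _ LE] W_pos[of y0] hausdorff2_const_pos
        emeasure_hausdorff2[OF LE, symmetric]
      by (simp add: matrix_of_matrix_vector_mul L_def det k_def ennreal_mult mult.assoc)
    define g where "g x = G (L' x)" for x
    have gL: "g (L y) = G y" for y using L'(2) by (simp add: g_def fun_eq_iff)
    have "hausdorff2_outer (g ` (L ` E)) \<le> ennreal ((1 + e)\<^sup>2) * hausdorff2_outer (L ` E)"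
    proof (rule hausdorff2_outer_lipschitz)
      fix x y assume "x \<in> L ` E" "y \<in> L ` E"
      then obtain u v where "u \<in> E" "v \<in> E" "x = L u" "y = L v" by auto
      then show "dist (g x) (g y) \<le> (1 + e) * dist x y"
        using near[of u v] subsetD[OF E(2)] by (simp add: gL algebra_simps abs_le_iff)
    qed (use e in simp)
    then show "hausdorff2_outer (G ` E) \<le> ennreal ((1 + e)\<^sup>2 * k) * emeasure lborel E"
      using k0 by (simp add: HL image_image gL ennreal_mult mult.assoc)
    define h where "h x = L (pr x)" for x
    have "hausdorff2_outer (h ` (G ` E)) \<le> ennreal ((1 / (1 - e))\<^sup>2) * hausdorff2_outer (G ` E)"
    proof (rule hausdorff2_outer_lipschitz)
      fix x y assume "x \<in> G ` E" "y \<in> G ` E"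
      then obtain u v where uv: "u \<in> E" "v \<in> E" "x = G u" "y = G v" by auto
      then have "(1 - e) * dist (L u) (L v) \<le> dist (G u) (G v)"
        using near[of u v] subsetD[OF E(2)] by (simp add: algebra_simps abs_le_iff)
      then show "dist (h x) (h y) \<le> 1 / (1 - e) * dist x y"
        using e uv by (simp add: h_def field_simps)
    qed (use e in simp)
    moreover have "h ` (G ` E) = L ` E" by (simp add: h_def image_image)
    ultimately show "ennreal k * emeasure lborel E \<le> ennreal (1 / (1 - e)\<^sup>2) * hausdorff2_outer (G ` E)"
      by (simp add: HL power_divide)
  qed
  have area_b: "area E \<le> ennreal ((1 + e) * k) * emeasure lborel E"
    "ennreal ((1 - e) * k) * emeasure lborel E \<le> area E"
    if E: "E \<in> sets borel" "E \<subseteq> ball y0 r" for E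
  proof -
    have Wb: "hausdorff2_const * W0 y \<le> (1 + e) * k" "(1 - e) * k \<le> hausdorff2_const * W0 y" if "y \<in> E" for y
    proof -
      have "\<bar>W y - W y0\<bar> \<le> e"
        using r2(2)[of y] that E(2) by (force simp: r_def dist_commute dist_real_def)
      moreover have "e \<le> e * W y0" using e W_ge_1[of y0] by simp
      ultimately have "W y \<le> (1 + e) * W y0" "(1 - e) * W y0 \<le> W y" by (auto simp: algebra_simps abs_le_iff)
      moreover have "W0 y = W y" using that E(2) r by (auto simp: W0_def)
      ultimately show "hausdorff2_const * W0 y \<le> (1 + e) * k" "(1 - e) * k \<le> hausdorff2_const * W0 y"
        using hausdorff2_const_pos mult_left_mono[of _ _ hausdorff2_const] by (auto simp: k_def mult.left_commute)
    qed
    have "area E \<le> (\<integral>\<^sup>+y\<in>E. ennreal ((1 + e) * k) \<partial>lborel)"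
      unfolding area_def by (intro nn_integral_mono) (auto simp: indicator_def intro!: ennreal_leI Wb)
    then show "area E \<le> ennreal ((1 + e) * k) * emeasure lborel E"
      using E by (simp add: nn_integral_cmult_indicator)
    have "(\<integral>\<^sup>+y\<in>E. ennreal ((1 - e) * k) \<partial>lborel) \<le> area E"
      unfolding area_def by (intro nn_integral_mono) (auto simp: indicator_def intro!: ennreal_leI Wb)
    then show "ennreal ((1 - e) * k) * emeasure lborel E \<le> area E"
      using E by (simp add: nn_integral_cmult_indicator)
  qed
  show ?thesis
  proof (rule that[OF r])
    fix E assume E: "E \<in> sets borel" "E \<subseteq> ball y0 r"
    have "(1 + e)\<^sup>2 * k = (1 + e)\<^sup>2 / (1 - e) * ((1 - e) * k)" using e by simp
    then have "ennreal ((1 + e)\<^sup>2 * k) * emeasure lborel E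
        = ennreal ((1 + e)\<^sup>2 / (1 - e)) * (ennreal ((1 - e) * k) * emeasure lborel E)"
      using e k0 by (simp add: ennreal_mult[symmetric] mult.assoc[symmetric])
    also have "\<dots> \<le> ennreal K * area E"
      using e by (intro mult_mono area_b[OF E] ennreal_leI) auto
    finally show "hausdorff2_outer (G ` E) \<le> ennreal K * area E" using main(1)[OF E] by (rule order_trans[rotated])
    have "area E \<le> ennreal (1 + e) * (ennreal k * emeasure lborel E)"
      using area_b(1)[OF E] e k0 by (simp add: ennreal_mult mult.assoc)
    also have "\<dots> \<le> ennreal (1 + e) * (ennreal (1 / (1 - e)\<^sup>2) * hausdorff2_outer (G ` E))"
      by (intro mult_left_mono main(2)[OF E]) auto
    also have "\<dots> = ennreal ((1 + e) / (1 - e)\<^sup>2) * hausdorff2_outer (G ` E)"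
    proof -
      have "ennreal ((1 + e) / (1 - e)\<^sup>2) = ennreal (1 + e) * ennreal (1 / (1 - e)\<^sup>2)"
        using e by (subst ennreal_mult[symmetric]) auto
      then show ?thesis by (simp only: mult.assoc)
    qed
    also have "\<dots> \<le> ennreal K * hausdorff2_outer (G ` E)"
      using e by (intro mult_right_mono ennreal_leI) auto
    finally show "area E \<le> ennreal K * hausdorff2_outer (G ` E)" .
  qed
qed

lemma ennreal_le_mult_gt_1:
  assumes "\<And>K::real. 1 < K \<Longrightarrow> a \<le> ennreal K * (b::ennreal)" shows "a \<le> b"
proof (cases "b = top")
  case False
  then obtain r where r: "b = ennreal r" "0 \<le> r" by (cases b) auto
  have "((\<lambda>K. ennreal (K * r)) \<longlongrightarrow> ennreal (1 * r)) (at_right 1)"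
    by (intro tendsto_intros)
  moreover have "\<forall>\<^sub>F K in at_right 1. a \<le> ennreal (K * r)"
    using assms r by (auto simp: eventually_at_right_field ennreal_mult intro!: exI[of _ 2])
  ultimately show ?thesis
    using r tendsto_lowerbound[of "\<lambda>K. ennreal (K * r)" _ "at_right 1" a] by simp
qed simp

lemma area_formula:
  assumes E: "E \<in> sets borel" "E \<subseteq> V"
  shows "emeasure hausdorff2 (G ` E) = area E"
proof -
  have le: "hausdorff2_outer (G ` E) \<le> ennreal K * area E \<and> area E \<le> ennreal K * hausdorff2_outer (G ` E)"
    if K: "1 < K" for K :: real
  proof (cases "E = {}")
    case True then show ?thesis by (simp add: area_def hausdorff2_outer_empty)
  next
    case False
    define good where "good U \<longleftrightarrow> open U \<and> (\<forall>E. E \<in> sets borel \<longrightarrow> E \<subseteq> U \<longrightarrow>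
      hausdorff2_outer (G ` E) \<le> ennreal K * area E \<and> area E \<le> ennreal K * hausdorff2_outer (G ` E))" for U
    have "\<exists>U. y \<in> U \<and> good U" if "y \<in> V" for y
      using area_local[OF that K] unfolding good_def by (metis centre_in_ball open_ball)
    then have cov: "V \<subseteq> \<Union>{U. good U}" by blast
    obtain F where F: "F \<subseteq> {U. good U}" "countable F" "\<Union>F = \<Union>{U. good U}"
      using Lindelof[of "{U. good U}"] by (auto simp: good_def)
    have "F \<noteq> {}"
    proof
      assume "F = {}"
      then have "\<Union>{U. good U} = {}" using F(3) by simp
      then show False using False E(2) cov by auto
    qed
    then obtain B :: "nat \<Rightarrow> (real^2) set" where B: "range B = F"
      using F(2) uncountable_def by metis
    define D where "D n = disjointed B n \<inter> E" for n
    have Bo: "good (B n)" for n using B F by auto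
    have D: "D n \<in> sets borel" "D n \<subseteq> B n" "D n \<subseteq> V" for n
    proof -
      have "range B \<subseteq> sets borel" using Bo by (auto simp: good_def)
      then have "disjointed B n \<in> sets borel" using sets.range_disjointed_sets by blast
      then show "D n \<in> sets borel" using E by (simp add: D_def)
      show "D n \<subseteq> B n" "D n \<subseteq> V" using disjointed_subset[of B n] E by (auto simp: D_def)
    qed
    have disj: "disjoint_family D"
      using disjoint_family_disjointed[of B] unfolding D_def disjoint_family_on_def by blast
    have UD: "(\<Union>n. D n) = E"
    proof -
      have "E \<subseteq> (\<Union>n. B n)" using E cov F B by auto
      then show ?thesis using UN_disjointed_eq[of B] by (auto simp: D_def)
    qed
    have area_sum: "area E = (\<Sum>n. area (D n))"
    proof -
      have "emeasure (density lborel (\<lambda>y. ennreal (hausdorff2_const * W0 y))) X = area X" if "X \<in> sets borel" for X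
        using that borel_W0 by (subst emeasure_density) (auto simp: area_def)
      then show ?thesis
        using suminf_emeasure[of D "density lborel (\<lambda>y. ennreal (hausdorff2_const * W0 y))"] D(1) E(1) disj UD
        by (simp add: image_subset_iff)
    qed
    have H_sum: "hausdorff2_outer (G ` E) = (\<Sum>n. hausdorff2_outer (G ` D n))"
    proof -
      have "disjoint_family (\<lambda>n. G ` D n)"
        using disj inj_G unfolding disjoint_family_on_def by (metis image_Int image_empty)
      then have "(\<Sum>n. emeasure hausdorff2 (G ` D n)) = emeasure hausdorff2 (\<Union>n. G ` D n)"
        using borel_G_image D by (intro suminf_emeasure) auto
      moreover have "(\<Union>n. G ` D n) = G ` E" using UD by blast
      ultimately show ?thesis using borel_G_image D E by (simp add: emeasure_hausdorff2)
    qed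
    have "hausdorff2_outer (G ` D n) \<le> ennreal K * area (D n)" "area (D n) \<le> ennreal K * hausdorff2_outer (G ` D n)" for n
      using Bo[of n] D[of n] unfolding good_def by auto
    then show ?thesis
      unfolding area_sum H_sum by (simp del: ennreal_suminf_cmult add: ennreal_suminf_cmult[symmetric] suminf_le)
  qed
  then have "hausdorff2_outer (G ` E) = area E"
    using antisym[OF ennreal_le_mult_gt_1 ennreal_le_mult_gt_1] by simp
  then show ?thesis using borel_G_image[OF E] by (simp add: emeasure_hausdorff2)
qed

lemma hausdorff2_graph_eq_distr:
  assumes D: "D \<in> sets borel" "D \<subseteq> V"
  shows "density hausdorff2 (indicator (G ` D)) =
    distr (density lborel (\<lambda>y. ennreal (hausdorff2_const * W0 y) * indicator D y)) borel G0"
proof (rule measure_eqI)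
  note [measurable] = borel_G0 borel_W0 D(1)
  fix A assume "A \<in> sets (density hausdorff2 (indicator (G ` D)))"
  then have A [measurable]: "A \<in> sets borel" by simp
  have GA: "G ` D \<inter> A = G ` (D \<inter> G0 -` A)" using D(2) by (auto simp: G0_def)
  have m: "D \<inter> G0 -` A \<in> sets borel"
    using measurable_sets[OF borel_G0 A] D(1) by simp
  have "emeasure (density hausdorff2 (indicator (G ` D))) A = emeasure hausdorff2 (G ` D \<inter> A)"
    using borel_G_image[OF D] A
    by (subst emeasure_density) (auto simp: indicator_inter_arith[symmetric])
  also have "\<dots> = area (D \<inter> G0 -` A)"
    unfolding GA using D by (intro area_formula m) auto
  also have "\<dots> = emeasure (distr (density lborel (\<lambda>y. ennreal (hausdorff2_const * W0 y) * indicator D y)) borel G0) A"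
    using m by (subst emeasure_distr, simp, simp, subst emeasure_density)
      (auto simp: area_def indicator_inter_arith mult.assoc measurable_sets[OF borel_G0 A, simplified]
        intro!: nn_integral_cong)
  finally show "emeasure (density hausdorff2 (indicator (G ` D))) A =
    emeasure (distr (density lborel (\<lambda>y. ennreal (hausdorff2_const * W0 y) * indicator D y)) borel G0) A" .
qed simp

end

section \<open>Graph patches of a surface\<close>

lemma matrix_inv_eqI:
  fixes A B :: "real^'n^'n"
  assumes "A ** B = mat 1" shows "matrix_inv A = B"
proof -
  have BA: "B ** A = mat 1" using assms matrix_left_right_inverse by blast
  have "A ** matrix_inv A = mat 1 \<and> matrix_inv A ** A = mat 1"
    unfolding matrix_inv_def by (rule someI[of _ B]) (use assms BA in simp)
  then have "matrix_inv A = (B ** A) ** matrix_inv A" using BA by simp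
  also have "\<dots> = B" using \<open>A ** matrix_inv A = mat 1 \<and> _\<close> by (simp add: matrix_mul_assoc[symmetric])
  finally show ?thesis .
qed

lemma trace_square_2: "trace (B ** B :: real^2^2) = (trace B)\<^sup>2 - 2 * det B"
  by (simp add: trace_def sum_2 matrix_matrix_mult_def det_2 power2_eq_square algebra_simps)

lemma openin_upper_unique:
  assumes "open U" "y \<in> U \<inter> upper"
    and "(f has_derivative D) (at y within U \<inter> upper)" "(f has_derivative D') (at y within U \<inter> upper)"
  shows "D = (D' :: real^2 \<Rightarrow> 'b::real_normed_vector)"
proof (rule frechet_derivative_unique_within[OF assms(3,4)])
  fix i :: "real^2" and e :: real assume i: "i \<in> Basis" and e: "0 < e"
  obtain r where r: "r > 0" "ball y r \<subseteq> U" using assms(1,2) open_contains_ball by blast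
  define d where "d = min e r / 2"
  have d: "0 < d" "d < e" "d < r" using e r by (auto simp: d_def)
  have "y + d *\<^sub>R i \<in> ball y r" using i d by (simp add: dist_norm)
  moreover have "0 \<le> i $ 2" using i by (auto simp: Basis_vec_def axis_def)
  ultimately show "\<exists>d. 0 < \<bar>d\<bar> \<and> \<bar>d\<bar> < e \<and> y + d *\<^sub>R i \<in> U \<inter> upper"
    using d r assms(2) by (intro exI[of _ d]) (auto simp: upper_def)
qed

lemma fd_cong_upper:
  fixes f g :: "real^2 \<Rightarrow> 'b::real_normed_vector"
  assumes U: "open U" and y: "y \<in> U \<inter> upper" and f: "f differentiable (at y)" and g: "g differentiable (at y)"
    and eq: "\<And>z. z \<in> U \<inter> upper \<Longrightarrow> f z = g z"
  shows "frechet_derivative f (at y) = frechet_derivative g (at y)"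
proof (rule openin_upper_unique[OF U y])
  show "(f has_derivative frechet_derivative f (at y)) (at y within U \<inter> upper)"
    using f frechet_derivative_works has_derivative_at_withinI by blast
  have "(g has_derivative frechet_derivative g (at y)) (at y within U \<inter> upper)"
    using g frechet_derivative_works has_derivative_at_withinI by blast
  then show "(f has_derivative frechet_derivative g (at y)) (at y within U \<inter> upper)"
    using eq by (intro has_derivative_transform[where f = g and g = f, OF y]) auto
qed

lemma has_derivative_pd:
  assumes "f differentiable (at y)"
  shows "(f has_derivative (\<lambda>v. v $ 1 *\<^sub>R pd 1 f y + v $ 2 *\<^sub>R pd 2 f y)) (at y)"
  using assms unfolding frechet_derivative_works fd_eq_pd[OF assms, symmetric] .

context graph_map
begin

lemma has_derivative_f: "y \<in> V \<Longrightarrow> (f has_derivative (\<lambda>v. v $ 1 * pd 1 f y + v $ 2 * pd 2 f y)) (at y)"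
  using has_derivative_pd[OF smooth_on_differentiable[OF smooth_f]] by simp

lemma W_mult: "W y * W y = 1 + (pd 1 f y * pd 1 f y + pd 2 f y * pd 2 f y)"
  using W_sq[of y] by (simp add: power2_eq_square)

lemma fd_G: "y \<in> V \<Longrightarrow> fd G y v = v $ 1 *\<^sub>R e1 + v $ 2 *\<^sub>R e2 + (v $ 1 * pd 1 f y + v $ 2 * pd 2 f y) *\<^sub>R e3"
proof (rule fd_eqI)
  assume y: "y \<in> V"
  have nth: "((\<lambda>y. y $ i) has_derivative (\<lambda>v. v $ i)) (at y)" for i
    by (rule bounded_linear_imp_has_derivative[OF bounded_linear_vec_nth])
  show "(G has_derivative (\<lambda>v. v $ 1 *\<^sub>R e1 + v $ 2 *\<^sub>R e2 + (v $ 1 * pd 1 f y + v $ 2 * pd 2 f y) *\<^sub>R e3)) (at y)"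
    unfolding G_def[abs_def]
    by (rule has_derivative_eq_rhs, (rule has_derivative_add has_derivative_const has_derivative_scaleR_left nth has_derivative_f[OF y])+) simp
qed

lemma pd_G: "y \<in> V \<Longrightarrow> pd 1 G y = e1 + pd 1 f y *\<^sub>R e3" "y \<in> V \<Longrightarrow> pd 2 G y = e2 + pd 2 f y *\<^sub>R e3"
  by (simp_all add: pd_def[of _ G] fd_G) (simp_all add: axis_def)

lemma pd_pd_G: "y \<in> V \<Longrightarrow> pd i (pd j G) y = pd i (pd j f) y *\<^sub>R e3"
proof -
  assume y: "y \<in> V"
  define c where "c = (if j = 1 then e1 else e2)"
  have j: "pd j G z = c + pd j f z *\<^sub>R e3" if "z \<in> V" for z
    using pd_G[OF that] exhaust_2[of j] by (auto simp: c_def)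
  have "pd i (pd j G) y = pd i (\<lambda>z. c + pd j f z *\<^sub>R e3) y"
    by (rule pd_cong[OF open_V y]) (rule j)
  also have "\<dots> = pd i (pd j f) y *\<^sub>R e3"
    unfolding pd_def[of i "pd j f"]
    by (rule pd_eqI) (auto intro!: derivative_eq_intros smooth_on_has_derivative[OF smooth_on_pd[OF smooth_f] y])
  finally show ?thesis .
qed

lemma cross_e: "cross3 e1 e2 = e3" "cross3 e2 e1 = - e3" "cross3 e1 e3 = - e2" "cross3 e3 e2 = - e1"
  "cross3 e2 e3 = e1" "cross3 e3 e1 = e2"
proof -
  have 1: "cross3 e1 e3 = - e2" and 2: "cross3 e2 e3 = e1"
    unfolding e3_cross Lagrange using on on_sym by simp_all
  show "cross3 e1 e2 = e3" "cross3 e2 e1 = - e3" "cross3 e1 e3 = - e2" "cross3 e3 e2 = - e1"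
    "cross3 e2 e3 = e1" "cross3 e3 e1 = e2"
    using 1 2 e3_cross cross_skew[of e2 e1] cross_skew[of e3 e1] cross_skew[of e3 e2] by simp_all
qed

definition nu :: "real^2 \<Rightarrow> real^3" where
  "nu y = (1 / W y) *\<^sub>R (e3 - pd 1 f y *\<^sub>R e1 - pd 2 f y *\<^sub>R e2)"

lemma norm_nu: "norm (nu y) = 1"
proof -
  have "(norm (e3 - pd 1 f y *\<^sub>R e1 - pd 2 f y *\<^sub>R e2))\<^sup>2 = (W y)\<^sup>2"
    unfolding power2_norm_eq_inner W_sq
    by (simp add: inner_diff_left inner_diff_right on on_sym power2_eq_square)
  then have "norm (e3 - pd 1 f y *\<^sub>R e1 - pd 2 f y *\<^sub>R e2) = W y"
    using W_pos[of y] by (simp add: power2_eq_iff_nonneg less_imp_le)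
  then show ?thesis using W_pos[of y] by (simp add: nu_def)
qed

lemma cross_pd_G: "y \<in> V \<Longrightarrow> cross3 (pd 1 G y) (pd 2 G y) = W y *\<^sub>R nu y"
  using W_pos[of y]
  by (simp add: pd_G nu_def cross_add_left cross_add_right cross_mult_left cross_mult_right cross_e algebra_simps)

lemma unit_normal_G: "y \<in> V \<Longrightarrow> unit_normal G y = nu y"
  using W_pos[of y] by (simp add: unit_normal_def cross_pd_G sgn_scaleR norm_nu sgn_div_norm)

lemma nu_inner: "y \<in> V \<Longrightarrow> nu y \<bullet> pd i G y = 0" "e3 \<bullet> nu y = 1 / W y"
  using exhaust_2[of i]
  by (auto simp: nu_def pd_G inner_diff_left inner_diff_right inner_add_right on on_sym)

lemma first_form_G:
  "y \<in> V \<Longrightarrow> first_form G y = vector [vector [1 + (pd 1 f y)\<^sup>2, pd 1 f y * pd 2 f y], vector [pd 1 f y * pd 2 f y, 1 + (pd 2 f y)\<^sup>2]]"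
  by (simp add: first_form_def vec_eq_iff forall_2 pd_G inner_add_left inner_add_right on on_sym power2_eq_square)

lemma second_form_G: "y \<in> V \<Longrightarrow> second_form G y = (\<chi> i j. pd i (pd j f) y / W y)"
  by (simp add: second_form_def vec_eq_iff pd_pd_G unit_normal_G nu_inner)

definition adj :: "real^2 \<Rightarrow> real^2^2" where
  "adj y = vector [vector [1 + (pd 2 f y)\<^sup>2, - (pd 1 f y * pd 2 f y)], vector [- (pd 1 f y * pd 2 f y), 1 + (pd 1 f y)\<^sup>2]]"

lemma inv_first_form_G: "y \<in> V \<Longrightarrow> matrix_inv (first_form G y) = (1 / (W y)\<^sup>2) *\<^sub>R adj y"
  "y \<in> V \<Longrightarrow> first_form G y ** ((1 / (W y)\<^sup>2) *\<^sub>R adj y) = mat 1"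
proof -
  assume y: "y \<in> V"
  have "(W y)\<^sup>2 \<noteq> 0" using W_pos[of y] by simp
  then show *: "first_form G y ** ((1 / (W y)\<^sup>2) *\<^sub>R adj y) = mat 1"
    unfolding first_form_G[OF y]
    by (simp add: vec_eq_iff forall_2 matrix_matrix_mult_def sum_2 adj_def mat_def add_divide_distrib[symmetric] diff_divide_distrib[symmetric])
      (simp add: W_mult power2_eq_square algebra_simps)
  then show "matrix_inv (first_form G y) = (1 / (W y)\<^sup>2) *\<^sub>R adj y" by (rule matrix_inv_eqI)
qed

definition mse :: "real^2 \<Rightarrow> real" where
  "mse y = (1 + (pd 2 f y)\<^sup>2) * pd 1 (pd 1 f) y - 2 * pd 1 f y * pd 2 f y * pd 1 (pd 2 f) y
     + (1 + (pd 1 f y)\<^sup>2) * pd 2 (pd 2 f) y"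

text \<open>Twice the negative Gauss curvature; this is \<open>|A|\<^sup>2\<close> only where \<open>mse\<close> vanishes.\<close>

definition asq :: "real^2 \<Rightarrow> real" where
  "asq y = 2 * ((pd 1 (pd 2 f) y)\<^sup>2 - pd 1 (pd 1 f) y * pd 2 (pd 2 f) y) / (W y)^4"

lemma trace_shape_G: "y \<in> V \<Longrightarrow> trace (shape_operator G y) = mse y / (W y)^3"
  using W_pos[of y] pd_commute[OF open_V smooth_f, of y 2 1]
  by (simp add: shape_operator_def inv_first_form_G second_form_G trace_def sum_2 matrix_matrix_mult_def adj_def mse_def
      add_divide_distrib[symmetric] diff_divide_distrib[symmetric] power2_eq_square power3_eq_cube)

lemma trace_shape_square_G:
  assumes y: "y \<in> V" and m: "mse y = 0"
  shows "trace (shape_operator G y ** shape_operator G y) = asq y"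
proof -
  have d1: "det ((1 / (W y)\<^sup>2) *\<^sub>R adj y) = 1 / (W y)\<^sup>2"
  proof -
    have "det (adj y) = W y * W y"
      by (simp add: det_2 adj_def W_mult power2_eq_square algebra_simps)
    moreover have "det ((1 / (W y)\<^sup>2) *\<^sub>R adj y) = det (adj y) / ((W y)\<^sup>2 * (W y)\<^sup>2)"
      by (simp only: det_2 vector_scaleR_component) (simp add: diff_divide_distrib)
    ultimately show ?thesis using W_pos[of y] by (simp add: power2_eq_square)
  qed
  have d2: "det (second_form G y) = (pd 1 (pd 1 f) y * pd 2 (pd 2 f) y - (pd 1 (pd 2 f) y)\<^sup>2) / (W y)\<^sup>2"
    using pd_commute[OF open_V smooth_f y, of 2 1]
    by (simp add: second_form_G[OF y] det_2 power2_eq_square diff_divide_distrib)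
  show ?thesis
    unfolding trace_square_2 trace_shape_G[OF y] m
    by (simp add: shape_operator_def det_mul inv_first_form_G(1)[OF y] d1 d2 asq_def)
      (simp add: minus_divide_left power2_eq_square power4_eq_xxxx)
qed

lemma smooth_asq: "smooth_on V asq"
proof -
  have "0 < (W y)^4" for y using W_pos[of y] by simp
  then show ?thesis
    unfolding asq_def[abs_def] using open_V smooth_f smooth_W
    by (intro smooth_on_divide smooth_on_mult smooth_on_diff smooth_on_power smooth_on_pd smooth_on_const)
      (auto simp: less_imp_neq[symmetric])
qed

end

locale graph_patch = graph_map +
  fixes S :: "(real^3) set"
  assumes openin_G: "openin (top_of_set S) (G ` (V \<inter> upper))"
begin

lemma inj_fd_G: "y \<in> V \<Longrightarrow> inj (frechet_derivative G (at y))"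
proof (rule injI)
  fix v w assume y: "y \<in> V" and eq: "fd G y v = fd G y w"
  have "fd G y v \<bullet> e1 = v $ 1" "fd G y v \<bullet> e2 = v $ 2" for v
    by (simp_all add: fd_G[OF y] inner_add_left on on_sym)
  then have "v $ 1 = w $ 1" "v $ 2 = w $ 2" using eq by metis+
  then show "v = w" by (simp add: vec_eq_iff forall_2)
qed

lemma local_param_G: "local_param S V G"
  unfolding local_param_def
proof (intro conjI ballI)
  show "\<exists>\<psi>. homeomorphism (V \<inter> upper) (G ` (V \<inter> upper)) G \<psi>"
    using continuous_on_subset[OF continuous_G, of "V \<inter> upper"]
    by (intro exI[of _ pr]) (auto simp: homeomorphism_def image_image intro: continuous_pr)
qed (auto simp: open_V smooth_G inj_fd_G openin_G)

lemma G_in_S: "y \<in> V \<inter> upper \<Longrightarrow> G y \<in> S"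
  using openin_imp_subset[OF openin_G] by blast

lemma transition:
  assumes lp: "local_param S U \<phi>" and y: "y \<in> U \<inter> upper" and y': "y' \<in> V \<inter> upper" and eq: "\<phi> y = G y'"
  obtains U' where "open U'" "y \<in> U'" "U' \<subseteq> U" "\<And>z. z \<in> U' \<Longrightarrow> pr (\<phi> z) \<in> V"
    "\<And>z. z \<in> U' \<inter> upper \<Longrightarrow> \<phi> z = G (pr (\<phi> z))" "smooth_on U' (\<lambda>z. pr (\<phi> z))"
proof -
  have U: "open U" and s: "smooth_on U \<phi>" and sub: "\<phi> ` (U \<inter> upper) \<subseteq> S"
    using lp openin_imp_subset unfolding local_param_def by blast+
  obtain O' where O': "open O'" "G ` (V \<inter> upper) = S \<inter> O'" using openin_G by (auto simp: openin_open)
  have c1: "continuous_on U \<phi>" by (rule smooth_on_continuous_on[OF s])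
  have c2: "continuous_on U (\<lambda>z. pr (\<phi> z))"
    by (rule continuous_on_compose2[OF continuous_pr[of UNIV] c1]) auto
  define U' where "U' = (U \<inter> \<phi> -` O') \<inter> (U \<inter> (\<lambda>z. pr (\<phi> z)) -` V)"
  show ?thesis
  proof
    show o: "open U'"
      unfolding U'_def using continuous_open_preimage[OF c1 U O'(1)] continuous_open_preimage[OF c2 U open_V] by blast
    show "y \<in> U'" using y y' eq O'(2) unfolding U'_def by auto
    show "pr (\<phi> z) \<in> V" if "z \<in> U'" for z using that by (auto simp: U'_def)
    show "\<phi> z = G (pr (\<phi> z))" if "z \<in> U' \<inter> upper" for z
    proof -
      have "\<phi> z \<in> S \<inter> O'" using that sub by (auto simp: U'_def)
      then obtain x where "\<phi> z = G x" using O'(2) by blast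
      then show ?thesis by simp
    qed
    have pr: "pr x = ((x - q) \<bullet> e1) *\<^sub>R axis 1 1 + ((x - q) \<bullet> e2) *\<^sub>R axis 2 1" for x
      by (simp add: pr_def vec_eq_iff forall_2 axis_def)
    have s': "smooth_on U' \<phi>" using s by (rule smooth_on_subset) (auto simp: U'_def)
    show "smooth_on U' (\<lambda>z. pr (\<phi> z))"
      unfolding pr using o s' by (intro smooth_intros)
  qed (auto simp: U'_def)
qed

lemma fd_fd_G:
  assumes x: "x \<in> V"
  shows "fd (\<lambda>x. fd G x b) x a = (\<Sum>i\<in>UNIV. \<Sum>j\<in>UNIV. a $ i * b $ j * pd i (pd j f) x) *\<^sub>R e3"
proof -
  have G': "fd G z b = b $ 1 *\<^sub>R pd 1 G z + b $ 2 *\<^sub>R pd 2 G z" if "z \<in> V" for z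
    by (rule fd_eq_pd[OF smooth_on_differentiable[OF smooth_G that]])
  have "fd (\<lambda>x. fd G x b) x a = fd (\<lambda>z. b $ 1 *\<^sub>R pd 1 G z + b $ 2 *\<^sub>R pd 2 G z) x a"
    using frechet_derivative_cong_open(1)[OF open_V x G'] by simp
  also have "\<dots> = b $ 1 *\<^sub>R fd (pd 1 G) x a + b $ 2 *\<^sub>R fd (pd 2 G) x a"
    by (rule fd_eqI, (rule has_derivative_add has_derivative_scaleR_right
      smooth_on_has_derivative[OF smooth_on_pd[OF smooth_G] x])+)
  finally have 1: "fd (\<lambda>x. fd G x b) x a = b $ 1 *\<^sub>R fd (pd 1 G) x a + b $ 2 *\<^sub>R fd (pd 2 G) x a" .
  have "fd (pd j G) x a = a $ 1 *\<^sub>R (pd 1 (pd j f) x *\<^sub>R e3) + a $ 2 *\<^sub>R (pd 2 (pd j f) x *\<^sub>R e3)" for j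
    unfolding pd_pd_G[OF x, symmetric]
    by (rule fd_eq_pd[OF smooth_on_differentiable[OF smooth_on_pd[OF smooth_G] x]])
  then show ?thesis unfolding 1 by (simp add: sum_2 algebra_simps)
qed

text \<open>The forms of an arbitrary parametrization \<open>\<phi>\<close> are those of \<open>G\<close> transformed by the Jacobian
  \<open>M\<close> of the transition map; only the sign of the normal is ambiguous.\<close>

lemma forms_transition:
  assumes lp: "local_param S U \<phi>" and y: "y \<in> U \<inter> upper" and y': "y' \<in> V \<inter> upper" and eq: "\<phi> y = G y'"
  obtains M :: "real^2^2" and s :: real where "invertible M" "s = 1 \<or> s = -1"
    "first_form \<phi> y = transpose M ** (first_form G y' ** M)"
    "second_form \<phi> y = s *\<^sub>R (transpose M ** (second_form G y' ** M))"
    "range (frechet_derivative \<phi> (at y)) = range (frechet_derivative G (at y'))"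
proof -
  obtain U' where U': "open U'" "y \<in> U'" "U' \<subseteq> U" "\<And>z. z \<in> U' \<Longrightarrow> pr (\<phi> z) \<in> V"
    "\<And>z. z \<in> U' \<inter> upper \<Longrightarrow> \<phi> z = G (pr (\<phi> z))" and st: "smooth_on U' (\<lambda>z. pr (\<phi> z))"
    using transition[OF assms] by metis
  define th where "th z = pr (\<phi> z)" for z
  have thy: "th y = y'" using eq by (simp add: th_def)
  have thV: "th ` U' \<subseteq> V" using U'(4) by (auto simp: th_def)
  have st: "smooth_on U' th" using st by (simp add: th_def[abs_def])
  have sphi: "smooth_on U' \<phi>" and injphi: "inj (frechet_derivative \<phi> (at y))"
    using lp y U'(3) by (auto simp: local_param_def intro: smooth_on_subset)
  have sGt: "smooth_on U' (\<lambda>z. G (th z))"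
    by (rule smooth_on_compose[OF U'(1) open_V smooth_G st thV])
  have Vy: "y' \<in> V" using y' by simp
  have fd1: "frechet_derivative \<phi> (at z) = frechet_derivative (\<lambda>z. G (th z)) (at z)" if "z \<in> U' \<inter> upper" for z
    by (rule fd_cong_upper[OF U'(1) that]) (use that U'(5) in \<open>auto simp: th_def[symmetric] intro: smooth_on_differentiable[OF sphi] smooth_on_differentiable[OF sGt]\<close>)
  have yU: "y \<in> U' \<inter> upper" using y U' by auto
  have fdphi: "fd \<phi> y v = fd G y' (fd th y v)" for v
    using fd1[OF yU] fd_compose[OF st smooth_G U'(2), of v] Vy thy by simp
  have pdphi: "pd i \<phi> y = fd G y' (pd i th y)" for i by (simp add: pd_def fdphi)
  have pd2: "pd i (pd j \<phi>) y = fd (\<lambda>x. fd G x (pd j th y)) y' (pd i th y) + fd G y' (pd i (pd j th) y)" for i j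
  proof -
    have "pd i (pd j \<phi>) y = pd i (pd j (\<lambda>z. G (th z))) y"
      unfolding pd_def[of i]
      by (rule fun_cong[OF fd_cong_upper[OF U'(1) yU]])
        (auto simp: pd_def[of j] fd1 intro!: smooth_on_differentiable[OF smooth_on_pd[OF sphi]] smooth_on_differentiable[OF smooth_on_pd[OF sGt]] U'(2))
    also have "\<dots> = fd (\<lambda>x. fd G x (pd j th y)) (th y) (pd i th y) + fd G (th y) (pd i (pd j th) y)"
      unfolding pd_def by (rule fd_second_compose[OF U'(1) open_V st smooth_G thV U'(2)])
    finally show ?thesis by (simp add: thy)
  qed
  define M :: "real^2^2" where "M = (\<chi> a i. pd i th y $ a)"
  have lint: "linear (frechet_derivative th (at y))"
    using smooth_on_has_derivative[OF st U'(2)] has_derivative_linear by blast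
  have fdth: "fd th y v = M *v v" for v
    by (simp add: fd_eq_pd[OF smooth_on_differentiable[OF st U'(2)]] M_def vec_eq_iff matrix_vector_mult_def sum_2 mult.commute)
  have "inj (frechet_derivative th (at y))"
  proof (rule injI)
    fix v w assume "fd th y v = fd th y w"
    then have "fd \<phi> y v = fd \<phi> y w" by (simp add: fdphi)
    then show "v = w" using injphi by (simp add: inj_def)
  qed
  then have surj: "surj (frechet_derivative th (at y))" and inj: "inj ((*v) M)"
    using linear_injective_imp_surjective[OF lint] fdth by (simp, simp add: inj_def)
  have inv: "invertible M"
    using inj by (simp add: invertible_left_inverse matrix_left_invertible_injective)
  have detM: "det M \<noteq> 0" using inv invertible_det_nz by blast
  have FG: "fd G y' v = v $ 1 *\<^sub>R pd 1 G y' + v $ 2 *\<^sub>R pd 2 G y'" for v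
    by (rule fd_eq_pd[OF smooth_on_differentiable[OF smooth_G Vy]])
  have cross: "cross3 (pd 1 \<phi> y) (pd 2 \<phi> y) = det M *\<^sub>R cross3 (pd 1 G y') (pd 2 G y')"
    using cross_skew[of "pd 2 G y'" "pd 1 G y'"]
    by (simp add: pdphi FG cross_add_left cross_add_right cross_mult_left cross_mult_right cross_refl det_2 M_def)
       (simp add: algebra_simps)
  define s where "s = sgn (det M)"
  have s: "s = 1 \<or> s = -1" using detM by (auto simp: s_def sgn_if)
  have un: "unit_normal \<phi> y = s *\<^sub>R nu y'"
    unfolding unit_normal_def cross unit_normal_G[OF Vy, unfolded unit_normal_def, symmetric] s_def
    by (simp add: sgn_scaleR)
  have nuG: "fd G y' v \<bullet> nu y' = 0" for v
    using nu_inner(1)[OF Vy] by (simp add: FG inner_add_left inner_commute[of _ "nu y'"] inner_add_right)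
  show ?thesis
  proof (rule that[OF inv s])
    have "pd i \<phi> y \<bullet> pd j \<phi> y = (\<Sum>a\<in>UNIV. \<Sum>b\<in>UNIV. M $ a $ i * (pd a G y' \<bullet> pd b G y') * M $ b $ j)" for i j
      by (simp add: pdphi FG M_def sum_2 inner_add_left inner_add_right algebra_simps)
    then show "first_form \<phi> y = transpose M ** (first_form G y' ** M)"
      by (simp add: vec_eq_iff first_form_def matrix_matrix_mult_def transpose_def sum_distrib_left mult.assoc sum_2 algebra_simps)
    have "pd i (pd j \<phi>) y \<bullet> unit_normal \<phi> y = s * (\<Sum>a\<in>UNIV. \<Sum>b\<in>UNIV. M $ a $ i * (pd a (pd b f) y' / W y') * M $ b $ j)" for i j
      unfolding un pd2 fd_fd_G[OF Vy]
      by (simp add: inner_add_left nuG nu_inner(2) M_def sum_2 add_divide_distrib algebra_simps)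
    then show "second_form \<phi> y = s *\<^sub>R (transpose M ** (second_form G y' ** M))"
      by (simp add: vec_eq_iff second_form_def[of \<phi>] second_form_G[OF Vy] matrix_matrix_mult_def transpose_def sum_2 algebra_simps)
    have "frechet_derivative \<phi> (at y) = frechet_derivative G (at y') \<circ> frechet_derivative th (at y)"
      using fdphi by (simp add: fun_eq_iff)
    then show "range (frechet_derivative \<phi> (at y)) = range (frechet_derivative G (at y'))"
      using surj image_comp[of "frechet_derivative G (at y')" "frechet_derivative th (at y)" UNIV] by simp
  qed
qed

lemma tangent_space_G:
  assumes y: "y \<in> V \<inter> upper" shows "tangent_space S (G y) = range (frechet_derivative G (at y))"
proof (intro equalityI subsetI)
  fix v assume "v \<in> tangent_space S (G y)"
  then obtain U \<phi> z \<xi> where *: "v = fd \<phi> z \<xi>" "local_param S U \<phi>" "z \<in> U \<inter> upper" "\<phi> z = G y"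
    by (auto simp: tangent_space_def)
  show "v \<in> range (frechet_derivative G (at y))"
    using forms_transition[OF *(2,3) y *(4)] *(1) by (metis rangeI)
next
  fix v assume "v \<in> range (frechet_derivative G (at y))"
  then show "v \<in> tangent_space S (G y)"
    unfolding tangent_space_def using local_param_G y by blast
qed

lemma norm_A_sq_eq_trace:
  assumes y: "y \<in> V \<inter> upper"
  shows "norm_A_sq S (G y) = trace (shape_operator G y ** shape_operator G y)"
  unfolding norm_A_sq_def
proof (rule the_equality)
  show "\<exists>U \<phi> z. local_param S U \<phi> \<and> z \<in> U \<inter> upper \<and> \<phi> z = G y \<and>
      trace (shape_operator G y ** shape_operator G y) = trace (shape_operator \<phi> z ** shape_operator \<phi> z)"
    using local_param_G y by blast
next
  fix a assume "\<exists>U \<phi> z. local_param S U \<phi> \<and> z \<in> U \<inter> upper \<and> \<phi> z = G y \<and>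
      a = trace (shape_operator \<phi> z ** shape_operator \<phi> z)"
  then obtain U \<phi> z where *: "local_param S U \<phi>" "z \<in> U \<inter> upper" "\<phi> z = G y"
      "a = trace (shape_operator \<phi> z ** shape_operator \<phi> z)" by blast
  obtain M :: "real^2^2" and s :: real where M: "invertible M" and s: "s = 1 \<or> s = -1" and
    I: "first_form \<phi> z = transpose M ** (first_form G y ** M)" and
    II: "second_form \<phi> z = s *\<^sub>R (transpose M ** (second_form G y ** M))"
    using forms_transition[OF *(1,2) y *(3)] by metis
  define A H where "A = first_form G y" and "H = second_form G y"
  define A' where "A' = matrix_inv A"
  have AA: "A ** A' = mat 1"
    using inv_first_form_G y by (simp add: A_def A'_def)
  obtain N where N: "M ** N = mat 1" "N ** M = mat 1" using M by (auto simp: invertible_def)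
  have NT: "transpose M ** transpose N = mat 1"
    using N(2) by (metis matrix_transpose_mul transpose_mat)
  have NT': "transpose N ** transpose M = mat 1"
    using N(1) by (metis matrix_transpose_mul transpose_mat)
  have "matrix_inv (first_form \<phi> z) = N ** (A' ** transpose N)"
  proof (rule matrix_inv_eqI)
    have "first_form \<phi> z ** (N ** (A' ** transpose N)) = transpose M ** (A ** ((M ** N) ** (A' ** transpose N)))"
      by (simp add: I A_def matrix_mul_assoc)
    also have "\<dots> = transpose M ** ((A ** A') ** transpose N)" by (simp add: N(1) matrix_mul_assoc)
    also have "\<dots> = mat 1" by (simp add: AA NT)
    finally show "first_form \<phi> z ** (N ** (A' ** transpose N)) = mat 1" .
  qed
  then have "shape_operator \<phi> z = s *\<^sub>R (N ** (A' ** ((transpose N ** transpose M) ** (H ** M))))"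
    by (simp add: shape_operator_def II H_def matrix_scalar_ac scalar_matrix_assoc matrix_mul_assoc)
  then have B: "shape_operator \<phi> z = s *\<^sub>R (N ** ((A' ** H) ** M))"
    by (simp add: NT' matrix_mul_assoc)
  have "shape_operator \<phi> z ** shape_operator \<phi> z = (N ** ((A' ** H) ** M)) ** (N ** ((A' ** H) ** M))"
    using s unfolding B by (auto simp: matrix_scalar_ac scalar_matrix_assoc[symmetric])
  also have "\<dots> = N ** ((A' ** H) ** ((M ** N) ** ((A' ** H) ** M)))" by (simp add: matrix_mul_assoc)
  also have "\<dots> = N ** (((A' ** H) ** (A' ** H)) ** M)" by (simp add: N(1) matrix_mul_assoc)
  also have "trace \<dots> = trace ((((A' ** H) ** (A' ** H)) ** M) ** N)" by (rule trace_mul_sym)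
  also have "\<dots> = trace (((A' ** H) ** (A' ** H)) ** (M ** N))" by (simp add: matrix_mul_assoc)
  also have "\<dots> = trace ((A' ** H) ** (A' ** H))" by (simp add: N(1))
  also have "\<dots> = trace (shape_operator G y ** shape_operator G y)"
    by (simp add: shape_operator_def A'_def A_def H_def)
  finally show "a = trace (shape_operator G y ** shape_operator G y)" using *(4) by simp
qed

subsection \<open>The surface gradient\<close>

text \<open>The coefficients of the gradient of \<open>u\<close> with respect to \<open>pd 1 G y\<close>, \<open>pd 2 G y\<close>, where
  \<open>U1\<close>, \<open>U2\<close> are the partial derivatives of \<open>u \<circ> G\<close>.\<close>

definition gradv :: "real^2 \<Rightarrow> real \<Rightarrow> real \<Rightarrow> real^3" where
  "gradv y U1 U2 = (((1 + (pd 2 f y)\<^sup>2) * U1 - pd 1 f y * pd 2 f y * U2) / (W y)\<^sup>2) *\<^sub>R pd 1 G y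
     + (((1 + (pd 1 f y)\<^sup>2) * U2 - pd 1 f y * pd 2 f y * U1) / (W y)\<^sup>2) *\<^sub>R pd 2 G y"

definition ginner :: "real^2 \<Rightarrow> real \<Rightarrow> real \<Rightarrow> real \<Rightarrow> real \<Rightarrow> real" where
  "ginner y U1 U2 V1 V2 = ((1 + (pd 2 f y)\<^sup>2) * U1 * V1 - pd 1 f y * pd 2 f y * (U1 * V2 + U2 * V1)
     + (1 + (pd 1 f y)\<^sup>2) * U2 * V2) / (W y)\<^sup>2"

lemma gradv_inner:
  assumes y: "y \<in> V"
  shows "gradv y U1 U2 \<bullet> pd 1 G y = U1" "gradv y U1 U2 \<bullet> pd 2 G y = U2"
proof -
  have G11: "pd 1 G y \<bullet> pd 1 G y = 1 + (pd 1 f y)\<^sup>2" "pd 1 G y \<bullet> pd 2 G y = pd 1 f y * pd 2 f y"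
    "pd 2 G y \<bullet> pd 1 G y = pd 1 f y * pd 2 f y" "pd 2 G y \<bullet> pd 2 G y = 1 + (pd 2 f y)\<^sup>2"
    by (simp_all add: pd_G[OF y] inner_add_left inner_add_right on on_sym power2_eq_square)
  have nz: "(W y)\<^sup>2 \<noteq> 0" using W_pos[of y] by simp
  have "((1 + (pd 2 f y)\<^sup>2) * U1 - pd 1 f y * pd 2 f y * U2) * (1 + (pd 1 f y)\<^sup>2)
      + ((1 + (pd 1 f y)\<^sup>2) * U2 - pd 1 f y * pd 2 f y * U1) * (pd 1 f y * pd 2 f y) = (W y)\<^sup>2 * U1"
    by (simp add: W_mult power2_eq_square algebra_simps)
  then show "gradv y U1 U2 \<bullet> pd 1 G y = U1"
    unfolding gradv_def inner_add_left inner_scaleR_left G11 times_divide_eq_left add_divide_distrib[symmetric]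
    using nz by simp
  have "((1 + (pd 2 f y)\<^sup>2) * U1 - pd 1 f y * pd 2 f y * U2) * (pd 1 f y * pd 2 f y)
      + ((1 + (pd 1 f y)\<^sup>2) * U2 - pd 1 f y * pd 2 f y * U1) * (1 + (pd 2 f y)\<^sup>2) = (W y)\<^sup>2 * U2"
    by (simp add: W_mult power2_eq_square algebra_simps)
  then show "gradv y U1 U2 \<bullet> pd 2 G y = U2"
    unfolding gradv_def inner_add_left inner_scaleR_left G11 times_divide_eq_left add_divide_distrib[symmetric]
    using nz by simp
qed

lemma gradv_gradv:
  assumes y: "y \<in> V" shows "gradv y U1 U2 \<bullet> gradv y V1 V2 = ginner y U1 U2 V1 V2"
  unfolding gradv_def[of y V1 V2]
  by (simp add: inner_add_right gradv_inner[OF y] ginner_def add_divide_distrib[symmetric]) (simp add: algebra_simps)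

lemma gradv_tangent: "y \<in> V \<inter> upper \<Longrightarrow> gradv y U1 U2 \<in> tangent_space S (G y)"
proof -
  assume y: "y \<in> V \<inter> upper"
  have "a *\<^sub>R pd 1 G y + b *\<^sub>R pd 2 G y = fd G y (vector [a, b])" for a b
    using fd_eq_pd[OF smooth_on_differentiable[OF smooth_G], of y "vector [a, b]"] y by simp
  then show ?thesis using y unfolding gradv_def by (simp add: tangent_space_G)
qed

lemma has_derivative_pr: "(pr has_derivative (\<lambda>w. vector [w \<bullet> e1, w \<bullet> e2])) (at x)"
proof -
  have pr: "pr = (\<lambda>x. ((x - q) \<bullet> e1) *\<^sub>R axis 1 1 + ((x - q) \<bullet> e2) *\<^sub>R axis 2 1)"
    by (simp add: pr_def vec_eq_iff forall_2 axis_def fun_eq_iff)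
  have "(\<lambda>w. vector [w \<bullet> e1, w \<bullet> e2]) = (\<lambda>w. (w \<bullet> e1) *\<^sub>R axis 1 1 + (w \<bullet> e2) *\<^sub>R (axis 2 1 :: real^2))"
    by (simp add: vec_eq_iff forall_2 axis_def fun_eq_iff)
  then show ?thesis unfolding pr by (auto intro!: derivative_eq_intros)
qed

lemma surface_gradient_G:
  assumes y: "y \<in> V \<inter> upper" and u: "\<And>z. z \<in> V \<inter> upper \<Longrightarrow> u (G z) = U z" and U: "U differentiable (at y)"
  shows "(u has_derivative (\<lambda>w. gradv y (pd 1 U y) (pd 2 U y) \<bullet> w)) (at (G y) within S)"
    and "surface_gradient S u (G y) = gradv y (pd 1 U y) (pd 2 U y)"
proof -
  let ?v = "gradv y (pd 1 U y) (pd 2 U y)"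
  have yV: "y \<in> V" using y by simp
  define c1 c2 where "c1 = ((1 + (pd 2 f y)\<^sup>2) * pd 1 U y - pd 1 f y * pd 2 f y * pd 2 U y) / (W y)\<^sup>2"
    and "c2 = ((1 + (pd 1 f y)\<^sup>2) * pd 2 U y - pd 1 f y * pd 2 f y * pd 1 U y) / (W y)\<^sup>2"
  define k where "k = c1 * pd 1 f y + c2 * pd 2 f y"
  have v: "?v = c1 *\<^sub>R e1 + c2 *\<^sub>R e2 + k *\<^sub>R e3"
    unfolding gradv_def c1_def[symmetric] c2_def[symmetric] pd_G(1)[OF yV] pd_G(2)[OF yV] k_def
    by (simp add: algebra_simps)
  have U12: "pd 1 U y = c1 + k * pd 1 f y" "pd 2 U y = c2 + k * pd 2 f y"
    using gradv_inner[OF yV, of "pd 1 U y" "pd 2 U y"]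
    by (simp_all add: v pd_G[OF yV] inner_add_left inner_add_right on on_sym mult.commute)
  define h where "h x = U (pr x) + k * ((x - q) \<bullet> e3 - f (pr x))" for x
  have dU: "(U has_derivative (\<lambda>v. v $ 1 * pd 1 U y + v $ 2 * pd 2 U y)) (at y)"
    using has_derivative_pd[OF U] by simp
  have "((\<lambda>x. U (pr x)) has_derivative (\<lambda>w. (w \<bullet> e1) * pd 1 U y + (w \<bullet> e2) * pd 2 U y)) (at (G y))"
    using has_derivative_compose[OF has_derivative_pr, of U _ "G y"] dU by fastforce
  moreover have "((\<lambda>x. f (pr x)) has_derivative (\<lambda>w. (w \<bullet> e1) * pd 1 f y + (w \<bullet> e2) * pd 2 f y)) (at (G y))"
    using has_derivative_compose[OF has_derivative_pr, of f _ "G y"] has_derivative_f[OF yV] by fastforce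
  ultimately have "(h has_derivative (\<lambda>w. (w \<bullet> e1) * pd 1 U y + (w \<bullet> e2) * pd 2 U y +
      k * (w \<bullet> e3 - ((w \<bullet> e1) * pd 1 f y + (w \<bullet> e2) * pd 2 f y)))) (at (G y))"
    unfolding h_def by (auto intro!: derivative_eq_intros)
  moreover have "(\<lambda>w. (w \<bullet> e1) * pd 1 U y + (w \<bullet> e2) * pd 2 U y +
      k * (w \<bullet> e3 - ((w \<bullet> e1) * pd 1 f y + (w \<bullet> e2) * pd 2 f y))) = (\<lambda>w. ?v \<bullet> w)"
  proof
    fix w
    have "?v \<bullet> w = c1 * (w \<bullet> e1) + c2 * (w \<bullet> e2) + k * (w \<bullet> e3)"
      unfolding v by (simp add: inner_add_left inner_add_right inner_commute[of _ w])
    then show "(w \<bullet> e1) * pd 1 U y + (w \<bullet> e2) * pd 2 U y +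
      k * (w \<bullet> e3 - ((w \<bullet> e1) * pd 1 f y + (w \<bullet> e2) * pd 2 f y)) = ?v \<bullet> w"
      by (simp only: U12) (simp add: algebra_simps)
  qed
  ultimately have hd: "(h has_derivative (\<lambda>w. ?v \<bullet> w)) (at (G y) within S)"
    by (simp add: has_derivative_at_withinI)
  obtain O' where O': "open O'" "G ` (V \<inter> upper) = S \<inter> O'" using openin_G by (auto simp: openin_open)
  have yO: "G y \<in> O'" "G y \<in> S" using y O' by auto
  obtain r where r: "r > 0" "ball (G y) r \<subseteq> O'" using O'(1) yO open_contains_ball by blast
  show d: "(u has_derivative (\<lambda>w. ?v \<bullet> w)) (at (G y) within S)"
  proof (rule has_derivative_transform_within[OF hd r(1) yO(2)])
    fix x assume "x \<in> S" "dist x (G y) < r"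
    then have "x \<in> S \<inter> O'" using r by (auto simp: dist_commute)
    then obtain z where z: "z \<in> V \<inter> upper" "x = G z" using O'(2) by blast
    then have "(x - q) \<bullet> e3 = f z" by (simp add: G_def inner_add_left on on_sym)
    then show "h x = u x" using z u by (simp add: h_def)
  qed
  show "surface_gradient S u (G y) = ?v"
    unfolding surface_gradient_def
  proof (rule the_equality)
    show "?v \<in> tangent_space S (G y) \<and> (u has_derivative (\<lambda>w. ?v \<bullet> w)) (at (G y) within S)"
      using d gradv_tangent[OF y] by simp
    fix v' assume v': "v' \<in> tangent_space S (G y) \<and> (u has_derivative (\<lambda>w. v' \<bullet> w)) (at (G y) within S)"
    have comp: "((\<lambda>z. u (G z)) has_derivative (\<lambda>\<xi>. a \<bullet> fd G y \<xi>)) (at y within V \<inter> upper)"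
      if "(u has_derivative (\<lambda>w. a \<bullet> w)) (at (G y) within S)" for a
    proof -
      have "G ` (V \<inter> upper) \<subseteq> S" using G_in_S by blast
      then show ?thesis
        by (rule has_derivative_in_compose[OF has_derivative_at_withinI[OF smooth_on_has_derivative[OF smooth_G yV]]
            has_derivative_subset[OF that]])
    qed
    have "(\<lambda>\<xi>. v' \<bullet> fd G y \<xi>) = (\<lambda>\<xi>. ?v \<bullet> fd G y \<xi>)"
      using comp[of v'] comp[OF d] v' by (intro openin_upper_unique[OF open_V y]) auto
    then have eq: "(v' - ?v) \<bullet> fd G y \<xi> = 0" for \<xi> by (simp add: fun_eq_iff inner_diff_left)
    obtain \<xi> where "v' = fd G y \<xi>"
      using v' by (auto simp: tangent_space_G[OF y])
    moreover obtain \<eta> where "?v = fd G y \<eta>"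
      using gradv_tangent[OF y, of "pd 1 U y" "pd 2 U y"] by (auto simp: tangent_space_G[OF y])
    moreover have "linear (frechet_derivative G (at y))"
      using smooth_on_has_derivative[OF smooth_G yV] has_derivative_linear by blast
    ultimately have "v' - ?v = fd G y (\<xi> - \<eta>)" by (simp add: linear_diff)
    then have "(v' - ?v) \<bullet> (v' - ?v) = 0" using eq by metis
    then show "v' = ?v" by simp
  qed
qed

end

subsection \<open>Existence of graph patches\<close>

lemma smooth_inverse_function:
  fixes \<psi> :: "real^2 \<Rightarrow> real^2"
  assumes U: "open U" and s: "smooth_on U \<psi>" and y0: "y0 \<in> U"
    and inj: "inj (frechet_derivative \<psi> (at y0))"
  obtains U' V \<theta> where "open U'" "U' \<subseteq> U" "y0 \<in> U'" "open V" "homeomorphism U' V \<psi> \<theta>" "smooth_on V \<theta>"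
proof -
  have bl: "bounded_linear (frechet_derivative \<psi> (at x))" if "x \<in> U" for x
    using smooth_on_has_derivative[OF s that] has_derivative_bounded_linear by blast
  define F where "F x = Blinfun (frechet_derivative \<psi> (at x))" for x
  have F: "blinfun_apply (F x) = frechet_derivative \<psi> (at x)" if "x \<in> U" for x
    using bl[OF that] by (simp add: F_def bounded_linear_Blinfun_apply)
  have contF: "continuous_on U F"
  proof (rule continuous_on_blinfun_componentwise)
    fix i :: "real^2"
    show "continuous_on U (\<lambda>x. blinfun_apply (F x) i)"
      using smooth_on_continuous_on[OF smooth_on_fd[OF s, of i]] by (simp add: F cong: continuous_on_cong)
  qed
  obtain g where g: "linear g" "g \<circ> frechet_derivative \<psi> (at y0) = id"
    using linear_injective_left_inverse[OF bounded_linear.linear[OF bl[OF y0]] inj] by blast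
  have inv: "Blinfun g o\<^sub>L F y0 = id_blinfun"
    using g F[OF y0] by (intro blinfun_eqI) (simp add: linear_linear bounded_linear_Blinfun_apply fun_eq_iff)
  have dF: "(\<psi> has_derivative blinfun_apply (F x)) (at x)" if "x \<in> U" for x
    using smooth_on_has_derivative[OF s that] by (simp add: F that)
  obtain U' V \<theta> g' where *: "open U'" "U' \<subseteq> U" "y0 \<in> U'" "open V" "\<psi> y0 \<in> V" "homeomorphism U' V \<psi> \<theta>"
      "\<And>y. y \<in> V \<Longrightarrow> (\<theta> has_derivative (g' y)) (at y)"
      "\<And>y. y \<in> V \<Longrightarrow> g' y = inv (blinfun_apply (F (\<theta> y)))"
      "\<And>y. y \<in> V \<Longrightarrow> bij (blinfun_apply (F (\<theta> y)))"
  proof (rule inverse_function_theorem[OF U _ contF y0 inv])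
    show "(\<psi> has_derivative blinfun_apply (F x)) (at x)" if "x \<in> U" for x by (rule dF[OF that])
  qed (rule that)
  have thU: "\<theta> ` V \<subseteq> U'" using *(6) by (auto simp: homeomorphism_def)
  define a where "a i j z = pd j \<psi> z $ i" for i j z
  define dt where "dt z = a 1 1 z * a 2 2 z - a 1 2 z * a 2 1 z" for z
  define N where "N v z = (vector [(a 2 2 z * v $ 1 - a 1 2 z * v $ 2) / dt z, (a 1 1 z * v $ 2 - a 2 1 z * v $ 1) / dt z] :: real^2)"
    for v :: "real^2" and z
  define U2 where "U2 = {z \<in> U'. dt z \<noteq> 0}"
  have sa: "smooth_on U' (a i j)" for i j
    unfolding a_def
    by (rule smooth_on_linear_comp[OF *(1) bounded_linear_vec_nth smooth_on_subset[OF smooth_on_pd[OF s] *(2)]])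
  have sdt: "smooth_on U' dt" unfolding dt_def by (intro smooth_intros *(1) sa)
  have U2: "open U2"
  proof -
    have "U2 = U' \<inter> dt -` (- {0})" by (auto simp: U2_def)
    then show ?thesis
      using continuous_open_preimage[OF smooth_on_continuous_on[OF sdt] *(1), of "- {0}"] by auto
  qed
  have fdp: "fd \<psi> z v = vector [a 1 1 z * v $ 1 + a 1 2 z * v $ 2, a 2 1 z * v $ 1 + a 2 2 z * v $ 2]" if "z \<in> U'" for z v
    using fd_eq_pd[OF smooth_on_differentiable[OF s], of z v] that *(2)
    by (auto simp: vec_eq_iff forall_2 a_def mult.commute)
  have thU2: "\<theta> ` V \<subseteq> U2"
  proof
    fix z assume z: "z \<in> \<theta> ` V"
    then have zU: "z \<in> U'" using thU by auto
    then have "blinfun_apply (F z) = frechet_derivative \<psi> (at z)" using *(2) by (intro F) auto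
    moreover have "bij (blinfun_apply (F z))" using z *(9) by auto
    ultimately have bij: "bij (frechet_derivative \<psi> (at z))" by simp
    have "dt z \<noteq> 0"
    proof
      assume "dt z = 0"
      then have e: "a 1 1 z * a 2 2 z = a 1 2 z * a 2 1 z" by (simp add: dt_def)
      have 0: "fd \<psi> z 0 = 0" using bl[of z] zU *(2) by (auto simp: linear_0 bounded_linear.linear)
      have "fd \<psi> z (vector [a 2 2 z, - a 2 1 z]) = 0" "fd \<psi> z (vector [- a 1 2 z, a 1 1 z]) = 0"
        using e by (auto simp: fdp[OF zU] vec_eq_iff forall_2 algebra_simps)
      then have "vector [a 2 2 z, - a 2 1 z] = (0 :: real^2)" "vector [- a 1 2 z, a 1 1 z] = (0 :: real^2)"
        using bij 0 by (metis bij_def injD)+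
      then have "a 1 1 z = 0" "a 2 2 z = 0" "a 1 2 z = 0" "a 2 1 z = 0" by (auto simp: vec_eq_iff forall_2)
      then have "fd \<psi> z (axis 1 1) = 0" by (simp add: fdp[OF zU] vec_eq_iff forall_2)
      then have "axis 1 1 = (0 :: real^2)" using bij 0 by (metis bij_def injD)
      then show False by simp
    qed
    then show "z \<in> U2" using zU by (simp add: U2_def)
  qed
  have sN: "smooth_on U2 (N v)" for v
  proof -
    have N: "N v = (\<lambda>z. ((a 2 2 z * v $ 1 - a 1 2 z * v $ 2) / dt z) *\<^sub>R axis 1 1
        + ((a 1 1 z * v $ 2 - a 2 1 z * v $ 1) / dt z) *\<^sub>R axis 2 1)"
      by (simp add: N_def vec_eq_iff forall_2 axis_def fun_eq_iff)
    have "smooth_on U2 (a i j)" "smooth_on U2 dt" for i j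
      using sa sdt by (auto intro: smooth_on_subset simp: U2_def)
    then show ?thesis unfolding N using U2 by (intro smooth_intros) (auto simp: U2_def)
  qed
  have g': "g' y v = N v (\<theta> y)" if "y \<in> V" for y v
  proof -
    have zU: "\<theta> y \<in> U2" "\<theta> y \<in> U'" using that thU2 thU by auto
    then have "fd \<psi> (\<theta> y) (N v (\<theta> y)) = v"
      by (simp add: fdp N_def U2_def vec_eq_iff forall_2 add_divide_distrib[symmetric] field_simps)
        (simp add: dt_def algebra_simps)
    then show ?thesis
      using *(8,9)[OF that] F zU *(2) by (metis bij_def inv_f_f subsetD)
  qed
  have "Ck_on k V \<theta>" for k
  proof (induction k)
    case 0
    show ?case using *(6) by (simp add: homeomorphism_def)
  next
    case (Suc k)
    show ?case
    proof (rule Ck_on_SucI[OF *(4) *(7)])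
      fix v
      have "Ck_on k V (\<lambda>y. N v (\<theta> y))"
        using sN thU2 by (intro Ck_on_compose[OF *(4) U2 _ Suc]) (auto simp: smooth_on_def)
      then show "Ck_on k V (\<lambda>x. g' x v)"
        using Ck_on_cong[OF *(4), of "\<lambda>x. g' x v" "\<lambda>y. N v (\<theta> y)" k] g' by simp
    qed
  qed
  then show ?thesis using * that by (auto simp: smooth_on_def)
qed

lemma orthonormal_eq_0:
  fixes x :: "real^3"
  assumes "e3 = cross3 e1 e2" "norm e3 = 1" "x \<bullet> e1 = 0" "x \<bullet> e2 = 0" "x \<bullet> e3 = 0"
  shows "x = 0"
proof -
  have "cross3 x e3 = 0" using assms by (simp add: Lagrange)
  then show ?thesis using norm_cross_dot[of x e3] assms by simp
qed

lemma local_param_openin_image: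
  assumes lp: "local_param S U \<phi>" and X: "openin (top_of_set (U \<inter> upper)) X"
  shows "openin (top_of_set S) (\<phi> ` X)"
proof -
  obtain \<psi> where "homeomorphism (U \<inter> upper) (\<phi> ` (U \<inter> upper)) \<phi> \<psi>" "openin (top_of_set S) (\<phi> ` (U \<inter> upper))"
    using lp by (auto simp: local_param_def)
  then show ?thesis using X homeomorphism_imp_open_map openin_trans by metis
qed

text \<open>A vector normal to the surface at \<open>p\<close> defines a linear function whose derivative along the
  surface vanishes at \<open>p\<close>; as this does not refer to a parametrization, all parametrizations at
  \<open>p\<close> have the same normals.\<close>

lemma normal_has_derivative_0:
  assumes lp: "local_param S U \<phi>" and y0: "y0 \<in> U \<inter> upper" and e: "\<And>v. e \<bullet> fd \<phi> y0 v = 0"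
  shows "((\<lambda>x. e \<bullet> x) has_derivative (\<lambda>_. 0)) (at (\<phi> y0) within S)"
  unfolding has_derivative_within_alt
proof (intro conjI allI impI)
  fix eps :: real assume eps: "0 < eps"
  define D where "D = frechet_derivative \<phi> (at y0)"
  have s: "smooth_on U \<phi>" and injD: "inj D" using lp y0 by (auto simp: local_param_def D_def)
  have dD: "(\<phi> has_derivative D) (at y0)" unfolding D_def using s y0 by (intro smooth_on_has_derivative) auto
  obtain B where B: "B > 0" "\<And>v. B * norm v \<le> norm (D v)"
    using linear_inj_bounded_below_pos[OF has_derivative_linear[OF dD] injD] by blast
  define c where "c = min (B / 2) (eps * B / (2 * (norm e + 1)))"
  have ne: "0 < norm e + 1" by (simp add: add_nonneg_pos)
  have c: "c > 0" using B eps ne by (simp add: c_def)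
  obtain d where d: "d > 0" "\<And>z. norm (z - y0) < d \<Longrightarrow> norm (\<phi> z - \<phi> y0 - D (z - y0)) \<le> c * norm (z - y0)"
    using dD c unfolding has_derivative_at_alt by blast
  obtain \<psi> where hom: "homeomorphism (U \<inter> upper) (\<phi> ` (U \<inter> upper)) \<phi> \<psi>" and op: "openin (top_of_set S) (\<phi> ` (U \<inter> upper))"
    using lp by (auto simp: local_param_def)
  have "openin (top_of_set S) (\<phi> ` (U \<inter> upper \<inter> ball y0 d))"
    by (intro local_param_openin_image[OF lp] openin_open_Int) auto
  then obtain O' where O': "open O'" "\<phi> ` (U \<inter> upper \<inter> ball y0 d) = S \<inter> O'" by (auto simp: openin_open)
  have "\<phi> y0 \<in> \<phi> ` (U \<inter> upper \<inter> ball y0 d)" using y0 d by auto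
  then have "\<phi> y0 \<in> O'" using O' by auto
  then obtain r where r: "r > 0" "ball (\<phi> y0) r \<subseteq> O'" using O'(1) open_contains_ball by blast
  have "norm (e \<bullet> x - e \<bullet> \<phi> y0 - 0) \<le> eps * norm (x - \<phi> y0)" if x: "x \<in> S" "norm (x - \<phi> y0) < r" for x
  proof -
    have "x \<in> S \<inter> O'" using x r by (auto simp: dist_norm norm_minus_commute)
    then have "x \<in> \<phi> ` (U \<inter> upper \<inter> ball y0 d)" using O'(2) by simp
    then obtain z where z: "z \<in> ball y0 d" "x = \<phi> z" by blast
    then have b: "norm (\<phi> z - \<phi> y0 - D (z - y0)) \<le> c * norm (z - y0)"
      by (intro d) (simp add: dist_norm norm_minus_commute)
    have "norm (D (z - y0)) \<le> norm (\<phi> z - \<phi> y0) + norm (\<phi> z - \<phi> y0 - D (z - y0))"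
      using norm_triangle_sub[of "D (z - y0)" "\<phi> z - \<phi> y0"] by (simp add: norm_minus_commute)
    then have "B * norm (z - y0) \<le> norm (x - \<phi> y0) + c * norm (z - y0)"
      using b B(2)[of "z - y0"] unfolding z(2) by linarith
    moreover have "c * norm (z - y0) \<le> B / 2 * norm (z - y0)"
      unfolding c_def by (intro mult_right_mono min.cobounded1) auto
    ultimately have zb: "B / 2 * norm (z - y0) \<le> norm (x - \<phi> y0)" by (simp add: algebra_simps)
    have "e \<bullet> x - e \<bullet> \<phi> y0 = e \<bullet> (\<phi> z - \<phi> y0 - D (z - y0))"
      using e[of "z - y0"] z(2) by (simp add: inner_diff_right D_def)
    also have "norm \<dots> \<le> norm e * (c * norm (z - y0))"
      unfolding real_norm_def using b by (intro order_trans[OF Cauchy_Schwarz_ineq2] mult_left_mono) auto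
    also have "\<dots> \<le> (norm e + 1) * (eps * B / (2 * (norm e + 1)) * norm (z - y0))"
      unfolding c_def using eps B by (intro mult_mono mult_right_mono min.cobounded2) auto
    also have "\<dots> = eps * (B / 2 * norm (z - y0))" using ne by (simp add: field_simps)
    also have "\<dots> \<le> eps * norm (x - \<phi> y0)" using eps zb by (intro mult_left_mono) auto
    finally show ?thesis by simp
  qed
  then show "\<exists>d>0. \<forall>y\<in>S. norm (y - \<phi> y0) < d \<longrightarrow> norm (e \<bullet> y - e \<bullet> \<phi> y0 - 0) \<le> eps * norm (y - \<phi> y0)"
    using r(1) by blast
qed simp

lemma normal_unique:
  assumes lp: "local_param S U \<phi>" "y0 \<in> U \<inter> upper" and e: "\<And>v. e \<bullet> fd \<phi> y0 v = 0"
    and lp': "local_param S U' \<phi>'" "y1 \<in> U' \<inter> upper" "\<phi>' y1 = \<phi> y0"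
  shows "e \<bullet> fd \<phi>' y1 v = 0"
proof -
  have U': "open U'" "smooth_on U' \<phi>'" "\<phi>' ` (U' \<inter> upper) \<subseteq> S"
    using lp' openin_imp_subset unfolding local_param_def by blast+
  have d: "(\<phi>' has_derivative frechet_derivative \<phi>' (at y1)) (at y1 within U' \<inter> upper)"
    using lp'(2) by (intro has_derivative_at_withinI[OF smooth_on_has_derivative[OF U'(2)]]) auto
  have "((\<lambda>x. e \<bullet> x) has_derivative (\<lambda>_. 0)) (at (\<phi>' y1) within \<phi>' ` (U' \<inter> upper))"
    using normal_has_derivative_0[OF lp e] U'(3) unfolding lp'(3) by (rule has_derivative_subset)
  then have "((\<lambda>z. e \<bullet> \<phi>' z) has_derivative (\<lambda>_. 0)) (at y1 within U' \<inter> upper)"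
    by (rule has_derivative_in_compose[OF d])
  moreover have "((\<lambda>z. e \<bullet> \<phi>' z) has_derivative (\<lambda>v. e \<bullet> fd \<phi>' y1 v)) (at y1 within U' \<inter> upper)"
    using d by (rule has_derivative_inner_right)
  ultimately have "(\<lambda>_. 0) = (\<lambda>v. e \<bullet> fd \<phi>' y1 v)"
    by (rule openin_upper_unique[OF U'(1) lp'(2)])
  then show ?thesis by metis
qed

lemma graph_reparametrization:
  assumes lp: "local_param S U \<phi>" and U0: "open U0" "U0 \<subseteq> U" "y0 \<in> U0" and up: "y0 \<in> upper"
    and on: "e1 \<bullet> e1 = 1" "e2 \<bullet> e2 = 1" "e3 \<bullet> e3 = 1" "e1 \<bullet> e2 = 0" "e1 \<bullet> e3 = 0" "e2 \<bullet> e3 = 0"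
    and e3: "e3 = cross3 e1 e2" and nrm: "\<And>v. e3 \<bullet> fd \<phi> y0 v = 0"
  obtains U' V f \<theta> where "open U'" "U' \<subseteq> U0" "y0 \<in> U'" "graph_map e1 e2 e3 V f"
    "homeomorphism U' V (\<lambda>z. vector [(\<phi> z - q) \<bullet> e1, (\<phi> z - q) \<bullet> e2]) \<theta>" "smooth_on V \<theta>"
    "\<And>x. x \<in> V \<Longrightarrow> \<phi> (\<theta> x) = graph_map.G q e1 e2 e3 f x"
proof -
  define \<psi> where "\<psi> z = (vector [(\<phi> z - q) \<bullet> e1, (\<phi> z - q) \<bullet> e2] :: real^2)" for z
  have s: "smooth_on U0 \<phi>" and inj\<phi>: "inj (frechet_derivative \<phi> (at y0))"
    using lp U0 up by (auto simp: local_param_def intro: smooth_on_subset)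
  have psi: "\<psi> = (\<lambda>z. ((\<phi> z - q) \<bullet> e1) *\<^sub>R axis 1 1 + ((\<phi> z - q) \<bullet> e2) *\<^sub>R axis 2 1)"
    by (simp add: \<psi>_def vec_eq_iff forall_2 axis_def fun_eq_iff)
  have s\<psi>: "smooth_on U0 \<psi>" unfolding psi using U0 s by (intro smooth_intros)
  have d\<phi>: "(\<phi> has_derivative frechet_derivative \<phi> (at y0)) (at y0)" by (rule smooth_on_has_derivative[OF s U0(3)])
  have "(\<psi> has_derivative (\<lambda>v. (fd \<phi> y0 v \<bullet> e1) *\<^sub>R axis 1 1 + (fd \<phi> y0 v \<bullet> e2) *\<^sub>R axis 2 1)) (at y0)"
    unfolding psi by (auto intro!: derivative_eq_intros d\<phi>)
  then have fd\<psi>: "fd \<psi> y0 v = (fd \<phi> y0 v \<bullet> e1) *\<^sub>R axis 1 1 + (fd \<phi> y0 v \<bullet> e2) *\<^sub>R axis 2 1" for v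
    by (rule fd_eqI)
  have "inj (frechet_derivative \<psi> (at y0))"
  proof (rule injI)
    fix v w assume eq: "fd \<psi> y0 v = fd \<psi> y0 w"
    have "fd \<psi> y0 v $ 1 = fd \<phi> y0 v \<bullet> e1" "fd \<psi> y0 v $ 2 = fd \<phi> y0 v \<bullet> e2" for v
      by (simp_all add: fd\<psi> axis_def)
    then have "fd \<phi> y0 v \<bullet> e1 = fd \<phi> y0 w \<bullet> e1" "fd \<phi> y0 v \<bullet> e2 = fd \<phi> y0 w \<bullet> e2" using eq by metis+
    moreover have "fd \<phi> y0 v \<bullet> e3 = 0" "fd \<phi> y0 w \<bullet> e3 = 0" using nrm by (simp_all add: inner_commute)
    ultimately have "fd \<phi> y0 v - fd \<phi> y0 w = 0"
      using on(3) by (intro orthonormal_eq_0[OF e3]) (simp_all add: inner_diff_left norm_eq_1)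
    then show "v = w" using inj\<phi> by (simp add: inj_def)
  qed
  then obtain U' V \<theta> where *: "open U'" "U' \<subseteq> U0" "y0 \<in> U'" "open V" "homeomorphism U' V \<psi> \<theta>" "smooth_on V \<theta>"
    using smooth_inverse_function[OF U0(1) s\<psi> U0(3)] by metis
  define f where "f x = (\<phi> (\<theta> x) - q) \<bullet> e3" for x
  have thU: "\<theta> ` V \<subseteq> U0" using *(2,5) by (auto simp: homeomorphism_def)
  have s\<phi>\<theta>: "smooth_on V (\<lambda>x. \<phi> (\<theta> x))" by (rule smooth_on_compose[OF *(4) U0(1) s *(6) thU])
  have sf: "smooth_on V f" unfolding f_def using *(4) s\<phi>\<theta> by (intro smooth_intros)
  interpret graph_map q e1 e2 e3 V f using on e3 *(4) sf by unfold_locales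
  show ?thesis
  proof (rule that[OF *(1,2,3)])
    show "graph_map e1 e2 e3 V f" by unfold_locales
    show "homeomorphism U' V (\<lambda>z. vector [(\<phi> z - q) \<bullet> e1, (\<phi> z - q) \<bullet> e2]) \<theta>"
      using *(5) by (simp add: \<psi>_def[abs_def])
    fix x assume x: "x \<in> V"
    have "\<psi> (\<theta> x) = x" using *(5) x by (simp add: homeomorphism_def)
    then have 1: "(\<phi> (\<theta> x) - q) \<bullet> e1 = x $ 1" "(\<phi> (\<theta> x) - q) \<bullet> e2 = x $ 2"
      by (auto simp: \<psi>_def vec_eq_iff forall_2)
    have "\<phi> (\<theta> x) - G x = 0"
    proof (rule orthonormal_eq_0[OF e3])
      show "norm e3 = 1" using on by (simp add: norm_eq_1)
      show "(\<phi> (\<theta> x) - G x) \<bullet> e1 = 0" "(\<phi> (\<theta> x) - G x) \<bullet> e2 = 0" "(\<phi> (\<theta> x) - G x) \<bullet> e3 = 0"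
        using 1 by (simp_all add: G_def f_def inner_diff_left inner_add_left on on_sym)
    qed
    then show "\<phi> (\<theta> x) = G x" by simp
  qed (rule *(6))
qed

lemma (in graph_map) inner_e3_pd_G: "y \<in> V \<Longrightarrow> e3 \<bullet> pd i G y = pd i f y"
  using exhaust_2[of i] by (auto simp: pd_G inner_add_right on on_sym)

text \<open>A patch centred at a point with horizontal tangent plane; along the boundary the free boundary
  condition becomes a Neumann condition for \<open>f\<close>.\<close>

locale centred_patch = graph_patch +
  fixes y0 :: "real^2"
  assumes y0: "y0 \<in> V \<inter> upper" and grad0: "pd 1 f y0 = 0" "pd 2 f y0 = 0"
    and neumann: "\<And>y. y \<in> V \<Longrightarrow> y $ 2 = 0 \<Longrightarrow> pd 2 f y = 0"

lemma interior_patch: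
  assumes lp: "local_param S U \<phi>" and y0: "y0 \<in> U" "0 < y0 $ 2"
  shows "\<exists>q e1 e2 e3 V f z. centred_patch q e1 e2 e3 V f S z \<and> graph_map.G q e1 e2 e3 f z = \<phi> y0 \<and> 0 < z $ 2"
proof -
  have up: "y0 \<in> upper" using y0 by (simp add: upper_def)
  have s: "smooth_on U \<phi>" and U: "open U" and inj\<phi>: "inj (frechet_derivative \<phi> (at y0))"
    using lp y0 up by (auto simp: local_param_def)
  have lin: "linear (frechet_derivative \<phi> (at y0))"
    using smooth_on_has_derivative[OF s y0(1)] has_derivative_linear by blast
  define a b where "a = pd 1 \<phi> y0" and "b = pd 2 \<phi> y0"
  have fd\<phi>: "fd \<phi> y0 v = v $ 1 *\<^sub>R a + v $ 2 *\<^sub>R b" for v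
    unfolding a_def b_def by (rule fd_eq_pd[OF smooth_on_differentiable[OF s y0(1)]])
  have ab0: "v = 0" if "v $ 1 *\<^sub>R a + v $ 2 *\<^sub>R b = 0" for v :: "real^2"
    using that inj\<phi> fd\<phi>[of v] linear_0[OF lin] by (metis injD)
  have a0: "a \<noteq> 0"
  proof
    assume "a = 0"
    then have "axis 1 1 = (0 :: real^2)" by (intro ab0) (simp add: axis_def)
    then show False by simp
  qed
  have crs: "cross3 a b \<noteq> 0"
  proof
    assume "cross3 a b = 0"
    then have "(a \<bullet> b) *\<^sub>R a - (a \<bullet> a) *\<^sub>R b = 0" using Lagrange[of a a b] by simp
    then have "vector [a \<bullet> b, - (a \<bullet> a)] = (0 :: real^2)" by (intro ab0) simp
    then show False using a0 by (simp add: vec_eq_iff forall_2)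
  qed
  define e3 e1 where "e3 = sgn (cross3 a b)" and "e1 = sgn a"
  define e2 where "e2 = cross3 e3 e1"
  have e31: "e3 \<bullet> e1 = 0" "e1 \<bullet> e3 = 0"
    by (simp_all add: e3_def e1_def sgn_div_norm dot_cross_self inner_commute)
  have on: "e1 \<bullet> e1 = 1" "e3 \<bullet> e3 = 1"
    using a0 crs by (simp_all add: e1_def e3_def dot_square_norm norm_sgn)
  have "(norm e2)\<^sup>2 = 1" using norm_cross_dot[of e3 e1] e31 on[folded norm_eq_1] by (simp add: e2_def)
  then have on2: "e2 \<bullet> e2 = 1" by (simp add: power2_norm_eq_inner)
  have orth: "e1 \<bullet> e2 = 0" "e2 \<bullet> e3 = 0" by (simp_all add: e2_def dot_cross_self inner_commute)
  have e3c: "e3 = cross3 e1 e2" using Lagrange[of e1 e3 e1] on e31 by (simp add: e2_def)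
  have nrm: "e3 \<bullet> fd \<phi> y0 v = 0" for v
    by (simp add: fd\<phi> e3_def sgn_div_norm inner_add_right dot_cross_self inner_commute)
  define q where "q = \<phi> y0 - e2"
  define U0 where "U0 = U \<inter> {y. 0 < y $ 2}"
  have U0: "open U0" "U0 \<subseteq> U" "y0 \<in> U0"
    using U y0 by (auto simp: U0_def intro!: open_Int open_halfspace_component_gt_cart)
  obtain U' V f \<theta> where *: "open U'" "U' \<subseteq> U0" "y0 \<in> U'" "graph_map e1 e2 e3 V f"
    and hom: "homeomorphism U' V (\<lambda>z. vector [(\<phi> z - q) \<bullet> e1, (\<phi> z - q) \<bullet> e2]) \<theta>" and s\<theta>: "smooth_on V \<theta>"
    and G\<theta>: "\<And>x. x \<in> V \<Longrightarrow> \<phi> (\<theta> x) = graph_map.G q e1 e2 e3 f x"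
    using graph_reparametrization[OF lp U0 up on(1) on2 on(2) orth(1) e31(2) orth(2) e3c nrm] by blast
  define V1 where "V1 = V \<inter> {x. 0 < x $ 2}"
  interpret g0: graph_map q e1 e2 e3 V f by (rule *(4))
  have V1: "open V1" unfolding V1_def using g0.open_V by (intro open_Int open_halfspace_component_gt_cart)
  interpret graph_map q e1 e2 e3 V1 f
    using g0.on g0.e3_cross V1 g0.smooth_f by unfold_locales (auto simp: V1_def intro: smooth_on_subset)
  define z where "z = (vector [0, 1] :: real^2)"
  have "vector [(\<phi> y0 - q) \<bullet> e1, (\<phi> y0 - q) \<bullet> e2] = z"
    using on2 orth by (simp add: q_def z_def inner_commute)
  then have zV: "z \<in> V" "\<theta> z = y0"
    using hom *(3) by (auto simp: homeomorphism_def)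
  then have zV1: "z \<in> V1" by (simp add: V1_def z_def)
  have Gz: "G z = \<phi> y0" using G\<theta>[OF zV(1)] zV(2) by simp
  have V1up: "V1 \<inter> upper = V1" by (auto simp: V1_def upper_def)
  have "homeomorphism V U' \<theta> (\<lambda>z. vector [(\<phi> z - q) \<bullet> e1, (\<phi> z - q) \<bullet> e2])"
    using hom homeomorphism_symD by blast
  then have "openin (top_of_set U') (\<theta> ` V1)"
    by (rule homeomorphism_imp_open_map) (use V1 in \<open>auto simp: V1_def intro: open_openin_trans open_subset\<close>)
  then have "open (\<theta> ` V1)" using *(1) openin_open_trans by blast
  moreover have "\<theta> ` V1 \<subseteq> U \<inter> upper"
    using hom *(2) by (auto simp: V1_def homeomorphism_def U0_def upper_def)
  ultimately have "openin (top_of_set S) (\<phi> ` \<theta> ` V1)"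
    by (intro local_param_openin_image[OF lp]) (rule open_subset)
  moreover have "\<phi> ` \<theta> ` V1 = G ` V1" using G\<theta> by (force simp: V1_def image_iff)
  ultimately interpret graph_patch q e1 e2 e3 V1 f S by unfold_locales (simp add: V1up)
  have grad: "pd i f z = 0" for i
  proof -
    have "e3 \<bullet> pd i G z = 0" unfolding pd_def
      by (rule normal_unique[OF lp _ nrm local_param_G _ Gz]) (use y0 up zV1 V1up in auto)
    then show ?thesis using inner_e3_pd_G[OF zV1] by simp
  qed
  have "centred_patch q e1 e2 e3 V1 f S z"
    using grad zV1 V1up by unfold_locales (auto simp: V1_def)
  moreover have "0 < z $ 2" by (simp add: z_def)
  ultimately show ?thesis using Gz by blast
qed

lemma boundary_patch:
  assumes lp: "local_param S U \<phi>" and y0: "y0 \<in> U" "y0 $ 2 = 0"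
    and n: "norm n = 1" and sub: "S \<subseteq> {x. a \<le> n \<bullet> x}" and bd: "surface_boundary S = S \<inter> {x. n \<bullet> x = a}"
    and free: "\<And>p. p \<in> surface_boundary S \<Longrightarrow> n \<in> tangent_space S p"
  shows "\<exists>q e1 e2 e3 V f z. centred_patch q e1 e2 e3 V f S z \<and> graph_map.G q e1 e2 e3 f z = \<phi> y0"
proof -
  have up: "y0 \<in> upper" using y0 by (simp add: upper_def)
  have s: "smooth_on U \<phi>" and U: "open U" and inj\<phi>: "inj (frechet_derivative \<phi> (at y0))"
    and S\<phi>: "\<phi> ` (U \<inter> upper) \<subseteq> S"
    using lp y0 up openin_imp_subset unfolding local_param_def by blast+
  have lin: "linear (frechet_derivative \<phi> (at y0))"
    using smooth_on_has_derivative[OF s y0(1)] has_derivative_linear by blast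
  define b1 b2 where "b1 = pd 1 \<phi> y0" and "b2 = pd 2 \<phi> y0"
  have fd\<phi>: "fd \<phi> y0 v = v $ 1 *\<^sub>R b1 + v $ 2 *\<^sub>R b2" for v
    unfolding b1_def b2_def by (rule fd_eq_pd[OF smooth_on_differentiable[OF s y0(1)]])
  have ab0: "v = 0" if "v $ 1 *\<^sub>R b1 + v $ 2 *\<^sub>R b2 = 0" for v :: "real^2"
    using that inj\<phi> fd\<phi>[of v] linear_0[OF lin] by (metis injD)
  have a0: "b1 \<noteq> 0"
  proof
    assume "b1 = 0"
    then have "axis 1 1 = (0 :: real^2)" by (intro ab0) (simp add: axis_def)
    then show False by simp
  qed
  have crs: "cross3 b1 b2 \<noteq> 0"
  proof
    assume "cross3 b1 b2 = 0"
    then have "(b1 \<bullet> b2) *\<^sub>R b1 - (b1 \<bullet> b1) *\<^sub>R b2 = 0" using Lagrange[of b1 b1 b2] by simp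
    then have "vector [b1 \<bullet> b2, - (b1 \<bullet> b1)] = (0 :: real^2)" by (intro ab0) simp
    then show False using a0 by (simp add: vec_eq_iff forall_2)
  qed
  define e3 e2 where "e3 = sgn (cross3 b1 b2)" and "e2 = n"
  define e1 where "e1 = cross3 e2 e3"
  have nrm: "e3 \<bullet> fd \<phi> y0 v = 0" for v
    by (simp add: fd\<phi> e3_def sgn_div_norm inner_add_right dot_cross_self inner_commute)
  have bdy: "\<phi> z \<in> surface_boundary S" if "z \<in> U" "z $ 2 = 0" for z
    using lp that by (auto simp: surface_boundary_def)
  have tan_n: "e3 \<bullet> n = 0"
  proof -
    obtain U1 \<phi>1 y1 \<xi> where "n = fd \<phi>1 y1 \<xi>" "local_param S U1 \<phi>1" "y1 \<in> U1 \<inter> upper" "\<phi>1 y1 = \<phi> y0"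
      using free[OF bdy[OF y0]] by (auto simp: tangent_space_def)
    then show ?thesis using normal_unique[OF lp _ nrm] y0 up by blast
  qed
  have on3: "e3 \<bullet> e3 = 1" using crs by (simp add: e3_def dot_square_norm norm_sgn)
  have on2: "e2 \<bullet> e2 = 1" using n by (simp add: e2_def norm_eq_1)
  have e23: "e2 \<bullet> e3 = 0" using tan_n by (simp add: e2_def inner_commute)
  have "(norm e1)\<^sup>2 = 1" using norm_cross_dot[of e2 e3] e23 on2[folded norm_eq_1] on3[folded norm_eq_1] by (simp add: e1_def)
  then have on1: "e1 \<bullet> e1 = 1" by (simp add: power2_norm_eq_inner)
  have orth: "e1 \<bullet> e2 = 0" "e1 \<bullet> e3 = 0" by (simp_all add: e1_def dot_cross_self)
  have e3c: "e3 = cross3 e1 e2"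
    using Lagrange[of e2 e2 e3] on2 e23 cross_skew[of e1 e2] by (simp add: e1_def)
  define q where "q = \<phi> y0"
  have qa: "n \<bullet> q = a" using bdy[OF y0] bd by (auto simp: q_def)
  define h where "h z = (\<phi> z - q) \<bullet> e2" for z
  have sh: "smooth_on U h" unfolding h_def using U s by (intro smooth_intros)
  have h_eq: "h z = n \<bullet> \<phi> z - a" for z using qa by (simp add: h_def e2_def inner_commute[of _ n] inner_diff_right)
  have h_ge: "0 \<le> h z" if "z \<in> U \<inter> upper" for z using that S\<phi> sub by (force simp: h_eq)
  have h_0: "h z = 0" if "z \<in> U" "z $ 2 = 0" for z using bdy[OF that] bd by (auto simp: h_eq)
  have line: "((\<lambda>t. h (z + t *\<^sub>R axis i 1)) has_real_derivative pd i h (z + t *\<^sub>R axis i 1)) (at t)"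
    if "z + t *\<^sub>R axis i 1 \<in> U" for z i t
  proof -
    let ?w = "z + t *\<^sub>R axis i 1"
    have l: "linear (frechet_derivative h (at ?w))"
      using smooth_on_has_derivative[OF sh that] has_derivative_linear by blast
    have "((\<lambda>t. h (z + t *\<^sub>R axis i 1)) has_derivative (\<lambda>c. fd h ?w (c *\<^sub>R axis i 1))) (at t)"
      by (rule has_derivative_compose[of "\<lambda>t. z + t *\<^sub>R axis i 1" _ t UNIV h])
        (use smooth_on_has_derivative[OF sh that] in \<open>auto intro!: derivative_eq_intros\<close>)
    then show ?thesis
      unfolding has_field_derivative_def
      by (rule has_derivative_eq_rhs) (simp add: linear_cmul[OF l] fun_eq_iff pd_def mult.commute)
  qed
  obtain r0 where r0: "r0 > 0" "ball y0 r0 \<subseteq> U" using U y0 open_contains_ball by blast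
  have near: "y0 + t *\<^sub>R axis i 1 \<in> U" if "\<bar>t\<bar> < r0" for t i
    using r0 that by (intro subsetD[OF r0(2)]) (simp add: dist_norm norm_axis_1)
  have h1: "pd 1 h y0 = 0"
  proof -
    have "((\<lambda>t. h (y0 + t *\<^sub>R axis 1 1)) has_real_derivative pd 1 h y0) (at 0)"
      using line[of y0 0 1] y0 by simp
    moreover have "((\<lambda>t. h (y0 + t *\<^sub>R axis 1 1)) has_real_derivative 0) (at 0)"
    proof (rule has_field_derivative_transform_within_open[of "\<lambda>_. 0" 0 0 "{-r0<..<r0}"])
      fix t assume "t \<in> {-r0<..<r0}"
      then have "\<bar>t\<bar> < r0" by auto
      then show "0 = h (y0 + t *\<^sub>R axis 1 1)"
        using h_0[OF near[of t 1]] y0(2) by (simp add: axis_def)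
    qed (use r0 in auto)
    ultimately show ?thesis by (rule DERIV_unique)
  qed
  have h2: "0 < pd 2 h y0"
  proof -
    have d: "((\<lambda>t. h (y0 + t *\<^sub>R axis 2 1)) has_real_derivative pd 2 h y0) (at 0)"
      using line[of y0 0 2] y0 by simp
    have "0 \<le> pd 2 h y0"
    proof (rule ccontr)
      assume "\<not> 0 \<le> pd 2 h y0"
      then obtain d' where d': "d' > 0" "\<And>t. 0 < t \<Longrightarrow> t < d' \<Longrightarrow> h (y0 + (0 + t) *\<^sub>R axis 2 1) < h (y0 + 0 *\<^sub>R axis 2 1)"
        using DERIV_neg_dec_right[OF d] by (auto simp: not_le)
      define t where "t = min d' r0 / 2"
      have t: "0 < t" "t < d'" "t < r0" using d' r0 by (auto simp: t_def)
      have "0 \<le> h (y0 + t *\<^sub>R axis 2 1)"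
        using t near[of t 2] y0 by (intro h_ge) (auto simp: upper_def)
      then show False using d'(2)[OF t(1,2)] h_0[OF y0] by simp
    qed
    moreover have "pd 2 h y0 \<noteq> 0"
    proof
      assume "pd 2 h y0 = 0"
      then have 0: "fd h y0 v = 0" for v using fd_eq_pd[OF smooth_on_differentiable[OF sh y0(1)]] h1 by simp
      have "fd h y0 v = fd \<phi> y0 v \<bullet> e2" for v
        unfolding h_def by (rule fd_eqI) (auto intro!: derivative_eq_intros smooth_on_has_derivative[OF s y0(1)])
      then have orth2: "fd \<phi> y0 v \<bullet> e2 = 0" for v using 0 by simp
      have b: "b1 \<bullet> e2 = 0" "b2 \<bullet> e2 = 0"
        using orth2[of "axis 1 1"] orth2[of "axis 2 1"] by (simp_all add: b1_def b2_def pd_def)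
      have "cross3 (cross3 b1 b2) e2 = 0"
        using Lagrange[of e2 b1 b2] cross_skew[of e2 "cross3 b1 b2"] b by (simp add: inner_commute)
      then have "cross3 e3 e2 = 0" by (simp add: e3_def sgn_div_norm cross_mult_left)
      then have "e1 = 0" using cross_skew[of e2 e3] by (simp add: e1_def)
      then show False using on1 by simp
    qed
    ultimately show ?thesis by simp
  qed
  have "isCont (pd 2 h) y0"
    using smooth_on_continuous_on[OF smooth_on_pd[OF sh]] U y0 by (metis continuous_on_eq_continuous_at)
  then obtain r1 where r1: "r1 > 0" "\<And>z. dist z y0 < r1 \<Longrightarrow> dist (pd 2 h z) (pd 2 h y0) < pd 2 h y0"
    using h2 by (metis continuous_at_eps_delta)
  define r where "r = min r0 r1"
  define U0 where "U0 = ball y0 r"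
  have U0: "open U0" "U0 \<subseteq> U" "y0 \<in> U0" using r0 r1 by (auto simp: U0_def r_def)
  have sgn_h: "0 \<le> h z \<longleftrightarrow> z \<in> upper" "h z = 0 \<longleftrightarrow> z $ 2 = 0" if z: "z \<in> U0" for z
  proof -
    define w where "w = z - (z $ 2) *\<^sub>R axis 2 1"
    have w2: "w $ 2 = 0" by (simp add: w_def axis_def)
    have seg: "w + t *\<^sub>R axis 2 1 \<in> U0" if "\<bar>t\<bar> \<le> \<bar>z $ 2\<bar>" for t
    proof -
      have "(norm (w + t *\<^sub>R axis 2 1 - y0))\<^sup>2 \<le> (norm (z - y0))\<^sup>2"
        unfolding norm2_sq using that y0 by (simp add: w_def axis_def abs_le_square_iff)
      then have "norm (w + t *\<^sub>R axis 2 1 - y0) \<le> norm (z - y0)" by (simp add: power2_le_iff_abs_le)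
      then show ?thesis using z by (simp add: U0_def dist_norm norm_minus_commute)
    qed
    have wU: "h w = 0" using seg[of 0] U0(2) w2 by (intro h_0) auto
    have dpos: "0 < pd 2 h x" if "x \<in> U0" for x
      using r1(2)[of x] that by (auto simp: U0_def r_def dist_commute dist_real_def)
    have zw: "z = w + (z $ 2) *\<^sub>R axis 2 1" by (simp add: w_def)
    have pos: "0 < h z" if pz: "0 < z $ 2"
    proof -
      have "\<exists>t>0. t < z $ 2 \<and> h (w + (z $ 2) *\<^sub>R axis 2 1) - h (w + 0 *\<^sub>R axis 2 1) = (z $ 2 - 0) * pd 2 h (w + t *\<^sub>R axis 2 1)"
        using seg U0(2) by (intro MVT2[OF pz] line) auto
      then obtain t where t: "0 < t" "t < z $ 2" "h (w + (z $ 2) *\<^sub>R axis 2 1) - h (w + 0 *\<^sub>R axis 2 1) = (z $ 2 - 0) * pd 2 h (w + t *\<^sub>R axis 2 1)"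
        by blast
      have "0 < pd 2 h (w + t *\<^sub>R axis 2 1)" using t by (intro dpos seg) auto
      then show ?thesis using t pz wU zw[symmetric] by simp
    qed
    have neg: "h z < 0" if neg: "z $ 2 < 0"
    proof -
      have "\<exists>t>z $ 2. t < 0 \<and> h (w + 0 *\<^sub>R axis 2 1) - h (w + (z $ 2) *\<^sub>R axis 2 1) = (0 - z $ 2) * pd 2 h (w + t *\<^sub>R axis 2 1)"
        using seg U0(2) by (intro MVT2[OF neg] line) auto
      then obtain t where t: "z $ 2 < t" "t < 0" "h (w + 0 *\<^sub>R axis 2 1) - h (w + (z $ 2) *\<^sub>R axis 2 1) = (0 - z $ 2) * pd 2 h (w + t *\<^sub>R axis 2 1)"
        by blast
      have "0 < pd 2 h (w + t *\<^sub>R axis 2 1)" using t by (intro dpos seg) auto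
      then have "0 < (0 - z $ 2) * pd 2 h (w + t *\<^sub>R axis 2 1)" using neg by (intro mult_pos_pos) simp_all
      then show ?thesis using t wU zw[symmetric] by simp
    qed
    have zero: "h z = 0" if "z $ 2 = 0" using that U0(2) z by (intro h_0) auto
    show "0 \<le> h z \<longleftrightarrow> z \<in> upper" "h z = 0 \<longleftrightarrow> z $ 2 = 0"
      using pos neg zero by (auto simp: upper_def less_le not_le) (metis less_le not_less_iff_gr_or_eq)+
  qed
  obtain U' V f \<theta> where *: "open U'" "U' \<subseteq> U0" "y0 \<in> U'" "graph_map e1 e2 e3 V f"
    and hom: "homeomorphism U' V (\<lambda>z. vector [(\<phi> z - q) \<bullet> e1, (\<phi> z - q) \<bullet> e2]) \<theta>" and s\<theta>: "smooth_on V \<theta>"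
    and G\<theta>: "\<And>x. x \<in> V \<Longrightarrow> \<phi> (\<theta> x) = graph_map.G q e1 e2 e3 f x"
    using graph_reparametrization[OF lp U0 up on1 on2 on3 orth(1) orth(2) e23 e3c nrm] by blast
  interpret graph_map q e1 e2 e3 V f by (rule *(4))
  define z :: "real^2" where "z = 0"
  have "vector [(\<phi> y0 - q) \<bullet> e1, (\<phi> y0 - q) \<bullet> e2] = z" by (simp add: q_def z_def vec_eq_iff forall_2)
  then have zV: "z \<in> V" "\<theta> z = y0"
    using hom *(3) by (auto simp: homeomorphism_def)
  have Gz: "G z = \<phi> y0" using G\<theta>[OF zV(1)] zV(2) by simp
  have th: "\<theta> x \<in> U'" "h (\<theta> x) = x $ 2" if "x \<in> V" for x
  proof -
    show "\<theta> x \<in> U'" using hom that by (auto simp: homeomorphism_def)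
    have "vector [(\<phi> (\<theta> x) - q) \<bullet> e1, (\<phi> (\<theta> x) - q) \<bullet> e2] = x" using hom that by (simp add: homeomorphism_def)
    then show "h (\<theta> x) = x $ 2" by (metis h_def vector_2(2))
  qed
  have th_up: "\<theta> x \<in> upper \<longleftrightarrow> x \<in> upper" "\<theta> x $ 2 = 0 \<longleftrightarrow> x $ 2 = 0" if "x \<in> V" for x
    using th[OF that] sgn_h[of "\<theta> x"] *(2) by (auto simp: upper_def)
  have thV: "\<theta> ` V = U'" using hom by (simp add: homeomorphism_def)
  have "\<theta> ` (V \<inter> upper) = U' \<inter> upper" using th_up thV by blast
  then have img: "G ` (V \<inter> upper) = \<phi> ` (U' \<inter> upper)" using G\<theta> by (metis (no_types, lifting) Int_iff image_cong image_image)
  have "U' \<subseteq> U" using *(2) U0(2) by blast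
  then have "openin (top_of_set (U \<inter> upper)) (U' \<inter> upper)"
    using openin_open_Int[OF *(1), of "U \<inter> upper"] by (simp add: Int_absorb1 Int_commute Int_left_commute inf.absorb_iff2)
  then have "openin (top_of_set S) (G ` (V \<inter> upper))"
    unfolding img by (rule local_param_openin_image[OF lp])
  then interpret graph_patch q e1 e2 e3 V f S by unfold_locales
  have zup: "z \<in> V \<inter> upper" using zV by (simp add: z_def upper_def)
  have grad: "pd i f z = 0" for i
  proof -
    have "e3 \<bullet> pd i G z = 0" unfolding pd_def
      by (rule normal_unique[OF lp _ nrm local_param_G zup Gz]) (use y0 up in auto)
    then show ?thesis using inner_e3_pd_G[OF zV(1)] by simp
  qed
  have "centred_patch q e1 e2 e3 V f S z"
  proof unfold_locales
    fix y assume y: "y \<in> V" "y $ 2 = 0"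
    have yup: "y \<in> V \<inter> upper" using y by (simp add: upper_def)
    have "G y \<in> surface_boundary S" using local_param_G y by (auto simp: surface_boundary_def)
    then obtain v where v: "e2 = fd G y v" using free tangent_space_G[OF yup] by (auto simp: e2_def)
    have "fd G y v \<bullet> e1 = v $ 1" "fd G y v \<bullet> e2 = v $ 2" "fd G y v \<bullet> e3 = v $ 1 * pd 1 f y + v $ 2 * pd 2 f y"
      by (simp_all add: fd_G[OF y(1)] inner_add_left on on_sym)
    then show "pd 2 f y = 0" using on on_sym unfolding v[symmetric] by simp
  qed (use zup grad in auto)
  then show ?thesis using Gz by blast
qed

lemma half_bubble_patch:
  assumes hb: "embedded_surface S" "norm n = 1" "S \<subseteq> {x. a \<le> n \<bullet> x}" "surface_boundary S = S \<inter> {x. n \<bullet> x = a}"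
      "\<And>p. p \<in> surface_boundary S \<Longrightarrow> n \<in> tangent_space S p"
    and p: "p \<in> S"
  obtains q e1 e2 e3 V f z where "centred_patch q e1 e2 e3 V f S z" "graph_map.G q e1 e2 e3 f z = p"
    "n \<bullet> p \<noteq> a \<Longrightarrow> 0 < z $ 2"
proof (cases "n \<bullet> p = a")
  case True
  then have "p \<in> surface_boundary S" using hb(4) p by simp
  then obtain U \<phi> y where y: "local_param S U \<phi>" "y \<in> U" "y $ 2 = 0" "p = \<phi> y" by (auto simp: surface_boundary_def)
  obtain q e1 e2 e3 V f z where "centred_patch q e1 e2 e3 V f S z" "graph_map.G q e1 e2 e3 f z = p"
    using boundary_patch[OF y(1,2,3) hb(2-5)] y(4) by metis
  then show ?thesis using that True by blast
next
  case False
  obtain U \<phi> y where y: "local_param S U \<phi>" "y \<in> U \<inter> upper" "p = \<phi> y"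
    using hb(1) p by (auto simp: embedded_surface_def)
  have "y $ 2 \<noteq> 0"
  proof
    assume "y $ 2 = 0"
    then have "p \<in> surface_boundary S" using y by (auto simp: surface_boundary_def)
    then show False using hb(4) False by simp
  qed
  then have "0 < y $ 2" using y(2) by (auto simp: upper_def)
  then obtain q e1 e2 e3 V f z where "centred_patch q e1 e2 e3 V f S z" "graph_map.G q e1 e2 e3 f z = p" "0 < z $ 2"
    using interior_patch[OF y(1), of y] y(2,3) by auto
  then show ?thesis using that by blast
qed

section \<open>The Simons identity\<close>

context graph_map
begin

lemma pd_rules:
  fixes g h :: "real^2 \<Rightarrow> real"
  assumes y: "y \<in> V"
  shows pd_add: "smooth_on V g \<Longrightarrow> smooth_on V h \<Longrightarrow> pd i (\<lambda>y. g y + h y) y = pd i g y + pd i h y"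
    and pd_diff: "smooth_on V g \<Longrightarrow> smooth_on V h \<Longrightarrow> pd i (\<lambda>y. g y - h y) y = pd i g y - pd i h y"
    and pd_mult: "smooth_on V g \<Longrightarrow> smooth_on V h \<Longrightarrow> pd i (\<lambda>y. g y * h y) y = pd i g y * h y + g y * pd i h y"
    and pd_const: "pd i (\<lambda>_. c :: real) y = 0"
proof -
  show "pd i (\<lambda>y. g y + h y) y = pd i g y + pd i h y" if "smooth_on V g" "smooth_on V h"
    unfolding pd_def[of i g] pd_def[of i h]
    by (rule pd_eqI[OF has_derivative_add]) (rule smooth_on_has_derivative[OF that(1) y] smooth_on_has_derivative[OF that(2) y])+
  show "pd i (\<lambda>y. g y - h y) y = pd i g y - pd i h y" if "smooth_on V g" "smooth_on V h"
    unfolding pd_def[of i g] pd_def[of i h]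
    by (rule pd_eqI[OF has_derivative_diff]) (rule smooth_on_has_derivative[OF that(1) y] smooth_on_has_derivative[OF that(2) y])+
  show "pd i (\<lambda>y. g y * h y) y = pd i g y * h y + g y * pd i h y" if "smooth_on V g" "smooth_on V h"
    unfolding pd_def[of i g] pd_def[of i h]
    using pd_eqI[OF has_derivative_mult[OF smooth_on_has_derivative[OF that(1) y] smooth_on_has_derivative[OF that(2) y]], of i]
    by simp
  show "pd i (\<lambda>_. c :: real) y = 0" by (rule pd_eqI[OF has_derivative_const])
qed

lemmas sm = smooth_on_add[OF open_V] smooth_on_diff[OF open_V] smooth_on_mult[OF open_V]
  smooth_on_const[OF open_V] smooth_on_pd smooth_f smooth_asq

abbreviation "P \<equiv> pd 1 f"
abbreviation "Q \<equiv> pd 2 f"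
abbreviation "R \<equiv> pd 1 (pd 1 f)"
abbreviation "H \<equiv> pd 1 (pd 2 f)"
abbreviation "T \<equiv> pd 2 (pd 2 f)"

lemma pd2P: "y \<in> V \<Longrightarrow> pd 2 P y = H y"
  by (rule pd_commute[OF open_V smooth_f])

lemma pd1H:
  assumes y: "y \<in> V" shows "pd 1 H y = pd 2 R y"
proof -
  have "pd 1 (pd 2 P) y = pd 1 H y" by (rule pd_cong[OF open_V y pd2P])
  then show ?thesis using pd_commute[OF open_V smooth_on_pd[OF smooth_f] y, of 1 2 1] by simp
qed

lemma pd2H: "y \<in> V \<Longrightarrow> pd 2 H y = pd 1 T y"
  by (rule pd_commute[OF open_V smooth_on_pd[OF smooth_f]])

lemma pd11H: "y \<in> V \<Longrightarrow> pd 1 (pd 1 H) y = pd 1 (pd 2 R) y"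
  by (rule pd_cong[OF open_V _ pd1H])

lemma pd22H:
  assumes y: "y \<in> V" shows "pd 2 (pd 2 H) y = pd 1 (pd 2 T) y"
proof -
  have "pd 2 (pd 2 H) y = pd 2 (pd 1 T) y" by (rule pd_cong[OF open_V y pd2H])
  also have "\<dots> = pd 1 (pd 2 T) y"
    by (rule pd_commute[OF open_V smooth_on_pd[OF smooth_on_pd[OF smooth_f]] y])
  finally show ?thesis .
qed

lemma pd22R:
  assumes y: "y \<in> V" shows "pd 2 (pd 2 R) y = pd 1 (pd 1 T) y"
proof -
  have "pd 2 (pd 1 H) y = pd 2 (pd 2 R) y" by (rule pd_cong[OF open_V y pd1H])
  moreover have "pd 2 (pd 1 H) y = pd 1 (pd 2 H) y"
    by (rule pd_commute[OF open_V smooth_on_pd[OF smooth_on_pd[OF smooth_f]] y])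
  moreover have "pd 1 (pd 2 H) y = pd 1 (pd 1 T) y" by (rule pd_cong[OF open_V y pd2H])
  ultimately show ?thesis by simp
qed

definition mseD :: "2 \<Rightarrow> real^2 \<Rightarrow> real" where
  "mseD i y = 2 * (Q y * (pd i Q y * R y)) + (pd i R y + Q y * (Q y * pd i R y))
     - 2 * (pd i P y * (Q y * H y) + P y * (pd i Q y * H y) + P y * (Q y * pd i H y))
     + 2 * (P y * (pd i P y * T y)) + (pd i T y + P y * (P y * pd i T y))"

lemma pd_mse: "y \<in> V \<Longrightarrow> pd i mse y = mseD i y"
  unfolding mse_def[abs_def] power2_eq_square
  by (simp add: pd_rules sm mseD_def algebra_simps)

lemma pd_pd_mse:
  assumes "y \<in> V" "P y = 0" "Q y = 0"
  shows "pd j (pd i mse) y = 2 * pd j Q y * pd i Q y * R y + pd j (pd i R) y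
    - 2 * (pd i P y * pd j Q y + pd j P y * pd i Q y) * H y + 2 * pd j P y * pd i P y * T y + pd j (pd i T) y"
proof -
  have "pd j (pd i mse) y = pd j (mseD i) y" by (rule pd_cong[OF open_V assms(1) pd_mse])
  also have "\<dots> = 2 * pd j Q y * pd i Q y * R y + pd j (pd i R) y
    - 2 * (pd i P y * pd j Q y + pd j P y * pd i Q y) * H y + 2 * pd j P y * pd i P y * T y + pd j (pd i T) y"
    unfolding mseD_def[abs_def] by (simp add: pd_rules sm assms algebra_simps)
  finally show ?thesis .
qed

definition KK :: "real^2 \<Rightarrow> real" where "KK y = (1 + (P y * P y + Q y * Q y)) * (1 + (P y * P y + Q y * Q y))"

lemma smooth_KK: "smooth_on V KK"
  unfolding KK_def[abs_def] by (intro sm)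

lemma KK_W: "KK y = W y ^ 4"
  by (simp add: KK_def W_mult[symmetric] power4_eq_xxxx)

lemma asq_KK: "asq y * KK y = 2 * (H y * H y - R y * T y)"
  using W_pos[of y] by (simp add: asq_def KK_W power2_eq_square)

lemma pd_KK: "y \<in> V \<Longrightarrow> pd i KK y = 4 * ((1 + (P y * P y + Q y * Q y)) * (P y * pd i P y + Q y * pd i Q y))"
  unfolding KK_def[abs_def] by (simp add: pd_rules sm algebra_simps)

lemma pd_asq_KK:
  assumes y: "y \<in> V"
  shows "pd i asq y * KK y + asq y * pd i KK y = 2 * (2 * (H y * pd i H y) - pd i R y * T y - R y * pd i T y)"
proof -
  have "pd i (\<lambda>y. asq y * KK y) y = pd i (\<lambda>y. 2 * (H y * H y - R y * T y)) y"
    by (simp add: asq_KK)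
  then show ?thesis using y by (simp add: pd_rules sm smooth_KK algebra_simps)
qed

lemma pd_pd_asq:
  assumes y: "y \<in> V" and 0: "P y = 0" "Q y = 0"
  shows "pd i (pd i asq) y = 2 * (2 * (pd i H y * pd i H y + H y * pd i (pd i H) y) - pd i (pd i R) y * T y
     - 2 * (pd i R y * pd i T y) - R y * pd i (pd i T) y) - 4 * asq y * (pd i P y * pd i P y + pd i Q y * pd i Q y)"
proof -
  have "pd i (\<lambda>y. pd i asq y * KK y + asq y * pd i KK y) y
      = pd i (\<lambda>y. 2 * (2 * (H y * pd i H y) - pd i R y * T y - R y * pd i T y)) y"
    by (rule pd_cong[OF open_V y pd_asq_KK])
  moreover have "pd i (pd i KK) y = 4 * (pd i P y * pd i P y + pd i Q y * pd i Q y)"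
  proof -
    have "pd i (pd i KK) y = pd i (\<lambda>y. 4 * ((1 + (P y * P y + Q y * Q y)) * (P y * pd i P y + Q y * pd i Q y))) y"
      by (rule pd_cong[OF open_V y pd_KK])
    then show ?thesis using y 0 by (simp add: pd_rules sm)
  qed
  moreover have "KK y = 1" "pd i KK y = 0" using 0 y by (simp_all add: KK_def pd_KK)
  ultimately show ?thesis using y by (simp add: pd_rules sm smooth_KK algebra_simps)
qed

lemma simons_horizontal:
  assumes y: "y \<in> V" and 0: "P y = 0" "Q y = 0" and mse: "mse y = 0"
    and d1: "\<And>i. pd i mse y = 0" and d2: "\<And>i j. pd j (pd i mse) y = 0"
  shows "asq y * (pd 1 (pd 1 asq) y + pd 2 (pd 2 asq) y) = (pd 1 asq y)\<^sup>2 + (pd 2 asq y)\<^sup>2 - 2 * asq y ^ 3"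
    and "- 2 * (asq y)\<^sup>2 \<le> pd 1 (pd 1 asq) y + pd 2 (pd 2 asq) y" and "0 \<le> asq y" and "R y + T y = 0"
proof -
  define r h a b where "r = R y" and "h = H y" and "a = pd 1 R y" and "b = pd 2 R y"
  define r12 t12 r11 t11 t22 where "r12 = pd 1 (pd 2 R) y" and "t12 = pd 1 (pd 2 T) y" and "r11 = pd 1 (pd 1 R) y"
    and "t11 = pd 1 (pd 1 T) y" and "t22 = pd 2 (pd 2 T) y"
  have t: "T y = - r" using mse 0 by (simp add: mse_def r_def)
  show "R y + T y = 0" using t by (simp add: r_def)
  have ti: "pd 1 T y = - a" "pd 2 T y = - b"
    using d1[of 1] d1[of 2] 0 y by (simp_all add: pd_mse mseD_def a_def b_def)
  have hi: "pd 1 H y = b" "pd 2 H y = - a" using pd1H[OF y] pd2H[OF y] ti by (simp_all add: b_def)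
  have P2: "pd 1 P y = r" "pd 2 P y = h" "pd 1 Q y = h" "pd 2 Q y = - r"
    using pd2P[OF y] t by (simp_all add: r_def h_def)
  have E11: "r11 + t11 = 2 * r * (r\<^sup>2 + h\<^sup>2)"
    using d2[of 1 1] pd_pd_mse[OF y 0, of 1 1] P2 t
    by (simp add: r11_def t11_def r_def[symmetric] h_def[symmetric] power2_eq_square algebra_simps)
  have E22: "t11 + t22 = - 2 * r * (r\<^sup>2 + h\<^sup>2)"
    using d2[of 2 2] pd_pd_mse[OF y 0, of 2 2] P2 t pd22R[OF y]
    by (simp add: t22_def t11_def r_def[symmetric] h_def[symmetric] power2_eq_square algebra_simps)
  have E12: "r12 + t12 = 2 * h * (r\<^sup>2 + h\<^sup>2)"
    using d2[of 1 2] pd_pd_mse[OF y 0, of 1 2] P2 t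
    by (simp add: r12_def t12_def r_def[symmetric] h_def[symmetric] power2_eq_square algebra_simps)
  have A: "asq y = 2 * (r\<^sup>2 + h\<^sup>2)"
    using asq_KK[of y] 0 t by (simp add: KK_def r_def h_def power2_eq_square)
  then show "0 \<le> asq y" by simp
  have K: "KK y = 1" "pd i KK y = 0" for i using 0 y by (simp_all add: KK_def pd_KK)
  have A1: "pd 1 asq y = 4 * (h * b + r * a)" "pd 2 asq y = 4 * (r * b - h * a)"
    using pd_asq_KK[OF y, of 1] pd_asq_KK[OF y, of 2]
    by (simp_all add: K hi ti t a_def[symmetric] b_def[symmetric] r_def[symmetric] h_def[symmetric])
  have "pd 1 (pd 1 asq) y = 2 * (2 * (b * b + h * r12) + r11 * r + 2 * (a * a) - r * t11) - 4 * asq y * (r * r + h * h)"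
    using pd_pd_asq[OF y 0, of 1] pd11H[OF y] P2
    by (simp add: hi ti t r12_def r11_def t11_def a_def[symmetric] r_def[symmetric] h_def[symmetric])
  moreover have "pd 2 (pd 2 asq) y = 2 * (2 * (a * a + h * t12) + t11 * r + 2 * (b * b) - r * t22) - 4 * asq y * (h * h + r * r)"
    using pd_pd_asq[OF y 0, of 2] pd22H[OF y] pd22R[OF y] P2
    by (simp add: hi ti t t12_def t11_def t22_def b_def[symmetric] r_def[symmetric] h_def[symmetric])
  ultimately have "pd 1 (pd 1 asq) y + pd 2 (pd 2 asq) y
      = 8 * (a * a + b * b) + 4 * h * (r12 + t12) + 2 * r * (r11 + t11) - 2 * r * (t11 + t22) - 8 * asq y * (r\<^sup>2 + h\<^sup>2)"
    by (simp add: power2_eq_square algebra_simps)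
  also have "\<dots> = 8 * (a * a + b * b) - 2 * (asq y)\<^sup>2"
    unfolding E11 E12 E22 A by (simp add: power2_eq_square algebra_simps)
  finally have L: "pd 1 (pd 1 asq) y + pd 2 (pd 2 asq) y = 8 * (a * a + b * b) - 2 * (asq y)\<^sup>2" .
  then show "- 2 * (asq y)\<^sup>2 \<le> pd 1 (pd 1 asq) y + pd 2 (pd 2 asq) y" by simp
  show "asq y * (pd 1 (pd 1 asq) y + pd 2 (pd 2 asq) y) = (pd 1 asq y)\<^sup>2 + (pd 2 asq y)\<^sup>2 - 2 * asq y ^ 3"
    unfolding L A1 A by (simp add: power2_eq_square power3_eq_cube algebra_simps)
qed

text \<open>The Laplace-Beltrami operator in the graph coordinates; for minimal graphs the first-order
  terms vanish.\<close>

definition lapl :: "(real^2 \<Rightarrow> real) \<Rightarrow> real^2 \<Rightarrow> real" where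
  "lapl U y = ((1 + (Q y)\<^sup>2) * pd 1 (pd 1 U) y - P y * Q y * (pd 1 (pd 2 U) y + pd 2 (pd 1 U) y)
     + (1 + (P y)\<^sup>2) * pd 2 (pd 2 U) y) / (W y)\<^sup>2"

text \<open>It is the trace over the tangent plane of the Hessian of any extension to the ambient space.\<close>

lemma lapl_trace:
  assumes O: "open O'" and w: "smooth_on O' w" and y: "y \<in> V" "G y \<in> O'"
    and U: "\<And>z. z \<in> V \<Longrightarrow> G z \<in> O' \<Longrightarrow> U z = w (G z)" and mse: "mse y = 0"
    and t: "t1 \<bullet> t1 = 1" "t2 \<bullet> t2 = 1" "t1 \<bullet> t2 = 0" "\<And>i. \<exists>a b. pd i G y = a *\<^sub>R t1 + b *\<^sub>R t2"
  shows "lapl U y = fd (\<lambda>x. fd w x t1) (G y) t1 + fd (\<lambda>x. fd w x t2) (G y) t2"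
proof -
  define V' where "V' = V \<inter> G -` O'"
  have V': "open V'" unfolding V'_def by (rule continuous_open_preimage[OF continuous_G open_V O])
  have yV: "y \<in> V'" and GV: "G ` V' \<subseteq> O'" and sG: "smooth_on V' G"
    using y by (auto simp: V'_def intro: smooth_on_subset[OF smooth_G])
  define B where "B u v = fd (\<lambda>x. fd w x v) (G y) u" for u v
  define D where "D v = fd w (G y) v" for v
  have linD: "linear D" unfolding D_def
    using smooth_on_has_derivative[OF w y(2)] has_derivative_linear by blast
  have B1: "B (a *\<^sub>R u + b *\<^sub>R u') v = a * B u v + b * B u' v" for a b u u' v
  proof -
    have l: "linear (\<lambda>u. B u v)" unfolding B_def
      using smooth_on_has_derivative[OF smooth_on_fd[OF w] y(2)] has_derivative_linear by blast
    show ?thesis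
      using linear_add[OF l, of "a *\<^sub>R u" "b *\<^sub>R u'"] linear_scale[OF l, of a u] linear_scale[OF l, of b u'] by simp
  qed
  have B2: "B v (a *\<^sub>R u + b *\<^sub>R u') = a * B v u + b * B v u'" for a b u u' v
  proof -
    have lw: "fd w x (a *\<^sub>R u + b *\<^sub>R u') = a *\<^sub>R fd w x u + b *\<^sub>R fd w x u'" if "x \<in> O'" for x
    proof -
      have l: "linear (frechet_derivative w (at x))"
        using smooth_on_has_derivative[OF w that] has_derivative_linear by blast
      show ?thesis by (simp only: linear_add[OF l] linear_scale[OF l])
    qed
    have "fd (\<lambda>x. fd w x (a *\<^sub>R u + b *\<^sub>R u')) (G y) v = fd (\<lambda>x. a *\<^sub>R fd w x u + b *\<^sub>R fd w x u') (G y) v"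
      using frechet_derivative_cong_open(1)[OF O y(2) lw] by simp
    also have "\<dots> = a *\<^sub>R fd (\<lambda>x. fd w x u) (G y) v + b *\<^sub>R fd (\<lambda>x. fd w x u') (G y) v"
      by (rule fd_eqI, (rule has_derivative_add has_derivative_scaleR_right smooth_on_has_derivative[OF smooth_on_fd[OF w] y(2)])+)
    finally show ?thesis by (simp add: B_def)
  qed
  have U2: "pd i (pd j U) y = B (pd i G y) (pd j G y) + pd i (pd j f) y * D e3" for i j
  proof -
    have "pd j U z = pd j (\<lambda>z. w (G z)) z" if "z \<in> V'" for z
      by (rule pd_cong[OF V' that]) (use U in \<open>auto simp: V'_def\<close>)
    then have "pd i (pd j U) y = pd i (pd j (\<lambda>z. w (G z))) y" by (rule pd_cong[OF V' yV])
    also have "\<dots> = B (pd i G y) (pd j G y) + D (pd i (pd j G) y)"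
      unfolding pd_def B_def D_def by (rule fd_second_compose[OF V' O sG w GV yV])
    also have "D (pd i (pd j G) y) = pd i (pd j f) y * D e3"
      using linD by (simp add: pd_pd_G[OF y(1)] linear_scale)
    finally show ?thesis .
  qed
  obtain a b where G1: "pd 1 G y = a *\<^sub>R t1 + b *\<^sub>R t2" using t(4) by blast
  obtain c d where G2: "pd 2 G y = c *\<^sub>R t1 + d *\<^sub>R t2" using t(4) by blast
  have t21: "t2 \<bullet> t1 = 0" using t(3) by (simp add: inner_commute)
  have GG: "pd 1 G y \<bullet> pd 1 G y = 1 + (P y)\<^sup>2" "pd 1 G y \<bullet> pd 2 G y = P y * Q y" "pd 2 G y \<bullet> pd 2 G y = 1 + (Q y)\<^sup>2"
    by (simp_all add: pd_G[OF y(1)] inner_add_left inner_add_right on on_sym power2_eq_square)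
  have g: "1 + (P y)\<^sup>2 = a * a + b * b" "P y * Q y = a * c + b * d" "1 + (Q y)\<^sup>2 = c * c + d * d"
    unfolding GG[symmetric] G1 G2 by (simp_all add: inner_add_left inner_add_right t t21)
  have "(W y)\<^sup>2 = (1 + (P y)\<^sup>2) * (1 + (Q y)\<^sup>2) - (P y * Q y) * (P y * Q y)"
    by (simp add: W_mult power2_eq_square algebra_simps)
  also have "\<dots> = (a * d - b * c)\<^sup>2" unfolding g by (simp add: power2_eq_square algebra_simps)
  finally have W2: "(W y)\<^sup>2 = (a * d - b * c)\<^sup>2" .
  have m: "(1 + (Q y)\<^sup>2) * R y - P y * Q y * (H y + pd 2 P y) + (1 + (P y)\<^sup>2) * T y = 0"
    using mse pd2P[OF y(1)] by (simp add: mse_def)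
  have "lapl U y * (W y)\<^sup>2 = (1 + (Q y)\<^sup>2) * pd 1 (pd 1 U) y - P y * Q y * (pd 1 (pd 2 U) y + pd 2 (pd 1 U) y)
     + (1 + (P y)\<^sup>2) * pd 2 (pd 2 U) y"
    using W_pos[of y] by (simp add: lapl_def)
  also have "\<dots> = (1 + (Q y)\<^sup>2) * B (pd 1 G y) (pd 1 G y)
      - P y * Q y * (B (pd 1 G y) (pd 2 G y) + B (pd 2 G y) (pd 1 G y)) + (1 + (P y)\<^sup>2) * B (pd 2 G y) (pd 2 G y)
      + ((1 + (Q y)\<^sup>2) * R y - P y * Q y * (H y + pd 2 P y) + (1 + (P y)\<^sup>2) * T y) * D e3"
    unfolding U2 by (simp add: algebra_simps)
  also have "\<dots> = (c * c + d * d) * B (pd 1 G y) (pd 1 G y)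
      - (a * c + b * d) * (B (pd 1 G y) (pd 2 G y) + B (pd 2 G y) (pd 1 G y)) + (a * a + b * b) * B (pd 2 G y) (pd 2 G y)"
    unfolding m unfolding g by simp
  also have "\<dots> = (a * d - b * c)\<^sup>2 * (B t1 t1 + B t2 t2)"
    unfolding G1 G2 B1 B2 by (simp add: power2_eq_square algebra_simps)
  finally have "lapl U y * (W y)\<^sup>2 = (W y)\<^sup>2 * (B t1 t1 + B t2 t2)" unfolding W2 .
  then show ?thesis using W_pos[of y] by (simp add: B_def)
qed

end

locale minimal_patch = graph_patch +
  assumes minimal: "minimal_surface S"
begin

lemma mse_0: "y \<in> V \<inter> upper \<Longrightarrow> mse y = 0"
  using minimal local_param_G trace_shape_G[of y] W_pos[of y] unfolding minimal_surface_def by fastforce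

lemma norm_A_sq_G: "y \<in> V \<inter> upper \<Longrightarrow> norm_A_sq S (G y) = asq y"
  using norm_A_sq_eq_trace[of y] trace_shape_square_G[of y] mse_0[of y] by simp

lemma pd_mse_0: "y \<in> V \<inter> upper \<Longrightarrow> pd i mse y = 0"
proof -
  assume y: "y \<in> V \<inter> upper"
  have s: "smooth_on V mse"
    unfolding mse_def[abs_def] power2_eq_square by (intro sm)
  have "frechet_derivative mse (at y) = frechet_derivative (\<lambda>_. 0) (at y)"
    using y by (intro fd_cong_upper[OF open_V y]) (auto intro: smooth_on_differentiable[OF s] mse_0)
  then show ?thesis by (simp add: pd_def)
qed

lemma pd_pd_mse_0: "y \<in> V \<Longrightarrow> 0 < y $ 2 \<Longrightarrow> pd j (pd i mse) y = 0"
proof -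
  assume y: "y \<in> V" "0 < y $ 2"
  have o: "open (V \<inter> {y. 0 < y $ 2})" using open_V by (intro open_Int open_halfspace_component_gt_cart)
  have "pd j (pd i mse) y = pd j (\<lambda>_. 0) y"
    by (rule pd_cong[OF o]) (use y in \<open>auto intro!: pd_mse_0 simp: upper_def\<close>)
  also have "\<dots> = 0" by (rule pd_const[OF y(1)])
  finally show ?thesis .
qed

lemma simons:
  assumes y: "y \<in> V" "0 < y $ 2"
  shows "asq y * lapl asq y = ginner y (pd 1 asq y) (pd 2 asq y) (pd 1 asq y) (pd 2 asq y) - 2 * asq y ^ 3"
    and "- 2 * (asq y)\<^sup>2 \<le> lapl asq y" and "0 \<le> asq y"
proof -
  have yup: "y \<in> V \<inter> upper" using y by (simp add: upper_def)
  obtain q' e1' e2' e3' V' f' z where c: "centred_patch q' e1' e2' e3' V' f' S z" and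
    Gz: "graph_map.G q' e1' e2' e3' f' z = G y" and z2: "0 < z $ 2"
    using interior_patch[OF local_param_G y] by blast
  interpret c: centred_patch q' e1' e2' e3' V' f' S z by (rule c)
  interpret c: minimal_patch q' e1' e2' e3' V' f' S by unfold_locales (rule minimal)
  have zV: "z \<in> V'" using c.y0 by simp
  obtain O1 where O1: "open O1" "G ` (V \<inter> upper) = S \<inter> O1" using openin_G by (auto simp: openin_open)
  define O' where "O' = pr -` V \<inter> O1"
  have O': "open O'" unfolding O'_def
    using O1(1) open_V continuous_pr[of UNIV] by (intro open_Int open_vimage)
  define w where "w x = asq (pr x)" for x
  have spr: "smooth_on O' pr"
  proof -
    have pr: "pr = (\<lambda>x. ((x - q) \<bullet> e1) *\<^sub>R axis 1 1 + ((x - q) \<bullet> e2) *\<^sub>R axis 2 1)"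
      by (simp add: pr_def vec_eq_iff forall_2 axis_def fun_eq_iff)
    show ?thesis unfolding pr using O' by (intro smooth_intros)
  qed
  have sw: "smooth_on O' w"
    unfolding w_def by (rule smooth_on_compose[OF O' open_V smooth_asq spr]) (auto simp: O'_def)
  have GyO: "G y \<in> O'" using O1(2) yup y by (auto simp: O'_def)
  have w_S: "w x = norm_A_sq S x" if "x \<in> S" "x \<in> O'" for x
  proof -
    have "x \<in> S \<inter> O1" using that by (simp add: O'_def)
    then obtain v where "v \<in> V \<inter> upper" "x = G v" using O1(2) by blast
    then show ?thesis using norm_A_sq_G by (simp add: w_def)
  qed
  have on: "e1' \<bullet> e1' = 1" "e2' \<bullet> e2' = 1" "e1' \<bullet> e2' = 0" by (rule c.on)+
  have tan: "range (frechet_derivative G (at y)) = range (frechet_derivative c.G (at z))"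
    using tangent_space_G[OF yup] c.tangent_space_G[OF c.y0] Gz by simp
  have "\<exists>a b. pd i G y = a *\<^sub>R e1' + b *\<^sub>R e2'" for i
  proof -
    have "pd i G y \<in> range (frechet_derivative c.G (at z))" unfolding tan[symmetric] pd_def by blast
    then show ?thesis by (auto simp: c.fd_G[OF zV] c.grad0)
  qed
  then have L1: "lapl asq y = fd (\<lambda>x. fd w x e1') (G y) e1' + fd (\<lambda>x. fd w x e2') (G y) e2'"
    using mse_0[OF yup] by (intro lapl_trace[OF O' sw y(1) GyO _ _ on]) (simp_all add: w_def)
  define V1 where "V1 = V' \<inter> {x. 0 < x $ 2}"
  have V1: "open V1" unfolding V1_def using c.open_V by (intro open_Int open_halfspace_component_gt_cart)
  interpret d: graph_map q' e1' e2' e3' V1 f'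
    using c.on c.e3_cross V1 c.smooth_f by unfold_locales (auto simp: V1_def intro: smooth_on_subset)
  have zV1: "z \<in> V1" using zV z2 by (simp add: V1_def)
  have "\<exists>a b. pd i d.G z = a *\<^sub>R e1' + b *\<^sub>R e2'" for i
  proof -
    have "e1' = 1 *\<^sub>R e1' + 0 *\<^sub>R e2'" "e2' = 0 *\<^sub>R e1' + 1 *\<^sub>R e2'" by simp_all
    then show ?thesis using exhaust_2[of i] d.pd_G[OF zV1] c.grad0 by (metis add_0_right scaleR_zero_left)
  qed
  moreover have "c.asq x = w (c.G x)" if "x \<in> V1" "c.G x \<in> O'" for x
  proof -
    have x: "x \<in> V' \<inter> upper" using that by (auto simp: V1_def upper_def)
    then have "c.asq x = norm_A_sq S (c.G x)" by (simp add: c.norm_A_sq_G)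
    also have "\<dots> = w (c.G x)" using w_S c.G_in_S[OF x] that by simp
    finally show ?thesis .
  qed
  ultimately have L2: "c.lapl c.asq z = fd (\<lambda>x. fd w x e1') (G y) e1' + fd (\<lambda>x. fd w x e2') (G y) e2'"
    using c.mse_0[OF c.y0] GyO unfolding Gz[symmetric] by (intro d.lapl_trace[OF O' sw zV1 _ _ _ on]) simp_all
  have L3: "c.lapl c.asq z = pd 1 (pd 1 c.asq) z + pd 2 (pd 2 c.asq) z"
    by (simp add: c.lapl_def c.grad0 c.W_sq)
  have A: "asq y = c.asq z"
    using norm_A_sq_G[OF yup] c.norm_A_sq_G[OF c.y0] Gz by simp
  have gr: "gradv y (pd 1 asq y) (pd 2 asq y) = c.gradv z (pd 1 c.asq z) (pd 2 c.asq z)"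
    using surface_gradient_G(2)[OF yup norm_A_sq_G smooth_on_differentiable[OF smooth_asq y(1)]]
      c.surface_gradient_G(2)[OF c.y0 c.norm_A_sq_G smooth_on_differentiable[OF c.smooth_asq zV]] Gz by simp
  have "ginner y (pd 1 asq y) (pd 2 asq y) (pd 1 asq y) (pd 2 asq y)
      = c.ginner z (pd 1 c.asq z) (pd 2 c.asq z) (pd 1 c.asq z) (pd 2 c.asq z)"
    unfolding gradv_gradv[OF y(1), symmetric] c.gradv_gradv[OF zV, symmetric] gr ..
  also have "\<dots> = (pd 1 c.asq z)\<^sup>2 + (pd 2 c.asq z)\<^sup>2"
    by (simp add: c.ginner_def c.grad0 c.W_def power2_eq_square)
  finally have Gi: "ginner y (pd 1 asq y) (pd 2 asq y) (pd 1 asq y) (pd 2 asq y) = (pd 1 c.asq z)\<^sup>2 + (pd 2 c.asq z)\<^sup>2" .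
  note sc = c.simons_horizontal[OF zV c.grad0 c.mse_0[OF c.y0] c.pd_mse_0[OF c.y0] c.pd_pd_mse_0[OF zV z2]]
  have L: "lapl asq y = pd 1 (pd 1 c.asq) z + pd 2 (pd 2 c.asq) z" using L1 L2 L3 by simp
  show "asq y * lapl asq y = ginner y (pd 1 asq y) (pd 2 asq y) (pd 1 asq y) (pd 2 asq y) - 2 * asq y ^ 3"
    "- 2 * (asq y)\<^sup>2 \<le> lapl asq y" "0 \<le> asq y"
    unfolding L Gi A using sc by simp_all
qed

lemma asq_nonneg: "y \<in> V \<inter> upper \<Longrightarrow> 0 \<le> asq y"
proof -
  assume y: "y \<in> V \<inter> upper"
  have "((\<lambda>t. asq (y + t *\<^sub>R axis 2 1)) \<longlongrightarrow> asq (y + 0 *\<^sub>R axis 2 1)) (at_right 0)"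
  proof -
    have "isCont asq y"
      using smooth_on_continuous_on[OF smooth_asq] open_V y by (metis IntD1 continuous_on_eq_continuous_at)
    then have "isCont (\<lambda>t. asq (y + t *\<^sub>R axis 2 1)) 0"
      by (intro isCont_o2[of 0 "\<lambda>t. y + t *\<^sub>R axis 2 1" asq]) auto
    then show ?thesis unfolding isCont_def by (rule filterlim_mono) (auto simp: at_within_le_at)
  qed
  moreover have "\<forall>\<^sub>F t in at_right 0. 0 \<le> asq (y + t *\<^sub>R axis 2 1)"
  proof -
    obtain r where r: "r > 0" "ball y r \<subseteq> V" using open_V y open_contains_ball by blast
    have "0 \<le> asq (y + t *\<^sub>R axis 2 1)" if "0 < t" "t < r" for t
    proof (rule simons(3))
      show "y + t *\<^sub>R axis 2 1 \<in> V" using r(2) that by (intro subsetD[OF r(2)]) (simp add: dist_norm norm_axis_1)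
      show "0 < (y + t *\<^sub>R axis 2 1) $ 2" using y that by (simp add: upper_def)
    qed
    then show ?thesis using r(1) by (auto simp: eventually_at_right_field)
  qed
  ultimately have "0 \<le> asq (y + 0 *\<^sub>R axis 2 1)" by (rule tendsto_lowerbound) simp
  then show ?thesis by simp
qed

end

locale free_boundary_patch = minimal_patch +
  assumes neumann: "\<And>y. y \<in> V \<Longrightarrow> y $ 2 = 0 \<Longrightarrow> pd 2 f y = 0"
begin

lemma boundary_pd1:
  assumes g: "smooth_on V g" and 0: "\<And>y. y \<in> V \<Longrightarrow> y $ 2 = 0 \<Longrightarrow> g y = (0 :: real)" and y: "y \<in> V" "y $ 2 = 0"
  shows "pd 1 g y = 0"
proof -
  obtain r where r: "r > 0" "ball y r \<subseteq> V" using open_V y open_contains_ball by blast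
  have l: "linear (frechet_derivative g (at y))"
    using smooth_on_has_derivative[OF g y(1)] has_derivative_linear by blast
  have "((\<lambda>t. g (y + t *\<^sub>R axis 1 1)) has_derivative (\<lambda>c. fd g y (c *\<^sub>R axis 1 1))) (at 0)"
    by (rule has_derivative_compose[of "\<lambda>t. y + t *\<^sub>R axis 1 1" _ 0 UNIV g])
      (use smooth_on_has_derivative[OF g y(1)] in \<open>auto intro!: derivative_eq_intros\<close>)
  then have 1: "((\<lambda>t. g (y + t *\<^sub>R axis 1 1)) has_real_derivative pd 1 g y) (at 0)"
    unfolding has_field_derivative_def
    by (rule has_derivative_eq_rhs) (simp add: linear_cmul[OF l] fun_eq_iff pd_def mult.commute)
  have "((\<lambda>t. g (y + t *\<^sub>R axis 1 1)) has_real_derivative 0) (at 0)"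
  proof (rule has_field_derivative_transform_within_open[of "\<lambda>_. 0" 0 0 "{-r<..<r}"])
    fix t assume "t \<in> {-r<..<r}"
    then have "y + t *\<^sub>R axis 1 1 \<in> V" by (intro subsetD[OF r(2)]) (auto simp: dist_norm norm_axis_1)
    then show "0 = g (y + t *\<^sub>R axis 1 1)" using y 0 by (simp add: axis_def)
  qed (use r in auto)
  with 1 show ?thesis by (rule DERIV_unique)
qed

text \<open>Reflecting the surface across the boundary plane extends it as a minimal surface, so that the
  normal derivative of the curvature vanishes at the boundary.\<close>

lemma pd2_asq_boundary:
  assumes y: "y \<in> V" "y $ 2 = 0"
  shows "pd 2 asq y = 0"
proof -
  have Q0: "Q y = 0" using neumann y by simp
  have H0: "H z = 0" if "z \<in> V" "z $ 2 = 0" for z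
    by (rule boundary_pd1[OF smooth_on_pd[OF smooth_f] neumann that])
  have R2: "pd 2 R y = 0"
    using boundary_pd1[OF smooth_on_pd[OF smooth_on_pd[OF smooth_f]] H0 y] pd1H[OF y(1)] by simp
  have "y \<in> V \<inter> upper" using y by (simp add: upper_def)
  then have "mseD 2 y = 0" using pd_mse_0[of y 2] pd_mse[OF y(1), of 2] by simp
  then have "(1 + P y * P y) * pd 2 T y = 0"
    using Q0 H0[OF y] R2 pd2P[OF y(1)] by (simp add: mseD_def algebra_simps)
  moreover have "1 + P y * P y > 0" by (simp add: add_pos_nonneg)
  ultimately have T2: "pd 2 T y = 0" by simp
  have "pd 2 KK y = 0" using Q0 H0[OF y] pd2P[OF y(1)] by (simp add: pd_KK[OF y(1)])
  then have "pd 2 asq y * KK y = 0"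
    using pd_asq_KK[OF y(1), of 2] H0[OF y] R2 T2 by simp
  then show ?thesis using W_pos[of y] by (simp add: KK_W)
qed

end

section \<open>Integration by parts\<close>

lemma upper_borel [measurable]: "upper \<in> sets borel"
proof -
  have "closed upper" unfolding upper_def by (rule closed_halfspace_component_ge_cart)
  then show ?thesis by (rule borel_closed)
qed

lemma AE_component_2: "AE y :: real^2 in lborel. y $ 2 \<noteq> 0"
proof -
  have "negligible {y :: real^2. y $ 2 = 0}" by (rule negligible_standard_hyperplane_cart)
  moreover have "closed {y :: real^2. y $ 2 = 0}"
    by (rule closed_Collect_eq) (auto intro: continuous_intros)
  ultimately have "{y :: real^2. y $ 2 = 0} \<in> null_sets lborel"
    by (auto simp: negligible_iff_emeasure0 null_sets_def emeasure_completion)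
  then show ?thesis by (auto dest: AE_not_in)
qed

lemma has_real_derivative_pd_line:
  fixes X :: "real^2 \<Rightarrow> real"
  assumes "X differentiable (at (y + t *\<^sub>R axis i 1))"
  shows "((\<lambda>t. X (y + t *\<^sub>R axis i 1)) has_real_derivative pd i X (y + t *\<^sub>R axis i 1)) (at t)"
proof -
  let ?w = "y + t *\<^sub>R axis i 1"
  have d: "(X has_derivative frechet_derivative X (at ?w)) (at ?w)"
    using assms frechet_derivative_works by blast
  then have l: "linear (frechet_derivative X (at ?w))" by (rule has_derivative_linear)
  have "((\<lambda>t. X (y + t *\<^sub>R axis i 1)) has_derivative (\<lambda>c. fd X ?w (c *\<^sub>R axis i 1))) (at t)"
    by (rule has_derivative_compose[of "\<lambda>t. y + t *\<^sub>R axis i 1" _ t UNIV X])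
      (use d in \<open>auto intro!: derivative_eq_intros\<close>)
  then show ?thesis
    unfolding has_field_derivative_def
    by (rule has_derivative_eq_rhs) (simp add: linear_cmul[OF l] fun_eq_iff pd_def mult.commute)
qed

lemma compact_continuous_bound:
  fixes g :: "'a::topological_space \<Rightarrow> real"
  assumes "compact K" "continuous_on K g"
  obtains B where "0 \<le> B" "\<And>y. y \<in> K \<Longrightarrow> \<bar>g y\<bar> \<le> B"
proof -
  have "bounded (g ` K)" using assms by (intro compact_imp_bounded compact_continuous_image)
  then obtain B where "\<forall>x\<in>g ` K. norm x \<le> B" unfolding bounded_iff by blast
  then have "\<bar>g y\<bar> \<le> max 0 B" if "y \<in> K" for y using that by (simp add: le_max_iff_disj)
  then show ?thesis using that[of "max 0 B"] by simp
qed

lemma integrable_compact_support: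
  fixes g :: "real^2 \<Rightarrow> real"
  assumes "g \<in> borel_measurable borel" "\<And>y. \<bar>g y\<bar> \<le> B" "\<And>y. y \<notin> cball c r \<Longrightarrow> g y = 0"
  shows "integrable lborel g"
proof (rule integrableI_bounded_set[where A = "cball c r" and B = B])
  show "emeasure lborel (cball c r) < \<infinity>" by (rule emeasure_lborel_cball_finite)
qed (use assms in auto)

text \<open>By translation invariance the integrals of all difference quotients vanish.\<close>

lemma integral_pd_upper:
  fixes X :: "real^2 \<Rightarrow> real"
  assumes diff: "\<And>y. X differentiable (at y)" and cont: "continuous_on UNIV (pd i X)"
    and supp: "\<And>y. y \<notin> cball c r \<Longrightarrow> X y = 0" and bd: "i = 1 \<or> (\<forall>y. y $ 2 = 0 \<longrightarrow> X y = 0)"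
  shows "integrable lborel (\<lambda>y. indicator upper y * pd i X y)"
    and "(\<integral>y. indicator upper y * pd i X y \<partial>lborel) = 0"
proof -
  define e where "e = (axis i 1 :: real^2)"
  have ne: "norm e = 1" by (simp add: e_def norm_axis_1)
  have pd0: "pd i X y = 0" if "y \<notin> cball c r" for y
  proof -
    have "pd i X y = pd i (\<lambda>_. 0) y"
      by (rule pd_cong[of "- cball c r"]) (use that supp in auto)
    then show ?thesis by (simp add: pd_eqI[OF has_derivative_const])
  qed
  obtain B where B: "0 \<le> B" "\<And>y. \<bar>pd i X y\<bar> \<le> B"
  proof -
    obtain B where B: "0 \<le> B" "\<And>y. y \<in> cball c r \<Longrightarrow> \<bar>pd i X y\<bar> \<le> B"
      using compact_continuous_bound[OF compact_cball continuous_on_subset[OF cont subset_UNIV]] by metis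
    have "\<bar>pd i X y\<bar> \<le> B" for y
      using pd0[of y] B by (cases "y \<in> cball c r") auto
    then show ?thesis using that B(1) by simp
  qed
  have contX: "continuous_on UNIV X"
    using diff by (simp add: continuous_at_imp_continuous_on differentiable_imp_continuous_within)
  obtain B' where B': "\<And>y. \<bar>X y\<bar> \<le> B'"
  proof -
    obtain B where B: "0 \<le> B" "\<And>y. y \<in> cball c r \<Longrightarrow> \<bar>X y\<bar> \<le> B"
      using compact_continuous_bound[OF compact_cball continuous_on_subset[OF contX subset_UNIV]] by metis
    have "\<bar>X y\<bar> \<le> B" for y
      using supp[of y] B by (cases "y \<in> cball c r") auto
    then show ?thesis by (rule that)
  qed
  have bm [measurable]: "X \<in> borel_measurable borel" "pd i X \<in> borel_measurable borel"
    using contX cont by (auto intro: borel_measurable_continuous_onI)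
  define g where "g y = indicator upper y * X y" for y
  have g_m [measurable]: "g \<in> borel_measurable borel" unfolding g_def by measurable
  show "integrable lborel (\<lambda>y. indicator upper y * pd i X y)"
    by (rule integrable_compact_support[where B = B and c = c and r = r])
      (use B pd0 in \<open>auto simp: indicator_def\<close>)
  have "\<bar>g y\<bar> \<le> B'" for y using B'[of y] abs_ge_zero[of "X y"] by (auto simp: g_def indicator_def)
  then have int_g: "integrable lborel g"
    by (rule integrable_compact_support[OF g_m, where c = c and r = r]) (use supp in \<open>auto simp: g_def\<close>)
  have lip: "\<bar>X (y + t *\<^sub>R e) - X (y + s *\<^sub>R e)\<bar> \<le> B * \<bar>t - s\<bar>" for y s t
  proof -
    have "norm (X (y + t *\<^sub>R e) - X (y + s *\<^sub>R e)) \<le> B * norm (t - s)"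
      unfolding e_def
      by (rule field_differentiable_bound[where S = UNIV and f = "\<lambda>t. X (y + t *\<^sub>R axis i 1)" and f' = "\<lambda>t. pd i X (y + t *\<^sub>R axis i 1)"])
        (use has_real_derivative_pd_line[OF diff] B in auto)
    then show ?thesis by simp
  qed
  have lip_g: "\<bar>g (y + t *\<^sub>R e) - g y\<bar> \<le> B * \<bar>t\<bar>" for y t
  proof (cases "y \<in> upper \<longleftrightarrow> y + t *\<^sub>R e \<in> upper")
    case True
    then show ?thesis using lip[of y t 0] B(1) by (auto simp: g_def indicator_def)
  next
    case False
    then have i: "i = 2" using exhaust_2[of i] by (auto simp: upper_def e_def axis_def)
    define s where "s = - (y $ 2)"
    have "X (y + s *\<^sub>R e) = 0" using bd i by (simp add: s_def e_def axis_def)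
    moreover have "\<bar>s\<bar> \<le> \<bar>t\<bar>" "\<bar>t - s\<bar> \<le> \<bar>t\<bar>" using False i by (auto simp: upper_def e_def axis_def s_def)
    moreover have "B * \<bar>s\<bar> \<le> B * \<bar>t\<bar>" "B * \<bar>t - s\<bar> \<le> B * \<bar>t\<bar>"
      using calculation B(1) by (auto intro: mult_left_mono)
    ultimately show ?thesis
      using False lip[of y 0 s] lip[of y t s] by (auto simp: g_def indicator_def)
  qed
  define h where "h n = inverse (real (Suc n))" for n
  have h0: "0 < h n" "h n \<le> 1" for n by (auto simp: h_def field_simps)
  have "h \<longlonglongrightarrow> 0" unfolding h_def by (rule LIMSEQ_inverse_real_of_nat)
  then have h_lim: "filterlim h (at 0) sequentially"
    using h0 by (intro filterlim_atI) (auto simp: less_imp_neq[symmetric])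
  define D where "D n y = (g (y + h n *\<^sub>R e) - g y) / h n" for n y
  have shift: "integrable lborel (\<lambda>y. g (y + h n *\<^sub>R e))" "(\<integral>y. g (y + h n *\<^sub>R e) \<partial>lborel) = (\<integral>y. g y \<partial>lborel)" for n
  proof -
    have d: "distr lborel borel (\<lambda>y. y + h n *\<^sub>R e) = lborel"
    proof -
      have "(\<lambda>y. y + h n *\<^sub>R e) = (+) (h n *\<^sub>R e)" by (simp add: fun_eq_iff add.commute)
      then show ?thesis using lborel_distr_plus[of "h n *\<^sub>R e"] by simp
    qed
    show "integrable lborel (\<lambda>y. g (y + h n *\<^sub>R e))"
      using int_g integrable_distr_eq[of "\<lambda>y. y + h n *\<^sub>R e" lborel borel g] by (simp add: d)
    show "(\<integral>y. g (y + h n *\<^sub>R e) \<partial>lborel) = (\<integral>y. g y \<partial>lborel)"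
      using integral_distr[of "\<lambda>y. y + h n *\<^sub>R e" lborel borel g] by (simp add: d)
  qed
  have D0: "(\<integral>y. D n y \<partial>lborel) = 0" for n
    unfolding D_def using shift int_g by simp
  have "(\<lambda>n. \<integral>y. D n y \<partial>lborel) \<longlonglongrightarrow> (\<integral>y. indicator upper y * pd i X y \<partial>lborel)"
  proof (rule integral_dominated_convergence[where w = "\<lambda>y. B * indicator (cball c (r + 1)) y"])
    show "integrable lborel (\<lambda>y. B * indicator (cball c (r + 1)) y)"
      by (rule integrable_compact_support[where B = B and c = c and r = "r + 1"]) (use B in \<open>auto simp: indicator_def\<close>)
    show "AE y in lborel. (\<lambda>n. D n y) \<longlonglongrightarrow> indicator upper y * pd i X y"
      using AE_component_2
    proof eventually_elim
      case (elim y)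
      have "((\<lambda>t. g (y + t *\<^sub>R e)) has_real_derivative indicator upper y * pd i X y) (at 0)"
      proof (rule has_field_derivative_transform_within_open[of "\<lambda>t. indicator upper y * X (y + t *\<^sub>R e)" _ 0 "{- \<bar>y $ 2\<bar> <..< \<bar>y $ 2\<bar>}"])
        show "((\<lambda>t. indicator upper y * X (y + t *\<^sub>R e)) has_real_derivative indicator upper y * pd i X y) (at 0)"
          using has_real_derivative_pd_line[OF diff, where y = y and t = 0 and i = i]
          unfolding e_def by (intro DERIV_cmult) simp
        fix t assume "t \<in> {- \<bar>y $ 2\<bar> <..< \<bar>y $ 2\<bar>}"
        then have "y \<in> upper \<longleftrightarrow> y + t *\<^sub>R e \<in> upper" by (auto simp: upper_def e_def axis_def)
        then show "indicator upper y * X (y + t *\<^sub>R e) = g (y + t *\<^sub>R e)" by (simp add: g_def indicator_def)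
      qed (use elim in auto)
      then have "(\<lambda>t. (g (y + (0 + t) *\<^sub>R e) - g (y + 0 *\<^sub>R e)) / t) \<midarrow>0\<rightarrow> indicator upper y * pd i X y"
        by (simp add: DERIV_def)
      from filterlim_compose[OF this h_lim] show ?case by (simp add: D_def)
    qed
    show "AE y in lborel. norm (D n y) \<le> B * indicator (cball c (r + 1)) y" for n
    proof (rule AE_I2)
      fix y :: "real^2"
      show "norm (D n y) \<le> B * indicator (cball c (r + 1)) y"
      proof (cases "y \<in> cball c (r + 1)")
        case True
        then show ?thesis using lip_g[of y "h n"] h0[of n] by (simp add: D_def field_simps)
      next
        case False
        then have "r + 1 < dist c y" by simp
        moreover have "dist c y \<le> dist c (y + h n *\<^sub>R e) + h n"
          using dist_triangle[of c y "y + h n *\<^sub>R e"] ne h0[of n] by (simp add: dist_norm)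
        ultimately have "y + h n *\<^sub>R e \<notin> cball c r" "y \<notin> cball c r" using h0[of n] by auto
        then show ?thesis using supp False by (simp add: D_def g_def)
      qed
    qed
  qed (auto simp: D_def)
  then show "(\<integral>y. indicator upper y * pd i X y \<partial>lborel) = 0"
    by (simp add: D0 LIMSEQ_const_iff)
qed

lemma integral_pd_upper_extend:
  fixes X :: "real^2 \<Rightarrow> real"
  assumes V: "open V" and X: "smooth_on V X" and sub: "cball c r \<subseteq> V" and supp: "\<And>y. y \<in> V \<Longrightarrow> y \<notin> cball c r \<Longrightarrow> X y = 0"
    and bd: "i = 1 \<or> (\<forall>y\<in>V. y $ 2 = 0 \<longrightarrow> X y = 0)"
  shows "integrable lborel (\<lambda>y. indicator (V \<inter> upper) y * pd i X y)"
    and "(\<integral>y. indicator (V \<inter> upper) y * pd i X y \<partial>lborel) = 0"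
proof -
  define Z where "Z y = (if y \<in> V then X y else 0)" for y
  have Z0: "Z y = 0" if "y \<notin> cball c r" for y using that supp by (simp add: Z_def)
  have dV: "Z differentiable (at y)" "pd i Z y = pd i X y" if "y \<in> V" for y
    using frechet_derivative_cong_open[OF V that, of Z X] smooth_on_differentiable[OF X that]
    by (simp_all add: Z_def pd_def)
  have dO: "Z differentiable (at y)" "pd i Z y = 0" if "y \<in> - cball c r" for y
  proof -
    have o: "open (- cball c r)" by auto
    show "Z differentiable (at y)" "pd i Z y = 0"
      using frechet_derivative_cong_open[OF o that, of Z "\<lambda>_. 0"] Z0 by (simp_all add: pd_def)
  qed
  have cov: "V \<union> - cball c r = UNIV" using sub by auto
  have "continuous_on (V \<union> - cball c r) (pd i Z)"
  proof (rule continuous_on_open_Un[OF V])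
    show "continuous_on V (pd i Z)"
      using smooth_on_continuous_on[OF smooth_on_pd[OF X]] dV by (simp cong: continuous_on_cong)
    show "continuous_on (- cball c r) (pd i Z)"
      by (rule continuous_on_eq[OF continuous_on_const[of _ 0]]) (use dO(2) in simp)
  qed auto
  then have cont: "continuous_on UNIV (pd i Z)" by (simp add: cov)
  have eq: "indicator (V \<inter> upper) y * pd i X y = indicator upper y * pd i Z y" for y
    using dV(2)[of y] dO(2)[of y] subsetD[OF sub, of y] by (cases "y \<in> V") (auto simp: indicator_def)
  have "Z differentiable (at y)" for y using dV dO cov by blast
  moreover have "i = 1 \<or> (\<forall>y. y $ 2 = 0 \<longrightarrow> Z y = 0)" using bd by (auto simp: Z_def)
  ultimately show "integrable lborel (\<lambda>y. indicator (V \<inter> upper) y * pd i X y)"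
    and "(\<integral>y. indicator (V \<inter> upper) y * pd i X y \<partial>lborel) = 0"
    unfolding eq using integral_pd_upper[OF _ cont, of c r] Z0 by auto
qed

context graph_map
begin

lemma
  fixes k :: "real^3 \<Rightarrow> real"
  assumes D: "D = V \<inter> upper" and GS: "G ` D \<subseteq> S" and cont: "continuous_on D (\<lambda>y. k (G y))"
    and zero: "\<And>x. x \<in> S \<Longrightarrow> x \<notin> G ` D \<Longrightarrow> k x = 0"
  shows set_integral_graph: "(LINT x:S|hausdorff2. k x) = hausdorff2_const * (\<integral>y. indicator D y * (W y * k (G y)) \<partial>lborel)"
    and set_integrable_graph: "set_integrable hausdorff2 S k \<longleftrightarrow> integrable lborel (\<lambda>y. indicator D y * (W y * k (G y)))"
proof -
  have Db: "D \<in> sets borel" "D \<subseteq> V" using D open_V by auto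
  note [measurable] = Db(1) borel_G0 borel_W0 borel_pr borel_G_image[OF Db]
  define kk where "kk y = indicator D y *\<^sub>R k (G y)" for y
  have kk [measurable]: "kk \<in> borel_measurable borel"
    unfolding kk_def by (rule borel_measurable_continuous_on_indicator[OF Db(1) cont])
  define \<kappa> where "\<kappa> x = indicator (G ` D) x * kk (pr x)" for x
  have \<kappa> [measurable]: "\<kappa> \<in> borel_measurable borel" unfolding \<kappa>_def by measurable
  have \<kappa>S: "indicator S x *\<^sub>R k x = indicator (G ` D) x *\<^sub>R \<kappa> x" for x
    using zero[of x] GS by (cases "x \<in> G ` D") (auto simp: \<kappa>_def kk_def indicator_def)
  let ?M = "density hausdorff2 (\<lambda>x. ennreal (indicator (G ` D) x))"
  have "(\<lambda>y. ennreal (hausdorff2_const * W0 y) * indicator D y) = (\<lambda>y. ennreal (hausdorff2_const * W0 y * indicator D y))"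
    by (auto simp: fun_eq_iff indicator_def)
  then have M: "?M = distr (density lborel (\<lambda>y. ennreal (hausdorff2_const * W0 y * indicator D y))) borel G0"
    using hausdorff2_graph_eq_distr[OF Db] by (simp add: ennreal_indicator)
  have w0: "0 \<le> hausdorff2_const * W0 y * indicator D y" for y
    using hausdorff2_const_pos W_pos[of y] by (simp add: W0_def)
  have w: "(hausdorff2_const * W0 y * indicator D y) *\<^sub>R \<kappa> (G0 y) = hausdorff2_const * (indicator D y * (W y * k (G y)))" for y
    using Db(2) by (auto simp: W0_def G0_def \<kappa>_def kk_def indicator_def)
  have "(LINT x:S|hausdorff2. k x) = (\<integral>x. \<kappa> x \<partial>?M)"
    unfolding set_lebesgue_integral_def \<kappa>S by (subst integral_density) auto
  also have "\<dots> = (\<integral>y. (hausdorff2_const * W0 y * indicator D y) *\<^sub>R \<kappa> (G0 y) \<partial>lborel)"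
    unfolding M using w0 by (subst integral_distr, simp, simp, subst integral_density) auto
  finally show "(LINT x:S|hausdorff2. k x) = hausdorff2_const * (\<integral>y. indicator D y * (W y * k (G y)) \<partial>lborel)"
    unfolding w by simp
  have "set_integrable hausdorff2 S k \<longleftrightarrow> integrable ?M \<kappa>"
    unfolding set_integrable_def \<kappa>S by (subst integrable_density) auto
  also have "\<dots> \<longleftrightarrow> integrable lborel (\<lambda>y. (hausdorff2_const * W0 y * indicator D y) *\<^sub>R \<kappa> (G0 y))"
    unfolding M using w0 by (subst integrable_distr_eq, simp, simp, subst integrable_density) auto
  finally show "set_integrable hausdorff2 S k \<longleftrightarrow> integrable lborel (\<lambda>y. indicator D y * (W y * k (G y)))"
    unfolding w using hausdorff2_const_pos by simp
qed

lemma graph_compact_finite: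
  assumes "cball c r \<subseteq> V"
  shows "emeasure hausdorff2 (G ` cball c r) < \<infinity>"
proof -
  obtain B where B: "\<And>y. y \<in> cball c r \<Longrightarrow> \<bar>W y\<bar> \<le> B"
    using compact_continuous_bound[OF compact_cball continuous_on_subset[OF smooth_on_continuous_on[OF smooth_W] assms]] by metis
  have "emeasure hausdorff2 (G ` cball c r) = area (cball c r)" by (rule area_formula) (use assms in auto)
  also have "\<dots> \<le> (\<integral>\<^sup>+y. ennreal (hausdorff2_const * B) * indicator (cball c r) y \<partial>lborel)"
    unfolding area_def
  proof (rule nn_integral_mono)
    fix y
    show "ennreal (hausdorff2_const * W0 y) * indicator (cball c r) y \<le> ennreal (hausdorff2_const * B) * indicator (cball c r) y"
    proof (cases "y \<in> cball c r")
      case True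
      then have "W0 y \<le> B" using B[OF True] assms by (auto simp: W0_def)
      then show ?thesis using hausdorff2_const_pos True by (simp add: ennreal_leI)
    qed simp
  qed
  also have "\<dots> = ennreal (hausdorff2_const * B) * emeasure lborel (cball c r)"
    by (simp add: nn_integral_cmult_indicator)
  also have "\<dots> < \<infinity>"
    using emeasure_lborel_cball_finite[of c r] by (simp add: ennreal_mult_less_top)
  finally show ?thesis .
qed

end

definition regF :: "(real^3) set \<Rightarrow> real \<Rightarrow> real^3 \<Rightarrow> real" where
  "regF S e x = sqrt (norm_A_sq S x + e)"

text \<open>For \<open>\<eta> = \<phi>\<^sup>2\<close> this is \<open>\<phi>\<^sup>2 |grad F|\<^sup>2 + (|grad (\<phi> F)|\<^sup>2 - |A|\<^sup>2 (\<phi> F)\<^sup>2) - F\<^sup>2 |grad \<phi>|\<^sup>2\<close>.  Unlike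
  the second variation it is linear in \<open>\<eta>\<close>, so that it can be localized.\<close>

definition Jint :: "(real^3) set \<Rightarrow> real \<Rightarrow> (real^3 \<Rightarrow> real) \<Rightarrow> real^3 \<Rightarrow> real" where
  "Jint S e \<eta> x = 2 * \<eta> x * (norm (surface_gradient S (regF S e) x))\<^sup>2
     + regF S e x * fd \<eta> x (surface_gradient S (regF S e) x) - norm_A_sq S x * \<eta> x * (regF S e x)\<^sup>2"

locale eps_patch = free_boundary_patch +
  fixes e :: real and y0 :: "real^2"
  assumes e: "0 < e" and asq_e: "\<And>y. y \<in> V \<Longrightarrow> 0 < asq y + e" and y0: "y0 \<in> V \<inter> upper"
begin

definition Fc :: "real^2 \<Rightarrow> real" where "Fc y = sqrt (asq y + e)"

lemma Fc_pos: "y \<in> V \<Longrightarrow> 0 < Fc y" using asq_e by (simp add: Fc_def)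

lemma Fc_sq: "y \<in> V \<Longrightarrow> Fc y * Fc y = asq y + e" using asq_e[of y] by (simp add: Fc_def)

lemma smooth_Fc: "smooth_on V Fc"
  unfolding Fc_def[abs_def] using asq_e open_V smooth_asq by (intro smooth_intros) auto

lemma pd_Fc: "y \<in> V \<Longrightarrow> 2 * (Fc y * pd i Fc y) = pd i asq y"
proof -
  assume y: "y \<in> V"
  have "pd i (\<lambda>y. Fc y * Fc y) y = pd i (\<lambda>y. asq y + e) y" by (rule pd_cong[OF open_V y Fc_sq])
  then show ?thesis using y by (simp add: pd_rules sm smooth_Fc)
qed

lemma pd_pd_Fc: "y \<in> V \<Longrightarrow> 2 * (pd j Fc y * pd i Fc y + Fc y * pd j (pd i Fc) y) = pd j (pd i asq) y"
proof -
  assume y: "y \<in> V"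
  have "pd j (\<lambda>y. 2 * (Fc y * pd i Fc y)) y = pd j (pd i asq) y" by (rule pd_cong[OF open_V y pd_Fc])
  then show ?thesis using y by (simp add: pd_rules sm smooth_Fc algebra_simps)
qed

lemma regF_G: "y \<in> V \<inter> upper \<Longrightarrow> regF S e (G y) = Fc y"
  by (simp add: regF_def Fc_def norm_A_sq_G)

abbreviation "gF y \<equiv> ginner y (pd 1 Fc y) (pd 2 Fc y) (pd 1 Fc y) (pd 2 Fc y)"

lemma gF_nonneg: "y \<in> V \<Longrightarrow> 0 \<le> gF y"
  using gradv_gradv[of y "pd 1 Fc y" "pd 2 Fc y" "pd 1 Fc y" "pd 2 Fc y"] inner_ge_zero by metis

text \<open>This says that \<open>ln F\<close> has Laplacian at least \<open>- |A|\<^sup>2\<close>.\<close>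

lemma Fc_subsolution:
  assumes y: "y \<in> V" "0 < y $ 2"
  shows "gF y \<le> Fc y * lapl Fc y + asq y * (Fc y)\<^sup>2"
proof -
  have a: "asq y * lapl asq y = ginner y (pd 1 asq y) (pd 2 asq y) (pd 1 asq y) (pd 2 asq y) - 2 * asq y ^ 3"
    "- 2 * (asq y)\<^sup>2 \<le> lapl asq y" "0 \<le> asq y" using simons[OF y] by auto
  have g: "ginner y (pd 1 asq y) (pd 2 asq y) (pd 1 asq y) (pd 2 asq y) = 4 * (asq y + e) * gF y"
    unfolding pd_Fc[OF y(1), symmetric] Fc_sq[OF y(1), symmetric]
    by (simp add: ginner_def algebra_simps)
  have L: "lapl asq y = 2 * gF y + 2 * (Fc y * lapl Fc y)"
    unfolding lapl_def ginner_def pd_pd_Fc[OF y(1), symmetric]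
    by (simp add: add_divide_distrib[symmetric]) (simp add: algebra_simps power2_eq_square)
  have F2: "(Fc y)\<^sup>2 = asq y + e" using Fc_sq[OF y(1)] by (simp add: power2_eq_square)
  have "0 \<le> lapl asq y - 4 * gF y + 2 * asq y * (asq y + e)"
  proof (cases "asq y = 0")
    case True
    then have "gF y = 0" using a(1) g e by simp
    then show ?thesis using a(2) True by simp
  next
    case False
    have "asq y * (lapl asq y - 4 * gF y + 2 * asq y * (asq y + e)) = 4 * e * gF y + 2 * e * (asq y)\<^sup>2"
      using a(1) unfolding g by (simp add: power2_eq_square power3_eq_cube algebra_simps)
    also have "0 \<le> \<dots>" using e gF_nonneg[OF y(1)] by simp
    finally show ?thesis using False a(3) by (simp add: zero_le_mult_iff)
  qed
  then show ?thesis using L F2 by (simp add: algebra_simps)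
qed

definition al :: "real^2 \<Rightarrow> real" where "al y = (1 + P y * P y) / W y"
definition be :: "real^2 \<Rightarrow> real" where "be y = (P y * Q y) / W y"
definition ga :: "real^2 \<Rightarrow> real" where "ga y = (1 + Q y * Q y) / W y"

lemma smooth_coeffs: "smooth_on V al" "smooth_on V be" "smooth_on V ga"
  unfolding al_def[abs_def] be_def[abs_def] ga_def[abs_def] using open_V smooth_W W_pos
  by (auto intro!: smooth_on_divide smooth_on_add smooth_on_mult smooth_on_const smooth_on_pd smooth_f simp: less_imp_neq[symmetric])

lemma W_ginner: "W y * ginner y U1 U2 V1 V2 = ga y * U1 * V1 - be y * (U1 * V2 + U2 * V1) + al y * U2 * V2"
proof -
  have "W y * (x / (W y)\<^sup>2) = x / W y" for x using W_pos[of y] by (simp add: power2_eq_square)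
  then show ?thesis unfolding ginner_def
    by (simp add: ga_def be_def al_def power2_eq_square add_divide_distrib[symmetric] diff_divide_distrib[symmetric])
qed

lemma W_lapl: "W y * lapl U y = ga y * pd 1 (pd 1 U) y - be y * (pd 1 (pd 2 U) y + pd 2 (pd 1 U) y) + al y * pd 2 (pd 2 U) y"
proof -
  have "W y * (x / (W y)\<^sup>2) = x / W y" for x using W_pos[of y] by (simp add: power2_eq_square)
  then show ?thesis unfolding lapl_def
    by (simp add: ga_def be_def al_def power2_eq_square add_divide_distrib[symmetric] diff_divide_distrib[symmetric])
qed

text \<open>On a minimal surface the coordinate functions are harmonic.\<close>

lemma coeffs_divergence:
  assumes y: "y \<in> V \<inter> upper"
  shows "pd 1 ga y = pd 2 be y" "pd 2 al y = pd 1 be y"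
proof -
  have yV: "y \<in> V" using y by simp
  have Wn: "W z \<noteq> 0" for z using W_pos[of z] by simp
  have W_i: "W y * pd i W y = P y * pd i P y + Q y * pd i Q y" for i
  proof -
    have "pd i (\<lambda>y. W y * W y) y = pd i (\<lambda>y. 1 + (P y * P y + Q y * Q y)) y" by (simp add: W_mult)
    then show ?thesis using yV by (simp add: pd_rules sm smooth_W)
  qed
  have ga_i: "pd i ga y * W y + ga y * pd i W y = 2 * (Q y * pd i Q y)" for i
  proof -
    have "pd i (\<lambda>y. ga y * W y) y = pd i (\<lambda>y. 1 + Q y * Q y) y" using Wn by (simp add: ga_def)
    then show ?thesis using yV by (simp add: pd_rules sm smooth_W smooth_coeffs)
  qed
  have al_i: "pd i al y * W y + al y * pd i W y = 2 * (P y * pd i P y)" for i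
  proof -
    have "pd i (\<lambda>y. al y * W y) y = pd i (\<lambda>y. 1 + P y * P y) y" using Wn by (simp add: al_def)
    then show ?thesis using yV by (simp add: pd_rules sm smooth_W smooth_coeffs)
  qed
  have be_i: "pd i be y * W y + be y * pd i W y = pd i P y * Q y + P y * pd i Q y" for i
  proof -
    have "pd i (\<lambda>y. be y * W y) y = pd i (\<lambda>y. P y * Q y) y" using Wn by (simp add: be_def)
    then show ?thesis using yV by (simp add: pd_rules sm smooth_W smooth_coeffs)
  qed
  have gaW: "ga y * W y = 1 + Q y * Q y" "al y * W y = 1 + P y * P y" "be y * W y = P y * Q y"
    using Wn by (simp_all add: ga_def al_def be_def)
  have m: "(1 + Q y * Q y) * R y - 2 * (P y * Q y * H y) + (1 + P y * P y) * T y = 0"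
    using mse_0[OF y] by (simp add: mse_def power2_eq_square)
  have "(pd 1 ga y - pd 2 be y) * W y * (W y * W y)
      = (2 * (Q y * H y) - (H y * Q y + P y * T y)) * (W y * W y)
        - (ga y * W y) * (W y * pd 1 W y) + (be y * W y) * (W y * pd 2 W y)"
  proof -
    have "(pd 1 ga y - pd 2 be y) * W y = 2 * (Q y * H y) - (H y * Q y + P y * T y) - ga y * pd 1 W y + be y * pd 2 W y"
      using ga_i[of 1] be_i[of 2] pd2P[OF yV] by (simp add: algebra_simps)
    from arg_cong[OF this, of "\<lambda>x. x * (W y * W y)"] show ?thesis by (simp add: algebra_simps)
  qed
  also have "\<dots> = - P y * ((1 + Q y * Q y) * R y - 2 * (P y * Q y * H y) + (1 + P y * P y) * T y)"
    unfolding gaW W_i W_mult pd2P[OF yV] by (simp add: algebra_simps)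
  finally show "pd 1 ga y = pd 2 be y" using Wn[of y] m by simp
  have "(pd 2 al y - pd 1 be y) * W y * (W y * W y)
      = (2 * (P y * H y) - (R y * Q y + P y * H y)) * (W y * W y)
        - (al y * W y) * (W y * pd 2 W y) + (be y * W y) * (W y * pd 1 W y)"
  proof -
    have "(pd 2 al y - pd 1 be y) * W y = 2 * (P y * H y) - (R y * Q y + P y * H y) - al y * pd 2 W y + be y * pd 1 W y"
      using al_i[of 2] be_i[of 1] pd2P[OF yV] by (simp add: algebra_simps)
    from arg_cong[OF this, of "\<lambda>x. x * (W y * W y)"] show ?thesis by (simp add: algebra_simps)
  qed
  also have "\<dots> = - Q y * ((1 + Q y * Q y) * R y - 2 * (P y * Q y * H y) + (1 + P y * P y) * T y)"
    unfolding gaW W_i W_mult pd2P[OF yV] by (simp add: algebra_simps)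
  finally show "pd 2 al y = pd 1 be y" using Wn[of y] m by simp
qed

lemma pd2_Fc_boundary: "y \<in> V \<Longrightarrow> y $ 2 = 0 \<Longrightarrow> pd 2 Fc y = 0"
  using pd_Fc[of y 2] pd2_asq_boundary[of y] Fc_pos[of y] by simp

lemma gradF_G:
  assumes y: "y \<in> V \<inter> upper"
  shows "surface_gradient S (regF S e) (G y) = gradv y (pd 1 Fc y) (pd 2 Fc y)"
  using y by (intro surface_gradient_G(2) regF_G smooth_on_differentiable[OF smooth_Fc]) auto

lemma fd_gradv:
  assumes h: "smooth_on UNIV h" and y: "y \<in> V"
  shows "fd h (G y) (gradv y U1 U2) = ginner y U1 U2 (pd 1 (\<lambda>y. h (G y)) y) (pd 2 (\<lambda>y. h (G y)) y)"
proof -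
  have l: "linear (frechet_derivative h (at (G y)))"
    using smooth_on_has_derivative[OF h] has_derivative_linear by blast
  have c: "fd h (G y) (pd i G y) = pd i (\<lambda>y. h (G y)) y" for i
    unfolding pd_def by (rule fd_compose[OF smooth_G h y, symmetric]) simp
  show ?thesis
    unfolding gradv_def
    by (simp add: linear_add[OF l] linear_scale[OF l] c ginner_def add_divide_distrib[symmetric]) (simp add: algebra_simps)
qed

lemma Jint_G:
  assumes h: "smooth_on UNIV \<eta>" and y: "y \<in> V \<inter> upper"
  shows "Jint S e \<eta> (G y) = 2 * \<eta> (G y) * gF y
    + Fc y * ginner y (pd 1 Fc y) (pd 2 Fc y) (pd 1 (\<lambda>y. \<eta> (G y)) y) (pd 2 (\<lambda>y. \<eta> (G y)) y) - asq y * \<eta> (G y) * (Fc y)\<^sup>2"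
  using y fd_gradv[OF h, of y]
  by (simp add: Jint_def gradF_G regF_G norm_A_sq_G power2_norm_eq_inner gradv_gradv)

lemma continuous_J:
  assumes h: "smooth_on UNIV \<eta>"
  shows "continuous_on (V \<inter> upper) (\<lambda>y. Jint S e \<eta> (G y))"
proof -
  have sh: "smooth_on V (\<lambda>y. \<eta> (G y))" by (rule smooth_on_compose[OF open_V _ h smooth_G]) auto
  have "continuous_on V (\<lambda>y. 2 * \<eta> (G y) * gF y
    + Fc y * ginner y (pd 1 Fc y) (pd 2 Fc y) (pd 1 (\<lambda>y. \<eta> (G y)) y) (pd 2 (\<lambda>y. \<eta> (G y)) y) - asq y * \<eta> (G y) * (Fc y)\<^sup>2)"
  proof -
    note c = smooth_on_continuous_on
    have "W y \<noteq> 0" for y using W_pos[of y] by simp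
    then show ?thesis
      unfolding ginner_def
      by (intro continuous_intros c[OF sh] c[OF smooth_Fc] c[OF smooth_asq] c[OF smooth_W] c[OF smooth_on_pd[OF smooth_Fc]]
          c[OF smooth_on_pd[OF smooth_f]] c[OF smooth_on_pd[OF sh]]) auto
  qed
  then show ?thesis
    by (rule continuous_on_eq[OF continuous_on_subset[OF _ Int_lower1]]) (rule Jint_G[OF h, symmetric])
qed

lemma local_inequality:
  assumes h: "smooth_on UNIV \<eta>" "\<And>x. 0 \<le> \<eta> x" "\<And>x. x \<notin> ball (G y0) \<rho> \<Longrightarrow> \<eta> x = 0"
    and \<rho>: "cball y0 \<rho> \<subseteq> V" "S \<inter> ball (G y0) \<rho> \<subseteq> G ` (V \<inter> upper)"
  shows "(LINT x:S|hausdorff2. Jint S e \<eta> x) \<le> 0"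
proof -
  define h where "h y = \<eta> (G y)" for y
  have sh: "smooth_on V h" unfolding h_def by (rule smooth_on_compose[OF open_V _ h(1) smooth_G]) auto
  have h0: "h y = 0" if "y \<notin> cball y0 \<rho>" for y
  proof -
    have "dist y y0 \<le> dist (G y) (G y0)" unfolding dist_G by (simp add: dist_norm norm_Pair)
    then have "G y \<notin> ball (G y0) \<rho>" using that by (auto simp: dist_commute)
    then show ?thesis using h(3) by (simp add: h_def)
  qed
  define X1 where "X1 y = h y * Fc y * (ga y * pd 1 Fc y - be y * pd 2 Fc y)" for y
  define X2 where "X2 y = h y * Fc y * (al y * pd 2 Fc y - be y * pd 1 Fc y)" for y
  have sX: "smooth_on V X1" "smooth_on V X2"
    unfolding X1_def X2_def by (intro sm sh smooth_Fc smooth_coeffs)+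
  have X0: "X1 y = 0" "X2 y = 0" if "y \<notin> cball y0 \<rho>" for y using h0[OF that] by (simp_all add: X1_def X2_def)
  have X2b: "X2 y = 0" if "y \<in> V" "y $ 2 = 0" for y
    using pd2_Fc_boundary[OF that] neumann[OF that] by (simp add: X2_def be_def)
  note I1 = integral_pd_upper_extend[OF open_V sX(1) \<rho>(1), of 1]
  note I2 = integral_pd_upper_extend[OF open_V sX(2) \<rho>(1), of 2]
  let ?D = "V \<inter> upper"
  have int1: "integrable lborel (\<lambda>y. indicator ?D y * pd 1 X1 y)" "(\<integral>y. indicator ?D y * pd 1 X1 y \<partial>lborel) = 0"
    using I1 X0 by auto
  have int2: "integrable lborel (\<lambda>y. indicator ?D y * pd 2 X2 y)" "(\<integral>y. indicator ?D y * pd 2 X2 y \<partial>lborel) = 0"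
    using I2 X0 X2b by auto
  have div: "pd 1 X1 y + pd 2 X2 y = W y * (Fc y * ginner y (pd 1 Fc y) (pd 2 Fc y) (pd 1 h y) (pd 2 h y)
      + h y * gF y + h y * (Fc y * lapl Fc y))" if y: "y \<in> ?D" for y
  proof -
    have yV: "y \<in> V" using y by simp
    have 1: "pd 1 X1 y = (pd 1 h y * Fc y + h y * pd 1 Fc y) * (ga y * pd 1 Fc y - be y * pd 2 Fc y)
        + h y * Fc y * (pd 1 ga y * pd 1 Fc y + ga y * pd 1 (pd 1 Fc) y - (pd 1 be y * pd 2 Fc y + be y * pd 1 (pd 2 Fc) y))"
      unfolding X1_def[abs_def] using yV by (simp add: pd_rules sm sh smooth_Fc smooth_coeffs)
    have 2: "pd 2 X2 y = (pd 2 h y * Fc y + h y * pd 2 Fc y) * (al y * pd 2 Fc y - be y * pd 1 Fc y)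
        + h y * Fc y * (pd 2 al y * pd 2 Fc y + al y * pd 2 (pd 2 Fc) y - (pd 2 be y * pd 1 Fc y + be y * pd 2 (pd 1 Fc) y))"
      unfolding X2_def[abs_def] using yV by (simp add: pd_rules sm sh smooth_Fc smooth_coeffs)
    have "W y * (Fc y * ginner y (pd 1 Fc y) (pd 2 Fc y) (pd 1 h y) (pd 2 h y) + h y * gF y + h y * (Fc y * lapl Fc y))
      = Fc y * (W y * ginner y (pd 1 Fc y) (pd 2 Fc y) (pd 1 h y) (pd 2 h y)) + h y * (W y * gF y) + h y * Fc y * (W y * lapl Fc y)"
      by (simp add: algebra_simps)
    then show ?thesis
      unfolding 1 2 W_ginner W_lapl coeffs_divergence[OF y] by (simp add: algebra_simps)
  qed
  have supp: "Jint S e \<eta> x = 0" if "x \<in> S" "x \<notin> G ` ?D" for x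
  proof -
    have x: "x \<notin> ball (G y0) \<rho>" using that \<rho>(2) by blast
    have "\<eta> x = 0" using h(3) x by simp
    moreover have "frechet_derivative \<eta> (at x) = (\<lambda>_. 0)"
    proof -
      have "(\<eta> has_derivative (\<lambda>_. 0)) (at x)"
      proof -
        have d: "(\<eta> has_derivative frechet_derivative \<eta> (at x)) (at x)" by (rule smooth_on_has_derivative[OF h(1)]) simp
        have "frechet_derivative \<eta> (at x) = (\<lambda>v. 0)"
          by (rule differential_zero_maxmin[OF UNIV_I open_UNIV d]) (use h(2) \<open>\<eta> x = 0\<close> in auto)
        then show ?thesis using d by simp
      qed
      then show ?thesis by (simp add: frechet_derivative_at[symmetric])
    qed
    ultimately show ?thesis by (simp add: Jint_def)
  qed
  have GS: "G ` ?D \<subseteq> S" using G_in_S by blast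
  have "(LINT x:S|hausdorff2. Jint S e \<eta> x) = hausdorff2_const * (\<integral>y. indicator ?D y * (W y * Jint S e \<eta> (G y)) \<partial>lborel)"
    by (rule set_integral_graph[OF refl GS continuous_J[OF h(1)] supp])
  moreover have "(\<integral>y. indicator ?D y * (W y * Jint S e \<eta> (G y)) \<partial>lborel)
      \<le> (\<integral>y. indicator ?D y * pd 1 X1 y + indicator ?D y * pd 2 X2 y \<partial>lborel)"
  proof (rule integral_mono_AE)
    show "integrable lborel (\<lambda>y. indicator ?D y * pd 1 X1 y + indicator ?D y * pd 2 X2 y)"
      using int1 int2 by auto
    have Db: "?D \<in> sets borel" using open_V by auto
    show "integrable lborel (\<lambda>y. indicator ?D y * (W y * Jint S e \<eta> (G y)))"
    proof -
      have c: "continuous_on ?D (\<lambda>y. W y * Jint S e \<eta> (G y))"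
        using continuous_J[OF h(1)] smooth_on_continuous_on[OF smooth_W]
        by (intro continuous_intros) (auto intro: continuous_on_subset)
      have "closed upper" unfolding upper_def by (rule closed_halfspace_component_ge_cart)
      then have "compact (cball y0 \<rho> \<inter> upper)" by (intro compact_Int_closed) auto
      moreover have "cball y0 \<rho> \<inter> upper \<subseteq> ?D" using \<rho> by auto
      ultimately obtain B where B: "\<And>y. y \<in> cball y0 \<rho> \<inter> upper \<Longrightarrow> \<bar>W y * Jint S e \<eta> (G y)\<bar> \<le> B"
        using compact_continuous_bound[OF _ continuous_on_subset[OF c]] by metis
      have z: "Jint S e \<eta> (G y) = 0" if "y \<in> ?D" "y \<notin> cball y0 \<rho>" for y
      proof -
        have yV: "y \<in> V" using that by simp
        have "pd i h y = pd i (\<lambda>_. 0) y" for i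
          by (rule pd_cong[of "- cball y0 \<rho>"]) (use that h0 in auto)
        then have "pd i h y = 0" for i using pd_const[OF yV] by simp
        moreover have "(\<lambda>y. \<eta> (G y)) = h" by (simp add: h_def fun_eq_iff)
        ultimately show ?thesis using h0[OF that(2)] Jint_G[OF h(1) that(1)] by (simp add: h_def ginner_def)
      qed
      show ?thesis
      proof (rule integrable_compact_support[where B = "max 0 B" and c = y0 and r = \<rho>])
        show "(\<lambda>y. indicator ?D y * (W y * Jint S e \<eta> (G y))) \<in> borel_measurable borel"
          using borel_measurable_continuous_on_indicator[OF Db c] by simp
        show "\<bar>indicator ?D y * (W y * Jint S e \<eta> (G y))\<bar> \<le> max 0 B" for y
          using B[of y] z[of y] by (cases "y \<in> cball y0 \<rho>") (auto simp: indicator_def le_max_iff_disj)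
        show "indicator ?D y * (W y * Jint S e \<eta> (G y)) = 0" if "y \<notin> cball y0 \<rho>" for y
          using z[OF _ that] by (auto simp: indicator_def)
      qed
    qed
    show "AE y in lborel. indicator ?D y * (W y * Jint S e \<eta> (G y)) \<le> indicator ?D y * pd 1 X1 y + indicator ?D y * pd 2 X2 y"
      using AE_component_2
    proof eventually_elim
      case (elim y)
      show ?case
      proof (cases "y \<in> ?D")
        case True
        then have y: "y \<in> V" "0 < y $ 2" using elim by (auto simp: upper_def less_le)
        have "h y * gF y \<le> h y * (Fc y * lapl Fc y + asq y * (Fc y)\<^sup>2)"
          using Fc_subsolution[OF y] h(2) by (intro mult_left_mono) (auto simp: h_def)
        then have "Jint S e \<eta> (G y) \<le> Fc y * ginner y (pd 1 Fc y) (pd 2 Fc y) (pd 1 h y) (pd 2 h y)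
      + h y * gF y + h y * (Fc y * lapl Fc y)"
          unfolding Jint_G[OF h(1) True] h_def by (simp add: algebra_simps)
        then have "W y * Jint S e \<eta> (G y) \<le> pd 1 X1 y + pd 2 X2 y"
          unfolding div[OF True] using W_pos[of y] by (intro mult_left_mono) auto
        then show ?thesis using True by simp
      qed simp
    qed
  qed
  moreover have "(\<integral>y. indicator ?D y * pd 1 X1 y + indicator ?D y * pd 2 X2 y \<partial>lborel) = 0"
    using int1 int2 by simp
  ultimately show ?thesis using hausdorff2_const_pos by (simp add: mult_le_0_iff)
qed

end

section \<open>The stability inequality\<close>

context eps_patch
begin

lemma continuous_patch_functions:
  shows "continuous_on (V \<inter> upper) (\<lambda>y. norm_A_sq S (G y))"
    and "continuous_on (V \<inter> upper) (\<lambda>y. regF S e (G y))"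
    and "continuous_on (V \<inter> upper) (\<lambda>y. (norm (surface_gradient S (regF S e) (G y)))\<^sup>2)"
    and "smooth_on UNIV \<phi> \<Longrightarrow> continuous_on (V \<inter> upper) (\<lambda>y. (norm (surface_gradient S \<phi> (G y)))\<^sup>2)"
    and "continuous_on (V \<inter> upper) (\<lambda>y. (norm (surface_gradient S (norm_A_sq S) (G y)))\<^sup>2)"
proof -
  note c = smooth_on_continuous_on
  have sub: "V \<inter> upper \<subseteq> V" by simp
  have eq: "continuous_on (V \<inter> upper) g \<Longrightarrow> (\<And>y. y \<in> V \<inter> upper \<Longrightarrow> k y = g y) \<Longrightarrow> continuous_on (V \<inter> upper) k" for g k :: "real^2 \<Rightarrow> real"
    by (metis (no_types, lifting) continuous_on_cong)
  have W0: "W y \<noteq> 0" for y using W_pos[of y] by simp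
  have gi: "continuous_on (V \<inter> upper) (\<lambda>y. ginner y (pd 1 u y) (pd 2 u y) (pd 1 u y) (pd 2 u y))" if "smooth_on V u" for u
    unfolding ginner_def using W0
    by (intro continuous_intros continuous_on_subset[OF _ sub] c[OF smooth_W] c[OF smooth_on_pd[OF that]] c[OF smooth_on_pd[OF smooth_f]]) auto
  have sg: "continuous_on (V \<inter> upper) (\<lambda>y. (norm (surface_gradient S k (G y)))\<^sup>2)"
    if "smooth_on V u" "\<And>y. y \<in> V \<inter> upper \<Longrightarrow> k (G y) = u y" for k u
  proof (rule eq[OF gi[OF that(1)]])
    fix y assume y: "y \<in> V \<inter> upper"
    show "(norm (surface_gradient S k (G y)))\<^sup>2 = ginner y (pd 1 u y) (pd 2 u y) (pd 1 u y) (pd 2 u y)"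
      using y surface_gradient_G(2)[OF y that(2) smooth_on_differentiable[OF that(1)]]
      by (simp add: power2_norm_eq_inner gradv_gradv)
  qed
  show "continuous_on (V \<inter> upper) (\<lambda>y. norm_A_sq S (G y))"
    by (rule eq[OF continuous_on_subset[OF c[OF smooth_asq] sub] norm_A_sq_G])
  show "continuous_on (V \<inter> upper) (\<lambda>y. regF S e (G y))"
    by (rule eq[OF continuous_on_subset[OF c[OF smooth_Fc] sub] regF_G])
  show "continuous_on (V \<inter> upper) (\<lambda>y. (norm (surface_gradient S (regF S e) (G y)))\<^sup>2)"
    by (rule sg[OF smooth_Fc regF_G])
  show "continuous_on (V \<inter> upper) (\<lambda>y. (norm (surface_gradient S \<phi> (G y)))\<^sup>2)" if "smooth_on UNIV \<phi>"
    by (rule sg[of "\<lambda>y. \<phi> (G y)"]) (auto intro: smooth_on_compose[OF open_V open_UNIV that smooth_G])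
  show "continuous_on (V \<inter> upper) (\<lambda>y. (norm (surface_gradient S (norm_A_sq S) (G y)))\<^sup>2)"
    by (rule sg[OF smooth_asq norm_A_sq_G])
qed

lemma patch_second_variation:
  assumes y: "y \<in> V \<inter> upper" and \<phi>: "smooth_on UNIV \<phi>" and u: "\<And>x. x \<in> S \<Longrightarrow> u x = \<phi> x * regF S e x"
  shows "(norm (surface_gradient S u (G y)))\<^sup>2 - norm_A_sq S (G y) * (u (G y))\<^sup>2
    = (regF S e (G y))\<^sup>2 * (norm (surface_gradient S \<phi> (G y)))\<^sup>2 + Jint S e (\<lambda>x. (\<phi> x)\<^sup>2) (G y)
      - (\<phi> (G y))\<^sup>2 * (norm (surface_gradient S (regF S e) (G y)))\<^sup>2" (is ?eq)
    and "surface_gradient S \<phi> (G y) \<bullet> surface_gradient S \<phi> (G y) = fd \<phi> (G y) (surface_gradient S \<phi> (G y))"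
    and "(norm (surface_gradient S (norm_A_sq S) (G y)))\<^sup>2 = 4 * (regF S e (G y))\<^sup>2 * (norm (surface_gradient S (regF S e) (G y)))\<^sup>2"
    and "surface_gradient S u (G y) = gradv y (pd 1 (\<lambda>y. \<phi> (G y) * Fc y) y) (pd 2 (\<lambda>y. \<phi> (G y) * Fc y) y)"
proof -
  define h where "h y = \<phi> (G y)" for y
  have sh: "smooth_on V h" unfolding h_def by (rule smooth_on_compose[OF open_V _ \<phi> smooth_G]) auto
  have yV: "y \<in> V" using y by simp
  have suF: "smooth_on V (\<lambda>y. h y * Fc y)" by (intro sm sh smooth_Fc)
  have gu: "surface_gradient S u (G y) = gradv y (pd 1 (\<lambda>y. h y * Fc y) y) (pd 2 (\<lambda>y. h y * Fc y) y)"
    by (rule surface_gradient_G(2)[OF y _ smooth_on_differentiable[OF suF yV]]) (simp add: u G_in_S regF_G h_def)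
  then show "surface_gradient S u (G y) = gradv y (pd 1 (\<lambda>y. \<phi> (G y) * Fc y) y) (pd 2 (\<lambda>y. \<phi> (G y) * Fc y) y)"
    by (simp add: h_def)
  have g\<phi>: "surface_gradient S \<phi> (G y) = gradv y (pd 1 h y) (pd 2 h y)"
    by (rule surface_gradient_G(2)[OF y _ smooth_on_differentiable[OF sh yV]]) (simp add: h_def)
  have hG: "(\<lambda>y. \<phi> (G y)) = h" by (simp add: h_def fun_eq_iff)
  show "surface_gradient S \<phi> (G y) \<bullet> surface_gradient S \<phi> (G y) = fd \<phi> (G y) (surface_gradient S \<phi> (G y))"
    unfolding g\<phi> fd_gradv[OF \<phi> yV] gradv_gradv[OF yV] hG ..
  have gw: "surface_gradient S (norm_A_sq S) (G y) = gradv y (pd 1 asq y) (pd 2 asq y)"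
    by (rule surface_gradient_G(2)[OF y norm_A_sq_G smooth_on_differentiable[OF smooth_asq yV]])
  show "(norm (surface_gradient S (norm_A_sq S) (G y)))\<^sup>2 = 4 * (regF S e (G y))\<^sup>2 * (norm (surface_gradient S (regF S e) (G y)))\<^sup>2"
    unfolding gw gradF_G[OF y] regF_G[OF y] power2_norm_eq_inner gradv_gradv[OF yV] pd_Fc[OF yV, symmetric]
    by (simp add: ginner_def power2_eq_square algebra_simps)
  have s2: "smooth_on UNIV (\<lambda>x. (\<phi> x)\<^sup>2)" using \<phi> by (intro smooth_on_power) auto
  have pd2: "pd i (\<lambda>y. (\<phi> (G y))\<^sup>2) y = 2 * h y * pd i h y" for i
    using yV sh by (simp add: h_def[symmetric] power2_eq_square pd_rules)
  have pdu: "pd i (\<lambda>y. h y * Fc y) y = pd i h y * Fc y + h y * pd i Fc y" for i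
    using yV by (simp add: pd_rules sh smooth_Fc)
  have uG: "u (G y) = h y * Fc y" using u[OF G_in_S[OF y]] regF_G[OF y] by (simp add: h_def)
  have expand: "ginner y (a1 * c + b * d1) (a2 * c + b * d2) (a1 * c + b * d1) (a2 * c + b * d2)
     = c\<^sup>2 * ginner y a1 a2 a1 a2 + (c * ginner y d1 d2 (2 * b * a1) (2 * b * a2)) + b\<^sup>2 * ginner y d1 d2 d1 d2" for a1 a2 b c d1 d2
    unfolding ginner_def
    by (simp only: times_divide_eq_right add_divide_distrib[symmetric]) (simp add: power2_eq_square algebra_simps)
  show ?eq
    unfolding gu g\<phi> gradF_G[OF y] regF_G[OF y] power2_norm_eq_inner gradv_gradv[OF yV] Jint_G[OF s2 y] pd2 norm_A_sq_G[OF y] uG pdu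
    unfolding expand unfolding h_def[symmetric] by (simp add: power2_eq_square algebra_simps)
qed

end

locale stable_half_bubble =
  fixes S :: "(real^3) set" and n :: "real^3" and a :: real
  assumes embedded: "embedded_surface S" and closed_S: "closed S" and minimal: "minimal_surface S"
    and norm_n: "norm n = 1" and above: "S \<subseteq> {x. a \<le> n \<bullet> x}"
    and bdry: "surface_boundary S = S \<inter> {x. n \<bullet> x = a}" and bdry_ne: "surface_boundary S \<noteq> {}"
    and free: "\<And>p. p \<in> surface_boundary S \<Longrightarrow> n \<in> tangent_space S p"
    and finite_curv: "finite_total_curvature S" and stable: "stable_surface S"
    and connected_S: "connected S"
begin

lemma S_borel [measurable]: "S \<in> sets borel" using closed_S by (rule borel_closed)

lemma patch_exists:
  assumes p: "p \<in> S" and e: "0 < e"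
  obtains q e1 e2 e3 V f z \<rho> where "eps_patch q e1 e2 e3 V f S e z" "centred_patch q e1 e2 e3 V f S z" "graph_map.G q e1 e2 e3 f z = p"
    "0 < \<rho>" "cball z \<rho> \<subseteq> V" "S \<inter> ball p \<rho> \<subseteq> graph_map.G q e1 e2 e3 f ` (V \<inter> upper)"
proof -
  obtain q e1 e2 e3 V f z where c: "centred_patch q e1 e2 e3 V f S z" and Gz: "graph_map.G q e1 e2 e3 f z = p"
    using half_bubble_patch[OF embedded norm_n above bdry free p] by metis
  interpret c: centred_patch q e1 e2 e3 V f S z by (rule c)
  interpret c: minimal_patch q e1 e2 e3 V f S by unfold_locales (rule minimal)
  define V1 where "V1 = V \<inter> c.asq -` {- e <..}"
  have V1: "open V1" "V1 \<subseteq> V" "V1 \<inter> upper = V \<inter> upper"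
    using continuous_open_preimage[OF smooth_on_continuous_on[OF c.smooth_asq] c.open_V, of "{- e <..}"]
      c.asq_nonneg e by (force simp: V1_def)+
  interpret d: graph_map q e1 e2 e3 V1 f
    using c.on c.e3_cross V1 c.smooth_f by unfold_locales (auto intro: smooth_on_subset)
  have cent: "centred_patch q e1 e2 e3 V1 f S z"
    by unfold_locales (use c.openin_G V1 c.y0 c.grad0 c.neumann in auto)
  have eps: "eps_patch q e1 e2 e3 V1 f S e z"
    by unfold_locales (use c.openin_G V1 c.y0 c.neumann e minimal in \<open>auto simp: V1_def\<close>)
  obtain O1 where O1: "open O1" "c.G ` (V1 \<inter> upper) = S \<inter> O1"
    using c.openin_G V1(3) by (auto simp: openin_open)
  have zV: "z \<in> V1" using c.y0 V1(3) by auto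
  obtain r1 where r1: "r1 > 0" "cball z r1 \<subseteq> V1" using V1(1) zV open_contains_cball by blast
  have "p \<in> O1" using O1(2) Gz c.y0 V1(3) by blast
  then obtain r2 where r2: "r2 > 0" "ball p r2 \<subseteq> O1" using O1(1) open_contains_ball by blast
  show ?thesis
  proof (rule that[OF eps cent Gz])
    show "0 < min r1 r2" using r1 r2 by simp
    show "cball z (min r1 r2) \<subseteq> V1" using r1 by auto
    show "S \<inter> ball p (min r1 r2) \<subseteq> c.G ` (V1 \<inter> upper)" using r2 O1(2) by auto
  qed
qed

lemma continuous_on_S:
  fixes k :: "real^3 \<Rightarrow> real"
  assumes e: "0 < e" and k: "\<And>q e1 e2 e3 V f z. eps_patch q e1 e2 e3 V f S e z \<Longrightarrow>
      continuous_on (V \<inter> upper) (\<lambda>y. k (graph_map.G q e1 e2 e3 f y))"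
  shows "continuous_on S k"
  unfolding continuous_on_eq_continuous_within
proof
  fix p assume p: "p \<in> S"
  obtain q e1 e2 e3 V f z \<rho> where c: "eps_patch q e1 e2 e3 V f S e z" and Gz: "graph_map.G q e1 e2 e3 f z = p"
    and \<rho>: "0 < \<rho>" "S \<inter> ball p \<rho> \<subseteq> graph_map.G q e1 e2 e3 f ` (V \<inter> upper)"
    using patch_exists[OF p e] by metis
  interpret c: eps_patch q e1 e2 e3 V f S e z by (rule c)
  have "continuous_on (S \<inter> ball p \<rho>) (\<lambda>x. k (c.G (c.pr x)))"
    by (rule continuous_on_compose2[OF k[OF c] c.continuous_pr]) (use \<rho>(2) in auto)
  then have "continuous_on (S \<inter> ball p \<rho>) k"
    by (rule continuous_on_eq) (use \<rho>(2) in auto)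
  then have "continuous (at p within S \<inter> ball p \<rho>) k"
    using p \<rho>(1) by (auto simp: continuous_on_eq_continuous_within)
  moreover have "at p within S = at p within S \<inter> ball p \<rho>"
    by (rule at_within_nhd[of _ "ball p \<rho>"]) (use \<rho>(1) in auto)
  ultimately show "continuous (at p within S) k" by simp
qed

lemma finite_area:
  assumes K: "compact K" shows "emeasure hausdorff2 (S \<inter> K) < \<infinity>"
proof -
  define good where "good B \<longleftrightarrow> open B \<and> (\<exists>X. X \<in> sets borel \<and> S \<inter> B \<subseteq> X \<and> emeasure hausdorff2 X < \<infinity>)" for B :: "(real^3) set"
  have ex: "\<exists>B. p \<in> B \<and> good B" if pS: "p \<in> S" for p
  proof -
    obtain q e1 e2 e3 V f z \<rho> where c: "eps_patch q e1 e2 e3 V f S 1 z" and Gz: "graph_map.G q e1 e2 e3 f z = p"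
      and \<rho>: "0 < \<rho>" "cball z \<rho> \<subseteq> V" "S \<inter> ball p \<rho> \<subseteq> graph_map.G q e1 e2 e3 f ` (V \<inter> upper)"
      using patch_exists[OF pS zero_less_one] by metis
    interpret c: eps_patch q e1 e2 e3 V f S 1 z by (rule c)
    have "S \<inter> ball p \<rho> \<subseteq> c.G ` cball z \<rho>"
    proof
      fix x assume x: "x \<in> S \<inter> ball p \<rho>"
      then obtain y where y: "x = c.G y" using \<rho>(3) by blast
      have "dist z y \<le> dist (c.G z) (c.G y)" unfolding c.dist_G by (simp add: dist_norm norm_Pair)
      then show "x \<in> c.G ` cball z \<rho>" using x y Gz by auto
    qed
    moreover have "c.G ` cball z \<rho> \<in> sets borel" by (rule c.borel_G_image) (use \<rho> in auto)
    ultimately show ?thesis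
      using c.graph_compact_finite[OF \<rho>(2)] \<rho>(1) unfolding good_def
      by (intro exI[of _ "ball p \<rho>"]) auto
  qed
  have "compact (S \<inter> K)" using K closed_S by (simp add: closed_Int_compact)
  moreover have "S \<inter> K \<subseteq> \<Union>{B. good B}" using ex by blast
  moreover have "\<And>B. B \<in> {B. good B} \<Longrightarrow> open B" by (simp add: good_def)
  ultimately obtain C where C: "C \<subseteq> {B. good B}" "finite C" "S \<inter> K \<subseteq> \<Union>C"
    using compactE by metis
  have "\<forall>B\<in>C. \<exists>X. X \<in> sets borel \<and> S \<inter> B \<subseteq> X \<and> emeasure hausdorff2 X < \<infinity>" using C(1) by (auto simp: good_def)
  then obtain X where X: "\<And>B. B \<in> C \<Longrightarrow> X B \<in> sets borel \<and> S \<inter> B \<subseteq> X B \<and> emeasure hausdorff2 (X B) < \<infinity>" by metis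
  have "emeasure hausdorff2 (S \<inter> K) \<le> emeasure hausdorff2 (\<Union>B\<in>C. X B)"
    by (rule emeasure_mono) (use C X in \<open>auto intro!: sets.finite_UN\<close>, blast)
  also have "\<dots> \<le> (\<Sum>B\<in>C. emeasure hausdorff2 (X B))"
    by (rule emeasure_subadditive_finite) (use C X in auto)
  also have "\<dots> < \<infinity>" using X C(2) by simp
  finally show ?thesis .
qed

lemma set_integrable_S:
  fixes k :: "real^3 \<Rightarrow> real"
  assumes k: "continuous_on S k" and K: "compact K" and 0: "\<And>x. x \<in> S \<Longrightarrow> x \<notin> K \<Longrightarrow> k x = 0"
  shows "set_integrable hausdorff2 S k"
proof -
  have cSK: "compact (S \<inter> K)" using K closed_S by (simp add: closed_Int_compact)
  obtain B where B: "0 \<le> B" "\<And>x. x \<in> S \<inter> K \<Longrightarrow> \<bar>k x\<bar> \<le> B"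
    using compact_continuous_bound[OF cSK continuous_on_subset[OF k Int_lower1]] by metis
  show ?thesis unfolding set_integrable_def
  proof (rule integrableI_bounded_set[where A = "S \<inter> K" and B = B])
    show "S \<inter> K \<in> sets hausdorff2" using cSK by (simp add: borel_compact)
    show "(\<lambda>x. indicator S x *\<^sub>R k x) \<in> borel_measurable hausdorff2"
      using borel_measurable_continuous_on_indicator[OF S_borel k] by simp
    show "emeasure hausdorff2 (S \<inter> K) < \<infinity>" by (rule finite_area[OF K])
  qed (use B 0 in \<open>auto simp: indicator_def\<close>)
qed

lemma continuous_Jint:
  assumes "0 < e" "smooth_on UNIV \<eta>" shows "continuous_on S (Jint S e \<eta>)"
  by (rule continuous_on_S[OF assms(1)]) (rule eps_patch.continuous_J[OF _ assms(2)])

lemma fd_0_outside: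
  assumes h: "smooth_on UNIV \<eta>" "closed K" "\<And>x. x \<notin> K \<Longrightarrow> \<eta> x = 0" "x \<notin> K"
  shows "fd \<eta> x v = (0 :: real)"
proof -
  have "frechet_derivative \<eta> (at x) = frechet_derivative (\<lambda>_. 0) (at x)"
    by (rule frechet_derivative_cong_open[of "- K"]) (use h in auto)
  then show ?thesis by simp
qed

lemma integrable_Jint:
  assumes e: "0 < e" and h: "smooth_on UNIV \<eta>" and K: "compact K" "\<And>x. x \<notin> K \<Longrightarrow> \<eta> x = 0"
  shows "set_integrable hausdorff2 S (Jint S e \<eta>)"
proof (rule set_integrable_S[OF continuous_Jint[OF e h] K(1)])
  fix x assume "x \<in> S" "x \<notin> K"
  then show "Jint S e \<eta> x = 0"
    using K fd_0_outside[OF h compact_imp_closed[OF K(1)] K(2)] by (simp add: Jint_def)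
qed

lemma Jint_add:
  assumes "smooth_on UNIV \<eta>" "smooth_on UNIV \<theta>"
  shows "Jint S e (\<lambda>x. \<eta> x + \<theta> x) x = Jint S e \<eta> x + Jint S e \<theta> x"
proof -
  have "fd (\<lambda>x. \<eta> x + \<theta> x) x v = fd \<eta> x v + fd \<theta> x v" for v
    by (rule fd_eqI[OF has_derivative_add]) (use assms smooth_on_has_derivative in auto)
  then show ?thesis by (simp add: Jint_def algebra_simps)
qed

text \<open>Induction over a finite cover by small balls: a bump function splits off the part of \<open>\<eta>\<close>
  that is supported in one of them.\<close>

lemma integral_Jint_le_0:
  assumes e: "0 < e" and h: "smooth_on UNIV \<eta>" "\<And>x. 0 \<le> \<eta> x" and K: "compact K" "\<And>x. x \<notin> K \<Longrightarrow> \<eta> x = 0"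
  shows "(LINT x:S|hausdorff2. Jint S e \<eta> x) \<le> 0"
proof -
  define good where "good p r \<longleftrightarrow> 0 < r \<and> (\<forall>\<eta>. smooth_on UNIV \<eta> \<longrightarrow> (\<forall>x. 0 \<le> \<eta> x) \<longrightarrow> (\<forall>x. x \<notin> ball p r \<longrightarrow> \<eta> x = 0)
    \<longrightarrow> (LINT x:S|hausdorff2. Jint S e \<eta> x) \<le> 0)" for p r
  have ex: "\<exists>r. good p r" if p: "p \<in> S" for p
  proof -
    obtain q e1 e2 e3 V f z \<rho> where c: "eps_patch q e1 e2 e3 V f S e z" and Gz: "graph_map.G q e1 e2 e3 f z = p"
      and \<rho>: "0 < \<rho>" "cball z \<rho> \<subseteq> V" "S \<inter> ball p \<rho> \<subseteq> graph_map.G q e1 e2 e3 f ` (V \<inter> upper)"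
      using patch_exists[OF p e] by metis
    have "good p \<rho>" unfolding good_def
      using eps_patch.local_inequality[OF c] \<rho> unfolding Gz by auto
    then show ?thesis by blast
  qed
  then obtain r where r: "\<And>p. p \<in> S \<Longrightarrow> good p (r p)" by metis
  have ind: "(LINT x:S|hausdorff2. Jint S e \<eta> x) \<le> 0"
    if "finite C" "C \<subseteq> S" "smooth_on UNIV \<eta>" "\<And>x. 0 \<le> \<eta> x" "\<And>x. x \<notin> K \<Longrightarrow> \<eta> x = 0"
      "\<And>x. x \<in> S \<Longrightarrow> x \<notin> (\<Union>p\<in>C. ball p (r p / 2)) \<Longrightarrow> \<eta> x = 0" for C \<eta>
    using that
  proof (induction C arbitrary: \<eta> rule: finite_induct)
    case empty
    have "Jint S e \<eta> x = 0" if x: "x \<in> S" for x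
    proof -
      have 0: "\<eta> x = 0" using empty(5) x by simp
      have d: "(\<eta> has_derivative frechet_derivative \<eta> (at x)) (at x)" by (rule smooth_on_has_derivative[OF empty(2)]) simp
      have "frechet_derivative \<eta> (at x) = (\<lambda>v. 0)"
        by (rule differential_zero_maxmin[OF UNIV_I open_UNIV d]) (use empty(3) 0 in auto)
      then show ?thesis using 0 by (simp add: Jint_def)
    qed
    then have "(LINT x:S|hausdorff2. Jint S e \<eta> x) = (LINT x:S|hausdorff2. 0)"
      by (intro set_lebesgue_integral_cong) auto
    then show ?case by simp
  next
    case (insert p C)
    have gp: "good p (r p)" using r insert.prems(1) by auto
    then have rp: "0 < r p" by (simp add: good_def)
    obtain b where b: "smooth_on UNIV b" "\<And>x. 0 \<le> b x" "\<And>x. b x \<le> 1"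
      "\<And>x. x \<in> ball p (r p / 2) \<Longrightarrow> b x = 1" "\<And>x. x \<notin> ball p (r p) \<Longrightarrow> b x = (0 :: real)"
      using exists_bump[OF rp] by metis
    define \<eta>1 \<eta>2 where "\<eta>1 x = \<eta> x * b x" and "\<eta>2 x = \<eta> x * (1 - b x)" for x
    have s1: "smooth_on UNIV \<eta>1" and s2: "smooth_on UNIV \<eta>2"
      unfolding \<eta>1_def \<eta>2_def using insert.prems(2) b(1) by (intro smooth_intros; simp)+
    have 1: "(LINT x:S|hausdorff2. Jint S e \<eta>1 x) \<le> 0"
      using gp s1 insert.prems(3) b unfolding good_def by (auto simp: \<eta>1_def)
    have 2: "(LINT x:S|hausdorff2. Jint S e \<eta>2 x) \<le> 0"
    proof (rule insert.IH[OF _ s2])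
      show "C \<subseteq> S" using insert.prems(1) by simp
      show "0 \<le> \<eta>2 x" for x using insert.prems(3) b by (simp add: \<eta>2_def)
      show "\<eta>2 x = 0" if "x \<notin> K" for x using insert.prems(4) that by (simp add: \<eta>2_def)
      show "\<eta>2 x = 0" if "x \<in> S" "x \<notin> (\<Union>p\<in>C. ball p (r p / 2))" for x
        using insert.prems(5)[of x] b(4)[of x] that by (cases "x \<in> ball p (r p / 2)") (auto simp: \<eta>2_def)
    qed
    have "Jint S e \<eta> x = Jint S e \<eta>1 x + Jint S e \<eta>2 x" for x
    proof -
      have "\<eta> = (\<lambda>x. \<eta>1 x + \<eta>2 x)" by (simp add: \<eta>1_def \<eta>2_def fun_eq_iff algebra_simps)
      then show ?thesis using Jint_add[OF s1 s2] by metis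
    qed
    then have "(LINT x:S|hausdorff2. Jint S e \<eta> x) = (LINT x:S|hausdorff2. Jint S e \<eta>1 x + Jint S e \<eta>2 x)" by simp
    also have "\<dots> = (LINT x:S|hausdorff2. Jint S e \<eta>1 x) + (LINT x:S|hausdorff2. Jint S e \<eta>2 x)"
      using insert.prems(4)
      by (intro set_integral_add(2) integrable_Jint[OF e s1 K(1)] integrable_Jint[OF e s2 K(1)]) (auto simp: \<eta>1_def \<eta>2_def)
    finally show ?case using 1 2 by simp
  qed
  have cSK: "compact (S \<inter> K)" using K closed_S by (simp add: closed_Int_compact)
  have rpos: "0 < r p" if "p \<in> S" for p using r[OF that] by (simp add: good_def)
  have "S \<inter> K \<subseteq> (\<Union>p\<in>S. ball p (r p / 2))" using rpos by force
  then obtain C where C: "C \<subseteq> S" "finite C" "S \<inter> K \<subseteq> (\<Union>p\<in>C. ball p (r p / 2))"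
    using compactE_image[OF cSK, of S "\<lambda>p. ball p (r p / 2)"] by auto
  show ?thesis
  proof (rule ind[OF C(2,1) h K(2)])
    fix x assume x: "x \<in> S" "x \<notin> (\<Union>p\<in>C. ball p (r p / 2))"
    then have "x \<notin> K" using C(3) by blast
    then show "\<eta> x = 0" by (rule K(2))
  qed
qed

definition times_F :: "real \<Rightarrow> (real^3 \<Rightarrow> real) \<Rightarrow> real^3 \<Rightarrow> real" where
  "times_F e \<phi> x = (if x \<in> S then \<phi> x * regF S e x else 0)"

lemma times_F_in_test_functions:
  assumes e: "0 < e" and \<phi>: "smooth_on UNIV \<phi>" and K: "compact K" "\<And>x. x \<notin> K \<Longrightarrow> \<phi> x = 0"
  shows "times_F e \<phi> \<in> test_functions S"
proof -
  have "compact (S \<inter> K)" using K closed_S by (simp add: closed_Int_compact)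
  moreover have "\<forall>x. x \<notin> S \<inter> K \<longrightarrow> times_F e \<phi> x = 0" using K by (auto simp: times_F_def)
  ultimately have "\<exists>K. compact K \<and> K \<subseteq> S \<and> (\<forall>x. x \<notin> K \<longrightarrow> times_F e \<phi> x = 0)" by blast
  moreover have "smooth_on_surface S (times_F e \<phi>)" unfolding smooth_on_surface_def
  proof
  fix p assume p: "p \<in> S"
  obtain q e1 e2 e3 V f z \<rho> where c: "eps_patch q e1 e2 e3 V f S e z" and Gz: "graph_map.G q e1 e2 e3 f z = p"
    and \<rho>: "0 < \<rho>" "S \<inter> ball p \<rho> \<subseteq> graph_map.G q e1 e2 e3 f ` (V \<inter> upper)"
    using patch_exists[OF p e] by metis
  interpret c: eps_patch q e1 e2 e3 V f S e z by (rule c)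
  define O' where "O' = c.pr -` V \<inter> ball p \<rho>"
  have O': "open O'" unfolding O'_def using c.open_V c.continuous_pr[of UNIV] by (intro open_Int open_vimage) auto
  have spr: "smooth_on O' c.pr"
  proof -
    have pr: "c.pr = (\<lambda>x. ((x - q) \<bullet> e1) *\<^sub>R axis 1 1 + ((x - q) \<bullet> e2) *\<^sub>R axis 2 1)"
      by (simp add: c.pr_def vec_eq_iff forall_2 axis_def fun_eq_iff)
    show ?thesis unfolding pr using O' by (intro smooth_intros)
  qed
  have "smooth_on O' (\<lambda>x. \<phi> x * c.Fc (c.pr x))"
    by (intro smooth_on_mult[OF O'] smooth_on_compose[OF O' c.open_V c.smooth_Fc spr] smooth_on_subset[OF \<phi>]) (auto simp: O'_def)
  moreover have "p \<in> O'" using Gz c.y0 \<rho>(1) by (auto simp: O'_def)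
  moreover have "times_F e \<phi> x = \<phi> x * c.Fc (c.pr x)" if "x \<in> O' \<inter> S" for x
  proof -
    have "x \<in> S \<inter> ball p \<rho>" using that by (simp add: O'_def)
    then have "x \<in> c.G ` (V \<inter> upper)" using \<rho>(2) by blast
    then obtain y where "y \<in> V \<inter> upper" "x = c.G y" by blast
    then show ?thesis using that c.regF_G by (simp add: times_F_def)
  qed
  ultimately show "\<exists>W g. open W \<and> p \<in> W \<and> smooth_on W g \<and> (\<forall>x\<in>W \<inter> S. times_F e \<phi> x = g x)"
    using O' by blast
  qed
  ultimately show ?thesis by (simp add: test_functions_def)
qed

lemma second_variation_integrand:
  assumes e: "0 < e" and \<phi>: "smooth_on UNIV \<phi>" and x: "x \<in> S"
  shows "(norm (surface_gradient S (times_F e \<phi>) x))\<^sup>2 - norm_A_sq S x * (times_F e \<phi> x)\<^sup>2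
    = (regF S e x)\<^sup>2 * (norm (surface_gradient S \<phi> x))\<^sup>2 + Jint S e (\<lambda>x. (\<phi> x)\<^sup>2) x
      - (\<phi> x)\<^sup>2 * (norm (surface_gradient S (regF S e) x))\<^sup>2"
    and "norm (surface_gradient S \<phi> x) \<le> onorm (frechet_derivative \<phi> (at x))"
    and "(norm (surface_gradient S (norm_A_sq S) x))\<^sup>2 = 4 * (norm_A_sq S x + e) * (norm (surface_gradient S (regF S e) x))\<^sup>2"
    and "0 \<le> norm_A_sq S x"
    and "surface_gradient S (times_F e (\<lambda>x. k * \<phi> x)) x = k *\<^sub>R surface_gradient S (times_F e \<phi>) x"
proof -
  obtain q e1 e2 e3 V f z \<rho> where c: "eps_patch q e1 e2 e3 V f S e z" and Gz: "graph_map.G q e1 e2 e3 f z = x"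
    using patch_exists[OF x e] by metis
  interpret c: eps_patch q e1 e2 e3 V f S e z by (rule c)
  note p = c.patch_second_variation[OF c.y0 \<phi>, of "times_F e \<phi>", unfolded Gz]
  show "(norm (surface_gradient S (times_F e \<phi>) x))\<^sup>2 - norm_A_sq S x * (times_F e \<phi> x)\<^sup>2
    = (regF S e x)\<^sup>2 * (norm (surface_gradient S \<phi> x))\<^sup>2 + Jint S e (\<lambda>x. (\<phi> x)\<^sup>2) x
      - (\<phi> x)\<^sup>2 * (norm (surface_gradient S (regF S e) x))\<^sup>2"
    by (rule p(1)) (simp add: times_F_def)
  show A0: "0 \<le> norm_A_sq S x" using c.norm_A_sq_G[OF c.y0] c.asq_nonneg[OF c.y0] Gz by simp
  have "(norm (surface_gradient S (norm_A_sq S) x))\<^sup>2 = 4 * (regF S e x)\<^sup>2 * (norm (surface_gradient S (regF S e) x))\<^sup>2"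
    by (rule p(3)) (simp add: times_F_def)
  moreover have "(regF S e x)\<^sup>2 = norm_A_sq S x + e" using A0 e by (simp add: regF_def)
  ultimately show "(norm (surface_gradient S (norm_A_sq S) x))\<^sup>2 = 4 * (norm_A_sq S x + e) * (norm (surface_gradient S (regF S e) x))\<^sup>2"
    by simp
  let ?v = "surface_gradient S \<phi> x"
  have "?v \<bullet> ?v = fd \<phi> x ?v" by (rule p(2)) (simp add: times_F_def)
  then have "norm ?v * norm ?v \<le> norm (fd \<phi> x ?v)" by (simp add: power2_norm_eq_inner[symmetric] power2_eq_square)
  also have "\<dots> \<le> onorm (frechet_derivative \<phi> (at x)) * norm ?v"
    using smooth_on_has_derivative[OF \<phi>] has_derivative_bounded_linear by (intro onorm) blast
  finally show "norm ?v \<le> onorm (frechet_derivative \<phi> (at x))"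
    using onorm_pos_le[of "frechet_derivative \<phi> (at x)"] smooth_on_has_derivative[OF \<phi>] has_derivative_bounded_linear
    by (cases "norm ?v = 0") (auto simp: mult_le_cancel_right)
  have k\<phi>: "smooth_on UNIV (\<lambda>x. k * \<phi> x)" using \<phi> by (intro smooth_intros) auto
  have sh: "smooth_on V (\<lambda>y. \<phi> (c.G y) * c.Fc y)"
    by (intro smooth_on_mult c.open_V c.smooth_Fc smooth_on_compose[OF c.open_V open_UNIV \<phi> c.smooth_G]) auto
  have pk: "pd i (\<lambda>y. k * \<phi> (c.G y) * c.Fc y) z = k * pd i (\<lambda>y. \<phi> (c.G y) * c.Fc y) z" for i
    using c.pd_mult[OF _ smooth_on_const[OF c.open_V] sh, of z i k] c.pd_const c.y0 by (simp add: mult.assoc)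
  have "surface_gradient S (times_F e (\<lambda>x. k * \<phi> x)) x = c.gradv z (pd 1 (\<lambda>y. k * \<phi> (c.G y) * c.Fc y) z) (pd 2 (\<lambda>y. k * \<phi> (c.G y) * c.Fc y) z)"
    using c.patch_second_variation(4)[OF c.y0 k\<phi>, of "times_F e (\<lambda>x. k * \<phi> x)", unfolded Gz] by (simp add: times_F_def)
  also have "\<dots> = k *\<^sub>R c.gradv z (pd 1 (\<lambda>y. \<phi> (c.G y) * c.Fc y) z) (pd 2 (\<lambda>y. \<phi> (c.G y) * c.Fc y) z)"
    unfolding pk c.gradv_def by (simp add: scaleR_add_right algebra_simps)
  also have "c.gradv z (pd 1 (\<lambda>y. \<phi> (c.G y) * c.Fc y) z) (pd 2 (\<lambda>y. \<phi> (c.G y) * c.Fc y) z) = surface_gradient S (times_F e \<phi>) x"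
    using p(4) by (simp add: times_F_def)
  finally show "surface_gradient S (times_F e (\<lambda>x. k * \<phi> x)) x = k *\<^sub>R surface_gradient S (times_F e \<phi>) x" .
qed

lemma second_variation_nonneg:
  assumes e: "0 < e" and \<phi>: "smooth_on UNIV \<phi>" and K: "compact K" "\<And>x. x \<notin> K \<Longrightarrow> \<phi> x = 0"
  shows "0 \<le> second_variation S (times_F e \<phi>)"
proof (rule ccontr)
  define u where "u = times_F e \<phi>"
  assume "\<not> 0 \<le> second_variation S (times_F e \<phi>)"
  then have neg: "second_variation S u < 0" by (simp add: u_def)
  have u0: "u \<noteq> 0"
  proof
    assume "u = 0"
    then have "u x = 0" for x by simp
    then have "0 \<le> second_variation S u"
      unfolding second_variation_def set_lebesgue_integral_def
      by (intro Bochner_Integration.integral_nonneg) (simp add: indicator_def)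
    then show False using neg by simp
  qed
  have scale: "(\<lambda>x. k * u x) = times_F e (\<lambda>x. k * \<phi> x)" for k by (simp add: u_def times_F_def fun_eq_iff)
  have k\<phi>: "smooth_on UNIV (\<lambda>x. k * \<phi> x)" for k using \<phi> by (intro smooth_intros) auto
  define V where "V = fun_space.span {u}"
  have V: "V = range (\<lambda>k x. k * u x)" unfolding V_def by (rule fun_space.span_singleton)
  have "V \<subseteq> test_functions S"
    unfolding V using times_F_in_test_functions[OF e k\<phi> K(1)] K(2) by (auto simp: scale)
  moreover have "second_variation S v < 0" if vV: "v \<in> V" and v0: "v \<noteq> 0" for v
  proof -
    obtain k where k: "v = (\<lambda>x. k * u x)" using vV unfolding V by blast
    then have "k \<noteq> 0" using v0 by (auto simp: fun_eq_iff)
    have "second_variation S v = (LINT x:S|hausdorff2. k\<^sup>2 * ((norm (surface_gradient S u x))\<^sup>2 - norm_A_sq S x * (u x)\<^sup>2))"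
      unfolding second_variation_def
    proof (rule set_lebesgue_integral_cong)
      show "\<forall>x. x \<in> S \<longrightarrow> (norm (surface_gradient S v x))\<^sup>2 - norm_A_sq S x * (v x)\<^sup>2 =
        k\<^sup>2 * ((norm (surface_gradient S u x))\<^sup>2 - norm_A_sq S x * (u x)\<^sup>2)"
        using second_variation_integrand(5)[OF e \<phi>, of _ k]
        by (simp add: k scale[of k] u_def[symmetric] power_mult_distrib algebra_simps)
          (simp add: u_def times_F_def power_mult_distrib algebra_simps)
    qed simp
    also have "\<dots> = k\<^sup>2 * second_variation S u" unfolding second_variation_def by simp
    finally show ?thesis using neg \<open>k \<noteq> 0\<close> by (simp add: mult_pos_neg)
  qed
  moreover have "fun_space.subspace V" unfolding V_def by (rule fun_space.subspace_span)
  moreover have "fun_space.dim V = 1"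
    unfolding V_def using fun_space.dim_span_eq_card_independent[of "{u}"] u0 by (simp add: fun_space.dependent_single)
  ultimately have "enat 1 \<in> {enat (fun_space.dim V) | V. fun_space.subspace V \<and> (\<exists>B. finite B \<and> fun_space.span B = V) \<and>
            V \<subseteq> test_functions S \<and> (\<forall>u\<in>V. u \<noteq> 0 \<longrightarrow> second_variation S u < 0)}"
    unfolding V_def by (intro CollectI exI[of _ "fun_space.span {u}"]) auto
  then have "enat 1 \<le> surface_index S" unfolding surface_index_def by (rule Sup_upper)
  then show False using stable by (simp add: stable_surface_def zero_enat_def)
qed

definition total_curv :: real where "total_curv = enn2real (\<integral>\<^sup>+x\<in>S. ennreal (norm_A_sq S x) \<partial>hausdorff2)"

text \<open>\<open>|grad F|\<^sup>2\<close> for \<open>F = sqrt (|A|\<^sup>2 + 1)\<close>, by the chain rule.\<close>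

definition grad_F_sq :: "real^3 \<Rightarrow> real" where
  "grad_F_sq x = (norm (surface_gradient S (norm_A_sq S) x))\<^sup>2 / (4 * (norm_A_sq S x + 1))"

lemma norm_A_sq_nonneg: "x \<in> S \<Longrightarrow> 0 \<le> norm_A_sq S x"
  using second_variation_integrand(4)[of 1 "\<lambda>_. 0" x] by (simp add: smooth_on_const)

lemma continuous_S_functions:
  shows "continuous_on S (norm_A_sq S)" "0 < e \<Longrightarrow> continuous_on S (regF S e)"
    "0 < e \<Longrightarrow> continuous_on S (\<lambda>x. (norm (surface_gradient S (regF S e) x))\<^sup>2)"
    "smooth_on UNIV \<phi> \<Longrightarrow> continuous_on S (\<lambda>x. (norm (surface_gradient S \<phi> x))\<^sup>2)"
    "continuous_on S grad_F_sq"
proof -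
  have 1: "0 < (1::real)" by simp
  show A: "continuous_on S (norm_A_sq S)"
    by (rule continuous_on_S[OF 1]) (rule eps_patch.continuous_patch_functions(1))
  show "continuous_on S (regF S e)" if "0 < e"
    by (rule continuous_on_S[OF that]) (rule eps_patch.continuous_patch_functions(2))
  show "continuous_on S (\<lambda>x. (norm (surface_gradient S (regF S e) x))\<^sup>2)" if "0 < e"
    by (rule continuous_on_S[OF that]) (rule eps_patch.continuous_patch_functions(3))
  show "continuous_on S (\<lambda>x. (norm (surface_gradient S \<phi> x))\<^sup>2)" if "smooth_on UNIV \<phi>"
    by (rule continuous_on_S[OF 1]) (rule eps_patch.continuous_patch_functions(4)[OF _ that])
  have "continuous_on S (\<lambda>x. (norm (surface_gradient S (norm_A_sq S) x))\<^sup>2)"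
    by (rule continuous_on_S[OF 1]) (rule eps_patch.continuous_patch_functions(5))
  moreover have "continuous_on S (\<lambda>x. 4 * (norm_A_sq S x + 1))" using A by (intro continuous_intros)
  moreover have "4 * (norm_A_sq S x + 1) \<noteq> 0" if "x \<in> S" for x using norm_A_sq_nonneg[OF that] by simp
  ultimately show "continuous_on S grad_F_sq"
    unfolding grad_F_sq_def by (intro continuous_on_divide) auto
qed

lemma integral_curvature_le:
  assumes K: "compact K"
  shows "set_integrable hausdorff2 (S \<inter> K) (norm_A_sq S)" "(LINT x:S \<inter> K|hausdorff2. norm_A_sq S x) \<le> total_curv"
proof -
  have cSK: "compact (S \<inter> K)" using K closed_S by (simp add: closed_Int_compact)
  have b: "S \<inter> K \<in> sets borel" using cSK by (simp add: borel_compact)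
  have c: "continuous_on (S \<inter> K) (norm_A_sq S)" using continuous_S_functions(1) by (rule continuous_on_subset) auto
  obtain B where B: "0 \<le> B" "\<And>x. x \<in> S \<inter> K \<Longrightarrow> \<bar>norm_A_sq S x\<bar> \<le> B"
    using compact_continuous_bound[OF cSK c] by metis
  have m: "(\<lambda>x. indicator (S \<inter> K) x *\<^sub>R norm_A_sq S x) \<in> borel_measurable hausdorff2"
    using borel_measurable_continuous_on_indicator[OF b c] by simp
  show "set_integrable hausdorff2 (S \<inter> K) (norm_A_sq S)" unfolding set_integrable_def
    by (rule integrableI_bounded_set[where A = "S \<inter> K" and B = B, OF _ m])
      (use b B finite_area[OF K] in \<open>auto simp: indicator_def\<close>)
  have "(LINT x:S \<inter> K|hausdorff2. norm_A_sq S x) = enn2real (\<integral>\<^sup>+x. ennreal (indicator (S \<inter> K) x *\<^sub>R norm_A_sq S x) \<partial>hausdorff2)"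
    unfolding set_lebesgue_integral_def using m norm_A_sq_nonneg
    by (intro integral_eq_nn_integral) (auto simp: indicator_def)
  also have "\<dots> \<le> total_curv" unfolding total_curv_def
  proof (rule enn2real_mono)
    show "(\<integral>\<^sup>+x. ennreal (indicator (S \<inter> K) x *\<^sub>R norm_A_sq S x) \<partial>hausdorff2) \<le> (\<integral>\<^sup>+x\<in>S. ennreal (norm_A_sq S x) \<partial>hausdorff2)"
      by (intro nn_integral_mono) (auto simp: indicator_def)
    show "(\<integral>\<^sup>+x\<in>S. ennreal (norm_A_sq S x) \<partial>hausdorff2) < top"
      using finite_curv by (simp add: finite_total_curvature_def)
  qed
  finally show "(LINT x:S \<inter> K|hausdorff2. norm_A_sq S x) \<le> total_curv" .
qed

lemma stability_inequality:
  assumes \<phi>: "smooth_on UNIV \<phi>" and K: "compact K" "\<And>x. x \<notin> K \<Longrightarrow> \<phi> x = 0"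
    and C: "\<And>x. onorm (frechet_derivative \<phi> (at x)) \<le> C"
  shows "(LINT x:S|hausdorff2. (\<phi> x)\<^sup>2 * grad_F_sq x) \<le> C\<^sup>2 * total_curv"
proof -
  have cSK: "compact (S \<inter> K)" using K closed_S by (simp add: closed_Int_compact)
  have bSK: "S \<inter> K \<in> sets borel" using cSK by (simp add: borel_compact)
  have c\<phi>: "continuous_on S \<phi>" using smooth_on_continuous_on[OF \<phi>] continuous_on_subset by blast
  have C0: "0 \<le> C"
  proof -
    have "bounded_linear (frechet_derivative \<phi> (at 0))"
      using smooth_on_has_derivative[OF \<phi>, of 0] has_derivative_bounded_linear by blast
    then show ?thesis using onorm_pos_le C[of 0] order_trans by blast
  qed
  have sg0: "surface_gradient S \<phi> x = 0" if "x \<in> S" "x \<notin> K" for x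
  proof -
    have "frechet_derivative \<phi> (at x) = (\<lambda>_. 0)"
      using fd_0_outside[OF \<phi> compact_imp_closed[OF K(1)] K(2) that(2)] by (simp add: fun_eq_iff)
    then show ?thesis using second_variation_integrand(2)[OF zero_less_one \<phi> that(1)] by (simp add: onorm_zero)
  qed
  have main: "(LINT x:S|hausdorff2. (\<phi> x)\<^sup>2 * grad_F_sq x) \<le> C\<^sup>2 * total_curv + e * (C\<^sup>2 * measure hausdorff2 (S \<inter> K))"
    if e: "0 < e" "e \<le> 1" for e
  proof -
    have s2: "smooth_on UNIV (\<lambda>x. (\<phi> x)\<^sup>2)" using \<phi> by (intro smooth_on_power) auto
    let ?A = "\<lambda>x. (regF S e x)\<^sup>2 * (norm (surface_gradient S \<phi> x))\<^sup>2"
    let ?J = "Jint S e (\<lambda>x. (\<phi> x)\<^sup>2)"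
    let ?B = "\<lambda>x. (\<phi> x)\<^sup>2 * (norm (surface_gradient S (regF S e) x))\<^sup>2"
    have iA: "set_integrable hausdorff2 S ?A"
      by (rule set_integrable_S[OF _ K(1)])
        (use continuous_S_functions(2)[OF e(1)] continuous_S_functions(4)[OF \<phi>] sg0 in \<open>auto intro!: continuous_intros\<close>)
    have iJ: "set_integrable hausdorff2 S ?J"
      by (rule integrable_Jint[OF e(1) s2 K(1)]) (use K(2) in simp)
    have iB: "set_integrable hausdorff2 S ?B"
      by (rule set_integrable_S[OF _ K(1)])
        (use continuous_S_functions(3)[OF e(1)] c\<phi> K(2) in \<open>auto intro!: continuous_intros\<close>)
    have iD: "set_integrable hausdorff2 S (\<lambda>x. (\<phi> x)\<^sup>2 * grad_F_sq x)"
      by (rule set_integrable_S[OF _ K(1)])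
        (use continuous_S_functions(5) c\<phi> K(2) in \<open>auto intro!: continuous_intros\<close>)
    have "0 \<le> second_variation S (times_F e \<phi>)" by (rule second_variation_nonneg[OF e(1) \<phi> K])
    also have "\<dots> = (LINT x:S|hausdorff2. ?A x + ?J x - ?B x)"
      unfolding second_variation_def
      by (rule set_lebesgue_integral_cong) (use second_variation_integrand(1)[OF e(1) \<phi>] in auto)
    also have "\<dots> = (LINT x:S|hausdorff2. ?A x) + (LINT x:S|hausdorff2. ?J x) - (LINT x:S|hausdorff2. ?B x)"
      by (simp only: set_integral_diff(2)[OF set_integral_add(1)[OF iA iJ] iB] set_integral_add(2)[OF iA iJ])
    finally have BA: "(LINT x:S|hausdorff2. ?B x) \<le> (LINT x:S|hausdorff2. ?A x)"
      using integral_Jint_le_0[OF e(1) s2 _ K(1)] K(2) by simp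
    have "(LINT x:S|hausdorff2. (\<phi> x)\<^sup>2 * grad_F_sq x) \<le> (LINT x:S|hausdorff2. ?B x)"
    proof (rule set_integral_mono[OF iD iB])
      fix x assume x: "x \<in> S"
      have A0: "0 \<le> norm_A_sq S x" by (rule norm_A_sq_nonneg[OF x])
      have "grad_F_sq x = 4 * (norm_A_sq S x + e) * (norm (surface_gradient S (regF S e) x))\<^sup>2 / (4 * (norm_A_sq S x + 1))"
        unfolding grad_F_sq_def second_variation_integrand(3)[OF e(1) \<phi> x] ..
      also have "\<dots> \<le> 4 * (norm_A_sq S x + 1) * (norm (surface_gradient S (regF S e) x))\<^sup>2 / (4 * (norm_A_sq S x + 1))"
        using A0 e by (intro divide_right_mono mult_right_mono) auto
      also have "\<dots> = (norm (surface_gradient S (regF S e) x))\<^sup>2" using A0 by simp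
      finally show "(\<phi> x)\<^sup>2 * grad_F_sq x \<le> ?B x" by (rule mult_left_mono) simp
    qed
    also have "\<dots> \<le> (LINT x:S|hausdorff2. ?A x)" by (rule BA)
    also have "\<dots> \<le> (LINT x:S \<inter> K|hausdorff2. C\<^sup>2 * (norm_A_sq S x + e))"
    proof -
      have iw: "set_integrable hausdorff2 (S \<inter> K) (\<lambda>x. C\<^sup>2 * (norm_A_sq S x + e))"
      proof -
        have "set_integrable hausdorff2 (S \<inter> K) (\<lambda>x. e)"
          unfolding set_integrable_def using bSK finite_area[OF K(1)] by (simp add: integrable_indicator_iff)
        then show ?thesis using integral_curvature_le(1)[OF K(1)] by (intro set_integrable_mult_right set_integral_add(1))
      qed
      show ?thesis unfolding set_lebesgue_integral_def
      proof (rule integral_mono)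
        show "integrable hausdorff2 (\<lambda>x. indicator S x *\<^sub>R ?A x)" using iA by (simp add: set_integrable_def)
        show "integrable hausdorff2 (\<lambda>x. indicator (S \<inter> K) x *\<^sub>R (C\<^sup>2 * (norm_A_sq S x + e)))"
          using iw by (simp add: set_integrable_def)
        fix x
        show "indicator S x *\<^sub>R ?A x \<le> indicator (S \<inter> K) x *\<^sub>R (C\<^sup>2 * (norm_A_sq S x + e))"
        proof (cases "x \<in> S")
          case True
          have A0: "0 \<le> norm_A_sq S x" by (rule norm_A_sq_nonneg[OF True])
          have "(norm (surface_gradient S \<phi> x))\<^sup>2 \<le> C\<^sup>2"
            using second_variation_integrand(2)[OF e(1) \<phi> True] C[of x] by (intro power_mono) auto
          then have "?A x \<le> (regF S e x)\<^sup>2 * C\<^sup>2" by (intro mult_left_mono) auto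
          moreover have "(regF S e x)\<^sup>2 = norm_A_sq S x + e" using A0 e by (simp add: regF_def)
          ultimately show ?thesis using True sg0[OF True] by (cases "x \<in> K") (auto simp: mult.commute)
        qed simp
      qed
    qed
    also have "\<dots> = C\<^sup>2 * ((LINT x:S \<inter> K|hausdorff2. norm_A_sq S x) + (LINT x:S \<inter> K|hausdorff2. e))"
    proof -
      have "set_integrable hausdorff2 (S \<inter> K) (\<lambda>x. e)"
        unfolding set_integrable_def using bSK finite_area[OF K(1)] by (simp add: integrable_indicator_iff)
      then show ?thesis using set_integral_add(2)[OF integral_curvature_le(1)[OF K(1)]] by simp
    qed
    also have "(LINT x:S \<inter> K|hausdorff2. e) = e * measure hausdorff2 (S \<inter> K)"
      using bSK finite_area[OF K(1)] by (simp add: set_integral_const mult.commute)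
    also have "C\<^sup>2 * ((LINT x:S \<inter> K|hausdorff2. norm_A_sq S x) + e * measure hausdorff2 (S \<inter> K))
        \<le> C\<^sup>2 * (total_curv + e * measure hausdorff2 (S \<inter> K))"
      using integral_curvature_le(2)[OF K(1)] by (intro mult_left_mono) auto
    finally show ?thesis by (simp add: algebra_simps)
  qed
  have "((\<lambda>e. C\<^sup>2 * total_curv + e * (C\<^sup>2 * measure hausdorff2 (S \<inter> K))) \<longlongrightarrow> C\<^sup>2 * total_curv + 0 * (C\<^sup>2 * measure hausdorff2 (S \<inter> K))) (at_right 0)"
    by (intro tendsto_intros)
  moreover have "\<forall>\<^sub>F e in at_right 0. (LINT x:S|hausdorff2. (\<phi> x)\<^sup>2 * grad_F_sq x) \<le> C\<^sup>2 * total_curv + e * (C\<^sup>2 * measure hausdorff2 (S \<inter> K))"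
    using main by (auto simp: eventually_at_right_field intro!: exI[of _ 1])
  ultimately have "(LINT x:S|hausdorff2. (\<phi> x)\<^sup>2 * grad_F_sq x) \<le> C\<^sup>2 * total_curv + 0 * (C\<^sup>2 * measure hausdorff2 (S \<inter> K))"
    by (rule tendsto_lowerbound) simp
  then show ?thesis by simp
qed

end

section \<open>Vanishing of the curvature\<close>

lemma AE_continuous_eq_0:
  fixes g :: "real^2 \<Rightarrow> real"
  assumes ae: "AE y in lborel. g y = 0" and U: "open U" and c: "continuous_on U g" and y: "y \<in> U"
  shows "g y = 0"
proof (rule ccontr)
  assume ne: "g y \<noteq> 0"
  define X where "X = U \<inter> g -` (- {0})"
  have X: "open X" "y \<in> X" unfolding X_def using continuous_open_preimage[OF c U, of "- {0}"] y ne by auto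
  obtain r where r: "0 < r" "ball y r \<subseteq> X" using X open_contains_ball by blast

  have "AE x in lborel. x \<notin> ball y r" using ae
    by eventually_elim (use r in \<open>auto simp: X_def\<close>)
  then have "ball y r \<in> null_sets lborel" by (subst AE_iff_null_sets) auto
  then have "emeasure lborel (ball y r) = 0" by auto
  then have "measure lborel (ball y r) = 0" by (simp add: measure_def)
  then show False using content_ball_pos[OF r(1), of y] by simp
qed

context stable_half_bubble
begin

lemma grad_F_sq_nonneg: "x \<in> S \<Longrightarrow> 0 \<le> grad_F_sq x"
  using norm_A_sq_nonneg[of x] by (simp add: grad_F_sq_def)

lemma integral_bump_grad_F_sq_0:
  assumes b: "smooth_on UNIV b" "\<And>x. 0 \<le> b x" "\<And>x. b x \<le> 1" "\<And>x. x \<notin> ball p r \<Longrightarrow> b x = 0"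
  shows "(LINT x:S|hausdorff2. b x * grad_F_sq x) = 0"
proof -
  obtain \<beta> :: "real^3 \<Rightarrow> real" where \<beta>: "smooth_on UNIV \<beta>" "\<And>x. 0 \<le> \<beta> x" "\<And>x. \<beta> x \<le> 1"
    "\<And>x. x \<in> ball 0 1 \<Longrightarrow> \<beta> x = 1" "\<And>x. x \<notin> ball 0 2 \<Longrightarrow> \<beta> x = 0"
    using exists_bump[of 2 0] by auto
  have \<beta>0: "fd \<beta> x v = 0" if "x \<notin> cball 0 2" for x v
    by (rule fd_0_outside[OF \<beta>(1) closed_cball _ that]) (use \<beta>(5) in auto)
  have "\<exists>C\<ge>0. \<forall>x. onorm (frechet_derivative \<beta> (at x)) \<le> C"
  proof -
    have "\<exists>B\<ge>0. \<forall>x. \<bar>fd \<beta> x i\<bar> \<le> B" for i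
    proof -
      have "continuous_on (cball 0 2) (\<lambda>x. fd \<beta> x i)"
        using smooth_on_continuous_on[OF smooth_on_fd[OF \<beta>(1)]] continuous_on_subset by blast
      then obtain B where "0 \<le> B" "\<And>x. x \<in> cball 0 2 \<Longrightarrow> \<bar>fd \<beta> x i\<bar> \<le> B"
        using compact_continuous_bound[OF compact_cball] by metis
      then show ?thesis using \<beta>0 by (metis abs_zero)
    qed
    then obtain B where B: "\<And>i. 0 \<le> B i" "\<And>i x. \<bar>fd \<beta> x i\<bar> \<le> B i" by metis
    have "onorm (frechet_derivative \<beta> (at x)) \<le> (\<Sum>i\<in>Basis. B i)" for x
    proof (rule onorm_le)
      fix v
      have "fd \<beta> x v = (\<Sum>i\<in>Basis. (v \<bullet> i) *\<^sub>R fd \<beta> x i)"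
        using smooth_on_differentiable[OF \<beta>(1)] by (intro fd_linear_sum) simp
      also have "norm \<dots> \<le> (\<Sum>i\<in>Basis. norm v * B i)"
      proof (rule sum_norm_le)
        fix i :: "real^3" assume "i \<in> Basis"
        then have "\<bar>v \<bullet> i\<bar> \<le> norm v" by (rule Basis_le_norm)
        then show "norm ((v \<bullet> i) *\<^sub>R fd \<beta> x i) \<le> norm v * B i"
          using B by (auto simp: abs_mult intro!: mult_mono)
      qed
      finally show "norm (fd \<beta> x v) \<le> (\<Sum>i\<in>Basis. B i) * norm v" by (simp add: sum_distrib_left mult.commute)
    qed
    then show ?thesis using B(1) by (intro exI[of _ "\<Sum>i\<in>Basis. B i"]) (auto intro: sum_nonneg)
  qed
  then obtain C where C: "0 \<le> C" "\<And>x. onorm (frechet_derivative \<beta> (at x)) \<le> C" by blast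
  have cb: "continuous_on S b" using smooth_on_continuous_on[OF b(1)] continuous_on_subset by blast
  have ib: "set_integrable hausdorff2 S (\<lambda>x. b x * grad_F_sq x)"
    by (rule set_integrable_S[OF _ compact_cball[of p r]])
      (use continuous_S_functions(5) cb b(4) in \<open>auto intro!: continuous_intros\<close>)
  have le: "(LINT x:S|hausdorff2. b x * grad_F_sq x) \<le> (C / real (Suc k))\<^sup>2 * total_curv" if k: "norm p + r \<le> real (Suc k)" for k
  proof -
    define R where "R = real (Suc k)"
    have R: "0 < R" by (simp add: R_def)
    define \<phi> where "\<phi> x = \<beta> ((1 / R) *\<^sub>R x)" for x
    have s\<phi>: "smooth_on UNIV \<phi>" unfolding \<phi>_def
      by (rule smooth_on_compose[OF _ _ \<beta>(1)]) (auto intro: smooth_on_bounded_linear bounded_linear_scaleR_right)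
    have \<phi>0: "\<phi> x = 0" if "x \<notin> cball 0 (2 * R)" for x
      using that R unfolding \<phi>_def by (intro \<beta>(5)) (simp add: field_simps)
    have \<phi>1: "\<phi> x = 1" if "x \<in> ball p r" for x
    proof -
      have "norm x < norm p + r" using that norm_triangle_sub[of x p] by (simp add: dist_norm norm_minus_commute)
      then have "norm x < R" using k by (simp add: R_def)
      then show ?thesis unfolding \<phi>_def using R by (intro \<beta>(4)) (simp add: field_simps)
    qed
    have on: "onorm (frechet_derivative \<phi> (at x)) \<le> C / R" for x
    proof (rule onorm_le)
      fix v
      let ?w = "(1 / R) *\<^sub>R x"
      have d: "(\<beta> has_derivative frechet_derivative \<beta> (at ?w)) (at ?w)" by (rule smooth_on_has_derivative[OF \<beta>(1)]) simp
      have "(\<phi> has_derivative (\<lambda>v. fd \<beta> ?w ((1 / R) *\<^sub>R v))) (at x)" unfolding \<phi>_def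
        by (rule has_derivative_compose[of "\<lambda>x. (1 / R) *\<^sub>R x" _ x UNIV \<beta>, OF _ d]) (auto intro!: derivative_eq_intros)
      then have "fd \<phi> x v = fd \<beta> ?w ((1 / R) *\<^sub>R v)" by (rule fd_eqI)
      also have "norm \<dots> \<le> onorm (frechet_derivative \<beta> (at ?w)) * norm ((1 / R) *\<^sub>R v)"
        using d has_derivative_bounded_linear by (intro onorm) blast
      also have "\<dots> \<le> C * norm ((1 / R) *\<^sub>R v)" using C by (intro mult_right_mono) auto
      finally show "norm (fd \<phi> x v) \<le> C / R * norm v" using R by simp
    qed
    have "(LINT x:S|hausdorff2. (\<phi> x)\<^sup>2 * grad_F_sq x) \<le> (C / R)\<^sup>2 * total_curv"
      by (rule stability_inequality[OF s\<phi> compact_cball[of 0 "2 * R"]]) (use \<phi>0 on in blast)+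
    moreover have "(LINT x:S|hausdorff2. b x * grad_F_sq x) \<le> (LINT x:S|hausdorff2. (\<phi> x)\<^sup>2 * grad_F_sq x)"
    proof (rule set_integral_mono[OF ib])
      have c\<phi>: "continuous_on S \<phi>" using smooth_on_continuous_on[OF s\<phi>] continuous_on_subset by blast
      show "set_integrable hausdorff2 S (\<lambda>x. (\<phi> x)\<^sup>2 * grad_F_sq x)"
        by (rule set_integrable_S[OF _ compact_cball[of 0 "2 * R"]])
          (use continuous_S_functions(5) c\<phi> \<phi>0 in \<open>auto intro!: continuous_intros\<close>)
      fix x assume x: "x \<in> S"
      have "b x \<le> (\<phi> x)\<^sup>2" using \<phi>1[of x] b(3,4)[of x] by (cases "x \<in> ball p r") auto
      then show "b x * grad_F_sq x \<le> (\<phi> x)\<^sup>2 * grad_F_sq x" using grad_F_sq_nonneg[OF x] by (rule mult_right_mono)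
    qed
    ultimately show ?thesis by (simp add: R_def)
  qed
  have "(\<lambda>k. (C / real (Suc k))\<^sup>2 * total_curv) \<longlonglongrightarrow> 0\<^sup>2 * total_curv"
    by (intro tendsto_intros LIMSEQ_Suc[OF lim_const_over_n])
  moreover have "\<exists>N. \<forall>k\<ge>N. (LINT x:S|hausdorff2. b x * grad_F_sq x) \<le> (C / real (Suc k))\<^sup>2 * total_curv"
  proof -
    obtain N where "norm p + r \<le> real N" using real_arch_simple by blast
    then have "\<forall>k\<ge>N. norm p + r \<le> real (Suc k)" by (auto intro: order_trans)
    then show ?thesis using le by blast
  qed
  ultimately have "(LINT x:S|hausdorff2. b x * grad_F_sq x) \<le> 0" using LIMSEQ_le_const by fastforce
  moreover have "0 \<le> (LINT x:S|hausdorff2. b x * grad_F_sq x)"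
    unfolding set_lebesgue_integral_def using b(2) grad_F_sq_nonneg
    by (intro Bochner_Integration.integral_nonneg) (auto simp: indicator_def)
  ultimately show ?thesis by simp
qed

lemma curvature_gradient_0:
  assumes c: "eps_patch q e1 e2 e3 V f S 1 z" and y: "y \<in> V" "0 < y $ 2"
  shows "grad_F_sq (graph_map.G q e1 e2 e3 f y) = 0"
proof -
  interpret c: eps_patch q e1 e2 e3 V f S 1 z by (rule c)
  have yup: "y \<in> V \<inter> upper" using y by (simp add: upper_def)
  obtain O1 where O1: "open O1" "c.G ` (V \<inter> upper) = S \<inter> O1" using c.openin_G by (auto simp: openin_open)
  have "c.G y \<in> O1" using O1(2) yup by blast
  then obtain r where r: "r > 0" "ball (c.G y) r \<subseteq> O1" using O1(1) open_contains_ball by blast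
  obtain b :: "real^3 \<Rightarrow> real" where b: "smooth_on UNIV b" "\<And>x. 0 \<le> b x" "\<And>x. b x \<le> 1"
    "\<And>x. x \<in> ball (c.G y) (r/2) \<Longrightarrow> b x = 1" "\<And>x. x \<notin> ball (c.G y) r \<Longrightarrow> b x = 0"
    using exists_bump[OF r(1)] by metis
  let ?D = "V \<inter> upper"
  let ?k = "\<lambda>x. b x * grad_F_sq x"
  have GS: "c.G ` ?D \<subseteq> S" using c.G_in_S by blast
  have cG: "continuous_on ?D c.G" using c.continuous_G by (rule continuous_on_subset) auto
  have ck: "continuous_on ?D (\<lambda>y. ?k (c.G y))"
  proof -
    have "continuous_on S ?k"
      using continuous_S_functions(5) smooth_on_continuous_on[OF b(1)]
      by (intro continuous_intros) (auto intro: continuous_on_subset)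
    then show ?thesis by (rule continuous_on_compose2[OF _ cG GS])
  qed
  have zero: "?k x = 0" if "x \<in> S" "x \<notin> c.G ` ?D" for x
    using that r(2) O1(2) b(5)[of x] by (metis IntI mult_zero_left subsetD)
  have int0: "(\<integral>y. indicator ?D y * (c.W y * ?k (c.G y)) \<partial>lborel) = 0"
    using c.set_integral_graph[OF refl GS ck zero] integral_bump_grad_F_sq_0[OF b(1,2,3,5)] hausdorff2_const_pos by simp
  have cW: "continuous_on ?D (\<lambda>y. c.W y * ?k (c.G y))"
    by (rule continuous_on_mult[OF continuous_on_subset[OF smooth_on_continuous_on[OF c.smooth_W]] ck]) simp
  have nn: "0 \<le> indicator ?D x * (c.W x * ?k (c.G x))" for x
    using grad_F_sq_nonneg c.G_in_S b(2) c.W_pos[of x] by (auto simp: indicator_def intro!: mult_nonneg_nonneg)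
  have Db: "?D \<in> sets borel" using c.open_V by auto
  have m: "(\<lambda>y. indicator ?D y * (c.W y * ?k (c.G y))) \<in> borel_measurable lborel"
    using borel_measurable_continuous_on_indicator[OF Db cW] by simp
  have "AE x in lborel. indicator ?D x * (c.W x * ?k (c.G x)) = 0"
  proof -
    have "integrable lborel (\<lambda>y. indicator ?D y * (c.W y * ?k (c.G y)))"
    proof -
      have "set_integrable hausdorff2 S ?k"
        by (rule set_integrable_S[OF _ compact_cball[of "c.G y" r]])
          (use continuous_S_functions(5) smooth_on_continuous_on[OF b(1)] b(5) in \<open>auto intro!: continuous_intros intro: continuous_on_subset\<close>)
      then show ?thesis using c.set_integrable_graph[OF refl GS ck zero] by simp
    qed
    then show ?thesis using integral_nonneg_eq_0_iff_AE[of lborel "\<lambda>y. indicator ?D y * (c.W y * ?k (c.G y))"] nn int0 by simp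
  qed
  moreover have "open (V \<inter> {y. 0 < y $ 2})" using c.open_V by (intro open_Int open_halfspace_component_gt_cart)
  moreover have "continuous_on (V \<inter> {y. 0 < y $ 2}) (\<lambda>y. indicator ?D y * (c.W y * ?k (c.G y)))"
    by (rule continuous_on_eq[OF continuous_on_subset[OF cW]]) (auto simp: upper_def)
  ultimately have "indicator ?D y * (c.W y * ?k (c.G y)) = 0"
    using y by (intro AE_continuous_eq_0[of _ "V \<inter> {y. 0 < y $ 2}"]) auto
  then show ?thesis using yup c.W_pos[of y] b(4)[of "c.G y"] r(1) by simp
qed

lemma asq_0_interior:
  assumes c: "eps_patch q e1 e2 e3 V f S 1 z" and y: "y \<in> V" "0 < y $ 2"
  shows "graph_map.asq f y = 0"
proof -
  interpret c: eps_patch q e1 e2 e3 V f S 1 z by (rule c)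
  have pd0: "pd i c.asq x = 0" if x: "x \<in> V" "0 < x $ 2" for x i
  proof -
    have xup: "x \<in> V \<inter> upper" using x by (simp add: upper_def)
    have "0 \<le> norm_A_sq S (c.G x)" using norm_A_sq_nonneg c.G_in_S[OF xup] by blast
    then have "surface_gradient S (norm_A_sq S) (c.G x) = 0"
      using curvature_gradient_0[OF c x] by (auto simp: grad_F_sq_def)
    moreover have "surface_gradient S (norm_A_sq S) (c.G x) = c.gradv x (pd 1 c.asq x) (pd 2 c.asq x)"
      by (rule c.surface_gradient_G(2)[OF xup c.norm_A_sq_G smooth_on_differentiable[OF c.smooth_asq x(1)]])
    ultimately have g0: "c.gradv x (pd 1 c.asq x) (pd 2 c.asq x) = 0" by simp
    have "pd 1 c.asq x = 0" "pd 2 c.asq x = 0"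
      using c.gradv_inner[OF x(1), of "pd 1 c.asq x" "pd 2 c.asq x"] unfolding g0 by simp_all
    then show ?thesis using exhaust_2[of i] by auto
  qed
  have o: "open (V \<inter> {y. 0 < y $ 2})" using c.open_V by (intro open_Int open_halfspace_component_gt_cart)
  have "pd j (pd i c.asq) y = 0" for i j
  proof -
    have "pd j (pd i c.asq) y = pd j (\<lambda>_. 0) y"
      by (rule pd_cong[OF o]) (use y pd0 in auto)
    also have "\<dots> = 0" by (rule c.pd_const[OF y(1)])
    finally show ?thesis .
  qed
  then have "c.lapl c.asq y = 0" by (simp add: c.lapl_def)
  then have "c.asq y ^ 3 = 0" using c.simons(1)[OF y] pd0[OF y] by (simp add: c.ginner_def)
  then show ?thesis by simp
qed

lemma second_derivatives_0:
  assumes c: "eps_patch q e1 e2 e3 V f S 1 z" and y: "y \<in> V \<inter> upper"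
  shows "pd i (pd j f) y = 0"
proof -
  interpret c: eps_patch q e1 e2 e3 V f S 1 z by (rule c)
  have int: "pd i (pd j f) x = 0" if x: "x \<in> V" "0 < x $ 2" for x i j
  proof -
    define P Q R H T where "P = pd 1 f x" and "Q = pd 2 f x" and "R = pd 1 (pd 1 f) x"
      and "H = pd 1 (pd 2 f) x" and "T = pd 2 (pd 2 f) x"
    have xup: "x \<in> V \<inter> upper" using x by (simp add: upper_def)
    have HRT: "H * H = R * T"
      using c.asq_KK[of x] asq_0_interior[OF c x] by (simp add: R_def H_def T_def)
    have m: "(1 + Q * Q) * R - 2 * P * Q * H + (1 + P * P) * T = 0"
      using c.mse_0[OF xup] by (simp add: c.mse_def P_def Q_def R_def H_def T_def power2_eq_square)
    have "((1 + Q * Q) * R - P * Q * H)\<^sup>2 + (1 + P * P + Q * Q) * (H * H)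
        = (1 + Q * Q) * (R * ((1 + Q * Q) * R - 2 * P * Q * H + (1 + P * P) * T)) + (1 + P * P) * (1 + Q * Q) * (H * H - R * T)"
      by (simp add: power2_eq_square algebra_simps)
    also have "\<dots> = 0" unfolding m HRT by simp
    finally have sq: "((1 + Q * Q) * R - P * Q * H)\<^sup>2 + (1 + P * P + Q * Q) * (H * H) = 0" .
    have pos: "0 < 1 + P * P + Q * Q" by (simp add: add_pos_nonneg)
    have "0 \<le> (1 + P * P + Q * Q) * (H * H)" using pos by (intro mult_nonneg_nonneg zero_le_square) simp
    then have "(1 + P * P + Q * Q) * (H * H) = 0" "((1 + Q * Q) * R - P * Q * H)\<^sup>2 = 0"
      using sq zero_le_power2[of "(1 + Q * Q) * R - P * Q * H"] by linarith+
    then have H0: "H = 0" and "(1 + Q * Q) * R = 0" using pos by auto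
    moreover have "1 + Q * Q \<noteq> 0" "1 + P * P \<noteq> 0"
      using zero_le_square[of Q] zero_le_square[of P] by linarith+
    ultimately have "R = 0" "T = 0" using m by auto
    then show ?thesis using H0 exhaust_2[of i] exhaust_2[of j] c.pd2P[OF x(1)]
      by (auto simp: R_def H_def T_def)
  qed
  have cont: "isCont (pd i (pd j f)) y"
    using smooth_on_continuous_on[OF smooth_on_pd[OF smooth_on_pd[OF c.smooth_f]]] c.open_V y
    by (metis IntD1 continuous_on_eq_continuous_at)
  have "((\<lambda>t. pd i (pd j f) (y + t *\<^sub>R axis 2 1)) \<longlongrightarrow> pd i (pd j f) (y + 0 *\<^sub>R axis 2 1)) (at_right 0)"
  proof -
    have "isCont (\<lambda>t. pd i (pd j f) (y + t *\<^sub>R axis 2 1)) 0"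
      using cont by (intro isCont_o2[of 0 "\<lambda>t. y + t *\<^sub>R axis 2 1" "pd i (pd j f)"]) auto
    then show ?thesis unfolding isCont_def by (rule filterlim_mono) (auto simp: at_within_le_at)
  qed
  moreover have "\<forall>\<^sub>F t in at_right 0. pd i (pd j f) (y + t *\<^sub>R axis 2 1) = 0"
  proof -
    obtain r where r: "r > 0" "ball y r \<subseteq> V" using c.open_V y open_contains_ball by blast
    have "pd i (pd j f) (y + t *\<^sub>R axis 2 1) = 0" if "0 < t" "t < r" for t
    proof (rule int)
      show "y + t *\<^sub>R axis 2 1 \<in> V" using that by (intro subsetD[OF r(2)]) (simp add: dist_norm norm_axis_1)
      show "0 < (y + t *\<^sub>R axis 2 1) $ 2" using y that by (simp add: upper_def)
    qed
    then show ?thesis using r(1) by (auto simp: eventually_at_right_field)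
  qed
  ultimately have "((\<lambda>t. 0) \<longlongrightarrow> pd i (pd j f) (y + 0 *\<^sub>R axis 2 1)) (at_right (0::real))"
    by (rule Lim_transform_eventually)
  then have "pd i (pd j f) (y + 0 *\<^sub>R axis 2 1) = 0"
    by (intro tendsto_unique[OF _ _ tendsto_const]) auto
  then show ?thesis by simp
qed

section \<open>Flatness\<close>

lemma flat_patch:
  assumes p: "p \<in> S"
  obtains q e1 e2 e3 V f z r where "centred_patch q e1 e2 e3 V f S z" "graph_map.G q e1 e2 e3 f z = p" "0 < r" "ball z r \<subseteq> V"
    "S \<inter> ball p r \<subseteq> graph_map.G q e1 e2 e3 f ` (ball z r \<inter> upper)"
    "\<And>y. y \<in> ball z r \<inter> upper \<Longrightarrow> f y = f z"
proof -
  obtain q e1 e2 e3 V f z \<rho> where c: "eps_patch q e1 e2 e3 V f S 1 z" and cc: "centred_patch q e1 e2 e3 V f S z"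
    and Gz: "graph_map.G q e1 e2 e3 f z = p"
    and \<rho>: "0 < \<rho>" "cball z \<rho> \<subseteq> V" "S \<inter> ball p \<rho> \<subseteq> graph_map.G q e1 e2 e3 f ` (V \<inter> upper)"
    using patch_exists[OF p zero_less_one] by metis
  interpret c: eps_patch q e1 e2 e3 V f S 1 z by (rule c)
  interpret cc: centred_patch q e1 e2 e3 V f S z by (rule cc)
  let ?B = "ball z \<rho> \<inter> upper"
  have cu: "convex upper"
  proof -
    have eq: "upper = {y. axis 2 1 \<bullet> y \<ge> (0::real)}" by (auto simp: upper_def inner_axis')
    show ?thesis unfolding eq by (rule convex_halfspace_ge)
  qed
  have cB: "convex ?B" using cu by (intro convex_Int convex_ball)
  have BV: "?B \<subseteq> V \<inter> upper" using \<rho>(2) by auto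
  have zB: "z \<in> ?B" using cc.y0 \<rho>(1) by auto
  have zero: "g y = g z" if g: "smooth_on V g" "\<And>x i. x \<in> ?B \<Longrightarrow> pd i g x = 0" and y: "y \<in> ?B" for g :: "real^2 \<Rightarrow> real" and y
  proof -
    have "(g has_derivative (\<lambda>h. 0)) (at x within ?B)" if x: "x \<in> ?B" for x
    proof -
      have d: "g differentiable (at x)" using g(1) x BV by (auto intro: smooth_on_differentiable)
      have "(g has_derivative (\<lambda>h. 0)) (at x)" using has_derivative_pd[OF d] g(2)[OF x] by simp
      then show ?thesis by (rule has_derivative_at_withinI)
    qed
    then obtain k where "\<And>x. x \<in> ?B \<Longrightarrow> g x = k" using has_derivative_zero_constant[OF cB] by blast
    then show ?thesis using y zB by metis
  qed
  have P0: "pd i f y = 0" if y: "y \<in> ?B" for i y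
  proof -
    have "pd i f y = pd i f z"
      by (rule zero[OF smooth_on_pd[OF c.smooth_f] _ y]) (use second_derivatives_0[OF c] BV in blast)
    then show ?thesis using cc.grad0 exhaust_2[of i] by auto
  qed
  show ?thesis
  proof (rule that[OF cc Gz \<rho>(1)])
    show "ball z \<rho> \<subseteq> V" using \<rho>(2) by auto
    show "f y = f z" if "y \<in> ?B" for y by (rule zero[OF c.smooth_f P0 that])
    show "S \<inter> ball p \<rho> \<subseteq> c.G ` ?B"
    proof
      fix x assume x: "x \<in> S \<inter> ball p \<rho>"
      then obtain y where y: "y \<in> V \<inter> upper" "x = c.G y" using \<rho>(3) by blast
      have "dist z y \<le> dist (c.G z) (c.G y)" unfolding c.dist_G by (simp add: dist_norm norm_Pair)
      then show "x \<in> c.G ` ?B" using x y Gz by auto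
    qed
  qed
qed

lemma planar_propagates:
  assumes p: "p \<in> S"
  obtains r where "0 < r" "\<And>x s. x \<in> S \<inter> ball p r \<Longrightarrow> 0 < s \<Longrightarrow> S \<inter> ball x s \<subseteq> {x. (x - p0) \<bullet> \<nu> = 0} \<Longrightarrow>
     S \<inter> ball p r \<subseteq> {x. (x - p0) \<bullet> \<nu> = 0}"
proof -
  obtain q e1 e2 e3 V f z r where cc: "centred_patch q e1 e2 e3 V f S z"
    and Gz: "graph_map.G q e1 e2 e3 f z = p" and r: "0 < r" "ball z r \<subseteq> V"
    and Sr: "S \<inter> ball p r \<subseteq> graph_map.G q e1 e2 e3 f ` (ball z r \<inter> upper)"
    and flat: "\<And>y. y \<in> ball z r \<inter> upper \<Longrightarrow> f y = f z"
    using flat_patch[OF p] by blast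
  interpret cc: centred_patch q e1 e2 e3 V f S z by (rule cc)
  define lm where "lm y = (cc.G y - p0) \<bullet> \<nu>" for y
  define c0 where "c0 = (q + f z *\<^sub>R e3 - p0) \<bullet> \<nu>"
  have lam: "lm y = c0 + y $ 1 * (e1 \<bullet> \<nu>) + y $ 2 * (e2 \<bullet> \<nu>)" if "y \<in> ball z r \<inter> upper" for y
    using flat[OF that] by (simp add: lm_def c0_def cc.G_def inner_add_left inner_diff_left)
  show ?thesis
  proof (rule that[OF r(1)])
    fix x s assume x: "x \<in> S \<inter> ball p r" and s: "0 < s" and pl: "S \<inter> ball x s \<subseteq> {x. (x - p0) \<bullet> \<nu> = 0}"
    obtain y where y: "y \<in> ball z r \<inter> upper" "x = cc.G y" using Sr x by blast
    have "isCont cc.G y"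
      using cc.continuous_G cc.open_V y r(2) by (metis IntD1 continuous_on_eq_continuous_at subsetD)
    then obtain d where d: "d > 0" "\<And>w. dist w y < d \<Longrightarrow> dist (cc.G w) (cc.G y) < s"
      using s by (metis continuous_at_eps_delta)
    obtain d' where d': "d' > 0" "ball y d' \<subseteq> ball z r" using y(1) open_contains_ball_eq[of "ball z r" y] by blast
    define t where "t = min d d' / 3"
    have t: "0 < t" "2 * t < d" "2 * t < d'" using d(1) d'(1) by (auto simp: t_def)
    have z0: "lm w = 0" and wB: "w \<in> ball z r \<inter> upper" if w: "w = y + a *\<^sub>R axis 1 1 + b *\<^sub>R axis 2 1" "0 \<le> a" "a \<le> t" "0 \<le> b" "b \<le> t" for w a b
    proof -
      have "norm (a *\<^sub>R axis 1 1 + b *\<^sub>R axis 2 1 :: real^2) \<le> a + b"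
        using w by (intro order_trans[OF norm_triangle_ineq]) (simp add: norm_axis_1)
      then have n: "dist w y \<le> 2 * t" using w by (simp add: dist_norm add.assoc)
      then have "w \<in> ball y d'" using t by (simp add: dist_commute)
      moreover have "w \<in> upper" using y w by (simp add: upper_def axis_def)
      ultimately show wB: "w \<in> ball z r \<inter> upper" using d'(2) by auto
      then have "cc.G w \<in> S" using r(2) by (intro cc.G_in_S) auto
      moreover have "cc.G w \<in> ball x s" using d(2)[of w] n t y(2) by (simp add: dist_commute)
      ultimately show "lm w = 0" using pl by (auto simp: lm_def)
    qed
    define w1 w2 where "w1 = y + t *\<^sub>R axis 1 1" and "w2 = y + t *\<^sub>R axis 2 1"
    have z: "lm y = 0" "lm w1 = 0" "lm w2 = 0" and B: "w1 \<in> ball z r \<inter> upper" "w2 \<in> ball z r \<inter> upper"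
      using z0[of y 0 0] z0[of w1 t 0] z0[of w2 0 t] wB[of w1 t 0] wB[of w2 0 t] t(1) by (auto simp: w1_def w2_def)
    have "t * (e1 \<bullet> \<nu>) = 0" "t * (e2 \<bullet> \<nu>) = 0"
    proof -
      have "lm w1 = lm y + t * (e1 \<bullet> \<nu>)" "lm w2 = lm y + t * (e2 \<bullet> \<nu>)"
        unfolding lam[OF y(1)] lam[OF B(1)] lam[OF B(2)] by (simp_all add: w1_def w2_def axis_def algebra_simps)
      then show "t * (e1 \<bullet> \<nu>) = 0" "t * (e2 \<bullet> \<nu>) = 0" using z by linarith+
    qed
    then have e0: "e1 \<bullet> \<nu> = 0" "e2 \<bullet> \<nu> = 0" using t(1) by simp_all
    then have "c0 = 0" using z(1) lam[OF y(1)] by simp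
    then have "lm w = 0" if "w \<in> ball z r \<inter> upper" for w using lam[OF that] e0 by simp
    then show "S \<inter> ball p r \<subseteq> {x. (x - p0) \<bullet> \<nu> = 0}" using Sr by (auto simp: lm_def)
  qed
qed

lemma planar:
  obtains p0 \<nu> where "p0 \<in> S" "n \<bullet> p0 = a" "norm \<nu> = 1" "n \<bullet> \<nu> = 0" "S \<subseteq> {x. (x - p0) \<bullet> \<nu> = 0}"
proof -
  obtain p0 where p0: "p0 \<in> surface_boundary S" using bdry_ne by blast
  then have p0S: "p0 \<in> S" "n \<bullet> p0 = a" using bdry by auto
  obtain q e1 e2 e3 V f z r where cc: "centred_patch q e1 e2 e3 V f S z"
    and Gz: "graph_map.G q e1 e2 e3 f z = p0" and r: "0 < r" "ball z r \<subseteq> V"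
    and Sr: "S \<inter> ball p0 r \<subseteq> graph_map.G q e1 e2 e3 f ` (ball z r \<inter> upper)"
    and flat: "\<And>y. y \<in> ball z r \<inter> upper \<Longrightarrow> f y = f z"
    using flat_patch[OF p0S(1)] by blast
  interpret cc: centred_patch q e1 e2 e3 V f S z by (rule cc)
  let ?P = "{x. (x - p0) \<bullet> e3 = 0}"
  have start: "S \<inter> ball p0 r \<subseteq> ?P"
  proof
    fix x assume "x \<in> S \<inter> ball p0 r"
    then obtain y where y: "y \<in> ball z r \<inter> upper" "x = cc.G y" using Sr by blast
    then show "x \<in> ?P"
      using flat[OF y(1)] by (simp add: Gz[symmetric] cc.G_def inner_diff_left inner_add_left cc.on cc.on_sym)
  qed
  obtain \<rho> where \<rho>: "\<And>p. p \<in> S \<Longrightarrow> 0 < \<rho> p"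
    "\<And>p x s. p \<in> S \<Longrightarrow> x \<in> S \<inter> ball p (\<rho> p) \<Longrightarrow> 0 < s \<Longrightarrow> S \<inter> ball x s \<subseteq> ?P \<Longrightarrow> S \<inter> ball p (\<rho> p) \<subseteq> ?P"
  proof -
    have "\<forall>p\<in>S. \<exists>r. 0 < r \<and> (\<forall>x s. x \<in> S \<inter> ball p r \<longrightarrow> 0 < s \<longrightarrow> S \<inter> ball x s \<subseteq> ?P \<longrightarrow> S \<inter> ball p r \<subseteq> ?P)"
    proof
      fix p assume "p \<in> S"
      obtain r where "0 < r" "\<And>x s. x \<in> S \<inter> ball p r \<Longrightarrow> 0 < s \<Longrightarrow> S \<inter> ball x s \<subseteq> ?P \<Longrightarrow> S \<inter> ball p r \<subseteq> ?P"
        using planar_propagates[OF \<open>p \<in> S\<close>] by metis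
      then show "\<exists>r. 0 < r \<and> (\<forall>x s. x \<in> S \<inter> ball p r \<longrightarrow> 0 < s \<longrightarrow> S \<inter> ball x s \<subseteq> ?P \<longrightarrow> S \<inter> ball p r \<subseteq> ?P)" by blast
    qed
    then obtain \<rho> where \<rho>: "\<forall>p\<in>S. 0 < \<rho> p \<and> (\<forall>x s. x \<in> S \<inter> ball p (\<rho> p) \<longrightarrow> 0 < s \<longrightarrow> S \<inter> ball x s \<subseteq> ?P \<longrightarrow> S \<inter> ball p (\<rho> p) \<subseteq> ?P)"
      by metis
    show ?thesis
      by (rule that[of \<rho>]) (rule \<rho>[rule_format, THEN conjunct1] \<rho>[rule_format, THEN conjunct2, rule_format]; assumption)+
  qed
  define A where "A = {x \<in> S. \<exists>s>0. S \<inter> ball x s \<subseteq> ?P}"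
  have step: "S \<inter> ball p (\<rho> p) \<inter> A = {} \<or> S \<inter> ball p (\<rho> p) \<subseteq> A" if p: "p \<in> S" for p
  proof (cases "S \<inter> ball p (\<rho> p) \<inter> A = {}")
    case False
    then obtain x s where "x \<in> S \<inter> ball p (\<rho> p)" "0 < s" "S \<inter> ball x s \<subseteq> ?P" unfolding A_def by blast
    then have sub: "S \<inter> ball p (\<rho> p) \<subseteq> ?P" using \<rho>(2)[OF p] by blast
    have "x' \<in> A" if "x' \<in> S \<inter> ball p (\<rho> p)" for x'
    proof -
      have "x' \<in> ball p (\<rho> p)" using that by (rule IntD2)
      then have "\<exists>s>0. ball x' s \<subseteq> ball p (\<rho> p)" by (rule open_contains_ball_eq[OF open_ball, THEN iffD1])
      then obtain s where "s > 0" "ball x' s \<subseteq> ball p (\<rho> p)" by blast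
      then show ?thesis using that sub unfolding A_def by blast
    qed
    then show ?thesis by blast
  qed simp
  have "openin (top_of_set S) A"
    unfolding openin_contains_ball
  proof (intro conjI ballI)
    fix x assume "x \<in> A"
    then have "x \<in> S" by (simp add: A_def)
    then have "S \<inter> ball x (\<rho> x) \<inter> A \<noteq> {}" using \<open>x \<in> A\<close> \<rho>(1) by auto
    then show "\<exists>e>0. ball x e \<inter> S \<subseteq> A" using step[OF \<open>x \<in> S\<close>] \<rho>(1)[OF \<open>x \<in> S\<close>] by (auto simp: Int_commute)
  qed (auto simp: A_def)
  moreover have "openin (top_of_set S) (S - A)"
    unfolding openin_contains_ball
  proof (intro conjI ballI)
    fix x assume "x \<in> S - A"
    then have x: "x \<in> S" "x \<notin> A" by auto
    then have "S \<inter> ball x (\<rho> x) \<inter> A = {}" using step[OF x(1)] \<rho>(1)[OF x(1)] by auto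
    then show "\<exists>e>0. ball x e \<inter> S \<subseteq> S - A" using \<rho>(1)[OF x(1)] by blast
  qed auto
  then have "closedin (top_of_set S) A"
    by (simp add: closedin_def A_def)
  moreover have "p0 \<in> A" using p0S start r(1) by (auto simp: A_def)
  ultimately have "A = S" using connected_S by (auto simp: connected_clopen)
  have SP: "S \<subseteq> ?P"
  proof
    fix x assume x: "x \<in> S"
    then obtain s where "0 < s" "S \<inter> ball x s \<subseteq> ?P" using \<open>A = S\<close> unfolding A_def by blast
    then show "x \<in> ?P" using x centre_in_ball by blast
  qed
  have "n \<bullet> e3 = 0"
  proof -
    have "n \<in> range (frechet_derivative cc.G (at z))"
      using free[OF p0] cc.tangent_space_G[OF cc.y0] Gz by simp
    then show ?thesis
      using cc.y0 by (auto simp: cc.fd_G cc.grad0 inner_add_left cc.on cc.on_sym)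
  qed
  then show ?thesis using that[of p0 e3] p0S SP cc.on by (simp add: norm_eq_1)
qed

lemma half_plane_S: "half_plane S"
proof -
  obtain p0 \<nu> where p0: "p0 \<in> S" "n \<bullet> p0 = a" and \<nu>: "norm \<nu> = 1" "n \<bullet> \<nu> = 0" and SP: "S \<subseteq> {x. (x - p0) \<bullet> \<nu> = 0}"
    using planar by blast
  define u where "u = cross3 n \<nu>"
  have u: "norm u = 1" "u \<bullet> n = 0" "u \<bullet> \<nu> = 0"
  proof -
    have "(norm u)\<^sup>2 = 1" using norm_cross_dot[of n \<nu>] \<nu> norm_n by (simp add: u_def)
    then show "norm u = 1" by (metis norm_ge_zero one_power2 power2_eq_iff_nonneg zero_le_one)
    show "u \<bullet> n = 0" "u \<bullet> \<nu> = 0" by (simp_all add: u_def dot_cross_self)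
  qed
  have nn: "n \<bullet> n = 1" "u \<bullet> u = 1" "\<nu> \<bullet> \<nu> = 1" using norm_n u(1) \<nu>(1) by (simp_all add: norm_eq_1)
  have \<nu>c: "\<nu> = cross3 u n"
    using Lagrange[of n n \<nu>] cross_skew[of u n] \<nu>(2) nn by (simp add: u_def)
  define F where "F y = p0 + y $ 1 *\<^sub>R u + y $ 2 *\<^sub>R n" for y :: "real^2"
  define \<tau> where "\<tau> x = (((x - p0) \<bullet> u) *\<^sub>R axis 1 1 + ((x - p0) \<bullet> n) *\<^sub>R axis 2 1 :: real^2)" for x
  have \<tau>c: "\<tau> x $ 1 = (x - p0) \<bullet> u" "\<tau> x $ 2 = (x - p0) \<bullet> n" for x by (simp_all add: \<tau>_def axis_def)
  have F\<tau>: "F (\<tau> x) = x" if "x \<in> S" for x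
  proof -
    have "x - F (\<tau> x) = 0"
    proof (rule orthonormal_eq_0[OF \<nu>c \<nu>(1)])
      show "(x - F (\<tau> x)) \<bullet> u = 0" "(x - F (\<tau> x)) \<bullet> n = 0"
        using u nn by (simp_all add: F_def \<tau>c inner_diff_left inner_add_left inner_commute[of n u])
      show "(x - F (\<tau> x)) \<bullet> \<nu> = 0"
        using SP that u \<nu> by (auto simp: F_def inner_diff_left inner_add_left)
    qed
    then show ?thesis by simp
  qed
  have \<tau>2: "\<tau> x $ 2 = n \<bullet> x - a" for x using p0(2) by (simp add: \<tau>c inner_commute[of _ n] inner_diff_right)
  have nF: "n \<bullet> F y = a + y $ 2" for y
    using p0(2) u nn by (simp add: F_def inner_add_right inner_commute[of n u])
  have contF: "continuous_on X F" for X unfolding F_def by (intro continuous_intros)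
  have S\<tau>: "0 \<le> \<tau> x $ 2" if "x \<in> S" for x using above that by (auto simp: \<tau>2)
  have open_im: "open (\<tau> ` \<phi> ` (U \<inter> {y. 0 < y $ 2}))" if lp: "local_param S U \<phi>" for U \<phi>
  proof (rule ccontr)
    have U: "open U" "smooth_on U \<phi>" and S\<phi>: "\<phi> ` (U \<inter> upper) \<subseteq> S"
      using lp openin_imp_subset unfolding local_param_def by blast+
    obtain \<psi> where "homeomorphism (U \<inter> upper) (\<phi> ` (U \<inter> upper)) \<phi> \<psi>" using lp by (auto simp: local_param_def)
    then have inj: "inj_on \<phi> (U \<inter> upper)" by (intro inj_on_inverseI[of _ \<psi>]) (simp add: homeomorphism_def)
    let ?U = "U \<inter> {y. 0 < y $ 2}"
    have sub: "?U \<subseteq> U \<inter> upper" by (auto simp: upper_def)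
    have "open ((\<lambda>y. \<tau> (\<phi> y)) ` ?U)"
    proof (rule invariance_of_domain)
      have "continuous_on UNIV \<tau>" unfolding \<tau>_def by (intro continuous_intros)
      then show "continuous_on ?U (\<lambda>y. \<tau> (\<phi> y))"
        by (rule continuous_on_compose2) (use smooth_on_continuous_on[OF U(2)] in \<open>auto intro: continuous_on_subset\<close>)
      show "open ?U" using U by (intro open_Int open_halfspace_component_gt_cart)
      show "inj_on (\<lambda>y. \<tau> (\<phi> y)) ?U"
      proof (rule inj_onI)
        fix v w assume vw: "v \<in> ?U" "w \<in> ?U" "\<tau> (\<phi> v) = \<tau> (\<phi> w)"
        then have "\<phi> v \<in> S" "\<phi> w \<in> S" using sub S\<phi> by blast+
        then have "\<phi> v = \<phi> w" using F\<tau> vw(3) by metis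
        then show "v = w" using inj vw(1,2) sub by (meson inj_onD subsetD)
      qed
    qed
    moreover assume "\<not> open (\<tau> ` \<phi> ` ?U)"
    ultimately show False by (simp add: image_image)
  qed
  have im_C: "y \<in> {y. 0 < y $ 2 \<and> F y \<in> S}" if lp: "local_param S U \<phi>" and y: "y \<in> \<tau> ` \<phi> ` (U \<inter> {y. 0 < y $ 2})" "0 < y $ 2" for U \<phi> y
  proof -
    have S\<phi>: "\<phi> ` (U \<inter> upper) \<subseteq> S" using lp openin_imp_subset unfolding local_param_def by blast
    obtain w where w: "w \<in> U" "0 < w $ 2" "y = \<tau> (\<phi> w)" using y(1) by blast
    then have "\<phi> w \<in> S" using S\<phi> by (auto simp: upper_def)
    then show ?thesis using F\<tau> w(3) y(2) by simp
  qed
  define C where "C = {y. 0 < y $ 2 \<and> F y \<in> S}"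
  let ?H = "{y :: real^2. 0 < y $ 2}"
  have oH: "open ?H" by (rule open_halfspace_component_gt_cart)
  have "open C"
    unfolding open_contains_ball
  proof
    fix y assume y: "y \<in> C"
    have FS: "F y \<in> S" "0 < y $ 2" using y by (auto simp: C_def)
    obtain U \<phi> w where lp: "local_param S U \<phi>" and w: "w \<in> U \<inter> upper" "F y = \<phi> w"
      using embedded FS(1) unfolding embedded_surface_def by blast
    have "w $ 2 \<noteq> 0"
    proof
      assume "w $ 2 = 0"
      then have "F y \<in> surface_boundary S" using lp w by (auto simp: surface_boundary_def)
      then show False using bdry nF[of y] FS(2) by simp
    qed
    then have w2: "0 < w $ 2" using w(1) by (auto simp: upper_def)
    have "\<tau> (F y) = y"
      using u nn by (simp add: vec_eq_iff forall_2 \<tau>c F_def inner_add_left inner_commute[of n u])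
    then have yim: "y \<in> \<tau> ` \<phi> ` (U \<inter> ?H)" using w w2 by (metis (no_types, lifting) IntD1 IntI image_eqI mem_Collect_eq)
    have "open (\<tau> ` \<phi> ` (U \<inter> ?H) \<inter> ?H)" using open_im[OF lp] oH by (rule open_Int)
    moreover have "y \<in> \<tau> ` \<phi> ` (U \<inter> ?H) \<inter> ?H" using yim FS(2) by simp
    ultimately obtain e where "e > 0" "ball y e \<subseteq> \<tau> ` \<phi> ` (U \<inter> ?H) \<inter> ?H" by (meson open_contains_ball)
    moreover have "\<tau> ` \<phi> ` (U \<inter> ?H) \<inter> ?H \<subseteq> C" using im_C[OF lp] by (auto simp: C_def)
    ultimately show "\<exists>e>0. ball y e \<subseteq> C" by blast
  qed
  moreover have "C \<noteq> {}"
  proof -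
    obtain U \<phi> w where lp: "local_param S U \<phi>" and w: "w \<in> U \<inter> upper"
      using embedded p0(1) unfolding embedded_surface_def by blast
    obtain r where r: "r > 0" "ball w r \<subseteq> U" using lp w open_contains_ball unfolding local_param_def by blast
    have "w + (r/2) *\<^sub>R axis 2 1 \<in> U" using r(1) by (intro subsetD[OF r(2)]) (simp add: dist_norm norm_axis_1)
    moreover have "0 < (w + (r/2) *\<^sub>R axis 2 1) $ 2" using w r(1) by (simp add: upper_def)
    ultimately have in_im: "\<tau> (\<phi> (w + (r/2) *\<^sub>R axis 2 1)) \<in> \<tau> ` \<phi> ` (U \<inter> ?H)" by blast
    define y where "y = \<tau> (\<phi> (w + (r/2) *\<^sub>R axis 2 1))"
    obtain d where d: "d > 0" "ball y d \<subseteq> \<tau> ` \<phi> ` (U \<inter> ?H)"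
      using open_im[OF lp] in_im open_contains_ball unfolding y_def by blast
    have S\<phi>: "\<phi> ` (U \<inter> upper) \<subseteq> S" using lp openin_imp_subset unfolding local_param_def by blast
    have y2: "0 \<le> y $ 2"
    proof -
      have "w + (r/2) *\<^sub>R axis 2 1 \<in> U \<inter> upper"
        using \<open>w + (r/2) *\<^sub>R axis 2 1 \<in> U\<close> \<open>0 < (w + (r/2) *\<^sub>R axis 2 1) $ 2\<close> by (simp add: upper_def)
      then show ?thesis unfolding y_def using S\<phi> by (intro S\<tau>) blast
    qed
    have "y + (d/2) *\<^sub>R axis 2 1 \<in> ball y d" using d(1) by (simp add: dist_norm norm_axis_1)
    moreover have "0 < (y + (d/2) *\<^sub>R axis 2 1) $ 2" using y2 d(1) by simp
    ultimately have "y + (d/2) *\<^sub>R axis 2 1 \<in> C" using im_C[OF lp] d(2) unfolding C_def by blast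
    then show ?thesis by blast
  qed
  moreover have "closedin (top_of_set ?H) C"
  proof -
    have "C = ?H \<inter> F -` S" by (auto simp: C_def)
    moreover have "closed (F -` S)" using contF[of UNIV] closed_S by (intro closed_vimage) auto
    ultimately show ?thesis by (metis closedin_closed)
  qed
  moreover have "connected ?H"
  proof -
    have "?H = {y. axis 2 1 \<bullet> y > (0::real)}" by (auto simp: inner_axis')
    then have "convex ?H" by (simp only: convex_halfspace_gt)
    then show ?thesis by (rule convex_connected)
  qed
  moreover have "openin (top_of_set ?H) C" using \<open>open C\<close> by (rule open_subset[rotated]) (auto simp: C_def)
  ultimately have CH: "C = ?H" by (auto simp: connected_clopen)
  have FS: "F y \<in> S" if y: "0 \<le> y $ 2" for y
  proof -
    have lim: "(\<lambda>k. F (y + inverse (real (Suc k)) *\<^sub>R axis 2 1)) \<longlonglongrightarrow> F (y + 0 *\<^sub>R axis 2 1)"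
      unfolding F_def by (intro tendsto_intros LIMSEQ_inverse_real_of_nat)
    have "F (y + inverse (real (Suc k)) *\<^sub>R axis 2 1) \<in> S" for k
    proof -
      have "0 < (y + inverse (real (Suc k)) *\<^sub>R axis 2 1) $ 2" using y by (simp add: add_nonneg_pos)
      then have "y + inverse (real (Suc k)) *\<^sub>R axis 2 1 \<in> C" using CH by blast
      then show ?thesis by (simp add: C_def)
    qed
    then have "F (y + 0 *\<^sub>R axis 2 1) \<in> S" using closed_sequentially[OF closed_S _ lim] by blast
    then show ?thesis by simp
  qed
  have "S = {p0 + s *\<^sub>R u + t *\<^sub>R n | s t. 0 \<le> t}"
  proof (intro equalityI subsetI)
    fix x assume x: "x \<in> S"
    have "x = p0 + \<tau> x $ 1 *\<^sub>R u + \<tau> x $ 2 *\<^sub>R n" using F\<tau>[OF x] by (simp add: F_def)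
    then show "x \<in> {p0 + s *\<^sub>R u + t *\<^sub>R n | s t. 0 \<le> t}" using S\<tau>[OF x] by blast
  next
    fix x assume "x \<in> {p0 + s *\<^sub>R u + t *\<^sub>R n | s t. 0 \<le> t}"
    then obtain s t where "x = p0 + s *\<^sub>R u + t *\<^sub>R n" "0 \<le> t" by blast
    then show "x \<in> S" using FS[of "vector [s, t]"] by (simp add: F_def)
  qed
  then show ?thesis unfolding half_plane_def using norm_n u by blast
qed

end

lemma isometric_surfaces_refl: "isometric_surfaces S S"
proof -
  have "smooth_on_surface S (\<lambda>x. x)" unfolding smooth_on_surface_def
    by (intro ballI exI[of _ UNIV] exI[of _ "\<lambda>x. x"]) (simp add: smooth_on_id)
  moreover have "homeomorphism S S (\<lambda>x. x) (\<lambda>x. x)" by (rule homeomorphism_ident)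
  moreover have "\<forall>p\<in>S. \<exists>D. ((\<lambda>x. x) has_derivative D) (at p within S) \<and>
      (\<forall>v \<in> tangent_space S p. \<forall>w \<in> tangent_space S p. D v \<bullet> D w = v \<bullet> w)"
    by (intro ballI exI[of _ "\<lambda>x. x"]) simp
  ultimately show ?thesis unfolding isometric_surfaces_def by blast
qed

theorem corollary22:
  fixes S :: "(real^3) set"
  assumes "half_bubble S" and "stable_surface S"
  shows "\<exists>P. half_plane P \<and> isometric_surfaces S P"
proof -
  obtain n a where *: "norm n = 1" "S \<subseteq> {x. a \<le> n \<bullet> x}" "surface_boundary S = S \<inter> {x. n \<bullet> x = a}"
    "surface_boundary S \<noteq> {}" "\<forall>p \<in> surface_boundary S. n \<in> tangent_space S p"
    using assms(1) unfolding half_bubble_def by blast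
  have "stable_half_bubble S n a"
    by unfold_locales (use * assms in \<open>auto simp: half_bubble_def properly_embedded_surface_def\<close>)
  then have "half_plane S" by (rule stable_half_bubble.half_plane_S)
  then show ?thesis using isometric_surfaces_refl by blast
qed

end
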